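(* In the partially functional linear model described in the context, suppose that: (1) $p\le n$, and the matrices $D_n$ and $D$ are positive definite; (2) $\max_{1\le j\le p}\|X_j\|_G\le M_1<\infty$ and $\max_{1\le j\le p}\mathrm{E}|X_j|^2\le v^2<\infty$; (3) $\|Y(\cdot)\|_{L^2(\mathcal T)}\le M_2$ almost surely; (4) $\mathrm{E}(\varepsilon\mid \boldsymbol X,Y)=0$ and $\mathrm{E}(\varepsilon^2\mid\boldsymbol X,Y)<\sigma^2$; (5) there are constants $c>0$ and $0<\theta\le 1$ with $D(\lambda)\le c\lambda^{-\theta}$ for all $\lambda>0$. Let $\delta_1,\delta_3,\delta_4,\delta_5\in(0,1)$ and $\delta_2\in(0,2e^{-1})$, let $\omega>0$ and $\lambda_n:=\omega n^{-\frac{1}{1+\theta}}$. Define $$N_1:=24p\|D^{-1}\|_{\mathrm{op}}\bigl(48p\|D^{-1}\|_{\mathrm{op}}M_1^4+M_1^2\bigr)\log\Bigl(\frac{2p^2}{\delta_5}\Bigr),$$ $$N_2:=\left[\frac{12p^2\kappa^2(v+M_1)^2M_2^2\|D^{-1}\|_{\mathrm{op}}}{\omega}\log^3\Bigl(\frac{2p}{\delta_2}\Bigr)\log\Bigl(\frac{2p}{\delta_5}\Bigr)\right]^{\frac{1+\theta}{\theta}},\qquad n_0:=\lceil\max\{N_1,N_2\}\rceil .$$ Put $A:=\omega^{-1}+\omega^{-\frac{1+\theta}{2}}\sqrt c$, $c_1:=2\kappa^2M_2^2$ and $$c_4:=\kappa M_2\bigl[v+8M_1\log^{1/2}(p/\delta_2)\bigr]\frac{3\|D^{-1}\|_{\mathrm{op}}}{2},\qquad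 c_5:=\frac{3\sqrt p\,\sigma v\|D^{-1}\|_{\mathrm{op}}}{2\sqrt{\delta_4}},$$ $$c_6:=\|f_0\|+\frac{2p\kappa(v+M_1)M_2c_5}{\omega}\log\Bigl(\frac{2p}{\delta_2}\Bigr)+\frac{\sigma A}{\sqrt{\delta_3}},\qquad c_7:=\|f_0\|\Bigl[2\kappa^2M_2^2A\log\Bigl(\frac{2}{\delta_1}\Bigr)+1\Bigr],$$ $$c_8:=\Bigl(2\kappa^2M_2^2A\log\Bigl(\frac{2}{\delta_1}\Bigr)+1\Bigr)^2\frac{\sigma A}{\sqrt{\delta_3}},\qquad c_9:=\frac{\kappa M_2(2c_4c_6+c_5)}{\sqrt\omega}\Bigl(c_1A\log\Bigl(\frac{2}{\delta_1}\Bigr)+1\Bigr)\Bigl[v+8M_1\log^{1/2}\Bigl(\frac{p}{\delta_2}\Bigr)\Bigr].$$ Then for every $n\ge n_0$, with probability at least $1-\sum_{i=1}^5\delta_i$, $$\mathcal E(\hat\eta_n)-\mathcal E(\eta_0)\le\bigl(2\lambda_{\max}(2c_4c_6+c_5)^2+2c_9^2\bigr)n^{-1}+\bigl(4(c_7+c_8)c_9\sqrt\omega\bigr)n^{-\frac{2+\theta}{2+2\theta}}+\bigl(2(c_7+c_8)^2\omega\bigr)n^{-\frac{1}{1+\theta}} .$$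
   Context: Setting. $\mathcal T\subset\mathbb R$ is compact; $L^2(\mathcal T)$ has inner product $\langle\cdot,\cdot\rangle$ and norm $\|\cdot\|$. The model is $Z=\boldsymbol X^T\boldsymbol\alpha_0+\int_{\mathcal T}Y(t)\beta_0(t)\,dt+\varepsilon$, where $\boldsymbol X=(X_1,\dots,X_p)^T$ is a random vector in $\mathbb R^p$, $Y$ is a random function on $\mathcal T$ with values in $L^2(\mathcal T)$, $\boldsymbol X$ and $Y$ are independent, $\mathrm E\boldsymbol X=\boldsymbol 0$, $\mathrm EY(t)=0$, $\boldsymbol\alpha_0\in\mathbb R^p$. The data $(Z_i,\boldsymbol X_i,Y_i)$, $i=1,\dots,n$, are i.i.d. copies of $(Z,\boldsymbol X,Y)$ (with noises $\varepsilon_i$). Kernel. $K:\mathcal T\times\mathcal T\to\mathbb R$ is a continuous symmetric nonnegative definite (reproducing) kernel; for a square integrable kernel $R$, $L_R$ is the integral operator $L_R(f)(t)=\int_{\mathcal T}R(s,t)f(s)\,ds$ on $L^2(\mathcal T)$, and $L_K^{1/2}$ is the nonnegative square root of $L_K$. The RKHS is $\mathcal H(K)=L_K^{1/2}(L^2(\mathcal T))$ with norm $\|L_K^{1/2}f\|_K=\|f\|$; it is assumed dense in $L^2(\mathcal T)$ and $L_K^{1/2}$ is injective. $\kappa:=\|L_K^{1/2}\|_{\mathrm{op}}<\infty$. The slope $\beta_0\in\mathcal H(K)$ and $f_0\in L^2(\mathcal T)$ satisfies $L_K^{1/2}f_0=\beta_0$. It is assumed that $\kappa>1$ and $M_2>1$.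 Covariances. $D:=\mathrm E(\boldsymbol X\boldsymbol X^T)$, $D_n:=\frac1n\sum_{i=1}^n\boldsymbol X_i\boldsymbol X_i^T$, $\lambda_{\max}$ is the largest eigenvalue of $D$, $\|\cdot\|_{\mathrm{op}}$ is the operator (spectral) norm. $C(s,t):=\mathrm E(Y(s)Y(t))$, $T:=L_K^{1/2}L_CL_K^{1/2}$, and the effective dimension is $D(\lambda):=\mathrm{Tr}((T+\lambda I)^{-1}T)$ for $\lambda>0$ (a function of $\lambda$, not to be confused with the matrix $D$). Sub-Gaussian norm. For a real random variable $W$, $\|W\|_G:=\sup_{k\ge1}\bigl[\mathrm E W^{2k}/(2k-1)!!\bigr]^{1/(2k)}$. Estimator. $(\hat{\boldsymbol\alpha}_n,\hat f_n)$ is a minimizer over $(\boldsymbol\alpha,f)\in\mathbb R^p\times L^2(\mathcal T)$ of $\frac1n\sum_{i=1}^n\bigl(Z_i-\boldsymbol X_i^T\boldsymbol\alpha-\langle Y_i,L_K^{1/2}f\rangle\bigr)^2+\lambda_n\|f\|^2$, and $\hat\beta_n=L_K^{1/2}\hat f_n$. Risk. $\eta_0(\boldsymbol X,Y):=\boldsymbol X^T\boldsymbol\alpha_0+\int_{\mathcal T}Y\beta_0$, $\hat\eta_n(\boldsymbol X,Y):=\boldsymbol X^T\hat{\boldsymbol\alpha}_n+\int_{\mathcal T}Y\hat\beta_n$. For a prediction rule $\eta$, $\mathcal E(\eta):=\mathrm E[Z^*-\eta(\boldsymbol X^*,Y^* )]^2$, where $(Z^*,\boldsymbol X^*,Y^*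 )$ is a copy of $(Z,\boldsymbol X,Y)$ independent of the data and the expectation is over this copy only (the data being held fixed); thus $\mathcal E(\hat\eta_n)-\mathcal E(\eta_0)=\mathrm E[\hat\eta_n(\boldsymbol X^*,Y^* )-\eta_0(\boldsymbol X^*,Y^* )]^2$ is a random variable depending on the data. *)

theory Defs
  imports "HOL-Probability.Probability"
begin

text \<open>
  Elements of \<open>L\<^sup>2(T)\<close> are handled through representatives of type \<^typ>\<open>real \<Rightarrow> real\<close>; only the
  values on \<open>T\<close> matter, and equality in \<open>L\<^sup>2(T)\<close> is \<open>l2_eq T\<close>.  Every class of Lebesgue measurable
  functions has a Borel representative, so Borel measurability is no restriction.
\<close>

abbreviation leb :: "real set \<Rightarrow> real measure" where
  "leb T \<equiv> restrict_space lborel T"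

definition l2_space :: "real set \<Rightarrow> (real \<Rightarrow> real) set" where
  "l2_space T = {f \<in> borel_measurable (leb T). integrable (leb T) (\<lambda>t. (f t)\<^sup>2)}"

definition l2_eq :: "real set \<Rightarrow> (real \<Rightarrow> real) \<Rightarrow> (real \<Rightarrow> real) \<Rightarrow> bool" where
  "l2_eq T f g \<longleftrightarrow> (AE t in leb T. f t = g t)"

definition l2_inner :: "real set \<Rightarrow> (real \<Rightarrow> real) \<Rightarrow> (real \<Rightarrow> real) \<Rightarrow> real" where
  "l2_inner T f g = (LINT t|leb T. f t * g t)"

definition l2_norm :: "real set \<Rightarrow> (real \<Rightarrow> real) \<Rightarrow> real" where
  "l2_norm T f = sqrt (l2_inner T f f)"

definition l2_open :: "real set \<Rightarrow> (real \<Rightarrow> real) set \<Rightarrow> bool" where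
  "l2_open T U \<longleftrightarrow> U \<subseteq> l2_space T \<and>
     (\<forall>f\<in>U. \<exists>e>0. \<forall>g\<in>l2_space T. l2_norm T (\<lambda>t. g t - f t) < e \<longrightarrow> g \<in> U)"

definition l2_borel :: "real set \<Rightarrow> (real \<Rightarrow> real) measure" where
  "l2_borel T = sigma (l2_space T) {U. l2_open T U}"

definition l2_orthonormal_basis :: "real set \<Rightarrow> (real \<Rightarrow> real) set \<Rightarrow> bool" where
  "l2_orthonormal_basis T B \<longleftrightarrow> B \<subseteq> l2_space T \<and>
     (\<forall>e\<in>B. \<forall>h\<in>B. l2_inner T e h = (if e = h then 1 else 0)) \<and>
     (\<forall>f\<in>l2_space T. (\<forall>e\<in>B. l2_inner T f e = 0) \<longrightarrow> l2_eq T f (\<lambda>_. 0))"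

type_synonym l2_op = "(real \<Rightarrow> real) \<Rightarrow> (real \<Rightarrow> real)"

definition l2_bounded_operator :: "real set \<Rightarrow> l2_op \<Rightarrow> bool" where
  "l2_bounded_operator T A \<longleftrightarrow>
     (\<forall>f\<in>l2_space T. A f \<in> l2_space T) \<and>
     (\<forall>f\<in>l2_space T. \<forall>g\<in>l2_space T. l2_eq T f g \<longrightarrow> l2_eq T (A f) (A g)) \<and>
     (\<forall>f\<in>l2_space T. \<forall>g\<in>l2_space T. \<forall>a b.
        l2_eq T (A (\<lambda>t. a * f t + b * g t)) (\<lambda>t. a * A f t + b * A g t)) \<and>
     (\<exists>B. \<forall>f\<in>l2_space T. l2_norm T (A f) \<le> B * l2_norm T f)"

definition l2_nonneg_operator :: "real set \<Rightarrow> l2_op \<Rightarrow> bool" where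
  "l2_nonneg_operator T A \<longleftrightarrow> l2_bounded_operator T A \<and>
     (\<forall>f\<in>l2_space T. \<forall>g\<in>l2_space T. l2_inner T (A f) g = l2_inner T f (A g)) \<and>
     (\<forall>f\<in>l2_space T. 0 \<le> l2_inner T (A f) f)"

definition l2_nonneg_sqrt :: "real set \<Rightarrow> l2_op \<Rightarrow> l2_op \<Rightarrow> bool" where
  "l2_nonneg_sqrt T A S \<longleftrightarrow> l2_nonneg_operator T S \<and>
     (\<forall>f\<in>l2_space T. l2_eq T (S (S f)) (A f))"

definition l2_opnorm :: "real set \<Rightarrow> l2_op \<Rightarrow> real" where
  "l2_opnorm T A = (SUP f\<in>{f \<in> l2_space T. l2_norm T f \<le> 1}. l2_norm T (A f))"

definition integral_operator :: "real set \<Rightarrow> (real \<Rightarrow> real \<Rightarrow> real) \<Rightarrow> l2_op" where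
  "integral_operator T R f = (\<lambda>t. LINT s|leb T. R s t * f s)"

definition l2_op_inverse :: "real set \<Rightarrow> l2_op \<Rightarrow> l2_op" where
  "l2_op_inverse T A g = (SOME f. f \<in> l2_space T \<and> l2_eq T (A f) g)"

text \<open>
  Trace of a nonnegative operator, with values in \<open>[0, \<infinity>]\<close>; it does not depend on the chosen basis.
  The extended values prevent a divergent trace from being read as \<open>0\<close>.
\<close>

definition l2_trace :: "real set \<Rightarrow> l2_op \<Rightarrow> ennreal" where
  "l2_trace T A =
     (\<Sum>\<^sub>\<infinity>e\<in>(SOME B. l2_orthonormal_basis T B). ennreal (l2_inner T (A e) e))"

definition effective_dimension :: "real set \<Rightarrow> l2_op \<Rightarrow> real \<Rightarrow> ennreal" where
  "effective_dimension T A l =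
     l2_trace T (\<lambda>f. l2_op_inverse T (\<lambda>h t. A h t + l * h t) (A f))"

definition continuous_psd_kernel :: "real set \<Rightarrow> (real \<Rightarrow> real \<Rightarrow> real) \<Rightarrow> bool" where
  "continuous_psd_kernel T K \<longleftrightarrow>
     continuous_on (T \<times> T) (\<lambda>(s, t). K s t) \<and>
     (\<forall>s\<in>T. \<forall>t\<in>T. K s t = K t s) \<and>
     (\<forall>F a. finite F \<and> F \<subseteq> T \<longrightarrow> 0 \<le> (\<Sum>s\<in>F. \<Sum>t\<in>F. a s * a t * K s t))"

text \<open>\<open>H(K)\<close> is the range of the square root \<open>S\<close> of the integral operator of \<open>K\<close>.\<close>

definition rkhs :: "real set \<Rightarrow> l2_op \<Rightarrow> (real \<Rightarrow> real) set" where
  "rkhs T S = {h \<in> l2_space T. \<exists>f\<in>l2_space T. l2_eq T (S f) h}"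

definition l2_dense :: "real set \<Rightarrow> (real \<Rightarrow> real) set \<Rightarrow> bool" where
  "l2_dense T H \<longleftrightarrow> (\<forall>f\<in>l2_space T. \<forall>e>0. \<exists>h\<in>H. l2_norm T (\<lambda>t. f t - h t) < e)"

definition l2_injective :: "real set \<Rightarrow> l2_op \<Rightarrow> bool" where
  "l2_injective T A \<longleftrightarrow>
     (\<forall>f\<in>l2_space T. \<forall>g\<in>l2_space T. l2_eq T (A f) (A g) \<longrightarrow> l2_eq T f g)"

definition pos_def_matrix :: "real^'p^'p \<Rightarrow> bool" where
  "pos_def_matrix A \<longleftrightarrow> transpose A = A \<and> (\<forall>x. x \<noteq> 0 \<longrightarrow> 0 < x \<bullet> (A *v x))"

definition matrix_opnorm :: "real^'p^'p \<Rightarrow> real" where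
  "matrix_opnorm A = onorm (\<lambda>x. A *v x)"

definition max_eigenvalue :: "real^'p^'p \<Rightarrow> real" where
  "max_eigenvalue A = Max {l. \<exists>x. x \<noteq> 0 \<and> A *v x = l *\<^sub>R x}"

text \<open>
  The factor \<open>\<Prod>i=1..k. 2i - 1\<close> is \<open>(2k - 1)!!\<close>; an infinite moment makes the norm infinite.
\<close>

definition sub_gaussian_norm :: "'w measure \<Rightarrow> ('w \<Rightarrow> real) \<Rightarrow> ennreal" where
  "sub_gaussian_norm M W = (SUP k\<in>{1::nat..}.
     if integrable M (\<lambda>w. W w ^ (2 * k))
     then ennreal (((LINT w|M. W w ^ (2 * k)) / (\<Prod>i=1..k. 2 * real i - 1)) powr (1 / real (2 * k)))
     else \<infinity>)"

definition generated_algebra :: "'w measure \<Rightarrow> ('w \<Rightarrow> 'a) \<Rightarrow> 'a measure \<Rightarrow> 'w measure" where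
  "generated_algebra M V N = vimage_algebra (space M) V N"

text \<open>\<open>indep_var\<close> only covers two variables with values in the same type.\<close>

definition independent_rvs ::
  "'w measure \<Rightarrow> 'a measure \<Rightarrow> ('w \<Rightarrow> 'a) \<Rightarrow> 'b measure \<Rightarrow> ('w \<Rightarrow> 'b) \<Rightarrow> bool" where
  "independent_rvs M N V N' V' \<longleftrightarrow> V \<in> measurable M N \<and> V' \<in> measurable M N' \<and>
     prob_space.indep_set M (sets (generated_algebra M V N)) (sets (generated_algebra M V' N'))"

definition second_moment_matrix :: "'w measure \<Rightarrow> ('w \<Rightarrow> real^'p) \<Rightarrow> real^'p^'p" where
  "second_moment_matrix M X = (\<chi> i j. LINT w|M. X w $ i * X w $ j)"

definition empirical_second_moment_matrix ::
  "nat \<Rightarrow> (nat \<Rightarrow> 'w \<Rightarrow> real^'p) \<Rightarrow> 'w \<Rightarrow> real^'p^'p" where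
  "empirical_second_moment_matrix n Xs w =
     (\<chi> i j. (1 / real n) * (\<Sum>k=1..n. Xs k w $ i * Xs k w $ j))"

definition second_moment_kernel ::
  "'w measure \<Rightarrow> ('w \<Rightarrow> real \<Rightarrow> real) \<Rightarrow> real \<Rightarrow> real \<Rightarrow> real" where
  "second_moment_kernel M Y s t = (LINT w|M. Y w s * Y w t)"

definition obs_space :: "real set \<Rightarrow> (real \<times> (real^'p) \<times> (real \<Rightarrow> real)) measure" where
  "obs_space T = borel \<Otimes>\<^sub>M (borel \<Otimes>\<^sub>M l2_borel T)"

definition iid_copies :: "'w measure \<Rightarrow> 'a measure \<Rightarrow> ('w \<Rightarrow> 'a) \<Rightarrow> nat \<Rightarrow> (nat \<Rightarrow> 'w \<Rightarrow> 'a) \<Rightarrow> bool" where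
  "iid_copies M N V n Vs \<longleftrightarrow>
     prob_space.indep_vars M (\<lambda>_. N) Vs {1..n} \<and> (\<forall>i\<in>{1..n}. distr M N (Vs i) = distr M N V)"

definition penalized_loss ::
  "real set \<Rightarrow> l2_op \<Rightarrow> nat \<Rightarrow> real \<Rightarrow> (nat \<Rightarrow> real) \<Rightarrow> (nat \<Rightarrow> real^'p) \<Rightarrow> (nat \<Rightarrow> real \<Rightarrow> real)
   \<Rightarrow> (real^'p) \<times> (real \<Rightarrow> real) \<Rightarrow> real" where
  "penalized_loss T S n l z x y = (\<lambda>(a, f).
     (1 / real n) * (\<Sum>i=1..n. (z i - x i \<bullet> a - l2_inner T (y i) (S f))\<^sup>2) + l * (l2_norm T f)\<^sup>2)"

definition linear_rule ::
  "real set \<Rightarrow> real^'p \<Rightarrow> (real \<Rightarrow> real) \<Rightarrow> real^'p \<Rightarrow> (real \<Rightarrow> real) \<Rightarrow> real" where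
  "linear_rule T a b = (\<lambda>x y. x \<bullet> a + l2_inner T y b)"

text \<open>
  The rule \<open>h\<close> is a fixed function here, so the expectation is only over the law of \<open>(Z, X, Y)\<close>, that
  is, over a new copy with the data held fixed once a data-dependent rule is plugged in.
\<close>

definition prediction_risk ::
  "'w measure \<Rightarrow> ('w \<Rightarrow> real) \<Rightarrow> ('w \<Rightarrow> real^'p) \<Rightarrow> ('w \<Rightarrow> real \<Rightarrow> real)
   \<Rightarrow> (real^'p \<Rightarrow> (real \<Rightarrow> real) \<Rightarrow> real) \<Rightarrow> real" where
  "prediction_risk M Z X Y h = (LINT w|M. (Z w - h (X w) (Y w))\<^sup>2)"

end

theory Submission
  imports Defs
begin

text \<open>
  Write \<open>l\<^sub>y(f) = \<langle>y, S f\<rangle>\<close> and \<open>t(f, g) = E (l\<^sub>Y(f) l\<^sub>Y(g))\<close>, and let \<open>a = \<alpha>h - \<alpha>0\<close> and \<open>h = fh - f0\<close> be the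
  errors of the estimator.  The noise is conditionally centred, \<open>X\<close> is centred and independent of \<open>Y\<close>, so all mixed
  terms vanish and the excess risk is \<open>a \<bullet> D a + t(h, h)\<close> (\<open>excess_risk\<close>).  The second summand is at most
  \<open>N(h)\<^sup>2\<close>, where \<open>N\<close> is the norm of the regularised form \<open>t + \<lambda> \<langle>_, _\<rangle>\<close>.

  Deterministic part.  The normal equations are linear in \<open>(a, h)\<close>.  Split \<open>a = a1 + a2\<close>, where \<open>a1\<close> are the
  coefficients of the regression of the noise on the covariates; then \<open>a2\<close> belongs to the regression of the numbers
  \<open>- l\<^sub>Y\<^sub>i(h)\<close>.  Inserting this into the equation tested with \<open>h\<close> leaves a single identity,
  \<open>\<lambda> \<parallel>h\<parallel>\<^sup>2 + t\<^sub>n(h) - q2 = r(h) - \<lambda> \<langle>f0, h\<rangle>\<close>: here \<open>t\<^sub>n\<close> is the empirical version of \<open>t\<close>, \<open>q2 = a2 \<bullet> D\<^sub>n a2\<close>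
  is the part of \<open>t\<^sub>n(h)\<close> that the covariates explain, and \<open>r(h)\<close> pairs \<open>l\<^sub>Y\<^sub>i(h)\<close> with the residuals of the noise.
  It is used twice, with \<open>t\<^sub>n(h) - q2\<close> bounded below by \<open>0\<close> and with \<open>t\<^sub>n\<close> replaced by \<open>t\<close>.  The two resulting
  inequalities bound \<open>N(h)\<close> and \<open>\<surd>\<lambda> \<parallel>h\<parallel>\<close> together (\<open>regularised_error_scalar\<close>, \<open>deterministic_error_bound\<close>), even
  though the relative error of \<open>t\<^sub>n\<close> may exceed \<open>1\<close>.

  Random part.  Five estimates, each with one of the failure probabilities, make this work (\<open>good_sample_event\<close>).
  \<open>t\<^sub>n\<close> is close to \<open>t\<close> and the empirical correlations of \<open>X\<close> with \<open>l\<^sub>Y(h)\<close> are small, both uniformly in \<open>h\<close>; the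
  entries of \<open>D\<^sub>n\<close> are close to those of \<open>D\<close>.  These three follow from one inequality in the style of Pinelis: for
  independent centred vectors with sum \<open>S\<^sub>n\<close>, each further summand \<open>V\<close> multiplies the bound on
  \<open>E cosh \<parallel>S\<^sub>n\<parallel>\<close> by at most \<open>E (exp \<parallel>V\<parallel> - \<parallel>V\<parallel>)\<close> (\<open>cosh_norm_step\<close>, \<open>iid_norm_tail\<close>).  The two noise terms
  are quadratic forms in the noise, whose expectation is at most \<open>\<sigma>\<^sup>2\<close> times an expected trace
  (\<open>iid_quadratic_form\<close>); Markov's inequality finishes them.

  Uniformity in \<open>h\<close> is obtained from coordinates: a bounded functional is controlled by the \<open>\<ell>\<^sup>2\<close> norm of its values on
  a complete orthonormal sequence, and a bilinear form by the Hilbert--Schmidt norm of its matrix.  One of the two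
  sequences is orthonormal for the regularised form; along it \<open>t(g\<^sub>k, g\<^sub>k)\<close> sums to at most the effective dimension
  (\<open>sum_L_sq_le_effective_dimension\<close>).  Operators enter only through their forms, and the resolvent
  is supplied by the Riesz representation theorem.
\<close>

section \<open>Exponential inequalities for real numbers\<close>

lemma cosh_sqrt_sums:
  fixes u :: real assumes "0 \<le> u"
  shows "(\<lambda>n. if even n then u ^ (n div 2) /\<^sub>R fact n else 0) sums cosh (sqrt u)"
proof -
  have "sqrt u ^ n = u ^ (n div 2)" if "even n" for n
    using that assms by (metis dvd_mult_div_cancel power_mult real_sqrt_pow2)
  then show ?thesis
    using cosh_converges[of "sqrt u"] by (simp cong: if_cong)
qed

text \<open>
  The power series of \<open>cosh (sqrt u)\<close> in \<open>u\<close> has nonnegative coefficients, and monomials are convex on the half line.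
\<close>

lemma convex_on_cosh_sqrt: "convex_on {0..} (\<lambda>u::real. cosh (sqrt u))"
proof (intro convex_onI)
  fix t x y :: real
  assume t: "0 < t" "t < 1" and x: "x \<in> {0..}" and y: "y \<in> {0..}"
  have conv: "convex_on {0..} (\<lambda>u::real. u ^ k)" for k
    using convex_power_even[of k] convex_power_odd[of k]
    by (cases "even k") (auto intro: convex_on_subset)
  have pow: "((1 - t) * x + t * y) ^ k \<le> (1 - t) * x ^ k + t * y ^ k" for k
    using convex_onD[OF conv, of t x y] t x y by simp
  define c where "c u n = (if even n then u ^ (n div 2) /\<^sub>R fact n else 0)" for u :: real and n :: nat
  have s: "c u sums cosh (sqrt u)" if "0 \<le> u" for u
    using cosh_sqrt_sums[OF that] by (simp add: c_def[abs_def])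
  have le: "c ((1 - t) * x + t * y) n \<le> (1 - t) * c x n + t * c y n" for n
    using mult_left_mono[OF pow, of "inverse (fact n)" "n div 2"] by (simp add: c_def algebra_simps)
  have "cosh (sqrt ((1 - t) * x + t * y)) \<le> (1 - t) * cosh (sqrt x) + t * cosh (sqrt y)"
    by (rule sums_le[OF le s sums_add[OF sums_mult[OF s] sums_mult[OF s]]]) (use t x y in auto)
  then show "cosh (sqrt ((1 - t) *\<^sub>R x + t *\<^sub>R y)) \<le> (1 - t) * cosh (sqrt x) + t * cosh (sqrt y)"
    by simp
qed simp

lemma sinh_ge_self: "(x::real) \<le> sinh x" if "0 \<le> x"
proof -
  have "sinh 0 - (0::real) \<le> sinh x - x"
    by (rule DERIV_nonneg_imp_nondecreasing[OF that])
       (auto intro!: exI derivative_eq_intros simp: cosh_real_ge_1)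
  then show ?thesis by simp
qed

text \<open>
  Let \<open>a\<close> and \<open>b\<close> be the norms of two vectors and \<open>s\<close> their inner product, so that the left side is \<open>cosh\<close> of the norm
  of the sum.  It is convex in \<open>s\<close>, hence lies below the chord between the extreme values \<open>s = - a b\<close> and
  \<open>s = a b\<close>, where it is \<open>cosh (a - b)\<close> and \<open>cosh (a + b)\<close>.  The bound on the chord is affine in \<open>s\<close>, so for a centred
  increment the last term has mean zero.
\<close>

lemma cosh_norm_step:
  fixes a b s :: real
  assumes a: "0 \<le> a" and b: "0 \<le> b" and s: "\<bar>s\<bar> \<le> a * b"
  shows "cosh (sqrt (a\<^sup>2 + 2 * s + b\<^sup>2)) \<le> cosh a * (exp b - b) + sinh a / a * s"
proof -
  have sb: "b \<le> sinh b" using sinh_ge_self[OF b] .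
  have eb: "exp b = cosh b + sinh b" by (simp add: cosh_plus_sinh)
  have sca: "0 \<le> sinh a" "sinh a \<le> cosh a" using a by (simp_all add: sinh_le_cosh_real)
  show ?thesis
  proof (cases "a * b = 0")
    case True
    have "s = 0" using s unfolding True by simp
    have "cosh b \<le> exp b - b" using eb sb by simp
    moreover have "cosh a \<le> cosh a * (exp b - b)"
      proof -
      have "1 \<le> exp b - b" using exp_ge_add_one_self[of b] by linarith
      from mult_left_mono[OF this, of "cosh a"] show ?thesis by (simp add: cosh_real_nonneg)
    qed
    ultimately show ?thesis using True a b \<open>s = 0\<close> by (auto simp: real_sqrt_unique)
  next
    case False
    then have ab: "0 < a" "0 < b" using a b by auto
    \<comment> \<open>the position of \<open>s\<close> between \<open>- a b\<close> and \<open>a b\<close>\<close>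
    define t where "t = (s + a * b) / (2 * (a * b))"
    have t01: "0 \<le> t" "t \<le> 1" using s ab by (auto simp: t_def field_simps abs_le_iff)
    have st: "s = (2 * t - 1) * (a * b)" using ab by (simp add: t_def field_simps)
    have u: "a\<^sup>2 + 2 * s + b\<^sup>2 = (1 - t) * (a - b)\<^sup>2 + t * (a + b)\<^sup>2"
      unfolding st by (simp add: power2_eq_square algebra_simps)
    \<comment> \<open>the values at the two ends of the chord\<close>
    have e1: "cosh (a - b) \<le> cosh a * (exp b - b) - b * sinh a"
    proof -
      have "cosh a * (b - sinh b) \<le> sinh a * (sinh b - b)"
        using sb sca cosh_real_pos[of a] by (smt (verit) mult_nonneg_nonneg mult_nonneg_nonpos)
      then show ?thesis by (simp add: cosh_diff eb algebra_simps)
    qed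
    have e2: "cosh (a + b) \<le> cosh a * (exp b - b) + b * sinh a"
    proof -
      have "sinh a * (sinh b - b) \<le> cosh a * (sinh b - b)"
        using sb sca by (intro mult_right_mono) auto
      then show ?thesis by (simp add: cosh_add eb algebra_simps)
    qed
    have "cosh (sqrt (a\<^sup>2 + 2 * s + b\<^sup>2)) \<le> (1 - t) * cosh (sqrt ((a - b)\<^sup>2)) + t * cosh (sqrt ((a + b)\<^sup>2))"
      unfolding u using convex_onD[OF convex_on_cosh_sqrt, of t "(a - b)\<^sup>2" "(a + b)\<^sup>2"] t01 by simp
    also have "\<dots> = (1 - t) * cosh (a - b) + t * cosh (a + b)"
      using ab by simp
    also have "\<dots> \<le> (1 - t) * (cosh a * (exp b - b) - b * sinh a) + t * (cosh a * (exp b - b) + b * sinh a)"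
      using e1 e2 t01 by (intro add_mono mult_left_mono) auto
    also have "\<dots> = cosh a * (exp b - b) + sinh a / a * s"
      using ab by (simp add: st field_simps)
    finally show ?thesis .
  qed
qed

text \<open>
  Replaces \<open>exp x - x\<close> by an even function, so that even moments suffice.  Without the factor \<open>sqrt 2\<close> the
  inequality fails near \<open>0\<close>, because of the cubic term of the exponential series.
\<close>

lemma exp_minus_self_le_cosh:
  fixes x :: real assumes "0 \<le> x"
  shows "exp x - x \<le> cosh (sqrt 2 * x)"
proof -
  have d2: "0 \<le> sqrt 2 * sinh (sqrt 2 * x) - exp x + 1" if "0 \<le> x" for x :: real
  proof -
    have "sqrt 2 * sinh (sqrt 2 * 0) - exp 0 + 1 \<le> sqrt 2 * sinh (sqrt 2 * x) - exp x + 1"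
    proof (rule DERIV_nonneg_imp_nondecreasing[OF that])
      fix y :: real assume y: "0 \<le> y" "y \<le> x"
      have "exp y \<le> exp (sqrt 2 * y)" using y by (simp add: mult_le_cancel_right1)
      also have "\<dots> \<le> 2 * cosh (sqrt 2 * y)" by (simp add: cosh_def)
      finally show "\<exists>D. ((\<lambda>x. sqrt 2 * sinh (sqrt 2 * x) - exp x + 1) has_real_derivative D) (at y) \<and> 0 \<le> D"
        by (intro exI[of _ "2 * cosh (sqrt 2 * y) - exp y"] conjI)
           (auto intro!: derivative_eq_intros)
    qed
    then show ?thesis by simp
  qed
  have "cosh (sqrt 2 * 0) - exp 0 + 0 \<le> cosh (sqrt 2 * x) - exp x + x"
    by (rule DERIV_nonneg_imp_nondecreasing[OF assms])
       (rule exI, rule conjI[rotated], rule d2, auto intro!: derivative_eq_intros simp: mult.commute)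
  then show ?thesis by simp
qed

lemma exp_minus_self_mono: "0 \<le> x \<Longrightarrow> x \<le> y \<Longrightarrow> exp x - x \<le> exp y - (y::real)"
  by (rule DERIV_nonneg_imp_nondecreasing[where f = "\<lambda>x. exp x - x"])
     (auto intro!: exI derivative_eq_intros)

text \<open>
  Comparison of the exponential series from its third term on with a geometric series.
\<close>

lemma exp_bernstein:
  fixes x :: real assumes x: "0 \<le> x" "x < 3"
  shows "exp x \<le> 1 + x + x\<^sup>2 / (2 * (1 - x / 3))"
proof -
  have fact_ge: "2 * 3 ^ n \<le> (fact (n + 2) :: real)" for n
  proof (induction n)
    case (Suc n)
    have "2 * 3 ^ Suc n \<le> 3 * (fact (n + 2) :: real)" using mult_left_mono[OF Suc, of 3] by (simp only: power_Suc mult_ac)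
    also have "\<dots> \<le> (real n + 3) * fact (n + 2)" by (intro mult_right_mono) auto
    also have "\<dots> = fact (Suc n + 2)" by (simp add: fact_reduce algebra_simps)
    finally show ?case by simp
  qed simp
  have s1: "(\<lambda>n. x ^ (n + 2) /\<^sub>R fact (n + 2)) sums (exp x - (\<Sum>i<2. x ^ i /\<^sub>R fact i))"
    by (rule sums_split_initial_segment[OF exp_converges])
  have s2: "(\<lambda>n. x\<^sup>2 / 2 * (x / 3) ^ n) sums (x\<^sup>2 / 2 * (1 / (1 - x / 3)))"
    using x by (intro sums_mult geometric_sums) auto
  have "x ^ (n + 2) /\<^sub>R fact (n + 2) \<le> x\<^sup>2 / 2 * (x / 3) ^ n" for n
  proof -
    have "x ^ (n + 2) / fact (n + 2) \<le> x ^ (n + 2) / (2 * 3 ^ n)"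
      using x fact_ge[of n] by (intro divide_left_mono) auto
    moreover have "x ^ (n + 2) / (2 * 3 ^ n) = x\<^sup>2 / 2 * (x / 3) ^ n"
      by (simp add: power_add power_divide power2_eq_square)
    moreover have "x ^ (n + 2) /\<^sub>R fact (n + 2) = x ^ (n + 2) / fact (n + 2)"
      by (simp only: real_scaleR_def divide_inverse mult.commute)
    ultimately show ?thesis by linarith
  qed
  from sums_le[OF this s1 s2] show ?thesis by (simp add: numeral_2_eq_2)
qed

section \<open>Tail bounds for norms of sums of independent vectors\<close>

lemma L2_set_add_sq:
  "L2_set (\<lambda>k. x k + y k) K = sqrt ((L2_set x K)\<^sup>2 + 2 * (\<Sum>k\<in>K. x k * y k) + (L2_set y K)\<^sup>2)"
  by (simp add: L2_set_def sum_nonneg power2_sum sum.distrib sum_distrib_left mult.assoc algebra_simps)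

lemma abs_sum_mult_le_L2_set: "\<bar>\<Sum>k\<in>K. x k * y k\<bar> \<le> L2_set x K * L2_set y K"
proof -
  have "\<bar>\<Sum>k\<in>K. x k * y k\<bar> \<le> (\<Sum>k\<in>K. \<bar>x k\<bar> * \<bar>y k\<bar>)"
    using sum_abs[of "\<lambda>k. x k * y k" K] by (simp add: abs_mult)
  then show ?thesis using L2_set_mult_ineq[of x y K] by linarith
qed

lemma borel_measurable_L2_set [measurable (raw)]:
  assumes "\<And>k. k \<in> K \<Longrightarrow> (\<lambda>x. f x k) \<in> borel_measurable M"
  shows "(\<lambda>x. L2_set (\<lambda>k. f x k) K) \<in> borel_measurable M"
  unfolding L2_set_def using assms by measurable

text \<open>
  Vectors of a Hilbert space are represented by finitely many coordinates; \<open>iid_norm_tail\<close> removes the restriction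
  to finite index sets.
\<close>

lemma cosh_L2_set_step:
  "cosh (L2_set (\<lambda>k. x k + y k) K)
    \<le> cosh (L2_set x K) * (exp (L2_set y K) - L2_set y K)
      + sinh (L2_set x K) / L2_set x K * (\<Sum>k\<in>K. x k * y k)"
  unfolding L2_set_add_sq by (rule cosh_norm_step) (simp_all add: abs_sum_mult_le_L2_set)

lemma measurable_cosh [measurable]: "(cosh :: real \<Rightarrow> real) \<in> borel_measurable borel"
  by (intro borel_measurable_continuous_onI continuous_intros)

text \<open>
  The term of \<open>cosh_L2_set_step\<close> that is linear in the increment integrates to zero.
\<close>

lemma nn_integral_cosh_L2_set_step:
  fixes V :: "'k \<Rightarrow> 'o \<Rightarrow> real"
  assumes P: "prob_space P" and K: "finite K"
    and V [measurable]: "\<And>k. k \<in> K \<Longrightarrow> integrable P (V k)"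
    and mean: "\<And>k. k \<in> K \<Longrightarrow> (LINT u|P. V k u) = 0"
    and C: "(\<integral>\<^sup>+u. ennreal (exp (L2_set (\<lambda>k. V k u) K) - L2_set (\<lambda>k. V k u) K) \<partial>P) \<le> ennreal C"
  shows "(\<integral>\<^sup>+u. ennreal (cosh (L2_set (\<lambda>k. x k + V k u) K)) \<partial>P) \<le> ennreal C * ennreal (cosh (L2_set x K))"
proof -
  interpret prob_space P by fact
  have Vm [measurable]: "V k \<in> borel_measurable P" if "k \<in> K" for k using V[OF that] by simp
  define N where "N u = L2_set (\<lambda>k. V k u) K" for u
  have N [measurable]: "N \<in> borel_measurable P" unfolding N_def[abs_def] by measurable
  have pos: "0 \<le> exp (N u) - N u" for u using exp_ge_add_one_self[of "N u"] by linarith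
  have int: "integrable P (\<lambda>u. exp (N u) - N u)"
    using C pos le_less_trans[OF C ennreal_less_top]
    by (intro integrableI_nonneg) (auto simp: N_def[symmetric])
  define R where "R u = cosh (L2_set x K) * (exp (N u) - N u) + sinh (L2_set x K) / L2_set x K * (\<Sum>k\<in>K. x k * V k u)" for u
  have intR: "integrable P R" unfolding R_def[abs_def] using int V by (intro Bochner_Integration.integrable_add integrable_mult_right Bochner_Integration.integrable_sum)
  have le: "cosh (L2_set (\<lambda>k. x k + V k u) K) \<le> R u" for u
    unfolding R_def N_def by (rule cosh_L2_set_step)
  have "(\<integral>\<^sup>+u. ennreal (cosh (L2_set (\<lambda>k. x k + V k u) K)) \<partial>P) \<le> (\<integral>\<^sup>+u. ennreal (R u) \<partial>P)"
    by (intro nn_integral_mono ennreal_leI le)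
  also have "\<dots> = ennreal (LINT u|P. R u)"
    by (rule nn_integral_eq_integral[OF intR]) (intro AE_I2 order_trans[OF _ le] cosh_real_nonneg)
  also have "(LINT u|P. R u) = cosh (L2_set x K) * (LINT u|P. exp (N u) - N u)"
    unfolding R_def using int V mean by (simp add: Bochner_Integration.integral_sum)
  also have "ennreal \<dots> = ennreal (cosh (L2_set x K)) * ennreal (LINT u|P. exp (N u) - N u)"
    by (simp add: ennreal_mult' cosh_real_nonneg)
  also have "ennreal (LINT u|P. exp (N u) - N u) = (\<integral>\<^sup>+u. ennreal (exp (N u) - N u) \<partial>P)"
    by (rule nn_integral_eq_integral[OF int, symmetric]) (use pos in simp)
  also have "ennreal (cosh (L2_set x K)) * \<dots> \<le> ennreal (cosh (L2_set x K)) * ennreal C"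
    using C by (intro mult_left_mono) (auto simp: N_def)
  finally show ?thesis by (simp add: mult.commute)
qed

text \<open>
  The summands are added one at a time, and the integral over the newest coordinate is evaluated first.
\<close>

lemma nn_integral_cosh_sum_PiM:
  fixes V :: "'k \<Rightarrow> 'o \<Rightarrow> real"
  assumes P: "prob_space P" and K: "finite K" and I: "finite I"
    and V: "\<And>k. k \<in> K \<Longrightarrow> integrable P (V k)"
    and mean: "\<And>k. k \<in> K \<Longrightarrow> (LINT u|P. V k u) = 0"
    and C: "(\<integral>\<^sup>+u. ennreal (exp (L2_set (\<lambda>k. V k u) K) - L2_set (\<lambda>k. V k u) K) \<partial>P) \<le> ennreal C"
  shows "(\<integral>\<^sup>+\<omega>. ennreal (cosh (L2_set (\<lambda>k. \<Sum>i\<in>I. V k (\<omega> i)) K)) \<partial>(\<Pi>\<^sub>M i\<in>I. P)) \<le> ennreal C ^ card I"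
  using I
proof (induction I)
  case empty
  interpret prob_space P by fact
  interpret E: prob_space "\<Pi>\<^sub>M i\<in>{}. P" by (rule prob_space_PiM) (rule P)
  show ?case by (simp add: E.emeasure_space_1 L2_set_0')
next
  case (insert j I)
  interpret prob_space P by fact
  interpret product_sigma_finite "\<lambda>_. P" by standard
  have Vm [measurable]: "V k \<in> borel_measurable P" if "k \<in> K" for k using V[OF that] by simp
  have "(\<integral>\<^sup>+\<omega>. ennreal (cosh (L2_set (\<lambda>k. \<Sum>i\<in>insert j I. V k (\<omega> i)) K)) \<partial>(\<Pi>\<^sub>M i\<in>insert j I. P))
      = (\<integral>\<^sup>+\<omega>. (\<integral>\<^sup>+u. ennreal (cosh (L2_set (\<lambda>k. \<Sum>i\<in>insert j I. V k (fun_upd \<omega> j u i)) K)) \<partial>P) \<partial>(\<Pi>\<^sub>M i\<in>I. P))"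
    by (intro product_nn_integral_insert insert) measurable
  also have "\<dots> = (\<integral>\<^sup>+\<omega>. (\<integral>\<^sup>+u. ennreal (cosh (L2_set (\<lambda>k. (\<Sum>i\<in>I. V k (\<omega> i)) + V k u) K)) \<partial>P) \<partial>(\<Pi>\<^sub>M i\<in>I. P))"
  proof (intro nn_integral_cong)
    fix \<omega> u
    have "(\<Sum>i\<in>insert j I. V k (fun_upd \<omega> j u i)) = (\<Sum>i\<in>I. V k (\<omega> i)) + V k u" for k
    proof -
      have "(\<Sum>i\<in>I. V k (fun_upd \<omega> j u i)) = (\<Sum>i\<in>I. V k (\<omega> i))"
        using insert(2) by (intro sum.cong) auto
      then show ?thesis using insert(1,2) by (simp add: add.commute)
    qed
    then show "ennreal (cosh (L2_set (\<lambda>k. \<Sum>i\<in>insert j I. V k (fun_upd \<omega> j u i)) K))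
       = ennreal (cosh (L2_set (\<lambda>k. (\<Sum>i\<in>I. V k (\<omega> i)) + V k u) K))" by simp
  qed
  also have "\<dots> \<le> (\<integral>\<^sup>+\<omega>. ennreal C * ennreal (cosh (L2_set (\<lambda>k. \<Sum>i\<in>I. V k (\<omega> i)) K)) \<partial>(\<Pi>\<^sub>M i\<in>I. P))"
    by (intro nn_integral_mono nn_integral_cosh_L2_set_step P K V mean C)
  also have "\<dots> = ennreal C * (\<integral>\<^sup>+\<omega>. ennreal (cosh (L2_set (\<lambda>k. \<Sum>i\<in>I. V k (\<omega> i)) K)) \<partial>(\<Pi>\<^sub>M i\<in>I. P))"
    by (intro nn_integral_cmult) measurable
  also have "\<dots> \<le> ennreal C * ennreal C ^ card I"
    by (intro mult_left_mono insert.IH) simp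
  finally show ?case using insert by simp
qed

definition iid_sample :: "'w measure \<Rightarrow> 'a measure \<Rightarrow> 'a measure \<Rightarrow> 'i set \<Rightarrow> ('i \<Rightarrow> 'w \<Rightarrow> 'a) \<Rightarrow> bool" where
  "iid_sample M N P I W \<longleftrightarrow> prob_space M \<and> finite I \<and> prob_space.indep_vars M (\<lambda>_. N) W I
     \<and> (\<forall>i\<in>I. distr M N (W i) = P)"

lemma iid_sampleD:
  assumes "iid_sample M N P I W"
  shows "prob_space M" "finite I" "\<And>i. i \<in> I \<Longrightarrow> W i \<in> measurable M N" "\<And>i. i \<in> I \<Longrightarrow> distr M N (W i) = P"
  using assms by (auto simp: iid_sample_def prob_space.indep_vars_def2)

lemma iid_sample_distr_PiM:
  assumes "iid_sample M N P I W" "I \<noteq> {}"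
  shows "distr M (\<Pi>\<^sub>M i\<in>I. N) (\<lambda>w. \<lambda>i\<in>I. W i w) = (\<Pi>\<^sub>M i\<in>I. P)" "prob_space P" "sets P = sets N" "space P = space N"
proof -
  interpret prob_space M using iid_sampleD[OF assms(1)] by simp
  have "distr M (\<Pi>\<^sub>M i\<in>I. N) (\<lambda>w. \<lambda>i\<in>I. W i w) = (\<Pi>\<^sub>M i\<in>I. distr M N (W i))"
    using assms(1) iid_sampleD[OF assms(1)]
    by (subst indep_vars_iff_distr_eq_PiM'[symmetric, OF assms(2)]) (auto simp: iid_sample_def)
  also have "\<dots> = (\<Pi>\<^sub>M i\<in>I. P)"
    by (rule PiM_cong) (simp_all add: iid_sampleD[OF assms(1)])
  finally show "distr M (\<Pi>\<^sub>M i\<in>I. N) (\<lambda>w. \<lambda>i\<in>I. W i w) = (\<Pi>\<^sub>M i\<in>I. P)" .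
  obtain j where j: "j \<in> I" using assms(2) by auto
  have Pj: "P = distr M N (W j)" using iid_sampleD(4)[OF assms(1) j] by simp
  show "prob_space P" unfolding Pj using iid_sampleD(3)[OF assms(1) j] by (rule prob_space_distr)
  show "sets P = sets N" "space P = space N" unfolding Pj by simp_all
qed

lemma iid_sample_nn_integral:
  assumes iid: "iid_sample M N P I W" and I: "I \<noteq> {}"
    and F: "F \<in> borel_measurable (\<Pi>\<^sub>M i\<in>I. N)"
  shows "(\<integral>\<^sup>+w. F (\<lambda>i\<in>I. W i w) \<partial>M) = (\<integral>\<^sup>+\<omega>. F \<omega> \<partial>(\<Pi>\<^sub>M i\<in>I. P))"
proof -
  have [measurable]: "(\<lambda>w. \<lambda>i\<in>I. W i w) \<in> measurable M (\<Pi>\<^sub>M i\<in>I. N)"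
    using iid_sampleD(3)[OF iid] by (intro measurable_restrict)
  show ?thesis
    unfolding iid_sample_distr_PiM(1)[OF iid I, symmetric] using F by (subst nn_integral_distr) simp_all
qed

text \<open>
  Markov's inequality for \<open>cosh (s * Q)\<close>, where \<open>Q\<close> is the norm of the sum, together with \<open>exp x \<le> 2 * cosh x\<close>.
\<close>

lemma iid_norm_tail_finite:
  fixes V :: "'k \<Rightarrow> 'a \<Rightarrow> real"
  assumes iid: "iid_sample M N P I W" and I: "I \<noteq> {}" and K: "finite K"
    and V: "\<And>k. k \<in> K \<Longrightarrow> integrable P (V k)"
    and mean: "\<And>k. k \<in> K \<Longrightarrow> (LINT u|P. V k u) = 0"
    and s: "0 < s"
    and C: "(\<integral>\<^sup>+u. ennreal (exp (s * L2_set (\<lambda>k. V k u) K) - s * L2_set (\<lambda>k. V k u) K) \<partial>P) \<le> ennreal (exp c)"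
  shows "measure M {w\<in>space M. r < L2_set (\<lambda>k. \<Sum>i\<in>I. V k (W i w)) K} \<le> 2 * exp (real (card I) * c - s * r)"
proof -
  interpret prob_space M using iid_sampleD[OF iid] by simp
  note P = iid_sample_distr_PiM[OF iid I]
  have Vm [measurable]: "V k \<in> borel_measurable N" if "k \<in> K" for k
    using V[OF that, THEN borel_measurable_integrable] P(3) by (simp cong: measurable_cong_sets)
  have Wm [measurable]: "W i \<in> measurable M N" if "i \<in> I" for i using iid_sampleD(3)[OF iid that] .
  have L: "L2_set (\<lambda>k. s * f k) K = s * L2_set f K" for f
    using L2_set_right_distrib[of s f K] s by simp
  have "(\<integral>\<^sup>+w. ennreal (cosh (s * L2_set (\<lambda>k. \<Sum>i\<in>I. V k (W i w)) K)) \<partial>M)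
      = (\<integral>\<^sup>+w. (\<lambda>\<omega>. ennreal (cosh (L2_set (\<lambda>k. \<Sum>i\<in>I. s * V k (\<omega> i)) K))) (\<lambda>i\<in>I. W i w) \<partial>M)"
    by (simp add: L sum_distrib_left[symmetric])
  also have "\<dots> = (\<integral>\<^sup>+\<omega>. ennreal (cosh (L2_set (\<lambda>k. \<Sum>i\<in>I. s * V k (\<omega> i)) K)) \<partial>(\<Pi>\<^sub>M i\<in>I. P))"
    by (rule iid_sample_nn_integral[OF iid I]) measurable
  also have "\<dots> \<le> ennreal (exp c) ^ card I"
    using V mean C by (intro nn_integral_cosh_sum_PiM P K iid_sampleD(2)[OF iid]) (auto simp: L)
  finally have E: "(\<integral>\<^sup>+w. ennreal (cosh (s * L2_set (\<lambda>k. \<Sum>i\<in>I. V k (W i w)) K)) \<partial>M) \<le> ennreal (exp (real (card I) * c))"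
    by (simp add: ennreal_power exp_of_nat_mult)
  define Q where "Q w = L2_set (\<lambda>k. \<Sum>i\<in>I. V k (W i w)) K" for w
  have Q [measurable]: "Q \<in> borel_measurable M" unfolding Q_def[abs_def] by measurable
  have "emeasure M {w\<in>space M. r < Q w} \<le> emeasure M {w\<in>space M. 1 \<le> ennreal (2 * exp (- (s * r))) * ennreal (cosh (s * Q w))}"
  proof (intro emeasure_mono subsetI CollectI conjI)
    fix w assume w: "w \<in> {w\<in>space M. r < Q w}"
    have "exp (s * r) \<le> exp (s * Q w)" using w s by simp
    also have "\<dots> \<le> 2 * cosh (s * Q w)" by (simp add: cosh_def)
    finally have "exp (- (s * r)) * exp (s * r) \<le> exp (- (s * r)) * (2 * cosh (s * Q w))" by (intro mult_left_mono) simp_all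
    then have "1 \<le> 2 * exp (- (s * r)) * cosh (s * Q w)" by (simp add: exp_minus)
    then show "1 \<le> ennreal (2 * exp (- (s * r))) * ennreal (cosh (s * Q w))"
      by (simp add: ennreal_mult'[symmetric] cosh_real_nonneg ennreal_1[symmetric] del: ennreal_1)
  qed auto
  also have "\<dots> \<le> ennreal (2 * exp (- (s * r))) * (\<integral>\<^sup>+w. ennreal (cosh (s * Q w)) * indicator (space M) w \<partial>M)"
    by (rule order_trans[OF _ nn_integral_Markov_inequality]) auto
  also have "\<dots> = ennreal (2 * exp (- (s * r))) * (\<integral>\<^sup>+w. ennreal (cosh (s * Q w)) \<partial>M)"
    by (intro arg_cong2[where f = "(*)"] nn_integral_cong) auto
  also have "\<dots> \<le> ennreal (2 * exp (- (s * r))) * ennreal (exp (real (card I) * c))"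
    using E by (intro mult_left_mono) (auto simp: Q_def)
  also have "\<dots> = ennreal (2 * exp (real (card I) * c - s * r))"
    by (simp add: ennreal_mult'[symmetric] exp_diff exp_minus field_simps)
  finally show ?thesis by (simp add: emeasure_eq_measure Q_def)
qed

text \<open>
  The finite dimensional bound does not depend on the number of coordinates, so it passes to increasing unions of
  index sets.
\<close>

lemma iid_norm_tail:
  fixes V :: "'k \<Rightarrow> 'a \<Rightarrow> real"
  assumes iid: "iid_sample M N P I W" and I: "I \<noteq> {}"
    and K: "\<And>m. finite (K m)" "incseq K"
    and V: "\<And>k. integrable P (V k)"
    and mean: "\<And>k. (LINT u|P. V k u) = 0"
    and s: "0 < s"
    and C: "\<And>m. (\<integral>\<^sup>+u. ennreal (exp (s * L2_set (\<lambda>k. V k u) (K m)) - s * L2_set (\<lambda>k. V k u) (K m)) \<partial>P) \<le> ennreal (exp c)"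
    and \<delta>: "2 * exp (real (card I) * c - s * r) \<le> \<delta>"
  shows "{w\<in>space M. \<exists>m. r < L2_set (\<lambda>k. \<Sum>i\<in>I. V k (W i w)) (K m)} \<in> sets M"
    and "measure M {w\<in>space M. \<exists>m. r < L2_set (\<lambda>k. \<Sum>i\<in>I. V k (W i w)) (K m)} \<le> \<delta>"
proof -
  interpret prob_space M using iid_sampleD[OF iid] by simp
  note P = iid_sample_distr_PiM[OF iid I]
  have Vm [measurable]: "V k \<in> borel_measurable N" for k
    using V[of k, THEN borel_measurable_integrable] P(3) by (simp cong: measurable_cong_sets)
  have Wm [measurable]: "W i \<in> measurable M N" if "i \<in> I" for i using iid_sampleD(3)[OF iid that] .
  define A where "A m = {w\<in>space M. r < L2_set (\<lambda>k. \<Sum>i\<in>I. V k (W i w)) (K m)}" for m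
  have A [measurable]: "A m \<in> sets M" for m unfolding A_def by measurable
  have eq: "{w\<in>space M. \<exists>m. r < L2_set (\<lambda>k. \<Sum>i\<in>I. V k (W i w)) (K m)} = (\<Union>m. A m)" by (auto simp: A_def)
  show "{w\<in>space M. \<exists>m. r < L2_set (\<lambda>k. \<Sum>i\<in>I. V k (W i w)) (K m)} \<in> sets M" unfolding eq by measurable
  have mono: "L2_set f (K m) \<le> L2_set f (K m')" if "m \<le> m'" for f m m'
    using incseqD[OF K(2) that] K(1) by (auto simp: L2_set_def intro!: sum_mono2)
  have "incseq A"
  proof (rule incseq_SucI, rule subsetI)
    fix m w assume "w \<in> A m"
    then show "w \<in> A (Suc m)"
      using mono[of m "Suc m" "\<lambda>k. \<Sum>i\<in>I. V k (W i w)"] by (auto simp: A_def)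
  qed
  then have "(\<lambda>m. measure M (A m)) \<longlonglongrightarrow> measure M (\<Union>m. A m)"
    by (intro finite_Lim_measure_incseq) auto
  moreover have "measure M (A m) \<le> \<delta>" for m
    unfolding A_def using iid_norm_tail_finite[OF iid I K(1) V mean s C] \<delta> by (rule order_trans)
  ultimately show "measure M {w\<in>space M. \<exists>m. r < L2_set (\<lambda>k. \<Sum>i\<in>I. V k (W i w)) (K m)} \<le> \<delta>"
    unfolding eq by (intro LIMSEQ_le_const2) auto
qed

section \<open>Exponential moments of a real random variable\<close>

text \<open>
  The moment of order \<open>2 k\<close> of the standard normal distribution.
\<close>

definition gauss_moment :: "nat \<Rightarrow> real" where
  "gauss_moment k = (\<Prod>i=1..k. 2 * real i - 1)"

lemma gauss_moment_0 [simp]: "gauss_moment 0 = 1"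
  and gauss_moment_Suc: "gauss_moment (Suc k) = (2 * real k + 1) * gauss_moment k"
  by (simp_all add: gauss_moment_def mult.commute)

lemma gauss_moment_ge_1: "1 \<le> gauss_moment k"
proof (induction k)
  case (Suc k)
  have "1 * 1 \<le> (2 * real k + 1) * gauss_moment k" using Suc by (intro mult_mono) auto
  then show ?case by (simp add: gauss_moment_Suc)
qed simp

lemma gauss_moment_div_fact_double: "gauss_moment k / fact (2 * k) = 1 / (2 ^ k * fact k)"
proof (induction k)
  case (Suc k)
  have "gauss_moment (Suc k) / fact (2 * Suc k) = (2 * real k + 1) / ((2 * real k + 2) * (2 * real k + 1)) * (gauss_moment k / fact (2 * k))"
    by (simp add: gauss_moment_Suc field_simps)
  also have "\<dots> = 1 / (2 * (real k + 1)) * (1 / (2 ^ k * fact k))"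
    unfolding Suc by (simp add: divide_simps)
  finally show ?case by (simp add: field_simps)
qed simp

text \<open>
  Equality holds at \<open>k = 0\<close>, and the quotient of consecutive left sides stays below \<open>2\<close>.
\<close>

lemma gauss_moment_div_fact: "gauss_moment (k + 2) / fact (k + 2) \<le> 3 / 8 * 2 ^ (k + 2)"
proof (induction k)
  case 0
  then show ?case by (simp add: gauss_moment_Suc numeral_2_eq_2)
next
  case (Suc k)
  have "gauss_moment (Suc k + 2) / fact (Suc k + 2) = (2 * real k + 5) / (real k + 3) * (gauss_moment (k + 2) / fact (k + 2))"
    by (simp add: gauss_moment_Suc field_simps)
  also have "\<dots> \<le> 2 * (3 / 8 * 2 ^ (k + 2))"
    using Suc gauss_moment_ge_1[of "k + 2"] by (intro mult_mono) (auto simp: field_simps)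
  finally show ?case by simp
qed

text \<open>
  The even moments are at most those of a centred normal variable with standard deviation \<open>m\<close>; in particular they are
  finite, since a divergent moment would make the norm infinite.
\<close>

lemma sub_gaussian_even_moment:
  assumes M: "prob_space M" and W: "W \<in> borel_measurable M"
    and sg: "sub_gaussian_norm M W \<le> ennreal m" and m: "0 \<le> m"
  shows "integrable M (\<lambda>w. W w ^ (2 * k))"
    and "(LINT w|M. W w ^ (2 * k)) \<le> m ^ (2 * k) * gauss_moment k"
    and "(\<integral>\<^sup>+w. ennreal (W w ^ (2 * k)) \<partial>M) \<le> ennreal (m ^ (2 * k) * gauss_moment k)"
proof -
  interpret prob_space M by fact
  have *: "integrable M (\<lambda>w. W w ^ (2 * k)) \<and> (LINT w|M. W w ^ (2 * k)) \<le> m ^ (2 * k) * gauss_moment k"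
  proof (cases "k = 0")
    case True
    then show ?thesis by (simp add: prob_space)
  next
    case False
    have "(if integrable M (\<lambda>w. W w ^ (2 * k))
       then ennreal (((LINT w|M. W w ^ (2 * k)) / gauss_moment k) powr (1 / real (2 * k)))
       else \<infinity>) \<le> sub_gaussian_norm M W"
      unfolding sub_gaussian_norm_def gauss_moment_def using False by (intro SUP_upper) auto
    then have le: "(if integrable M (\<lambda>w. W w ^ (2 * k))
       then ennreal (((LINT w|M. W w ^ (2 * k)) / gauss_moment k) powr (1 / real (2 * k)))
       else \<infinity>) \<le> ennreal m"
      using sg by (rule order_trans)
    then have int: "integrable M (\<lambda>w. W w ^ (2 * k))"
      by (auto split: if_splits simp: top_unique)
    define E where "E = (LINT w|M. W w ^ (2 * k)) / gauss_moment k"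
    have E: "0 \<le> E" unfolding E_def using gauss_moment_ge_1[of k] by (intro divide_nonneg_nonneg integral_nonneg) auto
    have "E powr (1 / real (2 * k)) \<le> m" using le int m by (simp add: E_def)
    then have "(E powr (1 / real (2 * k))) ^ (2 * k) \<le> m ^ (2 * k)" by (intro power_mono) auto
    moreover have "(E powr (1 / real (2 * k))) ^ (2 * k) = E"
      using E False by (cases "E = 0") (auto simp: powr_realpow[symmetric] powr_powr)
    ultimately have "E \<le> m ^ (2 * k)" by simp
    then show ?thesis using int gauss_moment_ge_1[of k] by (simp add: E_def divide_le_eq)
  qed
  then show 1: "integrable M (\<lambda>w. W w ^ (2 * k))" and 2: "(LINT w|M. W w ^ (2 * k)) \<le> m ^ (2 * k) * gauss_moment k" by auto
  show "(\<integral>\<^sup>+w. ennreal (W w ^ (2 * k)) \<partial>M) \<le> ennreal (m ^ (2 * k) * gauss_moment k)"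
    using nn_integral_eq_integral[OF 1] 2 by (simp add: ennreal_leI)
qed

text \<open>
  The series of \<open>cosh (sqrt 2 * a * W)\<close>, which dominates the integrand, is integrated term by term.
\<close>

lemma nn_integral_exp_minus_self_le_moments:
  assumes W: "W \<in> borel_measurable M" and a: "0 \<le> a"
    and mom: "\<And>k. (\<integral>\<^sup>+w. ennreal (W w ^ (2 * k)) \<partial>M) \<le> ennreal (m k)"
  shows "(\<integral>\<^sup>+w. ennreal (exp (a * \<bar>W w\<bar>) - a * \<bar>W w\<bar>) \<partial>M) \<le> (\<Sum>k. ennreal ((2 * a\<^sup>2) ^ k / fact (2 * k) * m k))"
proof -
  note W [measurable]
  have "ennreal (exp (a * \<bar>W w\<bar>) - a * \<bar>W w\<bar>) \<le> (\<Sum>k. ennreal ((2 * a\<^sup>2) ^ k / fact (2 * k)) * ennreal (W w ^ (2 * k)))" for w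
  proof -
    have "(\<lambda>n. if even n then (sqrt 2 * (a * \<bar>W w\<bar>)) ^ n /\<^sub>R fact n else 0) sums cosh (sqrt 2 * (a * \<bar>W w\<bar>))"
      by (rule cosh_converges)
    then have "(\<lambda>k. (sqrt 2 * (a * \<bar>W w\<bar>)) ^ (2 * k) /\<^sub>R fact (2 * k)) sums cosh (sqrt 2 * (a * \<bar>W w\<bar>))"
      by (subst (asm) sums_mono_reindex[of "\<lambda>k. 2 * k", symmetric]) (auto simp: strict_mono_def elim!: evenE)
    moreover have "(sqrt 2 * (a * \<bar>W w\<bar>)) ^ (2 * k) /\<^sub>R fact (2 * k) = (2 * a\<^sup>2) ^ k / fact (2 * k) * W w ^ (2 * k)" for k
      by (simp add: power_mult power_mult_distrib divide_inverse)
    ultimately have s: "(\<lambda>k. (2 * a\<^sup>2) ^ k / fact (2 * k) * W w ^ (2 * k)) sums cosh (sqrt 2 * (a * \<bar>W w\<bar>))" by simp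
    have "ennreal (exp (a * \<bar>W w\<bar>) - a * \<bar>W w\<bar>) \<le> ennreal (cosh (sqrt 2 * (a * \<bar>W w\<bar>)))"
      using a by (intro ennreal_leI exp_minus_self_le_cosh) simp
    also have "\<dots> = (\<Sum>k. ennreal ((2 * a\<^sup>2) ^ k / fact (2 * k) * W w ^ (2 * k)))"
      by (rule suminf_ennreal_eq[symmetric, OF _ s]) simp
    also have "\<dots> = (\<Sum>k. ennreal ((2 * a\<^sup>2) ^ k / fact (2 * k)) * ennreal (W w ^ (2 * k)))"
      by (intro suminf_cong ennreal_mult) (auto intro!: divide_nonneg_nonneg)
    finally show ?thesis .
  qed
  then have "(\<integral>\<^sup>+w. ennreal (exp (a * \<bar>W w\<bar>) - a * \<bar>W w\<bar>) \<partial>M)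
     \<le> (\<integral>\<^sup>+w. (\<Sum>k. ennreal ((2 * a\<^sup>2) ^ k / fact (2 * k)) * ennreal (W w ^ (2 * k))) \<partial>M)"
    by (intro nn_integral_mono)
  also have "\<dots> = (\<Sum>k. \<integral>\<^sup>+w. ennreal ((2 * a\<^sup>2) ^ k / fact (2 * k)) * ennreal (W w ^ (2 * k)) \<partial>M)"
    by (intro nn_integral_suminf) measurable
  also have "\<dots> = (\<Sum>k. ennreal ((2 * a\<^sup>2) ^ k / fact (2 * k)) * (\<integral>\<^sup>+w. ennreal (W w ^ (2 * k)) \<partial>M))"
    by (intro suminf_cong nn_integral_cmult) measurable
  also have "\<dots> \<le> (\<Sum>k. ennreal ((2 * a\<^sup>2) ^ k / fact (2 * k)) * ennreal (m k))"
    by (intro suminf_le mult_left_mono mom) auto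
  also have "\<dots> = (\<Sum>k. ennreal ((2 * a\<^sup>2) ^ k / fact (2 * k) * m k))"
    by (intro suminf_cong ennreal_mult'[symmetric]) (auto intro!: divide_nonneg_nonneg)
  finally show ?thesis .
qed

text \<open>
  For these moments the series of \<open>nn_integral_exp_minus_self_le_moments\<close> sums to the exponential exactly.
\<close>

lemma sub_gaussian_exp_bound:
  assumes W: "W \<in> borel_measurable M" and a: "0 \<le> a" and m: "0 \<le> m"
    and mom: "\<And>k. (\<integral>\<^sup>+w. ennreal (W w ^ (2 * k)) \<partial>M) \<le> ennreal (m ^ (2 * k) * gauss_moment k)"
  shows "(\<integral>\<^sup>+w. ennreal (exp (a * \<bar>W w\<bar>) - a * \<bar>W w\<bar>) \<partial>M) \<le> ennreal (exp (a\<^sup>2 * m\<^sup>2))"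
proof -
  have "(2 * a\<^sup>2) ^ k / fact (2 * k) * (m ^ (2 * k) * gauss_moment k) = (a\<^sup>2 * m\<^sup>2) ^ k /\<^sub>R fact k" for k
  proof -
    have "(2 * a\<^sup>2) ^ k / fact (2 * k) * (m ^ (2 * k) * gauss_moment k) = (2 * a\<^sup>2) ^ k * m ^ (2 * k) * (gauss_moment k / fact (2 * k))"
      by simp
    also have "\<dots> = (a\<^sup>2 * m\<^sup>2) ^ k / fact k"
      unfolding gauss_moment_div_fact_double by (simp add: power_mult_distrib power_mult)
    finally show ?thesis by (simp add: divide_inverse mult.commute)
  qed
  then have s: "(\<lambda>k. (2 * a\<^sup>2) ^ k / fact (2 * k) * (m ^ (2 * k) * gauss_moment k)) sums exp (a\<^sup>2 * m\<^sup>2)"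
    using exp_converges[of "a\<^sup>2 * m\<^sup>2"] by simp
  have "(\<integral>\<^sup>+w. ennreal (exp (a * \<bar>W w\<bar>) - a * \<bar>W w\<bar>) \<partial>M) \<le> (\<Sum>k. ennreal ((2 * a\<^sup>2) ^ k / fact (2 * k) * (m ^ (2 * k) * gauss_moment k)))"
    by (rule nn_integral_exp_minus_self_le_moments[OF W a mom])
  also have "\<dots> = ennreal (exp (a\<^sup>2 * m\<^sup>2))"
    by (rule suminf_ennreal_eq[OF _ s])
       (intro mult_nonneg_nonneg divide_nonneg_nonneg zero_le_power a m order_trans[OF zero_le_one gauss_moment_ge_1], simp_all)
  finally show ?thesis .
qed

text \<open>
  Moments of this size occur for centred products of two sub-Gaussian variables (\<open>XX_moments\<close>).  Divided by
  \<open>fact (2 * k)\<close> they grow geometrically, so only small \<open>a\<close> are admissible; below the threshold the geometric series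
  loses at most the factor \<open>9 / 8\<close>.
\<close>

lemma sub_exponential_exp_bound:
  assumes W: "W \<in> borel_measurable M" and a: "0 \<le> a" and u: "32 * (a\<^sup>2 * m ^ 4) \<le> 1 / 9"
    and mom: "\<And>k. (\<integral>\<^sup>+w. ennreal (W w ^ (2 * k)) \<partial>M) \<le> ennreal (4 ^ k * m ^ (4 * k) * gauss_moment (2 * k))"
  shows "(\<integral>\<^sup>+w. ennreal (exp (a * \<bar>W w\<bar>) - a * \<bar>W w\<bar>) \<partial>M) \<le> ennreal (exp (27 / 2 * (a\<^sup>2 * m ^ 4)))"
proof -
  define u where "u = a\<^sup>2 * m ^ 4"
  have u0: "0 \<le> u" "32 * u \<le> 1 / 9" using u by (auto simp: u_def zero_le_even_power)
  define f where "f k = (if k = 0 then 1 else 3 / 8 * (32 * u) ^ k)" for k :: nat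
  have le: "(2 * a\<^sup>2) ^ k / fact (2 * k) * (4 ^ k * m ^ (4 * k) * gauss_moment (2 * k)) \<le> f k" for k
  proof (cases k)
    case (Suc j)
    have "(2 * a\<^sup>2) ^ k / fact (2 * k) * (4 ^ k * m ^ (4 * k) * gauss_moment (2 * k)) = (8 * u) ^ k * (gauss_moment (2 * k) / fact (2 * k))"
    proof -
      have "(8 * u) ^ k = (2 * a\<^sup>2 * 4 * m ^ 4) ^ k" by (simp add: u_def mult_ac)
      also have "\<dots> = (2 * a\<^sup>2) ^ k * 4 ^ k * m ^ (4 * k)" by (simp only: power_mult_distrib power_mult)
      finally show ?thesis by simp
    qed
    also have "\<dots> \<le> (8 * u) ^ k * (3 / 8 * 2 ^ (2 * k))"
      using gauss_moment_div_fact[of "2 * j"] u0 by (intro mult_left_mono) (simp_all add: Suc)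
    also have "\<dots> = 3 / 8 * ((8 * u) ^ k * (2\<^sup>2) ^ k)" unfolding power_mult by (simp only: mult_ac)
    also have "\<dots> = 3 / 8 * (8 * u * 2\<^sup>2) ^ k" by (simp only: power_mult_distrib)
    also have "8 * u * 2\<^sup>2 = 32 * u" by simp
    also have "3 / 8 * (32 * u) ^ k = f k" using Suc by (simp add: f_def)
    finally show ?thesis .
  qed (simp add: f_def)
  have "(\<lambda>k. f (Suc k)) sums (3 / 8 * (32 * u) * (1 / (1 - 32 * u)))"
    using sums_mult[OF geometric_sums[of "32 * u"], of "3 / 8 * (32 * u)"] u0 by (simp add: f_def mult_ac)
  then have s: "f sums (3 / 8 * (32 * u) * (1 / (1 - 32 * u)) + f 0)" by (rule sums_Suc)
  have "(\<integral>\<^sup>+w. ennreal (exp (a * \<bar>W w\<bar>) - a * \<bar>W w\<bar>) \<partial>M)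
      \<le> (\<Sum>k. ennreal ((2 * a\<^sup>2) ^ k / fact (2 * k) * (4 ^ k * m ^ (4 * k) * gauss_moment (2 * k))))"
    by (rule nn_integral_exp_minus_self_le_moments[OF W a mom])
  also have "\<dots> \<le> (\<Sum>k. ennreal (f k))" by (intro suminf_le ennreal_leI le) auto
  also have "\<dots> = ennreal (3 / 8 * (32 * u) * (1 / (1 - 32 * u)) + f 0)"
    by (rule suminf_ennreal_eq[OF _ s]) (use u0 in \<open>auto simp: f_def\<close>)
  also have "\<dots> \<le> ennreal (exp (27 / 2 * u))"
  proof (intro ennreal_leI)
    have "1 / (1 - 32 * u) \<le> 9 / 8" using u0 by (simp add: divide_simps)
    then have "3 / 8 * (32 * u) * (1 / (1 - 32 * u)) \<le> 3 / 8 * (32 * u) * (9 / 8)" using u0 by (intro mult_left_mono) auto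
    also have "\<dots> + 1 \<le> exp (27 / 2 * u)" using exp_ge_add_one_self[of "27 / 2 * u"] by linarith
    finally show "3 / 8 * (32 * u) * (1 / (1 - 32 * u)) + f 0 \<le> exp (27 / 2 * u)" by (simp add: f_def)
  qed
  finally show ?thesis by (simp add: u_def)
qed

text \<open>
  The second moment \<open>v\<close> governs the exponent, and the bound \<open>b\<close> enters only as a correction; through \<open>v\<close> the
  effective dimension enters the rate.
\<close>

lemma bounded_exp_bound:
  assumes M: "prob_space M" and W: "W \<in> borel_measurable M"
    and b: "AE w in M. \<bar>W w\<bar> \<le> b" and v: "(\<integral>\<^sup>+w. ennreal ((W w)\<^sup>2) \<partial>M) \<le> ennreal v" "0 \<le> v"
    and a: "0 \<le> a" "a * b < 3"
  shows "(\<integral>\<^sup>+w. ennreal (exp (a * \<bar>W w\<bar>) - a * \<bar>W w\<bar>) \<partial>M) \<le> ennreal (exp (a\<^sup>2 * v / (2 * (1 - a * b / 3))))"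
proof -
  interpret prob_space M by fact
  note W [measurable]
  define q where "q = a\<^sup>2 / (2 * (1 - a * b / 3))"
  have q: "0 \<le> q" using a by (simp add: q_def)
  have "(\<integral>\<^sup>+w. ennreal (exp (a * \<bar>W w\<bar>) - a * \<bar>W w\<bar>) \<partial>M) \<le> (\<integral>\<^sup>+w. 1 + ennreal q * ennreal ((W w)\<^sup>2) \<partial>M)"
  proof (intro nn_integral_mono_AE, use b in eventually_elim)
    fix w assume w: "\<bar>W w\<bar> \<le> b"
    have ab: "a * \<bar>W w\<bar> \<le> a * b" using w a by (intro mult_left_mono)
    have "exp (a * \<bar>W w\<bar>) - a * \<bar>W w\<bar> \<le> 1 + (a * \<bar>W w\<bar>)\<^sup>2 / (2 * (1 - a * \<bar>W w\<bar> / 3))"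
      using exp_bernstein[of "a * \<bar>W w\<bar>"] a ab by auto
    also have "(a * \<bar>W w\<bar>)\<^sup>2 / (2 * (1 - a * \<bar>W w\<bar> / 3)) \<le> (a * \<bar>W w\<bar>)\<^sup>2 / (2 * (1 - a * b / 3))"
      using a ab by (intro divide_left_mono mult_left_mono) auto
    also have "\<dots> = q * (W w)\<^sup>2" by (simp add: q_def power_mult_distrib)
    finally have "ennreal (exp (a * \<bar>W w\<bar>) - a * \<bar>W w\<bar>) \<le> ennreal (1 + q * (W w)\<^sup>2)" by (simp add: ennreal_leI)
    then show "ennreal (exp (a * \<bar>W w\<bar>) - a * \<bar>W w\<bar>) \<le> 1 + ennreal q * ennreal ((W w)\<^sup>2)"
      using q by (simp add: ennreal_plus ennreal_mult' del: ennreal_plus[symmetric])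
  qed
  also have "\<dots> = 1 + ennreal q * (\<integral>\<^sup>+w. ennreal ((W w)\<^sup>2) \<partial>M)"
    by (subst nn_integral_add) (auto simp: nn_integral_cmult emeasure_space_1)
  also have "\<dots> \<le> 1 + ennreal q * ennreal v" using v by (intro add_left_mono mult_left_mono) auto
  also have "\<dots> = ennreal (1 + q * v)" using q v by (simp add: ennreal_plus ennreal_mult' del: ennreal_plus[symmetric])
  also have "\<dots> \<le> ennreal (exp (q * v))" using exp_ge_add_one_self by (intro ennreal_leI)
  finally show ?thesis by (simp add: q_def)
qed

section \<open>Quadratic forms in conditionally centred noise\<close>

text \<open>
  Conditionally on the design \<open>u\<close>, the noise \<open>e\<close> is centred with variance at most \<open>\<sigma>\<^sup>2\<close>.  Both properties are stated
  as integrals against bounded functions of \<open>u\<close>, the form in which they can be applied one coordinate at a time on a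
  product space.
\<close>

locale conditionally_centered_noise =
  fixes P :: "'a measure" and U :: "'u measure" and e :: "'a \<Rightarrow> real" and u :: "'a \<Rightarrow> 'u" and \<sigma> :: real
  assumes P: "prob_space P"
    and e [measurable]: "e \<in> borel_measurable P" and u [measurable]: "u \<in> measurable P U"
    and e2: "integrable P (\<lambda>x. (e x)\<^sup>2)"
    and centered: "\<And>\<phi> B. \<phi> \<in> borel_measurable U \<Longrightarrow> (\<And>x. x \<in> space U \<Longrightarrow> \<bar>\<phi> x\<bar> \<le> B) \<Longrightarrow> (LINT x|P. e x * \<phi> (u x)) = 0"
    and variance: "\<And>\<phi> B. \<phi> \<in> borel_measurable U \<Longrightarrow> (\<And>x. x \<in> space U \<Longrightarrow> 0 \<le> \<phi> x \<and> \<phi> x \<le> B)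
       \<Longrightarrow> (LINT x|P. (e x)\<^sup>2 * \<phi> (u x)) \<le> \<sigma>\<^sup>2 * (LINT x|P. \<phi> (u x))"
begin

sublocale prob_space P by (rule P)
sublocale product_sigma_finite "\<lambda>_. P" by standard

lemma integrable_component:
  assumes "finite I" "i \<in> I" "integrable P g"
  shows "integrable (Pi\<^sub>M I (\<lambda>_. P)) (\<lambda>\<omega>. g (\<omega> i) :: real)"
proof -
  have "distr (Pi\<^sub>M I (\<lambda>_. P)) P (\<lambda>\<omega>. \<omega> i) = P"
    using assms P by (intro distr_PiM_component) auto
  then show ?thesis
    using assms by (subst integrable_distr_eq[symmetric, where N = P]) auto
qed

lemma restrict_in_space:
  "\<omega> \<in> space (Pi\<^sub>M I (\<lambda>_. P)) \<Longrightarrow> (\<lambda>j\<in>I. u (\<omega> j)) \<in> space (Pi\<^sub>M I (\<lambda>_. U))"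
  using measurable_space[OF u] by (auto simp: space_PiM PiE_iff)

lemma integrable_quadratic_term:
  assumes I: "finite I" "i \<in> I" "k \<in> I"
    and H [measurable]: "H \<in> borel_measurable (Pi\<^sub>M I (\<lambda>_. U))"
    and B: "\<And>x. x \<in> space (Pi\<^sub>M I (\<lambda>_. U)) \<Longrightarrow> \<bar>H x\<bar> \<le> B"
  shows "integrable (Pi\<^sub>M I (\<lambda>_. P)) (\<lambda>\<omega>. e (\<omega> i) * e (\<omega> k) * H (\<lambda>j\<in>I. u (\<omega> j)))"
proof (rule Bochner_Integration.integrable_bound)
  show "integrable (Pi\<^sub>M I (\<lambda>_. P)) (\<lambda>\<omega>. B * ((e (\<omega> i))\<^sup>2 + (e (\<omega> k))\<^sup>2))"
    using I e2 by (intro integrable_mult_right Bochner_Integration.integrable_add integrable_component[where g = "\<lambda>x. (e x)\<^sup>2"])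
  show "(\<lambda>\<omega>. e (\<omega> i) * e (\<omega> k) * H (\<lambda>j\<in>I. u (\<omega> j))) \<in> borel_measurable (Pi\<^sub>M I (\<lambda>_. P))"
    using I by measurable
  show "AE \<omega> in Pi\<^sub>M I (\<lambda>_. P). norm (e (\<omega> i) * e (\<omega> k) * H (\<lambda>j\<in>I. u (\<omega> j))) \<le> norm (B * ((e (\<omega> i))\<^sup>2 + (e (\<omega> k))\<^sup>2))"
  proof (rule AE_I2)
    fix \<omega> assume \<omega>: "\<omega> \<in> space (Pi\<^sub>M I (\<lambda>_. P))"
    have "(\<lambda>j\<in>I. u (\<omega> j)) \<in> space (Pi\<^sub>M I (\<lambda>_. U))"
      using \<omega> by (rule restrict_in_space)
    from B[OF this] have H: "\<bar>H (\<lambda>j\<in>I. u (\<omega> j))\<bar> \<le> B" .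
    have "\<bar>e (\<omega> i) * e (\<omega> k)\<bar> \<le> (e (\<omega> i))\<^sup>2 + (e (\<omega> k))\<^sup>2"
      using sum_squares_bound[of "\<bar>e (\<omega> i)\<bar>" "\<bar>e (\<omega> k)\<bar>"] mult_nonneg_nonneg[OF abs_ge_zero[of "e (\<omega> i)"] abs_ge_zero[of "e (\<omega> k)"]]
      by (simp add: abs_mult del: mult_nonneg_nonneg)
    with H have "\<bar>e (\<omega> i) * e (\<omega> k)\<bar> * \<bar>H (\<lambda>j\<in>I. u (\<omega> j))\<bar> \<le> ((e (\<omega> i))\<^sup>2 + (e (\<omega> k))\<^sup>2) * B"
      by (intro mult_mono) auto
    then show "norm (e (\<omega> i) * e (\<omega> k) * H (\<lambda>j\<in>I. u (\<omega> j))) \<le> norm (B * ((e (\<omega> i))\<^sup>2 + (e (\<omega> k))\<^sup>2))"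
      using order_trans[OF abs_ge_zero H] by (simp add: abs_mult mult.commute)
  qed
qed

text \<open>
  Integrate over the coordinate \<open>i\<close> first.  If \<open>i \<noteq> k\<close>, then \<open>e (\<omega> k)\<close> is a constant there and the noise is centred;
  if \<open>i = k\<close>, the conditional variance is bounded.
\<close>

lemma quadratic_term:
  assumes I: "finite I" "i \<in> I" "k \<in> I"
    and H [measurable]: "H \<in> borel_measurable (Pi\<^sub>M I (\<lambda>_. U))"
    and B: "\<And>x. x \<in> space (Pi\<^sub>M I (\<lambda>_. U)) \<Longrightarrow> \<bar>H x\<bar> \<le> B"
    and H0: "i = k \<Longrightarrow> (\<And>x. x \<in> space (Pi\<^sub>M I (\<lambda>_. U)) \<Longrightarrow> 0 \<le> H x)"
  shows "(LINT \<omega>|Pi\<^sub>M I (\<lambda>_. P). e (\<omega> i) * e (\<omega> k) * H (\<lambda>j\<in>I. u (\<omega> j)))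
     \<le> (if i = k then \<sigma>\<^sup>2 * (LINT \<omega>|Pi\<^sub>M I (\<lambda>_. P). H (\<lambda>j\<in>I. u (\<omega> j))) else 0)"
proof -
  define J where "J = I - {i}"
  have J: "finite J" "i \<notin> J" "insert i J = I" using I by (auto simp: J_def)
  interpret PI: prob_space "Pi\<^sub>M I (\<lambda>_. P)" by (rule prob_space_PiM) (rule P)
  interpret PJ: prob_space "Pi\<^sub>M J (\<lambda>_. P)" by (rule prob_space_PiM) (rule P)
  \<comment> \<open>the coefficient as a function of the design \<open>v\<close> of the coordinate \<open>i\<close>, all others being fixed\<close>
  define \<phi> where "\<phi> x v = H (\<lambda>j\<in>I. if j = i then v else u (x j))" for x v
  have \<phi>eq: "H (\<lambda>j\<in>I. u (if j = i then y else x j)) = \<phi> x (u y)" for x y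
    unfolding \<phi>_def by (rule arg_cong[where f = H]) auto
  have up: "(\<lambda>j\<in>I. if j = i then v else u (x j)) \<in> space (Pi\<^sub>M I (\<lambda>_. U))"
    if "x \<in> space (Pi\<^sub>M J (\<lambda>_. P))" "v \<in> space U" for x v
    using that measurable_space[OF u] J by (auto simp: space_PiM PiE_iff)
  have \<phi>m: "\<phi> x \<in> borel_measurable U" if x: "x \<in> space (Pi\<^sub>M J (\<lambda>_. P))" for x
  proof -
    have "(\<lambda>v. \<lambda>j\<in>I. if j = i then v else u (x j)) \<in> measurable U (Pi\<^sub>M I (\<lambda>_. U))"
    proof (rule measurable_restrict)
      fix j assume "j \<in> I"
      show "(\<lambda>v. if j = i then v else u (x j)) \<in> measurable U U"
        using \<open>j \<in> I\<close> x J measurable_space[OF u] by (cases "j = i") (auto simp: space_PiM PiE_iff)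
    qed
    then show ?thesis unfolding \<phi>_def[abs_def] by measurable
  qed
  have \<phi>B: "\<bar>\<phi> x v\<bar> \<le> B" if "x \<in> space (Pi\<^sub>M J (\<lambda>_. P))" "v \<in> space U" for x v
    unfolding \<phi>_def using B up[OF that] by simp
  have int: "integrable (Pi\<^sub>M (insert i J) (\<lambda>_. P)) (\<lambda>\<omega>. e (\<omega> i) * e (\<omega> k) * H (\<lambda>j\<in>I. u (\<omega> j)))"
    unfolding J(3) using integrable_quadratic_term[OF I H B] .
  have *: "(LINT \<omega>|Pi\<^sub>M I (\<lambda>_. P). e (\<omega> i) * e (\<omega> k) * H (\<lambda>j\<in>I. u (\<omega> j)))
     = (LINT x|Pi\<^sub>M J (\<lambda>_. P). (LINT y|P. e y * e (fun_upd x i y k) * \<phi> x (u y)))"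
    using product_integral_insert[OF J(1,2) int] unfolding J(3) by (simp add: \<phi>eq)
  show ?thesis
  proof (cases "i = k")
    case False
    have "(LINT y|P. e y * e (fun_upd x i y k) * \<phi> x (u y)) = 0" if x: "x \<in> space (Pi\<^sub>M J (\<lambda>_. P))" for x
    proof -
      have "(LINT y|P. e y * \<phi> x (u y)) = 0" using centered[OF \<phi>m[OF x]] \<phi>B[OF x] by blast
      then have "(LINT y|P. e (x k) * (e y * \<phi> x (u y))) = 0" by simp
      then show ?thesis using False by (simp add: mult_ac)
    qed
    then show ?thesis unfolding * using False by (simp cong: Bochner_Integration.integral_cong)
  next
    case True
    have intH: "integrable (Pi\<^sub>M (insert i J) (\<lambda>_. P)) (\<lambda>\<omega>. H (\<lambda>j\<in>I. u (\<omega> j)))"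
    proof -
      have "integrable (Pi\<^sub>M I (\<lambda>_. P)) (\<lambda>\<omega>. H (\<lambda>j\<in>I. u (\<omega> j)))"
        by (rule PI.integrable_const_bound[where B = B])
           (auto intro!: AE_I2 B restrict_in_space)
      then show ?thesis using J by simp
    qed
    define g where "g \<omega> = \<sigma>\<^sup>2 * H (\<lambda>j\<in>I. u (\<omega> j)) - e (\<omega> i) * e (\<omega> k) * H (\<lambda>j\<in>I. u (\<omega> j))" for \<omega>
    have intg: "integrable (Pi\<^sub>M (insert i J) (\<lambda>_. P)) g"
      unfolding g_def[abs_def] using int intH by (intro Bochner_Integration.integrable_diff integrable_mult_right)
    have "0 \<le> (LINT y|P. g (fun_upd x i y))" if x: "x \<in> space (Pi\<^sub>M J (\<lambda>_. P))" for x
    proof -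
      note [measurable] = \<phi>m[OF x]
      have bd: "\<bar>\<phi> x (u y)\<bar> \<le> B" if "y \<in> space P" for y using \<phi>B[OF x measurable_space[OF u that]] .
      have i1: "integrable P (\<lambda>y. \<phi> x (u y))"
        by (rule integrable_const_bound[where B = B]) (auto intro!: AE_I2 bd)
      have i2: "integrable P (\<lambda>y. (e y)\<^sup>2 * \<phi> x (u y))"
      proof (rule Bochner_Integration.integrable_bound)
        show "integrable P (\<lambda>y. B * (e y)\<^sup>2)" using e2 by simp
        show "AE y in P. norm ((e y)\<^sup>2 * \<phi> x (u y)) \<le> norm (B * (e y)\<^sup>2)"
        proof (rule AE_I2)
          fix y assume "y \<in> space P"
          from mult_left_mono[OF bd[OF this] zero_le_power2[of "e y"]]
          show "norm ((e y)\<^sup>2 * \<phi> x (u y)) \<le> norm (B * (e y)\<^sup>2)" using order_trans[OF abs_ge_zero bd[OF \<open>y \<in> space P\<close>]] by (simp add: abs_mult mult.commute)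
        qed
      qed measurable
      have "(LINT y|P. g (fun_upd x i y)) = (LINT y|P. \<sigma>\<^sup>2 * \<phi> x (u y) - (e y)\<^sup>2 * \<phi> x (u y))"
        by (intro Bochner_Integration.integral_cong refl) (simp add: g_def \<phi>eq True[symmetric] power2_eq_square)
      also have "\<dots> = \<sigma>\<^sup>2 * (LINT y|P. \<phi> x (u y)) - (LINT y|P. (e y)\<^sup>2 * \<phi> x (u y))"
        using i1 i2 by simp
      also have "0 \<le> \<dots>"
      proof -
        have "(LINT y|P. (e y)\<^sup>2 * \<phi> x (u y)) \<le> \<sigma>\<^sup>2 * (LINT y|P. \<phi> x (u y))"
        proof (rule variance[OF \<phi>m[OF x]])
          fix v assume v: "v \<in> space U"
          show "0 \<le> \<phi> x v \<and> \<phi> x v \<le> B"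
            using H0[OF True up[OF x v]] \<phi>B[OF x v] by (simp add: \<phi>_def abs_le_iff)
        qed
        then show ?thesis by simp
      qed
      finally show ?thesis .
    qed
    then have "0 \<le> (LINT x|Pi\<^sub>M J (\<lambda>_. P). (LINT y|P. g (fun_upd x i y)))"
      by (rule integral_nonneg_AE[OF AE_I2])
    also have "\<dots> = (LINT \<omega>|Pi\<^sub>M I (\<lambda>_. P). g \<omega>)"
      using product_integral_insert[OF J(1,2) intg] unfolding J(3) by simp
    also have "\<dots> = \<sigma>\<^sup>2 * (LINT \<omega>|Pi\<^sub>M I (\<lambda>_. P). H (\<lambda>j\<in>I. u (\<omega> j)))
        - (LINT \<omega>|Pi\<^sub>M I (\<lambda>_. P). e (\<omega> i) * e (\<omega> k) * H (\<lambda>j\<in>I. u (\<omega> j)))"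
      unfolding g_def using int intH unfolding J(3) by simp
    finally show ?thesis using True by simp
  qed
qed

text \<open>
  In expectation, only the trace of a quadratic form whose coefficients depend on the design survives.
\<close>

lemma iid_quadratic_form:
  assumes iid: "iid_sample M N P I W" and I: "I \<noteq> {}"
    and H [measurable]: "\<And>i k. i \<in> I \<Longrightarrow> k \<in> I \<Longrightarrow> H i k \<in> borel_measurable (Pi\<^sub>M I (\<lambda>_. U))"
    and B: "\<And>i k x. i \<in> I \<Longrightarrow> k \<in> I \<Longrightarrow> x \<in> space (Pi\<^sub>M I (\<lambda>_. U)) \<Longrightarrow> \<bar>H i k x\<bar> \<le> B"
    and H0: "\<And>i x. i \<in> I \<Longrightarrow> x \<in> space (Pi\<^sub>M I (\<lambda>_. U)) \<Longrightarrow> 0 \<le> H i i x"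
  shows "integrable M (\<lambda>w. \<Sum>i\<in>I. \<Sum>k\<in>I. e (W i w) * e (W k w) * H i k (\<lambda>j\<in>I. u (W j w)))"
    and "(LINT w|M. (\<Sum>i\<in>I. \<Sum>k\<in>I. e (W i w) * e (W k w) * H i k (\<lambda>j\<in>I. u (W j w))))
       \<le> \<sigma>\<^sup>2 * (LINT w|M. (\<Sum>i\<in>I. H i i (\<lambda>j\<in>I. u (W j w))))"
proof -
  have fin: "finite I" using iid_sampleD(2)[OF iid] .
  note PP = iid_sample_distr_PiM[OF iid I]
  interpret PI: prob_space "Pi\<^sub>M I (\<lambda>_. P)" by (rule prob_space_PiM) (rule P)
  define \<pi> where "\<pi> w = (\<lambda>i\<in>I. W i w)" for w
  have \<pi>m: "\<pi> \<in> measurable M (Pi\<^sub>M I (\<lambda>_. N))"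
    unfolding \<pi>_def[abs_def] using iid_sampleD(3)[OF iid] by (intro measurable_restrict)
  have d: "distr M (Pi\<^sub>M I (\<lambda>_. N)) \<pi> = Pi\<^sub>M I (\<lambda>_. P)" using PP(1) by (simp add: \<pi>_def[abs_def])
  have sN: "sets (Pi\<^sub>M I (\<lambda>_. P)) = sets (Pi\<^sub>M I (\<lambda>_. N))" using PP(3) by (intro sets_PiM_cong) auto
  define F where "F \<omega> = (\<Sum>i\<in>I. \<Sum>k\<in>I. e (\<omega> i) * e (\<omega> k) * H i k (\<lambda>j\<in>I. u (\<omega> j)))" for \<omega>
  define G where "G \<omega> = (\<Sum>i\<in>I. H i i (\<lambda>j\<in>I. u (\<omega> j)))" for \<omega>
  have "(\<Sum>i\<in>I. \<Sum>k\<in>I. e (W i w) * e (W k w) * H i k (\<lambda>j\<in>I. u (W j w))) = F (\<pi> w)" for w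
    unfolding F_def by (intro sum.cong refl arg_cong2[where f = "(*)"] arg_cong[where f = "H _ _"]) (auto simp: \<pi>_def)
  moreover have "(\<Sum>i\<in>I. H i i (\<lambda>j\<in>I. u (W j w))) = G (\<pi> w)" for w
    unfolding G_def by (intro sum.cong refl arg_cong[where f = "H _ _"]) (auto simp: \<pi>_def)
  moreover have ti: "integrable (Pi\<^sub>M I (\<lambda>_. P)) (\<lambda>\<omega>. e (\<omega> i) * e (\<omega> k) * H i k (\<lambda>j\<in>I. u (\<omega> j)))" if "i \<in> I" "k \<in> I" for i k
    by (rule integrable_quadratic_term[OF fin that H[OF that] B[OF that]])
  have Fi: "integrable (Pi\<^sub>M I (\<lambda>_. P)) F"
    unfolding F_def[abs_def] using ti by (intro Bochner_Integration.integrable_sum) auto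
  have Hi: "integrable (Pi\<^sub>M I (\<lambda>_. P)) (\<lambda>\<omega>. H i i (\<lambda>j\<in>I. u (\<omega> j)))" if i: "i \<in> I" for i
  proof (rule PI.integrable_const_bound[where B = B])
    show "AE \<omega> in Pi\<^sub>M I (\<lambda>_. P). norm (H i i (\<lambda>j\<in>I. u (\<omega> j))) \<le> B"
      unfolding real_norm_def by (intro AE_I2 B[OF i i] restrict_in_space)
    show "(\<lambda>\<omega>. H i i (\<lambda>j\<in>I. u (\<omega> j))) \<in> borel_measurable (Pi\<^sub>M I (\<lambda>_. P))" using i by measurable
  qed
  have Gi: "integrable (Pi\<^sub>M I (\<lambda>_. P)) G"
    unfolding G_def[abs_def] using Hi by (intro Bochner_Integration.integrable_sum) auto
  have Fm: "F \<in> borel_measurable (Pi\<^sub>M I (\<lambda>_. N))" and Gm: "G \<in> borel_measurable (Pi\<^sub>M I (\<lambda>_. N))"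
    using borel_measurable_integrable[OF Fi] borel_measurable_integrable[OF Gi] by (simp_all cong: measurable_cong_sets add: sN)
  have "integrable M (\<lambda>w. F (\<pi> w))"
    using Fi unfolding d[symmetric] by (rule integrable_distr[OF \<pi>m])
  moreover have "(LINT w|M. F (\<pi> w)) = (LINT \<omega>|Pi\<^sub>M I (\<lambda>_. P). F \<omega>)"
    unfolding d[symmetric] by (rule integral_distr[symmetric, OF \<pi>m Fm])
  moreover have "(LINT w|M. G (\<pi> w)) = (LINT \<omega>|Pi\<^sub>M I (\<lambda>_. P). G \<omega>)"
    unfolding d[symmetric] by (rule integral_distr[symmetric, OF \<pi>m Gm])
  moreover have "(LINT \<omega>|Pi\<^sub>M I (\<lambda>_. P). F \<omega>) \<le> \<sigma>\<^sup>2 * (LINT \<omega>|Pi\<^sub>M I (\<lambda>_. P). G \<omega>)"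
  proof -
    have "(LINT \<omega>|Pi\<^sub>M I (\<lambda>_. P). F \<omega>)
        = (\<Sum>i\<in>I. \<Sum>k\<in>I. (LINT \<omega>|Pi\<^sub>M I (\<lambda>_. P). e (\<omega> i) * e (\<omega> k) * H i k (\<lambda>j\<in>I. u (\<omega> j))))"
      unfolding F_def using ti by (simp add: Bochner_Integration.integral_sum)
    also have "\<dots> \<le> (\<Sum>i\<in>I. \<Sum>k\<in>I. if i = k then \<sigma>\<^sup>2 * (LINT \<omega>|Pi\<^sub>M I (\<lambda>_. P). H i k (\<lambda>j\<in>I. u (\<omega> j))) else 0)"
      using B H0 by (intro sum_mono quadratic_term[OF fin _ _ H]) auto
    also have "\<dots> = \<sigma>\<^sup>2 * (LINT \<omega>|Pi\<^sub>M I (\<lambda>_. P). G \<omega>)"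
      unfolding G_def using Hi fin by (simp add: Bochner_Integration.integral_sum sum_distrib_left)
    finally show ?thesis .
  qed
  ultimately show "integrable M (\<lambda>w. \<Sum>i\<in>I. \<Sum>k\<in>I. e (W i w) * e (W k w) * H i k (\<lambda>j\<in>I. u (W j w)))"
    and "(LINT w|M. (\<Sum>i\<in>I. \<Sum>k\<in>I. e (W i w) * e (W k w) * H i k (\<lambda>j\<in>I. u (W j w))))
       \<le> \<sigma>\<^sup>2 * (LINT w|M. (\<Sum>i\<in>I. H i i (\<lambda>j\<in>I. u (W j w))))" by simp_all
qed

end

section \<open>Positive semidefinite forms on spaces of functions\<close>

definition comb :: "'k set \<Rightarrow> ('k \<Rightarrow> real) \<Rightarrow> ('k \<Rightarrow> 'x \<Rightarrow> real) \<Rightarrow> 'x \<Rightarrow> real" where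
  "comb K c g = (\<lambda>x. \<Sum>k\<in>K. c k * g k x)"

definition lin_functional :: "('x \<Rightarrow> real) set \<Rightarrow> (('x \<Rightarrow> real) \<Rightarrow> real) \<Rightarrow> bool" where
  "lin_functional V \<phi> \<longleftrightarrow> (\<forall>f\<in>V. \<forall>g\<in>V. \<forall>a b. \<phi> (\<lambda>x. a * f x + b * g x) = a * \<phi> f + b * \<phi> g)"

lemma lin_functionalD:
  "lin_functional V \<phi> \<Longrightarrow> f \<in> V \<Longrightarrow> g \<in> V \<Longrightarrow> \<phi> (\<lambda>x. a * f x + b * g x) = a * \<phi> f + b * \<phi> g"
  by (simp add: lin_functional_def)

text \<open>
  The elements are functions and the form may be degenerate, so functions that agree almost everywhere need not be
  identified.  The locale serves the inner product of \<open>L\<^sup>2\<close> and the regularised covariance form alike.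
\<close>

locale fun_form =
  fixes V :: "('x \<Rightarrow> real) set" and B :: "('x \<Rightarrow> real) \<Rightarrow> ('x \<Rightarrow> real) \<Rightarrow> real"
  assumes lin: "\<And>f g a b. f \<in> V \<Longrightarrow> g \<in> V \<Longrightarrow> (\<lambda>x. a * f x + b * g x) \<in> V"
    and zero: "(\<lambda>_. 0) \<in> V"
    and B_lin: "\<And>h. h \<in> V \<Longrightarrow> lin_functional V (\<lambda>f. B f h)"
    and sym: "\<And>f g. f \<in> V \<Longrightarrow> g \<in> V \<Longrightarrow> B f g = B g f"
    and nonneg: "\<And>f. f \<in> V \<Longrightarrow> 0 \<le> B f f"
begin

definition N :: "('x \<Rightarrow> real) \<Rightarrow> real" where "N f = sqrt (B f f)"

lemma N_nonneg: "f \<in> V \<Longrightarrow> 0 \<le> N f" by (simp add: N_def nonneg)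
lemma N_sq: "f \<in> V \<Longrightarrow> (N f)\<^sup>2 = B f f" by (simp add: N_def nonneg)

lemma B_linL: "f \<in> V \<Longrightarrow> g \<in> V \<Longrightarrow> h \<in> V \<Longrightarrow> B (\<lambda>x. a * f x + b * g x) h = a * B f h + b * B g h"
  using lin_functionalD[OF B_lin] by blast

lemma B_linR: "f \<in> V \<Longrightarrow> g \<in> V \<Longrightarrow> h \<in> V \<Longrightarrow> B h (\<lambda>x. a * f x + b * g x) = a * B h f + b * B h g"
  using B_linL[of f g h a b] sym lin by simp

lemma diff_in: "f \<in> V \<Longrightarrow> g \<in> V \<Longrightarrow> (\<lambda>x. f x - g x) \<in> V"
  using lin[of f g 1 "-1"] by simp

lemma scale_in: "f \<in> V \<Longrightarrow> (\<lambda>x. c * f x) \<in> V"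
  using lin[of f f c 0] by simp

lemma functional_0: "lin_functional V \<phi> \<Longrightarrow> \<phi> (\<lambda>_. 0) = 0"
  using lin_functionalD[of V \<phi> "\<lambda>_. 0" "\<lambda>_. 0" 0 0] zero by simp

lemma functional_scale: "lin_functional V \<phi> \<Longrightarrow> f \<in> V \<Longrightarrow> \<phi> (\<lambda>x. c * f x) = c * \<phi> f"
  using lin_functionalD[of V \<phi> f f c 0] by simp

lemma functional_diff: "lin_functional V \<phi> \<Longrightarrow> f \<in> V \<Longrightarrow> g \<in> V \<Longrightarrow> \<phi> (\<lambda>x. f x - g x) = \<phi> f - \<phi> g"
  using lin_functionalD[of V \<phi> f g 1 "-1"] by simp

lemma comb_in: "(\<And>k. k \<in> K \<Longrightarrow> g k \<in> V) \<Longrightarrow> comb K c g \<in> V"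
proof (induction K rule: infinite_finite_induct)
  case (insert k K)
  then show ?case using lin[of "g k" "comb K c g" "c k" 1] by (simp add: comb_def)
qed (auto simp: comb_def zero)

lemma functional_comb:
  assumes "lin_functional V \<phi>" and "\<And>k. k \<in> K \<Longrightarrow> g k \<in> V"
  shows "\<phi> (comb K c g) = (\<Sum>k\<in>K. c k * \<phi> (g k))"
  using assms(2)
proof (induction K rule: infinite_finite_induct)
  case (insert k K)
  then show ?case
    using lin_functionalD[OF assms(1), of "g k" "comb K c g" "c k" 1] comb_in[of K g c] by (simp add: comb_def)
qed (use functional_0[OF assms(1)] in \<open>auto simp: comb_def\<close>)

lemma B_diff_diff:
  assumes "f \<in> V" "g \<in> V"
  shows "B (\<lambda>x. f x - g x) (\<lambda>x. f x - g x) = B f f - 2 * B f g + B g g"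
  using functional_diff[OF B_lin[OF diff_in[OF assms]] assms] functional_diff[OF B_lin[OF assms(1)] assms]
    functional_diff[OF B_lin[OF assms(2)] assms] sym[of f "\<lambda>x. f x - g x"] sym[of g "\<lambda>x. f x - g x"] sym[of g f]
    diff_in[OF assms] assms by simp

lemma cauchy_schwarz:
  assumes "f \<in> V" "g \<in> V" shows "\<bar>B f g\<bar> \<le> N f * N g"
proof -
  have quad: "0 \<le> B f f + 2 * t * B f g + t\<^sup>2 * B g g" for t
    using nonneg[OF lin[OF assms, of 1 t]] assms lin[OF assms, of 1 t] sym[OF assms]
    by (simp add: B_linL[of f g _ 1 t, simplified] B_linR[of f g _ 1 t, simplified] power2_eq_square algebra_simps)
  have "(B f g)\<^sup>2 \<le> B f f * B g g"
  proof (cases "B g g = 0")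
    case True
    have "B f g = 0"
    proof (rule ccontr)
      assume "B f g \<noteq> 0"
      then show False using quad[of "- (B f f + 1) / (2 * B f g)"] True nonneg[OF assms(1)] by (simp add: field_simps)
    qed
    then show ?thesis using True by simp
  next
    case False
    then have "0 < B g g" using nonneg[OF assms(2)] by simp
    then show ?thesis using quad[of "- B f g / B g g"] by (simp add: power2_eq_square field_simps)
  qed
  then have "sqrt ((B f g)\<^sup>2) \<le> sqrt (B f f * B g g)" by (rule real_sqrt_le_mono)
  then show ?thesis by (simp add: N_def real_sqrt_mult)
qed

lemma N_triangle_diff:
  assumes "f \<in> V" "g \<in> V" "h \<in> V"
  shows "N (\<lambda>x. f x - h x) \<le> N (\<lambda>x. f x - g x) + N (\<lambda>x. g x - h x)"
proof -
  let ?u = "\<lambda>x. f x - g x" and ?v = "\<lambda>x. g x - h x"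
  have uv: "?u \<in> V" "?v \<in> V" using assms by (auto intro: diff_in)
  have e: "(\<lambda>x. f x - h x) = (\<lambda>x. 1 * ?u x + 1 * ?v x)" by auto
  have "B (\<lambda>x. f x - h x) (\<lambda>x. f x - h x) = B ?u ?u + 2 * B ?u ?v + B ?v ?v"
    unfolding e using uv lin[OF uv, of 1 1] sym[OF uv] by (simp add: B_linL[OF uv, of _ 1 1, simplified] B_linR[OF uv, of _ 1 1, simplified])
  also have "\<dots> \<le> (N ?u + N ?v)\<^sup>2"
    using cauchy_schwarz[OF uv] N_sq[OF uv(1)] N_sq[OF uv(2)] by (simp add: power2_sum)
  finally show ?thesis
    unfolding N_def[of "\<lambda>x. f x - h x"] using N_nonneg[OF uv(1)] N_nonneg[OF uv(2)] by (intro real_le_lsqrt) auto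
qed

definition bounded_functional :: "(('x \<Rightarrow> real) \<Rightarrow> real) \<Rightarrow> real \<Rightarrow> bool" where
  "bounded_functional \<phi> C \<longleftrightarrow> lin_functional V \<phi> \<and> 0 \<le> C \<and> (\<forall>f\<in>V. \<bar>\<phi> f\<bar> \<le> C * N f)"

lemma bounded_functionalD:
  assumes "bounded_functional \<phi> C"
  shows "lin_functional V \<phi>" "0 \<le> C" "\<And>f. f \<in> V \<Longrightarrow> \<bar>\<phi> f\<bar> \<le> C * N f"
  using assms by (auto simp: bounded_functional_def)

lemma bounded_functional_B: "h \<in> V \<Longrightarrow> bounded_functional (\<lambda>f. B f h) (N h)"
  unfolding bounded_functional_def using B_lin cauchy_schwarz N_nonneg by (auto simp: mult.commute)

text \<open>
  Zero vectors are admitted: sequences indexed by all natural numbers then also cover finite dimensional spaces, and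
  the Gram--Schmidt process need not skip dependent vectors.
\<close>

definition orthonormal :: "('k \<Rightarrow> 'x \<Rightarrow> real) \<Rightarrow> bool" where
  "orthonormal g \<longleftrightarrow> (\<forall>k. g k \<in> V) \<and> (\<forall>j k. j \<noteq> k \<longrightarrow> B (g j) (g k) = 0) \<and> (\<forall>k. B (g k) (g k) \<in> {0, 1})"

lemma orthonormal_in: "orthonormal g \<Longrightarrow> g k \<in> V" by (simp add: orthonormal_def)

lemma B_comb_orthonormal:
  assumes g: "orthonormal g" and K: "finite K"
  shows "B (comb K c g) (g j) = (if j \<in> K then c j * B (g j) (g j) else 0)"
proof -
  have "B (comb K c g) (g j) = (\<Sum>k\<in>K. c k * B (g k) (g j))"
    by (rule functional_comb[OF B_lin]) (simp_all add: orthonormal_in[OF g])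
  also have "\<dots> = (\<Sum>k\<in>K. if k = j then c j * B (g j) (g j) else 0)"
    using g by (intro sum.cong) (auto simp: orthonormal_def)
  finally show ?thesis using K by simp
qed

lemma B_comb_comb_orthonormal:
  assumes g: "orthonormal g" and K: "finite K"
  shows "B (comb K c g) (comb K d g) = (\<Sum>k\<in>K. c k * d k * B (g k) (g k))"
proof -
  have c: "comb K c g \<in> V" by (intro comb_in orthonormal_in[OF g])
  have d: "comb K d g \<in> V" by (intro comb_in orthonormal_in[OF g])
  have "B (comb K c g) (comb K d g) = B (comb K d g) (comb K c g)" using sym[OF c d] .
  also have "\<dots> = (\<Sum>k\<in>K. d k * B (g k) (comb K c g))"
    by (rule functional_comb[OF B_lin[OF c]]) (simp_all add: orthonormal_in[OF g])
  also have "\<dots> = (\<Sum>k\<in>K. c k * d k * B (g k) (g k))"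
    using B_comb_orthonormal[OF g K, of c] sym[OF c orthonormal_in[OF g]] by (intro sum.cong) auto
  finally show ?thesis .
qed

lemma N_comb_le:
  assumes g: "orthonormal g" and K: "finite K"
  shows "N (comb K c g) \<le> L2_set c K"
  unfolding N_def L2_set_def B_comb_comb_orthonormal[OF g K]
proof (intro real_sqrt_le_mono sum_mono)
  fix k
  have "B (g k) (g k) = 0 \<or> B (g k) (g k) = 1" using g by (simp add: orthonormal_def)
  then have "B (g k) (g k) \<le> 1" by auto
  from mult_left_mono[OF this zero_le_power2[of "c k"]]
  show "c k * c k * B (g k) (g k) \<le> (c k)\<^sup>2" by (simp add: power2_eq_square)
qed

lemma bessel:
  assumes g: "orthonormal g" and K: "finite K" and \<phi>: "bounded_functional \<phi> C"
  shows "(\<Sum>k\<in>K. (\<phi> (g k))\<^sup>2) \<le> C\<^sup>2"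
proof -
  let ?c = "\<lambda>k. \<phi> (g k)"
  have in_V: "comb K ?c g \<in> V" by (intro comb_in orthonormal_in[OF g])
  have "(\<Sum>k\<in>K. (\<phi> (g k))\<^sup>2) = \<phi> (comb K ?c g)"
    using functional_comb[OF bounded_functionalD(1)[OF \<phi>], of K g ?c] orthonormal_in[OF g] by (simp add: power2_eq_square)
  also have "\<dots> \<le> C * N (comb K ?c g)" using bounded_functionalD(3)[OF \<phi> in_V] by simp
  also have "\<dots> \<le> C * L2_set ?c K" by (intro mult_left_mono N_comb_le[OF g K] bounded_functionalD(2)[OF \<phi>])
  finally have le: "(L2_set ?c K)\<^sup>2 \<le> C * L2_set ?c K" by (simp add: L2_set_def sum_nonneg)
  have "L2_set ?c K \<le> C"
  proof (cases "L2_set ?c K = 0")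
    case False
    then have "0 < L2_set ?c K" by (simp add: less_le)
    then show ?thesis using le by (simp add: power2_eq_square)
  qed (use bounded_functionalD(2)[OF \<phi>] in simp)
  then have "(L2_set ?c K)\<^sup>2 \<le> C\<^sup>2" by (intro power_mono) auto
  then show ?thesis by (simp add: L2_set_def sum_nonneg)
qed

definition total :: "('k \<Rightarrow> 'x \<Rightarrow> real) \<Rightarrow> bool" where
  "total g \<longleftrightarrow> (\<forall>f\<in>V. (\<forall>k. B f (g k) = 0) \<longrightarrow> B f f = 0)"

text \<open>
  The Gram--Schmidt process; the state after \<open>n\<close> steps is the function that holds the first \<open>n\<close> vectors.  A remainder of
  norm zero is turned into the zero vector, as \<open>1 / 0 = 0\<close>.
\<close>

primrec gs_list :: "(nat \<Rightarrow> 'x \<Rightarrow> real) \<Rightarrow> nat \<Rightarrow> nat \<Rightarrow> 'x \<Rightarrow> real" where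
  "gs_list x 0 = (\<lambda>_ _. 0)"
| "gs_list x (Suc n) = (let r = (\<lambda>t. x n t - comb {..<n} (\<lambda>j. B (x n) (gs_list x n j)) (gs_list x n) t)
     in (gs_list x n)(n := (\<lambda>t. 1 / N r * r t)))"

definition gs :: "(nat \<Rightarrow> 'x \<Rightarrow> real) \<Rightarrow> nat \<Rightarrow> 'x \<Rightarrow> real" where
  "gs x k = gs_list x (Suc k) k"

definition gs_rest :: "(nat \<Rightarrow> 'x \<Rightarrow> real) \<Rightarrow> nat \<Rightarrow> 'x \<Rightarrow> real" where
  "gs_rest x n = (\<lambda>t. x n t - comb {..<n} (\<lambda>j. B (x n) (gs x j)) (gs x) t)"

lemma gs_list_eq: "j < n \<Longrightarrow> gs_list x n j = gs x j"
proof (induction n)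
  case (Suc n)
  then show ?case by (cases "j = n") (auto simp: Let_def gs_def)
qed simp

lemma gs_eq: "gs x n = (\<lambda>t. 1 / N (gs_rest x n) * gs_rest x n t)"
proof -
  have "comb {..<n} (\<lambda>j. B (x n) (gs_list x n j)) (gs_list x n) = comb {..<n} (\<lambda>j. B (x n) (gs x j)) (gs x)"
    by (auto simp: comb_def gs_list_eq intro!: sum.cong ext)
  then show ?thesis by (simp add: gs_def Let_def gs_rest_def)
qed

lemma gs_orthonormal_total:
  assumes x: "\<And>n. x n \<in> V" and tot: "total x"
  shows "orthonormal (gs x)" "total (gs x)"
proof -
  have gV: "gs x n \<in> V" for n
  proof (induction n rule: less_induct)
    case (less n)
    then have "gs_rest x n \<in> V" unfolding gs_rest_def by (intro diff_in x comb_in) auto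
    then show ?case unfolding gs_eq[of x n] by (rule scale_in)
  qed
  have rV: "gs_rest x n \<in> V" for n unfolding gs_rest_def by (intro diff_in x comb_in gV)
  have cV: "comb K c (gs x) \<in> V" for K c by (intro comb_in gV)
  have fc: "\<phi> (comb K c (gs x)) = (\<Sum>k\<in>K. c k * \<phi> (gs x k))" if "lin_functional V \<phi>" for \<phi> K c
    by (rule functional_comb[OF that gV])
  have norm: "B (gs x n) (gs x n) \<in> {0, 1}" for n
  proof -
    define c where "c = 1 / N (gs_rest x n)"
    have e: "gs x n = (\<lambda>t. c * gs_rest x n t)" unfolding c_def by (rule gs_eq)
    have "B (gs x n) (gs x n) = c\<^sup>2 * B (gs_rest x n) (gs_rest x n)"
      unfolding e functional_scale[OF B_lin[OF scale_in[OF rV]] rV] sym[OF rV scale_in[OF rV]]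
        functional_scale[OF B_lin[OF rV] rV] by (simp add: power2_eq_square)
    also have "\<dots> \<in> {0, 1}" unfolding N_sq[OF rV, symmetric] c_def by (cases "N (gs_rest x n) = 0") (auto simp: power_divide)
    finally show ?thesis .
  qed
  have null: "B f (gs x n) = B f (gs x n) * B (gs x n) (gs x n)" if "f \<in> V" for f n
    using norm[of n] cauchy_schwarz[OF that gV[of n]] by (auto simp: N_def)
  have orth: "B (gs x m) (gs x n) = 0" if "m < n" for m n
    using that
  proof (induction n arbitrary: m rule: less_induct)
    case (less n)
    have o: "B (gs x i) (gs x j) = 0" if "i < n" "j < n" "i \<noteq> j" for i j
      using less.IH[of i j] less.IH[of j i] that sym[OF gV gV] by (metis linorder_neqE_nat)
    have "B (gs_rest x n) (gs x m) = B (x n) (gs x m) - (\<Sum>j<n. B (x n) (gs x j) * B (gs x j) (gs x m))"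
      unfolding gs_rest_def by (simp only: functional_diff[OF B_lin[OF gV[of m]] x[of n] cV] fc[OF B_lin[OF gV[of m]]])
    also have "(\<Sum>j<n. B (x n) (gs x j) * B (gs x j) (gs x m)) = (\<Sum>j<n. if j = m then B (x n) (gs x m) * B (gs x m) (gs x m) else 0)"
      using o less.prems by (intro sum.cong) auto
    also have "\<dots> = B (x n) (gs x m)" using less.prems null[OF x[of n], of m] by simp
    finally have "B (gs_rest x n) (gs x m) = 0" by simp
    then have "B (gs x n) (gs x m) = 0" unfolding gs_eq[of x n] functional_scale[OF B_lin[OF gV[of m]] rV[of n]] by simp
    then show ?case using sym[OF gV gV] by simp
  qed
  show on: "orthonormal (gs x)"
    unfolding orthonormal_def using gV norm orth sym[OF gV gV] by (metis linorder_neqE_nat)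
  show "total (gs x)"
    unfolding total_def
  proof (intro ballI impI)
    fix f assume f: "f \<in> V" and 0: "\<forall>k. B f (gs x k) = 0"
    have "B f (x n) = 0" for n
    proof -
      have rest: "B f (gs_rest x n) = 0"
      proof (cases "N (gs_rest x n) = 0")
        case True
        then show ?thesis using cauchy_schwarz[OF f rV[of n]] by simp
      next
        case False
        have "B f (gs x n) = 1 / N (gs_rest x n) * B f (gs_rest x n)"
          unfolding gs_eq[of x n] sym[OF f scale_in[OF rV]] functional_scale[OF B_lin[OF f] rV[of n]] by (simp add: sym[OF f rV])
        then show ?thesis using 0 False by simp
      qed
      have "B (gs_rest x n) f = B (x n) f - (\<Sum>j<n. B (x n) (gs x j) * B (gs x j) f)"
        unfolding gs_rest_def by (simp only: functional_diff[OF B_lin[OF f] x[of n] cV] fc[OF B_lin[OF f]])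
      then show ?thesis using 0 rest sym[OF f gV] sym[OF f rV] sym[OF f x] by simp
    qed
    then show "B f f = 0" using tot f by (auto simp: total_def)
  qed
qed

end

locale complete_fun_form = fun_form +
  assumes complete: "\<And>s. (\<And>n. s n \<in> V) \<Longrightarrow> (\<And>e. 0 < e \<Longrightarrow> \<exists>n0. \<forall>m\<ge>n0. \<forall>n\<ge>n0. N (\<lambda>x. s m x - s n x) < e)
     \<Longrightarrow> \<exists>f\<in>V. (\<lambda>n. N (\<lambda>x. s n x - f x)) \<longlonglongrightarrow> 0"
begin

lemma functional_limit:
  assumes \<phi>: "bounded_functional \<phi> C" and s: "\<And>n. s n \<in> V" and f: "f \<in> V"
    and lim: "(\<lambda>n. N (\<lambda>x. s n x - f x)) \<longlonglongrightarrow> 0"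
  shows "(\<lambda>n. \<phi> (s n)) \<longlonglongrightarrow> \<phi> f"
proof -
  have "\<bar>\<phi> (s n) - \<phi> f\<bar> \<le> C * N (\<lambda>x. s n x - f x)" for n
    using bounded_functionalD(3)[OF \<phi> diff_in[OF s[of n] f]] functional_diff[OF bounded_functionalD(1)[OF \<phi>] s[of n] f] by simp
  moreover have "(\<lambda>n. C * N (\<lambda>x. s n x - f x)) \<longlonglongrightarrow> 0" using tendsto_mult_right_zero[OF lim] .
  ultimately have "(\<lambda>n. \<phi> (s n) - \<phi> f) \<longlonglongrightarrow> 0"
    by (intro Lim_null_comparison[OF _ \<open>(\<lambda>n. C * N (\<lambda>x. s n x - f x)) \<longlonglongrightarrow> 0\<close>]) auto
  then show ?thesis by (rule LIM_zero_cancel)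
qed

lemma riesz_fischer:
  assumes g: "orthonormal g" and bd: "\<And>n. (\<Sum>k<n. (c k)\<^sup>2) \<le> C"
  obtains f where "f \<in> V" "(\<lambda>n. N (\<lambda>x. comb {..<n::nat} c g x - f x)) \<longlonglongrightarrow> 0"
proof -
  let ?s = "\<lambda>n. comb {..<n} c g"
  have sV: "?s n \<in> V" for n by (intro comb_in orthonormal_in[OF g])
  have "summable (\<lambda>k. (c k)\<^sup>2)" by (rule summableI_nonneg_bounded[of _ C]) (auto intro: bd)
  then have Cau: "Cauchy (\<lambda>n. \<Sum>k<n. (c k)\<^sup>2)" by (simp add: summable_iff_convergent convergent_Cauchy)
  have key: "N (\<lambda>x. ?s m x - ?s n x) \<le> sqrt ((\<Sum>k<m. (c k)\<^sup>2) - (\<Sum>k<n. (c k)\<^sup>2))" if "n \<le> m" for m n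
  proof -
    have split: "{..<m} = {..<n} \<union> {n..<m}" "{..<n} \<inter> {n..<m} = {}" using that by auto
    have "(\<lambda>x. ?s m x - ?s n x) = comb {n..<m} c g"
      by (simp add: comb_def split(1) sum.union_disjoint[OF _ _ split(2)] fun_eq_iff)
    moreover have "(\<Sum>k<m. (c k)\<^sup>2) - (\<Sum>k<n. (c k)\<^sup>2) = (\<Sum>k\<in>{n..<m}. (c k)\<^sup>2)"
      by (simp add: split(1) sum.union_disjoint[OF _ _ split(2)])
    ultimately show ?thesis using N_comb_le[OF g, of "{n..<m}" c] by (simp add: L2_set_def)
  qed
  have sw: "N (\<lambda>x. ?s m x - ?s n x) = N (\<lambda>x. ?s n x - ?s m x)" for m n
    unfolding N_def B_diff_diff[OF sV sV] using sym[OF sV sV, of m n] by simp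
  have "\<exists>f\<in>V. (\<lambda>n. N (\<lambda>x. ?s n x - f x)) \<longlonglongrightarrow> 0"
  proof (rule complete[OF sV])
    fix e :: real assume e: "0 < e"
    obtain n0 where n0: "\<And>m n. n0 \<le> m \<Longrightarrow> n0 \<le> n \<Longrightarrow> \<bar>(\<Sum>k<m. (c k)\<^sup>2) - (\<Sum>k<n. (c k)\<^sup>2)\<bar> < e\<^sup>2"
      using CauchyD[OF Cau, of "e\<^sup>2"] e by auto
    have *: "N (\<lambda>x. ?s m x - ?s n x) < e" if "n0 \<le> n" "n \<le> m" for m n
    proof -
      have "N (\<lambda>x. ?s m x - ?s n x) \<le> sqrt ((\<Sum>k<m. (c k)\<^sup>2) - (\<Sum>k<n. (c k)\<^sup>2))" by (rule key[OF that(2)])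
      also have "\<dots> < sqrt (e\<^sup>2)" using n0[of m n] that by (intro real_sqrt_less_mono) auto
      finally show ?thesis using e by simp
    qed
    show "\<exists>n0. \<forall>m\<ge>n0. \<forall>n\<ge>n0. N (\<lambda>x. ?s m x - ?s n x) < e"
    proof (intro exI allI impI)
      fix m n assume "n0 \<le> m" "n0 \<le> n"
      then show "N (\<lambda>x. ?s m x - ?s n x) < e"
        using *[of n m] *[of m n] sw[of m n] by (cases "n \<le> m") auto
    qed
  qed
  then show thesis using that by blast
qed

lemma expansion:
  assumes g: "orthonormal g" "total (g :: nat \<Rightarrow> _)" and f: "f \<in> V"
  shows "(\<lambda>n. N (\<lambda>x. comb {..<n} (\<lambda>k. B f (g k)) g x - f x)) \<longlonglongrightarrow> 0"
proof -
  let ?c = "\<lambda>k. B f (g k)"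
  have sV: "comb {..<n} ?c g \<in> V" for n by (intro comb_in orthonormal_in[OF g(1)])
  have eq: "B (g k) f = B f (g k)" for k using sym[OF f orthonormal_in[OF g(1)]] by simp
  have "(\<Sum>k<n. (?c k)\<^sup>2) \<le> (N f)\<^sup>2" for n
    using bessel[OF g(1) _ bounded_functional_B[OF f], of "{..<n}"] by (simp add: eq)
  from riesz_fischer[OF g(1) this] obtain h where h: "h \<in> V" and lim: "(\<lambda>n. N (\<lambda>x. comb {..<n} ?c g x - h x)) \<longlonglongrightarrow> 0" by blast
  have "B (\<lambda>x. f x - h x) (g k) = 0" for k
  proof -
    have "(\<lambda>n. B (comb {..<n} ?c g) (g k)) \<longlonglongrightarrow> B h (g k)"
      by (rule functional_limit[OF bounded_functional_B[OF orthonormal_in[OF g(1)]] sV h lim])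
    moreover have "\<forall>\<^sub>F n in sequentially. B (comb {..<n} ?c g) (g k) = B f (g k)"
    proof (rule eventually_sequentiallyI[of "Suc k"])
      fix n assume "Suc k \<le> n"
      moreover have "B f (g k) * B (g k) (g k) = B f (g k)"
      proof -
        have "B (g k) (g k) = 0 \<or> B (g k) (g k) = 1" using g(1) by (auto simp: orthonormal_def)
        then show ?thesis using cauchy_schwarz[OF f orthonormal_in[OF g(1)], of k] by (auto simp: N_def)
      qed
      ultimately show "B (comb {..<n} ?c g) (g k) = B f (g k)" by (simp add: B_comb_orthonormal[OF g(1)])
    qed
    then have "(\<lambda>n. B (comb {..<n} ?c g) (g k)) \<longlonglongrightarrow> B f (g k)" by (rule tendsto_eventually)
    ultimately have "B h (g k) = B f (g k)" by (rule LIMSEQ_unique)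
    then show ?thesis using functional_diff[OF B_lin[OF orthonormal_in[OF g(1)]] f h] by simp
  qed
  then have 0: "B (\<lambda>x. f x - h x) (\<lambda>x. f x - h x) = 0" using g(2) diff_in[OF f h] by (auto simp: total_def)
  have "N (\<lambda>x. comb {..<n} ?c g x - f x) = N (\<lambda>x. comb {..<n} ?c g x - h x)" for n
  proof -
    have "N (\<lambda>x. f x - h x) = 0" "N (\<lambda>x. h x - f x) = 0"
      using 0 B_diff_diff[OF f h] B_diff_diff[OF h f] sym[OF f h] by (auto simp: N_def)
    then show ?thesis
      using N_triangle_diff[OF sV f h, of n] N_triangle_diff[OF sV h f, of n] by simp
  qed
  then show ?thesis using lim by simp
qed

lemma functional_expansion:
  assumes g: "orthonormal g" "total (g :: nat \<Rightarrow> _)" and f: "f \<in> V" and \<phi>: "bounded_functional \<phi> C"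
  shows "(\<lambda>n. \<Sum>k<n. B f (g k) * \<phi> (g k)) \<longlonglongrightarrow> \<phi> f"
proof -
  have "(\<lambda>n. \<phi> (comb {..<n} (\<lambda>k. B f (g k)) g)) \<longlonglongrightarrow> \<phi> f"
    by (rule functional_limit[OF \<phi> comb_in f expansion[OF g f]]) (rule orthonormal_in[OF g(1)])
  then show ?thesis
    by (simp add: functional_comb[OF bounded_functionalD(1)[OF \<phi>]] orthonormal_in[OF g(1)])
qed

text \<open>
  Turns a bound that is uniform in \<open>f\<close> into a bound on countably many numbers, to which a tail inequality for vectors
  applies.
\<close>

lemma functional_bound_from_coordinates:
  assumes g: "orthonormal g" "total (g :: nat \<Rightarrow> _)" and f: "f \<in> V" and \<phi>: "bounded_functional \<phi> C"
    and b: "\<And>n. L2_set (\<lambda>k. \<phi> (g k)) {..<n} \<le> b"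
  shows "\<bar>\<phi> f\<bar> \<le> b * N f"
proof (rule LIMSEQ_le_const2[OF tendsto_rabs[OF functional_expansion[OF g f \<phi>]]], intro exI allI impI)
  fix n :: nat
  have "\<bar>\<Sum>k<n. B f (g k) * \<phi> (g k)\<bar> \<le> L2_set (\<lambda>k. B f (g k)) {..<n} * L2_set (\<lambda>k. \<phi> (g k)) {..<n}"
    by (rule abs_sum_mult_le_L2_set)
  also have "\<dots> \<le> N f * b"
  proof (intro mult_mono b N_nonneg f L2_set_nonneg)
    have "(\<Sum>k<n. (B f (g k))\<^sup>2) \<le> (N f)\<^sup>2"
      using bessel[OF g(1) _ bounded_functional_B[OF f], of "{..<n}"] sym[OF f orthonormal_in[OF g(1)]] by simp
    then show "L2_set (\<lambda>k. B f (g k)) {..<n} \<le> N f" unfolding L2_set_def by (rule real_le_lsqrt[OF N_nonneg[OF f]])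
  qed
  finally show "\<bar>\<Sum>k<n. B f (g k) * \<phi> (g k)\<bar> \<le> b * N f" by (simp add: mult.commute)
qed

text \<open>
  The representer is the sum of the series with coefficients \<open>\<phi> (g k)\<close>.  The last clause computes its image under any
  other functional, which also shows measurability when \<open>\<phi>\<close> depends on a parameter.
\<close>

lemma riesz:
  assumes g: "orthonormal g" "total (g :: nat \<Rightarrow> _)" and \<phi>: "bounded_functional \<phi> C"
  obtains r where "r \<in> V" "\<And>f. f \<in> V \<Longrightarrow> B r f = \<phi> f"
    "\<And>\<psi> C'. bounded_functional \<psi> C' \<Longrightarrow> (\<lambda>n. \<Sum>k<n. \<phi> (g k) * \<psi> (g k)) \<longlonglongrightarrow> \<psi> r"
proof -
  have sV: "comb {..<n} (\<lambda>k. \<phi> (g k)) g \<in> V" for n by (intro comb_in orthonormal_in[OF g(1)])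
  have "(\<Sum>k<n. (\<phi> (g k))\<^sup>2) \<le> C\<^sup>2" for n using bessel[OF g(1) _ \<phi>] by simp
  from riesz_fischer[OF g(1) this] obtain r where r: "r \<in> V"
    and lim: "(\<lambda>n. N (\<lambda>x. comb {..<n} (\<lambda>k. \<phi> (g k)) g x - r x)) \<longlonglongrightarrow> 0" by blast
  have conv: "(\<lambda>n. \<Sum>k<n. \<phi> (g k) * \<psi> (g k)) \<longlonglongrightarrow> \<psi> r" if \<psi>: "bounded_functional \<psi> C'" for \<psi> C'
    using functional_limit[OF \<psi> sV r lim] by (simp add: functional_comb[OF bounded_functionalD(1)[OF \<psi>]] orthonormal_in[OF g(1)])
  have "B r f = \<phi> f" if f: "f \<in> V" for f
  proof (rule LIMSEQ_unique[OF conv[OF bounded_functional_B[OF f]]])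
    show "(\<lambda>n. \<Sum>k<n. \<phi> (g k) * B (g k) f) \<longlonglongrightarrow> \<phi> f"
      using functional_expansion[OF g f \<phi>] sym[OF f orthonormal_in[OF g(1)]] by (simp add: mult.commute)
  qed
  then show thesis using r conv by (intro that)
qed

end

section \<open>Square integrable functions on a compact set\<close>

locale compact_domain =
  fixes T :: "real set" assumes compact_T: "compact T"
begin

lemma T_borel [measurable, simp]: "T \<in> sets borel"
  using compact_T by (simp add: compact_imp_closed)

lemma space_leb [simp]: "space (leb T) = T" by (simp add: space_restrict_space)

sublocale leb: finite_measure "leb T"
proof
  have "emeasure (leb T) (space (leb T)) = emeasure lborel T"
    by (simp add: emeasure_restrict_space)
  also have "\<dots> < \<infinity>" using compact_T by (intro emeasure_bounded_finite compact_imp_bounded)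
  finally show "emeasure (leb T) (space (leb T)) \<noteq> \<infinity>" by simp
qed

lemma l2_measurable [measurable_dest]: "f \<in> l2_space T \<Longrightarrow> f \<in> borel_measurable (leb T)"
  and l2_sq_integrable: "f \<in> l2_space T \<Longrightarrow> integrable (leb T) (\<lambda>t. (f t)\<^sup>2)"
  by (simp_all add: l2_space_def)

lemma l2_mult_integrable:
  assumes f: "f \<in> l2_space T" and g: "g \<in> l2_space T"
  shows "integrable (leb T) (\<lambda>t. f t * g t)"
proof (rule Bochner_Integration.integrable_bound)
  show "integrable (leb T) (\<lambda>t. (f t)\<^sup>2 + (g t)\<^sup>2)"
    using l2_sq_integrable[OF f] l2_sq_integrable[OF g] by (rule Bochner_Integration.integrable_add)
  show "(\<lambda>t. f t * g t) \<in> borel_measurable (leb T)" using f g by (intro borel_measurable_times l2_measurable)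
  have "\<bar>f t * g t\<bar> \<le> (f t)\<^sup>2 + (g t)\<^sup>2" for t
    using sum_squares_bound[of "\<bar>f t\<bar>" "\<bar>g t\<bar>"] mult_nonneg_nonneg[OF abs_ge_zero[of "f t"] abs_ge_zero[of "g t"]]
    unfolding abs_mult power2_abs by linarith
  then show "AE t in leb T. norm (f t * g t) \<le> norm ((f t)\<^sup>2 + (g t)\<^sup>2)" by simp
qed

lemma l2_lin: "f \<in> l2_space T \<Longrightarrow> g \<in> l2_space T \<Longrightarrow> (\<lambda>t. a * f t + b * g t) \<in> l2_space T"
proof -
  assume f: "f \<in> l2_space T" and g: "g \<in> l2_space T"
  have "(\<lambda>t. (a * f t + b * g t)\<^sup>2) = (\<lambda>t. a\<^sup>2 * (f t)\<^sup>2 + (2 * a * b * (f t * g t) + b\<^sup>2 * (g t)\<^sup>2))"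
    by (auto simp: power2_eq_square algebra_simps)
  moreover have "integrable (leb T) \<dots>"
    using l2_sq_integrable[OF f] l2_sq_integrable[OF g] l2_mult_integrable[OF f g]
    by (intro Bochner_Integration.integrable_add integrable_mult_right)
  moreover have "(\<lambda>t. a * f t + b * g t) \<in> borel_measurable (leb T)"
    using f g by (intro borel_measurable_add borel_measurable_times borel_measurable_const l2_measurable)
  ultimately show ?thesis by (simp add: l2_space_def)
qed

lemma l2_inner_lin: "h \<in> l2_space T \<Longrightarrow> lin_functional (l2_space T) (\<lambda>f. l2_inner T f h)"
  unfolding lin_functional_def l2_inner_def
  using l2_mult_integrable by (simp add: distrib_right mult.assoc)

sublocale l2: fun_form "l2_space T" "l2_inner T"
  by standard
     (simp_all add: l2_lin l2_inner_lin, simp_all add: l2_space_def l2_inner_def mult.commute)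

lemma N_eq_l2_norm: "l2.N = l2_norm T" by (simp add: l2.N_def l2_norm_def fun_eq_iff)

lemma l2_norm_0_iff: "f \<in> l2_space T \<Longrightarrow> l2_inner T f f = 0 \<longleftrightarrow> (AE t in leb T. f t = 0)"
  unfolding l2_inner_def using l2_mult_integrable[of f f] by (subst integral_nonneg_eq_0_iff_AE) auto

lemma l2_eq_iff: "f \<in> l2_space T \<Longrightarrow> g \<in> l2_space T \<Longrightarrow> l2_eq T f g \<longleftrightarrow> l2_norm T (\<lambda>t. f t - g t) = 0"
  using l2_norm_0_iff[OF l2.diff_in[of f g]] by (simp add: l2_eq_def l2_norm_def)

lemma l2_inner_cong: "l2_eq T f g \<Longrightarrow> f \<in> l2_space T \<Longrightarrow> g \<in> l2_space T \<Longrightarrow> h \<in> l2_space T \<Longrightarrow> l2_inner T f h = l2_inner T g h"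
  unfolding l2_inner_def l2_eq_def by (intro integral_cong_AE) auto

lemma l2_bounded_measurable: "f \<in> borel_measurable (leb T) \<Longrightarrow> (\<And>t. \<bar>f t\<bar> \<le> C) \<Longrightarrow> f \<in> l2_space T"
proof -
  assume f: "f \<in> borel_measurable (leb T)" and C: "\<And>t. \<bar>f t\<bar> \<le> C"
  have "integrable (leb T) (\<lambda>t. (f t)\<^sup>2)"
    by (rule leb.integrable_const_bound[where B = "C\<^sup>2"])
       (use f C power_mono[OF C, of _ 2] in \<open>auto\<close>)
  then show ?thesis using f by (simp add: l2_space_def)
qed

lemma l2_integrable: "f \<in> l2_space T \<Longrightarrow> integrable (leb T) f"
  using l2_mult_integrable[OF _ l2_bounded_measurable[of "\<lambda>_. 1" 1]] by simp

text \<open>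
  The Riesz--Fischer theorem: a subsequence with summable increments converges almost everywhere, and Fatou's lemma
  gives convergence in norm.
\<close>

lemma l2_complete:
  assumes s: "\<And>n::nat. s n \<in> l2_space T"
    and cauchy: "\<And>e. 0 < e \<Longrightarrow> \<exists>n0. \<forall>m\<ge>n0. \<forall>n\<ge>n0. l2.N (\<lambda>x. s m x - s n x) < e"
  shows "\<exists>f\<in>l2_space T. (\<lambda>n. l2.N (\<lambda>x. s n x - f x)) \<longlonglongrightarrow> 0"
proof -
  have [measurable]: "s n \<in> borel_measurable (leb T)" for n using s[of n] by (rule l2_measurable)
  have "\<exists>n0. \<forall>m\<ge>n0. \<forall>n\<ge>n0. l2.N (\<lambda>x. s m x - s n x) < (1/2) ^ j" for j :: nat using cauchy by simp
  then obtain q where q: "\<And>j m n. q j \<le> m \<Longrightarrow> q j \<le> n \<Longrightarrow> l2.N (\<lambda>x. s m x - s n x) < (1/2) ^ j" by metis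
  \<comment> \<open>indices of a subsequence along which successive distances are at most \<open>(1/2) ^ j\<close>\<close>
  define r where "r j = (\<Sum>i\<le>j. q i)" for j
  have rq: "q j \<le> r j" "r j \<le> r (Suc j)" for j by (auto simp: r_def intro: member_le_sum)
  have r_mono: "r i \<le> r j" if "i \<le> j" for i j using rq(2) that by (rule lift_Suc_mono_le)
  define d where "d j t = s (r (Suc j)) t - s (r j) t" for j t
  have dV: "d j \<in> l2_space T" for j unfolding d_def[abs_def] by (intro l2.diff_in s)
  have [measurable]: "d j \<in> borel_measurable (leb T)" for j using dV[of j] by (rule l2_measurable)
  have dN: "l2.N (d j) \<le> (1/2) ^ j" for j
    using q[of j "r (Suc j)" "r j"] rq[of j] unfolding d_def[abs_def] by simp
  have one: "(\<lambda>_. 1) \<in> l2_space T" by (rule l2_bounded_measurable[of _ 1]) auto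
  have ad: "(\<lambda>t. \<bar>d j t\<bar>) \<in> l2_space T" "l2.N (\<lambda>t. \<bar>d j t\<bar>) = l2.N (d j)" for j
    using dV[of j] by (auto simp: l2_space_def l2.N_def l2_inner_def abs_mult[symmetric])
  have d1: "(LINT t|leb T. \<bar>d j t\<bar>) \<le> (1/2) ^ j * l2.N (\<lambda>_. 1)" for j
  proof -
    have "(LINT t|leb T. \<bar>d j t\<bar>) = l2_inner T (\<lambda>t. \<bar>d j t\<bar>) (\<lambda>_. 1)" by (simp add: l2_inner_def)
    also have "\<dots> \<le> l2.N (\<lambda>t. \<bar>d j t\<bar>) * l2.N (\<lambda>_. 1)" using l2.cauchy_schwarz[OF ad(1) one, of j] by simp
    also have "\<dots> \<le> (1/2) ^ j * l2.N (\<lambda>_. 1)" using dN[of j] ad(2)[of j] by (intro mult_right_mono l2.N_nonneg one) simp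
    finally show ?thesis .
  qed
  have "(\<integral>\<^sup>+t. (\<Sum>j. ennreal \<bar>d j t\<bar>) \<partial>leb T) = (\<Sum>j. \<integral>\<^sup>+t. ennreal \<bar>d j t\<bar> \<partial>leb T)"
    by (rule nn_integral_suminf) measurable
  also have "\<dots> = (\<Sum>j. ennreal (LINT t|leb T. \<bar>d j t\<bar>))"
    using l2_integrable[OF ad(1)] by (intro suminf_cong nn_integral_eq_integral) auto
  also have "\<dots> \<le> (\<Sum>j. ennreal ((1/2) ^ j * l2.N (\<lambda>_. 1)))"
    by (intro suminf_le ennreal_leI d1) auto
  also have "\<dots> = ennreal (\<Sum>j. (1/2) ^ j * l2.N (\<lambda>_. 1))"
    by (intro suminf_ennreal2 mult_nonneg_nonneg l2.N_nonneg one summable_mult2 summable_geometric) auto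
  also have "\<dots> < \<infinity>" by simp
  finally have "AE t in leb T. (\<Sum>j. ennreal \<bar>d j t\<bar>) \<noteq> \<infinity>"
    by (intro nn_integral_PInf_AE) auto
  then have conv: "AE t in leb T. (\<lambda>j. s (r j) t) \<longlonglongrightarrow> lim (\<lambda>j. s (r j) t)"
  proof eventually_elim
    fix t assume "(\<Sum>j. ennreal \<bar>d j t\<bar>) \<noteq> \<infinity>"
    then have "summable (\<lambda>j. \<bar>d j t\<bar>)" by (intro summable_suminf_not_top) auto
    then have "summable (\<lambda>j. d j t)" by (rule summable_rabs_cancel)
    then have "convergent (\<lambda>n. \<Sum>j<n. d j t)" by (simp add: summable_iff_convergent)
    moreover have "(\<Sum>j<n. d j t) = s (r n) t - s (r 0) t" for n
      unfolding d_def by (rule sum_lessThan_telescope)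
    ultimately have "convergent (\<lambda>n. s (r n) t - s (r 0) t)" by simp
    then have "convergent (\<lambda>n. s (r n) t)" using convergent_add_const_right_iff[of "\<lambda>n. s (r n) t" "- s (r 0) t"] by simp
    then show "(\<lambda>j. s (r j) t) \<longlonglongrightarrow> lim (\<lambda>j. s (r j) t)" by (simp add: convergent_LIMSEQ_iff)
  qed
  define f where "f t = lim (\<lambda>j. s (r j) t)" for t
  have [measurable]: "f \<in> borel_measurable (leb T)" unfolding f_def[abs_def] by measurable
  have fatou: "(\<integral>\<^sup>+t. ennreal ((f t - s n t)\<^sup>2) \<partial>leb T) \<le> ennreal (e\<^sup>2)"
    if e: "0 \<le> e" and n: "\<And>m. n \<le> m \<Longrightarrow> l2.N (\<lambda>x. s m x - s n x) \<le> e" and le: "\<forall>\<^sub>F j in sequentially. n \<le> r j" for n e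
  proof -
    have "(\<integral>\<^sup>+t. ennreal ((f t - s n t)\<^sup>2) \<partial>leb T) = (\<integral>\<^sup>+t. liminf (\<lambda>j. ennreal ((s (r j) t - s n t)\<^sup>2)) \<partial>leb T)"
    proof (intro nn_integral_cong_AE, use conv in eventually_elim)
      fix t assume "(\<lambda>j. s (r j) t) \<longlonglongrightarrow> lim (\<lambda>j. s (r j) t)"
      then have "(\<lambda>j. ennreal ((s (r j) t - s n t)\<^sup>2)) \<longlonglongrightarrow> ennreal ((f t - s n t)\<^sup>2)"
        unfolding f_def by (intro tendsto_intros)
      then show "ennreal ((f t - s n t)\<^sup>2) = liminf (\<lambda>j. ennreal ((s (r j) t - s n t)\<^sup>2))"
        by (intro lim_imp_Liminf[symmetric]) auto
    qed
    also have "\<dots> \<le> liminf (\<lambda>j. \<integral>\<^sup>+t. ennreal ((s (r j) t - s n t)\<^sup>2) \<partial>leb T)"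
      by (rule nn_integral_liminf) measurable
    also have "\<dots> \<le> liminf (\<lambda>j. ennreal (e\<^sup>2))"
    proof (rule Liminf_mono, use le in eventually_elim)
      fix j assume j: "n \<le> r j"
      have "(\<integral>\<^sup>+t. ennreal ((s (r j) t - s n t)\<^sup>2) \<partial>leb T) = ennreal ((l2.N (\<lambda>t. s (r j) t - s n t))\<^sup>2)"
        unfolding l2.N_sq[OF l2.diff_in[OF s s]] l2_inner_def power2_eq_square[symmetric]
        by (rule nn_integral_eq_integral[OF l2_sq_integrable[OF l2.diff_in[OF s s]]]) simp
      also have "\<dots> \<le> ennreal (e\<^sup>2)" by (intro ennreal_leI power_mono n j l2.N_nonneg l2.diff_in s)
      finally show "(\<integral>\<^sup>+t. ennreal ((s (r j) t - s n t)\<^sup>2) \<partial>leb T) \<le> ennreal (e\<^sup>2)" .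
    qed
    finally show ?thesis by (simp add: Liminf_const)
  qed
  have diff: "(\<lambda>t. f t - s n t) \<in> l2_space T \<and> l2.N (\<lambda>t. f t - s n t) \<le> e"
    if e: "0 \<le> e" and n: "\<And>m. n \<le> m \<Longrightarrow> l2.N (\<lambda>x. s m x - s n x) \<le> e" and le: "\<forall>\<^sub>F j in sequentially. n \<le> r j" for n e
  proof -
    note F = fatou[OF e n le]
    have int: "integrable (leb T) (\<lambda>t. (f t - s n t)\<^sup>2)"
      by (rule integrableI_nonneg) (use F le_less_trans[OF F ennreal_less_top] in auto)
    then have V: "(\<lambda>t. f t - s n t) \<in> l2_space T" by (simp add: l2_space_def)
    have "ennreal (LINT t|leb T. (f t - s n t)\<^sup>2) \<le> ennreal (e\<^sup>2)"
      using F nn_integral_eq_integral[OF int] by simp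
    then have "l2.N (\<lambda>t. f t - s n t) \<le> e"
      unfolding l2.N_def l2_inner_def power2_eq_square[symmetric] by (intro real_le_lsqrt e) simp
    with V show ?thesis by simp
  qed
  show ?thesis
  proof (cases "\<exists>b. \<forall>j. r j \<le> b")
    case True
    \<comment> \<open>all thresholds vanish eventually\<close>
    then obtain b where b: "\<And>j. r j \<le> b" by auto
    have z: "l2.N (\<lambda>x. s m x - s b x) \<le> 0" if "b \<le> m" for m
    proof (rule field_le_epsilon)
      fix e :: real assume "0 < e"
      then obtain j where "(1/2) ^ j < e" using real_arch_pow_inv[of e "1/2"] by auto
      moreover have "l2.N (\<lambda>x. s m x - s b x) < (1/2) ^ j"
        using q[of j m b] rq(1)[of j] b[of j] that by linarith
      ultimately show "l2.N (\<lambda>x. s m x - s b x) \<le> 0 + e" by simp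
    qed
    have "(\<lambda>n. l2.N (\<lambda>x. s n x - s b x)) \<longlonglongrightarrow> 0"
      by (rule tendsto_eventually, rule eventually_sequentiallyI[of b])
         (use z l2.N_nonneg[OF l2.diff_in[OF s s]] in \<open>auto intro: antisym\<close>)
    then show ?thesis using s by blast
  next
    case False
    have ev: "\<forall>\<^sub>F j in sequentially. n \<le> r j" for n
    proof -
      obtain i where "n \<le> r i" using False by (meson linorder_linear)
      then show ?thesis using r_mono by (intro eventually_sequentiallyI[of i]) (meson order_trans)
    qed
    obtain n1 where n1: "\<And>m. n1 \<le> m \<Longrightarrow> l2.N (\<lambda>x. s m x - s n1 x) \<le> 1"
      using cauchy[of 1] by (meson less_imp_le order_refl zero_less_one)
    have "(\<lambda>t. 1 * (f t - s n1 t) + 1 * s n1 t) \<in> l2_space T"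
      using diff[OF _ n1 ev] s by (intro l2_lin) auto
    then have fV: "f \<in> l2_space T" by simp
    have "(\<lambda>n. l2.N (\<lambda>x. s n x - f x)) \<longlonglongrightarrow> 0"
    proof (rule LIMSEQ_I)
      fix e :: real assume e: "0 < e"
      then obtain n0 where n0: "\<And>m n. n0 \<le> m \<Longrightarrow> n0 \<le> n \<Longrightarrow> l2.N (\<lambda>x. s m x - s n x) < e / 2"
        using cauchy[of "e / 2"] by auto
      have "l2.N (\<lambda>x. s n x - f x) < e" if n: "n0 \<le> n" for n
      proof -
        have "l2.N (\<lambda>x. s n x - f x) = l2.N (\<lambda>x. f x - s n x)"
          by (simp add: l2.N_def l2_inner_def power2_eq_square[symmetric] power2_commute)
        also have "\<dots> \<le> e / 2"
          using diff[of "e / 2" n, OF _ _ ev] e n0[OF _ n] n by (auto intro: less_imp_le order_trans)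
        finally show ?thesis using e by simp
      qed
      then show "\<exists>no. \<forall>n\<ge>no. norm (l2.N (\<lambda>x. s n x - f x) - 0) < e"
        using l2.N_nonneg[OF l2.diff_in[OF s fV]] by (auto intro!: exI[of _ n0])
    qed
    then show ?thesis using fV by blast
  qed
qed

sublocale l2: complete_fun_form "l2_space T" "l2_inner T"
  by standard (rule l2_complete)

definition half_line :: "nat \<Rightarrow> real \<Rightarrow> real" where
  "half_line k = indicator {..from_nat_into \<rat> k}"

lemma half_line_in: "half_line k \<in> l2_space T"
  unfolding half_line_def by (rule l2_bounded_measurable[of _ 1]) (auto simp: indicator_def measurable_restrict_space1)

text \<open>
  A function orthogonal to all these indicators integrates to zero over half lines with rational end points, then over
  all half lines, and then over all Borel sets.
\<close>

lemma total_half_line: "l2.total half_line"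
  unfolding l2.total_def
proof (intro ballI impI)
  fix f assume f: "f \<in> l2_space T" and orth: "\<forall>k. l2_inner T f (half_line k) = 0"
  define F where "F t = indicator T t * f t" for t
  have F: "integrable lborel F"
    using l2_integrable[OF f] unfolding F_def[abs_def] by (subst (asm) integrable_restrict_space) auto
  have rat: "(LINT t:{..q}|lborel. F t) = 0" if "q \<in> \<rat>" for q
  proof -
    have "\<exists>k. q = from_nat_into \<rat> k"
      using that countable_rat by (metis from_nat_into_surj)
    then obtain k where k: "q = from_nat_into \<rat> k" by auto
    have "(LINT t:{..q}|lborel. F t) = (LINT t|lborel. indicator T t *\<^sub>R (f t * half_line k t))"
      unfolding set_lebesgue_integral_def F_def half_line_def k
      by (intro Bochner_Integration.integral_cong refl) (auto simp: indicator_def)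
    also have "\<dots> = l2_inner T f (half_line k)"
      unfolding l2_inner_def by (subst integral_restrict_space) auto
    finally show ?thesis using orth by simp
  qed
  have atMost: "(LINT t:{..a}|lborel. F t) = 0" for a
  proof -
    have "\<exists>q\<in>\<rat>. a < q \<and> q < a + 1 / real (Suc n)" for n by (rule Rats_dense_in_real) simp
    then obtain q where q: "\<And>n. q n \<in> \<rat>" "\<And>n. a < q n" "\<And>n. q n < a + 1 / real (Suc n)" by metis
    have "(\<lambda>n. LINT t|lborel. indicator {..q n} t *\<^sub>R F t) \<longlonglongrightarrow> (LINT t|lborel. indicator {..a} t *\<^sub>R F t)"
    proof (rule integral_dominated_convergence[where w = "\<lambda>t. \<bar>F t\<bar>"])
      show "integrable lborel (\<lambda>t. \<bar>F t\<bar>)" using F by simp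
      show "AE t in lborel. (\<lambda>n. indicator {..q n} t *\<^sub>R F t) \<longlonglongrightarrow> indicator {..a} t *\<^sub>R F t"
      proof (rule AE_I2, rule tendsto_eventually)
        fix t
        show "\<forall>\<^sub>F n in sequentially. indicator {..q n} t *\<^sub>R F t = indicator {..a} t *\<^sub>R F t"
        proof (cases "t \<le> a")
          case True
          then show ?thesis using q(2) by (auto simp: indicator_def less_imp_le intro!: always_eventually intro: order_trans)
        next
          case False
          then have "\<forall>\<^sub>F n in sequentially. 1 / real (Suc n) < t - a"
            using LIMSEQ_inverse_real_of_nat order_tendstoD(2)[of _ 0 sequentially "t - a"] by (simp add: inverse_eq_divide)
          then show ?thesis
          proof eventually_elim
            case (elim n)
            then show ?case using False q(3)[of n] by (auto simp: indicator_def)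
          qed
        qed
      qed
    qed (use F in \<open>auto simp: indicator_def borel_measurable_integrable\<close>)
    moreover have "(LINT t|lborel. indicator {..q n} t *\<^sub>R F t) = 0" for n
      using rat[OF q(1)] by (simp add: set_lebesgue_integral_def)
    ultimately show ?thesis by (simp add: set_lebesgue_integral_def LIMSEQ_const_iff)
  qed
  have si: "set_integrable lborel A F" if "A \<in> sets borel" for A
    using that F unfolding set_integrable_def by (intro integrable_mult_indicator) auto
  have whole: "(LINT t|lborel. F t) = 0"
  proof -
    obtain b where b: "\<And>t. t \<in> T \<Longrightarrow> t \<le> b" using compact_imp_bounded[OF compact_T] by (metis bounded_real abs_le_D1)
    have "(LINT t|lborel. F t) = (LINT t:{..b}|lborel. F t)"
      unfolding set_lebesgue_integral_def using b by (intro Bochner_Integration.integral_cong refl) (auto simp: F_def indicator_def)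
    then show ?thesis using atMost by simp
  qed
  have all: "(LINT t:A|lborel. F t) = 0" if "A \<in> sets borel" for A
  proof -
    have "A \<in> sigma_sets UNIV (range (\<lambda>a::real. {..a}))"
      using that borel_eq_atMost[where 'a = real] by (metis sets_measure_of top_greatest Pow_UNIV)
    moreover have "Int_stable (range (\<lambda>a::real. {..a}))" by (auto simp: Int_stable_def)
    ultimately have facts: "Int_stable (range (\<lambda>a::real. {..a}))" "range (\<lambda>a::real. {..a}) \<subseteq> Pow UNIV"
      "A \<in> sigma_sets UNIV (range (\<lambda>a::real. {..a}))" by auto
    from facts show ?thesis
    proof (induction rule: sigma_sets_induct_disjoint)
      case (basic A) then show ?case using atMost by auto
    next
      case empty show ?case by (simp add: set_lebesgue_integral_def)
    next
      case (compl A)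
      have A: "A \<in> sets borel" using compl(1) borel_eq_atMost[where 'a = real] by (metis sets_measure_of top_greatest Pow_UNIV)
      have "(LINT t:(UNIV - A)|lborel. F t) = (LINT t|lborel. F t - indicator A t *\<^sub>R F t)"
        unfolding set_lebesgue_integral_def
        by (intro Bochner_Integration.integral_cong refl) (auto simp: indicator_def)
      also have "\<dots> = (LINT t|lborel. F t) - (LINT t:A|lborel. F t)"
        unfolding set_lebesgue_integral_def
        by (rule Bochner_Integration.integral_diff[OF F si[OF A, unfolded set_integrable_def]])
      finally show ?case using compl whole by simp
    next
      case (union A)
      have A: "A i \<in> sets borel" for i using union(2) borel_eq_atMost[where 'a = real] by (metis sets_measure_of top_greatest Pow_UNIV range_subsetD)
      have "(LINT t:(\<Union>i. A i)|lborel. F t) = (\<Sum>i. (LINT t:(A i)|lborel. F t))"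
        using union(1) A by (intro lebesgue_integral_countable_add si) (auto simp: disjoint_family_on_def)
      then show ?case using union by simp
    qed
  qed
  have "AE t in lborel. F t = 0"
    by (rule density_unique_real[OF F, of "\<lambda>_. 0"]) (use all in auto)
  then have "AE t in lborel. t \<in> T \<longrightarrow> f t = 0" by eventually_elim (auto simp: F_def)
  then have "AE t in leb T. f t = 0" by (subst AE_restrict_space_iff) auto
  then show "l2_inner T f f = 0" using l2_norm_0_iff[OF f] by simp
qed

lemma ex_orthonormal_total: "\<exists>u::nat \<Rightarrow> real \<Rightarrow> real. l2.orthonormal u \<and> l2.total u"
  using l2.gs_orthonormal_total[OF half_line_in total_half_line] by blast

lemma l2_open_Pow: "{U. l2_open T U} \<subseteq> Pow (l2_space T)" by (auto simp: l2_open_def)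

lemma space_l2_borel [simp]: "space (l2_borel T) = l2_space T"
  unfolding l2_borel_def by (rule space_measure_of[OF l2_open_Pow])

lemma l2_open_borel: "l2_open T U \<Longrightarrow> U \<in> sets (l2_borel T)"
  unfolding l2_borel_def sets_measure_of[OF l2_open_Pow] by (rule sigma_sets.Basic) simp

lemma l2_lipschitz_measurable:
  assumes L: "\<And>f g. f \<in> l2_space T \<Longrightarrow> g \<in> l2_space T \<Longrightarrow> \<bar>\<phi> g - \<phi> f\<bar> \<le> C * l2_norm T (\<lambda>t. g t - f t)"
  shows "(\<phi> :: _ \<Rightarrow> real) \<in> borel_measurable (l2_borel T)"
proof (rule borel_measurableI)
  fix S :: "real set" assume S: "open S"
  have "l2_open T (\<phi> -` S \<inter> l2_space T)"
    unfolding l2_open_def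
  proof (intro conjI ballI)
    fix f assume f: "f \<in> \<phi> -` S \<inter> l2_space T"
    then obtain e where e: "0 < e" "\<And>y. \<bar>y - \<phi> f\<bar> < e \<Longrightarrow> y \<in> S"
      using S unfolding open_dist by (auto simp: dist_real_def)
    show "\<exists>d>0. \<forall>g\<in>l2_space T. l2_norm T (\<lambda>t. g t - f t) < d \<longrightarrow> g \<in> \<phi> -` S \<inter> l2_space T"
    proof (intro exI[of _ "e / (\<bar>C\<bar> + 1)"] conjI ballI impI)
      show "0 < e / (\<bar>C\<bar> + 1)" using e by simp
      fix g assume g: "g \<in> l2_space T" and less: "l2_norm T (\<lambda>t. g t - f t) < e / (\<bar>C\<bar> + 1)"
      have n: "0 \<le> l2_norm T (\<lambda>t. g t - f t)" using l2.N_nonneg[OF l2.diff_in, of g f] f g by (simp add: N_eq_l2_norm)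
      have "\<bar>\<phi> g - \<phi> f\<bar> \<le> C * l2_norm T (\<lambda>t. g t - f t)" using L f g by simp
      also have "\<dots> \<le> (\<bar>C\<bar> + 1) * l2_norm T (\<lambda>t. g t - f t)" using n by (intro mult_right_mono) auto
      also have "\<dots> < e" using less by (simp add: pos_less_divide_eq mult.commute)
      finally show "g \<in> \<phi> -` S \<inter> l2_space T" using e(2) g by simp
    qed
  qed auto
  then show "\<phi> -` S \<inter> space (l2_borel T) \<in> sets (l2_borel T)" by (simp add: l2_open_borel)
qed

lemma l2_inner_measurable: "w \<in> l2_space T \<Longrightarrow> (\<lambda>y. l2_inner T y w) \<in> borel_measurable (l2_borel T)"
proof (rule l2_lipschitz_measurable[where C = "l2_norm T w"])
  fix f g assume w: "w \<in> l2_space T" and fg: "f \<in> l2_space T" "g \<in> l2_space T"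
  have "l2_inner T g w - l2_inner T f w = l2_inner T (\<lambda>t. g t - f t) w"
    using l2.functional_diff[OF l2_inner_lin[OF w] fg(2,1)] by simp
  then show "\<bar>l2_inner T g w - l2_inner T f w\<bar> \<le> l2_norm T w * l2_norm T (\<lambda>t. g t - f t)"
    using l2.cauchy_schwarz[OF l2.diff_in[OF fg(2,1)] w] by (simp add: N_eq_l2_norm mult.commute)
qed

lemma l2_norm_measurable: "l2_norm T \<in> borel_measurable (l2_borel T)"
proof (rule l2_lipschitz_measurable[where C = 1])
  fix f g assume fg: "f \<in> l2_space T" "g \<in> l2_space T"
  have "l2_norm T (\<lambda>t. f t - g t) = l2_norm T (\<lambda>t. g t - f t)"
    by (simp add: l2_norm_def l2_inner_def power2_eq_square[symmetric] power2_commute)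
  then show "\<bar>l2_norm T g - l2_norm T f\<bar> \<le> 1 * l2_norm T (\<lambda>t. g t - f t)"
    using l2.N_triangle_diff[OF fg l2.zero] l2.N_triangle_diff[OF fg(2,1) l2.zero] by (simp add: N_eq_l2_norm)
qed

end

section \<open>The covariance form and its regularisation\<close>

lemma ennreal_sum_le: "ennreal (\<Sum>k\<in>K. f k) \<le> (\<Sum>k\<in>K. ennreal (f k))"
proof -
  have "ennreal (\<Sum>k\<in>K. f k) \<le> ennreal (\<Sum>k\<in>K. max 0 (f k))" by (intro ennreal_leI sum_mono) auto
  also have "\<dots> = (\<Sum>k\<in>K. ennreal (max 0 (f k)))" by (intro sum_ennreal[symmetric]) auto
  also have "\<dots> = (\<Sum>k\<in>K. ennreal (f k))" by (intro sum.cong) (auto simp: max_def ennreal_neg)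
  finally show ?thesis .
qed

context compact_domain begin

lemma basis_exists: "\<exists>B. l2_orthonormal_basis T B"
proof -
  obtain u :: "nat \<Rightarrow> real \<Rightarrow> real" where u: "l2.orthonormal u" "l2.total u" using ex_orthonormal_total by blast
  have un: "l2_inner T (u k) (u k) = 0 \<or> l2_inner T (u k) (u k) = 1" for k using u by (auto simp: l2.orthonormal_def)
  have uV: "u k \<in> l2_space T" for k using l2.orthonormal_in[OF u(1)] .
  let ?B = "{u k |k. l2_inner T (u k) (u k) = 1}"
  have compl: "l2_eq T f (\<lambda>_. 0)" if f: "f \<in> l2_space T" and orth: "\<forall>e\<in>?B. l2_inner T f e = 0" for f
  proof -
    have "l2_inner T f (u k) = 0" for k
      using un[of k] orth l2.cauchy_schwarz[OF f uV, of k] by (auto simp: l2.N_def)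
    then have "l2_inner T f f = 0" using u(2) f by (auto simp: l2.total_def)
    then show ?thesis using l2_norm_0_iff[OF f] by (simp add: l2_eq_def)
  qed
  have ortho: "l2_inner T e h = (if e = h then 1 else 0)" if "e \<in> ?B" "h \<in> ?B" for e h
  proof -
    obtain j k where jk: "e = u j" "h = u k" "l2_inner T (u j) (u j) = 1" using \<open>e \<in> ?B\<close> \<open>h \<in> ?B\<close> by auto
    show ?thesis
    proof (cases "e = h")
      case False
      then have "j \<noteq> k" using jk by auto
      then show ?thesis using False jk u(1) by (simp add: l2.orthonormal_def)
    qed (use jk in simp)
  qed
  have "l2_orthonormal_basis T ?B"
    unfolding l2_orthonormal_basis_def
  proof (intro conjI ballI impI)
    show "?B \<subseteq> l2_space T" using uV by blast
  qed (fact ortho, fact compl)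
  then show ?thesis by blast
qed

text \<open>
  By Bessel's inequality, only finitely many basis elements have a coefficient above a given threshold at a given member
  of a total sequence, and each basis element has some nonzero coefficient.
\<close>

lemma basis_countable:
  assumes B: "l2_orthonormal_basis T B" shows "countable B"
proof -
  obtain u :: "nat \<Rightarrow> real \<Rightarrow> real" where u: "l2.orthonormal u" "l2.total u" using ex_orthonormal_total by blast
  have uV: "u k \<in> l2_space T" for k using l2.orthonormal_in[OF u(1)] .
  have BV: "e \<in> l2_space T" if "e \<in> B" for e using B that by (auto simp: l2_orthonormal_basis_def)
  define g where "g e = (if e \<in> B then e else (\<lambda>_. 0))" for e
  have g: "l2.orthonormal g"
    using B l2.zero l2.functional_0[OF l2_inner_lin] l2.sym[OF l2.zero]
    by (auto simp: l2.orthonormal_def g_def l2_orthonormal_basis_def l2_inner_def split: if_splits)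
  define A where "A k m = {e\<in>B. 1 / real (Suc m) < (l2_inner T e (u k))\<^sup>2}" for k m :: nat
  have "finite (A k m)" for k m
  proof (rule ccontr)
    assume inf: "infinite (A k m)"
    let ?C = "(l2.N (u k))\<^sup>2"
    obtain c :: nat where c: "?C * real (Suc m) < real c" using reals_Archimedean2 by blast
    obtain K where K: "K \<subseteq> A k m" "finite K" "card K = c" using infinite_arbitrarily_large[OF inf] by blast
    have "real c * (1 / real (Suc m)) = (\<Sum>e\<in>K. 1 / real (Suc m))" using K by simp
    also have "\<dots> \<le> (\<Sum>e\<in>K. (l2_inner T (g e) (u k))\<^sup>2)"
      using K by (intro sum_mono) (auto simp: A_def g_def less_imp_le)
    also have "\<dots> \<le> ?C" by (rule l2.bessel[OF g K(2) l2.bounded_functional_B[OF uV]])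
    finally show False using c by (simp add: divide_simps)
  qed
  then have "countable (\<Union>k. \<Union>m. A k m)" by (intro countable_UN countableI_type countable_finite)
  moreover have "B \<subseteq> (\<Union>k. \<Union>m. A k m)"
  proof
    fix e assume e: "e \<in> B"
    have "\<exists>k. l2_inner T e (u k) \<noteq> 0"
    proof (rule ccontr)
      assume "\<not> ?thesis"
      then have "l2_inner T e e = 0" using u(2) BV[OF e] by (auto simp: l2.total_def)
      then show False using B e by (auto simp: l2_orthonormal_basis_def)
    qed
    then obtain k where "0 < (l2_inner T e (u k))\<^sup>2" by auto
    then obtain m where "inverse (real (Suc m)) < (l2_inner T e (u k))\<^sup>2" using reals_Archimedean by blast
    then show "e \<in> (\<Union>k. \<Union>m. A k m)" using e by (auto simp: A_def inverse_eq_divide)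
  qed
  ultimately show ?thesis by (rule countable_subset[rotated])
qed

text \<open>
  The trace is an unordered sum over an unspecified basis, whereas expansions are limits of partial sums.  The
  sequence \<open>e\<close> enumerates the basis, padded with zero vectors, and \<open>F n\<close> are the basis elements among the first \<open>n\<close>
  terms.
\<close>

lemma basis_sequence:
  assumes B: "l2_orthonormal_basis T B"
  obtains e :: "nat \<Rightarrow> real \<Rightarrow> real" and F :: "nat \<Rightarrow> (real \<Rightarrow> real) set"
  where "l2.orthonormal e" "l2.total e" "\<And>n. finite (F n)" "\<And>n. F n \<subseteq> B"
    "\<And>n \<phi>. \<phi> (\<lambda>_. 0) = (0::real) \<Longrightarrow> (\<Sum>k<n. \<phi> (e k)) = (\<Sum>b\<in>F n. \<phi> b)"
proof -
  have cB: "countable B" by (rule basis_countable[OF B])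
  let ?i = "to_nat_on B"
  define e where "e k = (if k \<in> ?i ` B then from_nat_into B k else (\<lambda>_. 0))" for k
  have inj: "inj_on ?i B" using cB by (rule inj_on_to_nat_on)
  have ei: "e (?i b) = b" if "b \<in> B" for b using that cB by (simp add: e_def)
  define F where "F n = {b\<in>B. ?i b < n}" for n
  have eB: "e k = (\<lambda>_. 0) \<or> (e k \<in> B \<and> ?i (e k) = k)" for k
    using cB by (auto simp: e_def)
  have fin: "finite (F n)" for n
    by (rule finite_imageD[of ?i]) (auto simp: F_def intro: finite_subset[of _ "{..<n}"] inj_on_subset[OF inj])
  have Bo: "l2_inner T b c = (if b = c then 1 else 0)" if "b \<in> B" "c \<in> B" for b c
    using B that by (auto simp: l2_orthonormal_basis_def)
  have z: "l2_inner T (\<lambda>_. 0) c = 0" "l2_inner T c (\<lambda>_. 0) = 0" for c by (simp_all add: l2_inner_def)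
  have o: "l2.orthonormal e"
    unfolding l2.orthonormal_def
  proof (intro conjI allI impI)
    fix k show "e k \<in> l2_space T" using eB[of k] l2.zero B by (auto simp: l2_orthonormal_basis_def)
    show "l2_inner T (e k) (e k) \<in> {0, 1}" using eB[of k] Bo z by auto
  next
    fix j k :: nat assume "j \<noteq> k"
    then show "l2_inner T (e j) (e k) = 0" using eB[of j] eB[of k] Bo[of "e j" "e k"] z by metis
  qed
  have t: "l2.total e"
    unfolding l2.total_def
  proof (intro ballI impI)
    fix f assume f: "f \<in> l2_space T" "\<forall>k. l2_inner T f (e k) = 0"
    have "l2_inner T f b = 0" if "b \<in> B" for b using f(2) ei[OF that] by metis
    then have "l2_eq T f (\<lambda>_. 0)" using B f(1) by (auto simp: l2_orthonormal_basis_def)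
    then show "l2_inner T f f = 0" using l2_norm_0_iff[OF f(1)] by (simp add: l2_eq_def)
  qed
  have s: "(\<Sum>k<n. \<phi> (e k)) = (\<Sum>b\<in>F n. \<phi> b)" if "\<phi> (\<lambda>_. 0) = (0::real)" for n \<phi>
  proof -
    have "(\<Sum>b\<in>F n. \<phi> b) = (\<Sum>b\<in>F n. \<phi> (e (?i b)))" by (intro sum.cong) (auto simp: ei F_def)
    also have "\<dots> = (\<Sum>k\<in>?i ` F n. \<phi> (e k))"
      by (rule sum.reindex[symmetric, unfolded comp_def]) (auto simp: F_def intro: inj_on_subset[OF inj])
    also have "\<dots> = (\<Sum>k<n. \<phi> (e k))"
    proof (rule sum.mono_neutral_left)
      show "\<forall>k\<in>{..<n} - ?i ` F n. \<phi> (e k) = 0"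
      proof
        fix k assume "k \<in> {..<n} - ?i ` F n"
        then have "k \<notin> ?i ` B" by (auto simp: F_def)
        then show "\<phi> (e k) = 0" using that by (simp add: e_def)
      qed
    qed (auto simp: F_def)
    finally show ?thesis by simp
  qed
  show thesis by (rule that[OF o t fin _ s]) (auto simp: F_def)
qed

end

text \<open>
  In the application \<open>S\<close> is the square root of the kernel operator; \<open>Y\<close> is the random curve.
\<close>

locale covariance_form = compact_domain T + prob_space M
  for T :: "real set" and M :: "'w measure" +
  fixes S :: l2_op and Y :: "'w \<Rightarrow> real \<Rightarrow> real" and M2 :: real
  assumes S: "l2_nonneg_operator T S" and Ym [measurable]: "Y \<in> measurable M (l2_borel T)"
    and Yj: "(\<lambda>(w, t). Y w t) \<in> borel_measurable (M \<Otimes>\<^sub>M leb T)"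
    and Yb: "AE w in M. l2_norm T (Y w) \<le> M2" and M2: "0 \<le> M2"
begin

definition \<kappa> :: real where "\<kappa> = l2_opnorm T S"
definition m :: real where "m = \<kappa> * M2"

lemma Y_in: "w \<in> space M \<Longrightarrow> Y w \<in> l2_space T"
  using measurable_space[OF Ym] by simp

lemma S_in: "f \<in> l2_space T \<Longrightarrow> S f \<in> l2_space T"
  using S by (auto simp: l2_nonneg_operator_def l2_bounded_operator_def)

lemma S_lin: "f \<in> l2_space T \<Longrightarrow> g \<in> l2_space T \<Longrightarrow> l2_eq T (S (\<lambda>t. a * f t + b * g t)) (\<lambda>t. a * S f t + b * S g t)"
  using S by (auto simp: l2_nonneg_operator_def l2_bounded_operator_def)

lemma S_sym: "f \<in> l2_space T \<Longrightarrow> g \<in> l2_space T \<Longrightarrow> l2_inner T (S f) g = l2_inner T f (S g)"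
  using S by (auto simp: l2_nonneg_operator_def)

lemma S_functional: "y \<in> l2_space T \<Longrightarrow> lin_functional (l2_space T) (\<lambda>f. l2_inner T y (S f))"
  unfolding lin_functional_def
proof (intro ballI allI)
  fix f g a b assume y: "y \<in> l2_space T" and fg: "f \<in> l2_space T" "g \<in> l2_space T"
  have "l2_inner T (S (\<lambda>t. a * f t + b * g t)) y = l2_inner T (\<lambda>t. a * S f t + b * S g t) y"
    using fg y by (intro l2_inner_cong S_lin S_in l2_lin)
  also have "\<dots> = a * l2_inner T (S f) y + b * l2_inner T (S g) y" using fg y by (intro l2.B_linL S_in)
  finally show "l2_inner T y (S (\<lambda>t. a * f t + b * g t)) = a * l2_inner T y (S f) + b * l2_inner T y (S g)"
    using l2.sym[OF y] S_in l2_lin fg by simp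
qed

lemma S_bound_ex: obtains b where "\<And>f. f \<in> l2_space T \<Longrightarrow> l2_norm T (S f) \<le> b * l2_norm T f"
proof -
  have "\<exists>b. \<forall>f\<in>l2_space T. l2_norm T (S f) \<le> b * l2_norm T f"
    using S unfolding l2_nonneg_operator_def l2_bounded_operator_def by blast
  then show thesis using that by blast
qed

lemma S_bdd: "bdd_above ((\<lambda>f. l2_norm T (S f)) ` {f \<in> l2_space T. l2_norm T f \<le> 1})"
proof -
  obtain b where b: "\<And>f. f \<in> l2_space T \<Longrightarrow> l2_norm T (S f) \<le> b * l2_norm T f"
    using S_bound_ex by blast
  have "l2_norm T (S f) \<le> \<bar>b\<bar>" if f: "f \<in> l2_space T" "l2_norm T f \<le> 1" for f
  proof -
    have "b * l2_norm T f \<le> \<bar>b\<bar> * 1" using f l2.N_nonneg[OF f(1)] by (intro mult_mono) (auto simp: N_eq_l2_norm)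
    then show ?thesis using b[OF f(1)] by simp
  qed
  then show ?thesis by (intro bdd_aboveI[of _ "\<bar>b\<bar>"]) auto
qed

lemma \<kappa>_nonneg: "0 \<le> \<kappa>"
proof -
  have "l2_norm T (S (\<lambda>_. 0)) \<le> \<kappa>"
    unfolding \<kappa>_def l2_opnorm_def by (rule cSUP_upper[OF _ S_bdd]) (use l2.zero in \<open>auto simp: l2_norm_def l2_inner_def\<close>)
  then show ?thesis using l2.N_nonneg[OF S_in[OF l2.zero]] by (simp add: N_eq_l2_norm)
qed

lemma S_norm: assumes f: "f \<in> l2_space T" shows "l2_norm T (S f) \<le> \<kappa> * l2_norm T f"
proof (cases "l2_norm T f = 0")
  case True
  obtain b where b: "\<And>f. f \<in> l2_space T \<Longrightarrow> l2_norm T (S f) \<le> b * l2_norm T f"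
    using S_bound_ex by blast
  show ?thesis using b[OF f] True by simp
next
  case False
  define r where "r = l2_norm T f"
  have r: "0 < r" using False l2.N_nonneg[OF f] by (simp add: N_eq_l2_norm r_def)
  define h where "h = (\<lambda>t. 1 / r * f t)"
  have h: "h \<in> l2_space T" unfolding h_def by (rule l2.scale_in[OF f])
  have scale: "l2_norm T (\<lambda>t. c * g t) = \<bar>c\<bar> * l2_norm T g" for c g
  proof -
    have "l2_inner T (\<lambda>t. c * g t) (\<lambda>t. c * g t) = (LINT t|leb T. c\<^sup>2 * (g t * g t))"
      unfolding l2_inner_def by (intro Bochner_Integration.integral_cong refl) (simp add: power2_eq_square)
    also have "\<dots> = c\<^sup>2 * l2_inner T g g" by (simp add: l2_inner_def)
    finally show ?thesis by (simp add: l2_norm_def real_sqrt_mult)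
  qed
  have h1: "l2_norm T h = 1" unfolding h_def scale using r by (simp add: r_def)
  have "l2_norm T (S h) \<le> \<kappa>"
    unfolding \<kappa>_def l2_opnorm_def by (rule cSUP_upper[OF _ S_bdd]) (use h h1 in auto)
  moreover have "l2_norm T (S f) = r * l2_norm T (S h)"
  proof -
    have e: "f = (\<lambda>t. r * h t + 0 * h t)" using r by (simp add: h_def)
    have "l2_eq T (S f) (\<lambda>t. r * S h t + 0 * S h t)" by (subst e, rule S_lin[OF h h])
    then have "l2_eq T (S f) (\<lambda>t. r * S h t)" by simp
    then have "l2_inner T (S f) (S f) = l2_inner T (\<lambda>t. r * S h t) (\<lambda>t. r * S h t)"
      unfolding l2_inner_def l2_eq_def using l2_measurable[OF S_in[OF f]] l2_measurable[OF S_in[OF h]]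
      by (intro integral_cong_AE) auto
    then have "l2_norm T (S f) = l2_norm T (\<lambda>t. r * S h t)" by (simp add: l2_norm_def)
    then show ?thesis using scale[of r "S h"] r by simp
  qed
  ultimately show ?thesis using r by (simp add: r_def mult.commute)
qed

text \<open>
  The linear predictor with slope \<open>S f\<close>.
\<close>

definition L :: "'w \<Rightarrow> (real \<Rightarrow> real) \<Rightarrow> real" where "L w f = l2_inner T (Y w) (S f)"

lemma inner_S_bound: "y \<in> l2_space T \<Longrightarrow> f \<in> l2_space T \<Longrightarrow> \<bar>l2_inner T y (S f)\<bar> \<le> l2_norm T y * \<kappa> * l2_norm T f"
  using l2.cauchy_schwarz[of y "S f"] S_in S_norm mult_left_mono[OF S_norm l2.N_nonneg, of f y]
  by (fastforce simp: N_eq_l2_norm mult.assoc)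

lemma inner_S_bounded_functional: "y \<in> l2_space T \<Longrightarrow> l2.bounded_functional (\<lambda>f. l2_inner T y (S f)) (l2_norm T y * \<kappa>)"
  unfolding l2.bounded_functional_def using S_functional inner_S_bound \<kappa>_nonneg l2.N_nonneg[of y] by (auto simp: N_eq_l2_norm)

lemma L_measurable [measurable]: "f \<in> l2_space T \<Longrightarrow> (\<lambda>w. L w f) \<in> borel_measurable M"
  unfolding L_def by (rule measurable_compose[OF Ym l2_inner_measurable[OF S_in]])

lemma L_functional: "w \<in> space M \<Longrightarrow> lin_functional (l2_space T) (L w)"
  unfolding L_def[abs_def] using S_functional[OF Y_in] .

lemma m_nonneg: "0 \<le> m" using \<kappa>_nonneg M2 by (simp add: m_def)

lemma L_bound:
  assumes "w \<in> space M" "l2_norm T (Y w) \<le> M2" shows "l2.bounded_functional (L w) m"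
proof -
  have "l2_norm T (Y w) * \<kappa> \<le> m" using mult_right_mono[OF assms(2) \<kappa>_nonneg] by (simp add: m_def mult.commute)
  then have "l2_norm T (Y w) * \<kappa> * l2_norm T f \<le> m * l2_norm T f" if "f \<in> l2_space T" for f
    using l2.N_nonneg[OF that] by (intro mult_right_mono) (auto simp: N_eq_l2_norm)
  then show ?thesis
    unfolding l2.bounded_functional_def using L_functional[OF assms(1)] m_nonneg inner_S_bound[OF Y_in[OF assms(1)]]
    by (fastforce simp: L_def N_eq_l2_norm)
qed

lemma L_AE: "AE w in M. w \<in> space M \<and> l2.bounded_functional (L w) m"
  using AE_space Yb by eventually_elim (auto intro: L_bound)

lemma L_AE_bound: "f \<in> l2_space T \<Longrightarrow> AE w in M. \<bar>L w f\<bar> \<le> m * l2_norm T f"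
  using L_AE by eventually_elim (auto dest: l2.bounded_functionalD(3) simp: N_eq_l2_norm)

lemma L_mult_AE_bound:
  assumes "f \<in> l2_space T" "g \<in> l2_space T" shows "AE w in M. \<bar>L w f * L w g\<bar> \<le> m\<^sup>2 * l2_norm T f * l2_norm T g"
  using L_AE_bound[OF assms(1)] L_AE_bound[OF assms(2)]
proof eventually_elim
  case (elim w)
  have "\<bar>L w f\<bar> * \<bar>L w g\<bar> \<le> (m * l2_norm T f) * (m * l2_norm T g)"
    using elim m_nonneg l2.N_nonneg[OF assms(1)] by (intro mult_mono) (auto simp: N_eq_l2_norm)
  then show ?case by (simp add: abs_mult power2_eq_square mult_ac)
qed

text \<open>
  The quadratic form of the operator \<open>S \<circ> C \<circ> S\<close>, where \<open>C\<close> is the covariance operator of \<open>Y\<close>.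
\<close>

definition t :: "(real \<Rightarrow> real) \<Rightarrow> (real \<Rightarrow> real) \<Rightarrow> real" where "t f g = (LINT w|M. L w f * L w g)"

lemma L_mult_integrable: "f \<in> l2_space T \<Longrightarrow> g \<in> l2_space T \<Longrightarrow> integrable M (\<lambda>w. L w f * L w g)"
  by (rule integrable_const_bound[where B = "m\<^sup>2 * l2_norm T f * l2_norm T g"]) (use L_mult_AE_bound in auto)

lemma t_functional: "g \<in> l2_space T \<Longrightarrow> lin_functional (l2_space T) (\<lambda>f. t f g)"
  unfolding lin_functional_def
proof (intro ballI allI)
  fix f h a b assume g: "g \<in> l2_space T" and fh: "f \<in> l2_space T" "h \<in> l2_space T"
  have "t (\<lambda>x. a * f x + b * h x) g = (LINT w|M. a * (L w f * L w g) + b * (L w h * L w g))"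
    unfolding t_def
  proof (intro Bochner_Integration.integral_cong refl)
    fix w assume w: "w \<in> space M"
    show "L w (\<lambda>x. a * f x + b * h x) * L w g = a * (L w f * L w g) + b * (L w h * L w g)"
      unfolding lin_functionalD[OF L_functional[OF w] fh] by (simp add: algebra_simps)
  qed
  then show "t (\<lambda>x. a * f x + b * h x) g = a * t f g + b * t h g"
    using L_mult_integrable g fh by (simp add: t_def)
qed

lemma t_sym: "t f g = t g f" by (simp add: t_def mult.commute)
lemma t_nonneg: "0 \<le> t f f" unfolding t_def by (rule integral_nonneg_AE) simp

lemma t_bound: assumes "f \<in> l2_space T" "g \<in> l2_space T" shows "\<bar>t f g\<bar> \<le> m\<^sup>2 * l2_norm T f * l2_norm T g"
proof -
  have "\<bar>t f g\<bar> \<le> (LINT w|M. \<bar>L w f * L w g\<bar>)" unfolding t_def by (rule integral_abs_bound)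
  also have "\<dots> \<le> (LINT w|M. m\<^sup>2 * l2_norm T f * l2_norm T g)"
    using L_mult_integrable[OF assms] L_mult_AE_bound[OF assms] by (intro integral_mono_AE) auto
  finally show ?thesis by (simp add: prob_space)
qed

text \<open>
  The form of \<open>S \<circ> C \<circ> S + l\<close>; its norm \<open>Nl\<close> measures the error of the penalised estimator.
\<close>

definition Bl :: "real \<Rightarrow> (real \<Rightarrow> real) \<Rightarrow> (real \<Rightarrow> real) \<Rightarrow> real" where
  "Bl l f g = l * l2_inner T f g + t f g"

definition Nl :: "real \<Rightarrow> (real \<Rightarrow> real) \<Rightarrow> real" where "Nl l f = sqrt (Bl l f f)"

lemma Bl_form:
  assumes l: "0 < l" shows "fun_form (l2_space T) (Bl l)"
proof
  fix f g a b assume fg: "f \<in> l2_space T" "g \<in> l2_space T"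
  show "(\<lambda>x. a * f x + b * g x) \<in> l2_space T" using fg by (rule l2_lin)
  show "Bl l f g = Bl l g f" using l2.sym[OF fg] t_sym[of f g] by (simp add: Bl_def)
next
  show "(\<lambda>_. 0) \<in> l2_space T" by (rule l2.zero)
next
  fix h assume h: "h \<in> l2_space T"
  show "lin_functional (l2_space T) (\<lambda>f. Bl l f h)"
    using lin_functionalD[OF l2_inner_lin[OF h]] lin_functionalD[OF t_functional[OF h]]
    by (simp add: lin_functional_def Bl_def algebra_simps)
next
  fix f assume "f \<in> l2_space T"
  then show "0 \<le> Bl l f f" using l2.nonneg[of f] t_nonneg[of f] l by (simp add: Bl_def)
qed

lemma Nl_eq: "0 < l \<Longrightarrow> fun_form.N (Bl l) = Nl l"
  using fun_form.N_def[OF Bl_form] by (simp add: Nl_def fun_eq_iff)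

lemma l2_norm_le_Nl: assumes l: "0 < l" and f: "f \<in> l2_space T" shows "sqrt l * l2_norm T f \<le> Nl l f"
  unfolding Nl_def l2_norm_def real_sqrt_mult[symmetric] Bl_def using t_nonneg by (intro real_sqrt_le_mono) simp

lemma Nl_le_l2_norm: assumes l: "0 < l" and f: "f \<in> l2_space T" shows "Nl l f \<le> sqrt (l + m\<^sup>2) * l2_norm T f"
proof -
  have "t f f \<le> m\<^sup>2 * l2_inner T f f"
    using t_bound[OF f f] l2.N_sq[OF f] by (simp add: N_eq_l2_norm power2_eq_square mult.assoc abs_le_iff)
  then have "Bl l f f \<le> (l + m\<^sup>2) * l2_inner T f f" by (simp add: Bl_def algebra_simps)
  then show ?thesis unfolding Nl_def l2_norm_def real_sqrt_mult[symmetric] by (rule real_sqrt_le_mono)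
qed

text \<open>
  The norms \<open>Nl l\<close> and \<open>l2_norm T\<close> are equivalent, since \<open>t\<close> is bounded.
\<close>

lemma Bl_complete:
  assumes l: "0 < l" shows "complete_fun_form (l2_space T) (Bl l)"
proof -
  interpret B: fun_form "l2_space T" "Bl l" by (rule Bl_form[OF l])
  show ?thesis
  proof
    fix s :: "nat \<Rightarrow> real \<Rightarrow> real"
    assume s: "\<And>n. s n \<in> l2_space T" and c: "\<And>e. 0 < e \<Longrightarrow> \<exists>n0. \<forall>m\<ge>n0. \<forall>n\<ge>n0. B.N (\<lambda>x. s m x - s n x) < e"
    have "\<exists>f\<in>l2_space T. (\<lambda>n. l2.N (\<lambda>x. s n x - f x)) \<longlonglongrightarrow> 0"
    proof (rule l2_complete[OF s])
      fix e :: real assume e: "0 < e"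
      then obtain n0 where n0: "\<And>i j. n0 \<le> i \<Longrightarrow> n0 \<le> j \<Longrightarrow> B.N (\<lambda>x. s i x - s j x) < sqrt l * e"
        using c[of "sqrt l * e"] l by auto
      have "l2.N (\<lambda>x. s i x - s j x) < e" if "n0 \<le> i" "n0 \<le> j" for i j
      proof -
        have "sqrt l * l2.N (\<lambda>x. s i x - s j x) < sqrt l * e"
          using l2_norm_le_Nl[OF l l2.diff_in[OF s s], of i j] n0[OF that] by (simp add: N_eq_l2_norm Nl_eq[OF l])
        then show ?thesis using l by simp
      qed
      then show "\<exists>n0. \<forall>m\<ge>n0. \<forall>n\<ge>n0. l2.N (\<lambda>x. s m x - s n x) < e" by blast
    qed
    then obtain f where f: "f \<in> l2_space T" and lim: "(\<lambda>n. l2.N (\<lambda>x. s n x - f x)) \<longlonglongrightarrow> 0" by blast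
    have "(\<lambda>n. sqrt (l + m\<^sup>2) * l2.N (\<lambda>x. s n x - f x)) \<longlonglongrightarrow> 0" by (rule tendsto_mult_right_zero[OF lim])
    then have "(\<lambda>n. B.N (\<lambda>x. s n x - f x)) \<longlonglongrightarrow> 0"
      by (rule Lim_null_comparison[rotated])
         (use Nl_le_l2_norm[OF l l2.diff_in[OF s f]] B.N_nonneg[OF l2.diff_in[OF s f]] in \<open>auto simp: Nl_eq[OF l] N_eq_l2_norm\<close>)
    then show "\<exists>f\<in>l2_space T. (\<lambda>n. B.N (\<lambda>x. s n x - f x)) \<longlonglongrightarrow> 0" using f by blast
  qed
qed

text \<open>
  A sequence that is total for the inner product is total for \<open>Bl l\<close>, as expanding \<open>f\<close> in it shows; the Gram--Schmidt
  process for \<open>Bl l\<close> can therefore start from it.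
\<close>

lemma Bl_ex_basis:
  assumes l: "0 < l"
  shows "\<exists>g::nat \<Rightarrow> real \<Rightarrow> real. fun_form.orthonormal (l2_space T) (Bl l) g \<and> fun_form.total (l2_space T) (Bl l) g"
proof -
  interpret B: complete_fun_form "l2_space T" "Bl l" by (rule Bl_complete[OF l])
  obtain e :: "nat \<Rightarrow> real \<Rightarrow> real" where e: "l2.orthonormal e" "l2.total e" using ex_orthonormal_total by blast
  have eV: "e k \<in> l2_space T" for k using l2.orthonormal_in[OF e(1)] .
  have "B.total e"
    unfolding B.total_def
  proof (intro ballI impI)
    fix f assume f: "f \<in> l2_space T" and 0: "\<forall>k. Bl l f (e k) = 0"
    have bd: "l2.bounded_functional (\<lambda>h. Bl l h f) (sqrt (l + m\<^sup>2) * B.N f)"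
      unfolding l2.bounded_functional_def
    proof (intro conjI ballI)
      show "lin_functional (l2_space T) (\<lambda>h. Bl l h f)" by (rule B.B_lin[OF f])
      show "0 \<le> sqrt (l + m\<^sup>2) * B.N f" using B.N_nonneg[OF f] l by simp
      fix h assume h: "h \<in> l2_space T"
      have "\<bar>Bl l h f\<bar> \<le> B.N h * B.N f" by (rule B.cauchy_schwarz[OF h f])
      also have "\<dots> \<le> (sqrt (l + m\<^sup>2) * l2.N h) * B.N f"
        using Nl_le_l2_norm[OF l h] B.N_nonneg[OF f] by (intro mult_right_mono) (auto simp: Nl_eq[OF l] N_eq_l2_norm)
      finally show "\<bar>Bl l h f\<bar> \<le> sqrt (l + m\<^sup>2) * B.N f * l2.N h" by (simp add: mult_ac)
    qed
    have "(\<lambda>n. \<Sum>k<n. l2_inner T f (e k) * Bl l (e k) f) \<longlonglongrightarrow> Bl l f f"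
      by (rule l2.functional_expansion[OF e f bd])
    moreover have "Bl l (e k) f = 0" for k using 0 B.sym[OF f eV] by simp
    ultimately show "Bl l f f = 0" by (simp add: LIMSEQ_const_iff)
  qed
  then show ?thesis using B.gs_orthonormal_total[where x = e, OF eV] by blast
qed

end

section \<open>Covariance operator and effective dimension\<close>

context covariance_form begin

sublocale MT: pair_sigma_finite M "leb T" by standard

lemma Y_joint_measurable [measurable (raw)]:
  assumes "f \<in> measurable N M" "g \<in> measurable N (leb T)"
  shows "(\<lambda>x. Y (f x) (g x)) \<in> borel_measurable N"
  using measurable_compose[OF measurable_Pair[OF assms] Yj] by simp

text \<open>
  The kernel of the covariance operator is a pointwise expectation, so its form is a double integral; the bound on
  the norm of \<open>Y\<close> makes the order of integration irrelevant.
\<close>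

lemma fubini_Y:
  assumes Z: "integrable M Z" and v: "v \<in> l2_space T"
  shows "(LINT s|leb T. (LINT w|M. Z w * Y w s) * v s) = (LINT w|M. Z w * l2_inner T (Y w) v)"
proof -
  note [measurable] = l2_measurable[OF v] borel_measurable_integrable[OF Z]
  have av: "(\<lambda>s. \<bar>v s\<bar>) \<in> l2_space T" "l2_norm T (\<lambda>s. \<bar>v s\<bar>) = l2_norm T v"
    using v by (auto simp: l2_space_def l2_norm_def l2_inner_def abs_mult[symmetric])
  have aY: "(\<lambda>s. \<bar>Y w s\<bar>) \<in> l2_space T" "l2_norm T (\<lambda>s. \<bar>Y w s\<bar>) = l2_norm T (Y w)" if "w \<in> space M" for w
    using Y_in[OF that] by (auto simp: l2_space_def l2_norm_def l2_inner_def abs_mult[symmetric])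
  have int: "integrable (M \<Otimes>\<^sub>M leb T) (\<lambda>(w, s). Z w * Y w s * v s)"
  proof (rule MT.Fubini_integrable)
    show "(\<lambda>(w, s). Z w * Y w s * v s) \<in> borel_measurable (M \<Otimes>\<^sub>M leb T)" by measurable
    show "integrable M (\<lambda>w. LINT s|leb T. norm (case (w, s) of (w, s) \<Rightarrow> Z w * Y w s * v s))"
    proof (rule Bochner_Integration.integrable_bound)
      show "integrable M (\<lambda>w. M2 * l2_norm T v * Z w)" using Z by simp
      show "(\<lambda>w. LINT s|leb T. norm (case (w, s) of (w, s) \<Rightarrow> Z w * Y w s * v s)) \<in> borel_measurable M"
        by (rule leb.borel_measurable_lebesgue_integral) measurable
      show "AE w in M. norm (LINT s|leb T. norm (case (w, s) of (w, s) \<Rightarrow> Z w * Y w s * v s)) \<le> norm (M2 * l2_norm T v * Z w)"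
        using AE_space Yb
      proof eventually_elim
        case (elim w)
        have "(LINT s|leb T. norm (Z w * Y w s * v s)) = (LINT s|leb T. \<bar>Z w\<bar> * (\<bar>Y w s\<bar> * \<bar>v s\<bar>))"
          by (simp add: abs_mult mult.assoc)
        also have "\<dots> = \<bar>Z w\<bar> * l2_inner T (\<lambda>s. \<bar>Y w s\<bar>) (\<lambda>s. \<bar>v s\<bar>)" by (simp add: l2_inner_def)
        also have "\<dots> \<le> \<bar>Z w\<bar> * (l2_norm T (Y w) * l2_norm T v)"
          using l2.cauchy_schwarz[OF aY(1)[OF elim(1)] av(1)] aY(2)[OF elim(1)] av(2)
          by (intro mult_left_mono) (auto simp: N_eq_l2_norm)
        also have "\<dots> \<le> \<bar>Z w\<bar> * (M2 * l2_norm T v)"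
          using elim(2) l2.N_nonneg[OF v] by (intro mult_left_mono mult_right_mono) (auto simp: N_eq_l2_norm)
        finally have "(LINT s|leb T. norm (Z w * Y w s * v s)) \<le> \<bar>Z w\<bar> * (M2 * l2_norm T v)" .
        then show ?case using M2 l2.N_nonneg[OF v] by (simp add: abs_mult mult_ac N_eq_l2_norm)
      qed
    qed
    show "AE w in M. integrable (leb T) (\<lambda>s. case (w, s) of (w, s) \<Rightarrow> Z w * Y w s * v s)"
      using AE_space
    proof eventually_elim
      case (elim w)
      then show ?case using integrable_mult_right[OF l2_mult_integrable[OF Y_in[OF elim] v], of "Z w"] by (simp add: mult.assoc)
    qed
  qed
  have "(LINT s|leb T. (LINT w|M. Z w * Y w s) * v s) = (LINT s|leb T. (LINT w|M. Z w * Y w s * v s))" by simp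
  also have "\<dots> = (LINT w|M. (LINT s|leb T. Z w * Y w s * v s))"
    by (rule MT.Fubini_integral) (rule int)
  also have "\<dots> = (LINT w|M. Z w * l2_inner T (Y w) v)" by (simp add: l2_inner_def mult.assoc)
  finally show ?thesis .
qed

lemma Y_section_sq_integrable:
  "integrable (leb T) (\<lambda>s. LINT w|M. (Y w s)\<^sup>2)" "AE s in leb T. integrable M (\<lambda>w. (Y w s)\<^sup>2)"
proof -
  have "(\<integral>\<^sup>+w. (\<integral>\<^sup>+s. ennreal ((Y w s)\<^sup>2) \<partial>leb T) \<partial>M) \<le> (\<integral>\<^sup>+w. ennreal (M2\<^sup>2) \<partial>M)"
  proof (intro nn_integral_mono_AE, use AE_space Yb in eventually_elim)
    fix w assume w: "w \<in> space M" and le: "l2_norm T (Y w) \<le> M2"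
    have "(\<integral>\<^sup>+s. ennreal ((Y w s)\<^sup>2) \<partial>leb T) = ennreal (l2_inner T (Y w) (Y w))"
      unfolding l2_inner_def power2_eq_square[symmetric] by (rule nn_integral_eq_integral[OF l2_sq_integrable[OF Y_in[OF w]]]) simp
    also have "l2_inner T (Y w) (Y w) = (l2_norm T (Y w))\<^sup>2" using l2.N_sq[OF Y_in[OF w]] by (simp add: N_eq_l2_norm)
    also have "ennreal \<dots> \<le> ennreal (M2\<^sup>2)" using le l2.N_nonneg[OF Y_in[OF w]] by (intro ennreal_leI power_mono) (auto simp: N_eq_l2_norm)
    finally show "(\<integral>\<^sup>+s. ennreal ((Y w s)\<^sup>2) \<partial>leb T) \<le> ennreal (M2\<^sup>2)" .
  qed
  also have "\<dots> < \<infinity>" by (simp add: emeasure_space_1)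
  finally have fin: "(\<integral>\<^sup>+w. (\<integral>\<^sup>+s. ennreal ((Y w s)\<^sup>2) \<partial>leb T) \<partial>M) < \<infinity>" .
  have fub: "(\<integral>\<^sup>+w. (\<integral>\<^sup>+s. ennreal ((Y w s)\<^sup>2) \<partial>leb T) \<partial>M) = (\<integral>\<^sup>+z. ennreal ((\<lambda>(w, s). (Y w s)\<^sup>2) z) \<partial>(M \<Otimes>\<^sub>M leb T))"
  proof -
    have "(\<lambda>z. ennreal ((\<lambda>(w, s). (Y w s)\<^sup>2) z)) \<in> borel_measurable (M \<Otimes>\<^sub>M leb T)" by measurable
    from leb.nn_integral_fst[OF this] show ?thesis by simp
  qed
  have int: "integrable (M \<Otimes>\<^sub>M leb T) (\<lambda>(w, s). (Y w s)\<^sup>2)"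
    by (rule integrableI_nonneg) (use fin fub in \<open>auto simp: split_beta\<close>)
  have int': "integrable (leb T \<Otimes>\<^sub>M M) (\<lambda>(s, w). (Y w s)\<^sup>2)" using MT.integrable_product_swap[OF int] by (simp add: split_beta)
  interpret TM: pair_sigma_finite "leb T" M by standard
  show "integrable (leb T) (\<lambda>s. LINT w|M. (Y w s)\<^sup>2)" using TM.integrable_fst'[OF int'] by simp
  show "AE s in leb T. integrable M (\<lambda>w. (Y w s)\<^sup>2)" using TM.AE_integrable_fst'[OF int'] by simp
qed

lemma covariance_operator:
  assumes u: "u \<in> l2_space T"
  shows "integral_operator T (second_moment_kernel M Y) u \<in> l2_space T"
    and "v \<in> l2_space T \<Longrightarrow> l2_inner T (integral_operator T (second_moment_kernel M Y) u) v
          = (LINT w|M. l2_inner T (Y w) u * l2_inner T (Y w) v)"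
proof -
  note [measurable] = l2_measurable[OF u]
  let ?C = "integral_operator T (second_moment_kernel M Y) u"
  let ?I = "\<lambda>w. l2_inner T (Y w) u"
  have Im [measurable]: "?I \<in> borel_measurable M" by (rule measurable_compose[OF Ym l2_inner_measurable[OF u]])
  have Ib: "AE w in M. \<bar>?I w\<bar> \<le> M2 * l2_norm T u" using AE_space Yb
  proof eventually_elim
    case (elim w)
    have "\<bar>?I w\<bar> \<le> l2_norm T (Y w) * l2_norm T u" using l2.cauchy_schwarz[OF Y_in[OF elim(1)] u] by (simp add: N_eq_l2_norm)
    also have "\<dots> \<le> M2 * l2_norm T u" using elim(2) l2.N_nonneg[OF u] by (intro mult_right_mono) (auto simp: N_eq_l2_norm)
    finally show ?case .
  qed
  have Cm [measurable]: "?C \<in> borel_measurable (leb T)"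
    unfolding integral_operator_def second_moment_kernel_def
    by (rule leb.borel_measurable_lebesgue_integral, unfold split_beta', intro borel_measurable_times borel_measurable_lebesgue_integral) measurable
  have good: "AE s in leb T. ?C s = (LINT w|M. ?I w * Y w s) \<and> \<bar>?C s\<bar>\<^sup>2 \<le> (M2 * l2_norm T u)\<^sup>2 * (LINT w|M. (Y w s)\<^sup>2)"
    using AE_space Y_section_sq_integrable(2)
  proof eventually_elim
    case (elim s)
    have Ysm [measurable]: "(\<lambda>w. Y w s) \<in> borel_measurable M" using elim(1) by measurable
    have Yi: "integrable M (\<lambda>w. Y w s)" using elim(2) by (rule square_integrable_imp_integrable[rotated]) measurable
    have "?C s = (LINT r|leb T. (LINT w|M. Y w s * Y w r) * u r)"
      by (simp add: integral_operator_def second_moment_kernel_def mult.commute)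
    also have "\<dots> = (LINT w|M. Y w s * ?I w)" by (rule fubini_Y[OF Yi u])
    finally have C: "?C s = (LINT w|M. ?I w * Y w s)" by (simp add: mult.commute)
    have "\<bar>?C s\<bar> \<le> (LINT w|M. \<bar>?I w * Y w s\<bar>)" unfolding C by (rule integral_abs_bound)
    also have "\<dots> \<le> (LINT w|M. (M2 * l2_norm T u) * \<bar>Y w s\<bar>)"
    proof (rule integral_mono_AE)
      show bd: "AE w in M. \<bar>?I w * Y w s\<bar> \<le> (M2 * l2_norm T u) * \<bar>Y w s\<bar>"
        using Ib
      proof eventually_elim
        case (elim w)
        then show ?case unfolding abs_mult by (rule mult_right_mono) simp
      qed
      show "integrable M (\<lambda>w. \<bar>?I w * Y w s\<bar>)"
      proof (rule Bochner_Integration.integrable_bound)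
        show "integrable M (\<lambda>w. (M2 * l2_norm T u) * \<bar>Y w s\<bar>)" using Yi by simp
        show "(\<lambda>w. \<bar>?I w * Y w s\<bar>) \<in> borel_measurable M" by measurable
        show "AE w in M. norm \<bar>?I w * Y w s\<bar> \<le> norm (M2 * l2_norm T u * \<bar>Y w s\<bar>)"
          using bd
        proof eventually_elim
          case (elim w)
          then show ?case unfolding real_norm_def abs_abs using abs_ge_self by (rule order_trans)
        qed
      qed
    qed (use Yi in auto)
    also have "\<dots> = M2 * l2_norm T u * (LINT w|M. \<bar>Y w s\<bar>)" by simp
    finally have le: "\<bar>?C s\<bar> \<le> M2 * l2_norm T u * (LINT w|M. \<bar>Y w s\<bar>)" .
    have "(LINT w|M. \<bar>Y w s\<bar>)\<^sup>2 \<le> (LINT w|M. (Y w s)\<^sup>2)"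
      using variance_positive[of "\<lambda>w. \<bar>Y w s\<bar>"] variance_eq[of "\<lambda>w. \<bar>Y w s\<bar>"] Yi elim(2) by simp
    then have "(M2 * l2_norm T u * (LINT w|M. \<bar>Y w s\<bar>))\<^sup>2 \<le> (M2 * l2_norm T u)\<^sup>2 * (LINT w|M. (Y w s)\<^sup>2)"
      unfolding power_mult_distrib[of "M2 * l2_norm T u"] by (intro mult_left_mono) auto
    with power_mono[OF le abs_ge_zero, of 2] C show ?case by simp
  qed
  show CV: "?C \<in> l2_space T"
    unfolding l2_space_def
  proof (intro CollectI conjI Cm)
    show "integrable (leb T) (\<lambda>s. (?C s)\<^sup>2)"
      by (rule Bochner_Integration.integrable_bound[of _ "\<lambda>s. (M2 * l2_norm T u)\<^sup>2 * (LINT w|M. (Y w s)\<^sup>2)"])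
         (use Y_section_sq_integrable(1) good in auto)
  qed
  assume v: "v \<in> l2_space T"
  note [measurable] = l2_measurable[OF v]
  have Ii: "integrable M ?I" by (rule integrable_const_bound[OF _ Im]) (use Ib in simp)
  have m2: "(\<lambda>s. LINT w|M. ?I w * Y w s) \<in> borel_measurable (leb T)"
    by (rule borel_measurable_lebesgue_integral) measurable
  have "l2_inner T ?C v = (LINT s|leb T. (LINT w|M. ?I w * Y w s) * v s)"
    unfolding l2_inner_def[of T ?C]
  proof (rule integral_cong_AE)
    show "AE s in leb T. ?C s * v s = (LINT w|M. ?I w * Y w s) * v s" using good by eventually_elim simp
    show "(\<lambda>s. (LINT w|M. ?I w * Y w s) * v s) \<in> borel_measurable (leb T)" using m2 by measurable
  qed measurable
  also have "\<dots> = (LINT w|M. ?I w * l2_inner T (Y w) v)" by (rule fubini_Y[OF Ii v])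
  finally show "l2_inner T ?C v = (LINT w|M. l2_inner T (Y w) u * l2_inner T (Y w) v)" .
qed

text \<open>
  The operator whose effective dimension is assumed to grow polynomially.
\<close>

definition smoothed_covariance :: l2_op where "smoothed_covariance = S \<circ> integral_operator T (second_moment_kernel M Y) \<circ> S"

lemma smoothed_covariance_in: "f \<in> l2_space T \<Longrightarrow> smoothed_covariance f \<in> l2_space T"
  unfolding smoothed_covariance_def comp_def by (intro S_in covariance_operator(1))

lemma smoothed_covariance_inner:
  assumes f: "f \<in> l2_space T" and g: "g \<in> l2_space T"
  shows "l2_inner T (smoothed_covariance f) g = t f g"
proof -
  have "l2_inner T (smoothed_covariance f) g = l2_inner T (integral_operator T (second_moment_kernel M Y) (S f)) (S g)"
    unfolding smoothed_covariance_def comp_def by (rule S_sym[OF covariance_operator(1)[OF S_in[OF f]] g])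
  also have "\<dots> = t f g" unfolding covariance_operator(2)[OF S_in[OF f] S_in[OF g]] by (simp add: t_def L_def)
  finally show ?thesis .
qed

text \<open>
  The resolvent is characterised by its form: \<open>f\<close> is the Riesz representer of \<open>t b\<close> with respect to \<open>Bl l\<close>.  The
  representer is a solution of the operator equation, and whichever solution \<open>l2_op_inverse\<close> chooses satisfies the same
  identity.
\<close>

lemma resolvent:
  assumes l: "0 < l" and b: "b \<in> l2_space T"
  defines "f \<equiv> l2_op_inverse T (\<lambda>h s. smoothed_covariance h s + l * h s) (smoothed_covariance b)"
  shows "f \<in> l2_space T" and "g \<in> l2_space T \<Longrightarrow> Bl l f g = t b g"
proof -
  interpret B: complete_fun_form "l2_space T" "Bl l" by (rule Bl_complete[OF l])
  obtain e :: "nat \<Rightarrow> real \<Rightarrow> real" where e: "B.orthonormal e" "B.total e" using Bl_ex_basis[OF l] by blast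
  have tb: "lin_functional (l2_space T) (t b)" proof -
    have "(\<lambda>f. t f b) = t b" by (rule ext) (rule t_sym)
    then show ?thesis using t_functional[OF b] by simp
  qed
  have tbd: "B.bounded_functional (t b) (m\<^sup>2 * l2_norm T b / sqrt l)"
    unfolding B.bounded_functional_def
  proof (intro conjI ballI tb)
    show "0 \<le> m\<^sup>2 * l2_norm T b / sqrt l" using l l2.N_nonneg[OF b] by (simp add: N_eq_l2_norm)
    fix h assume h: "h \<in> l2_space T"
    have "l2_norm T h \<le> B.N h / sqrt l" using l2_norm_le_Nl[OF l h] l by (simp add: Nl_eq[OF l] pos_le_divide_eq mult.commute)
    then have "m\<^sup>2 * l2_norm T b * l2_norm T h \<le> m\<^sup>2 * l2_norm T b * (B.N h / sqrt l)"
      using l2.N_nonneg[OF b] by (intro mult_left_mono) (auto simp: N_eq_l2_norm)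
    then show "\<bar>t b h\<bar> \<le> m\<^sup>2 * l2_norm T b / sqrt l * B.N h" using t_bound[OF b h] by simp
  qed
  have "\<exists>r\<in>l2_space T. \<forall>f\<in>l2_space T. Bl l r f = t b f"
  proof (rule B.riesz[OF e tbd])
    fix r assume "r \<in> l2_space T" "\<And>f. f \<in> l2_space T \<Longrightarrow> Bl l r f = t b f"
    then show ?thesis by blast
  qed
  then obtain r where r: "r \<in> l2_space T" and rep: "\<And>f. f \<in> l2_space T \<Longrightarrow> Bl l r f = t b f" by blast
  have eqs: "l2_inner T (\<lambda>s. (smoothed_covariance h s + l * h s) - smoothed_covariance b s) k = Bl l h k - t b k"
    if h: "h \<in> l2_space T" and k: "k \<in> l2_space T" for h k
  proof -
    have V: "(\<lambda>s. 1 * smoothed_covariance h s + l * h s) \<in> l2_space T" by (rule l2_lin[OF smoothed_covariance_in[OF h] h])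
    have "l2_inner T (\<lambda>s. (1 * smoothed_covariance h s + l * h s) - smoothed_covariance b s) k = (1 * l2_inner T (smoothed_covariance h) k + l * l2_inner T h k) - l2_inner T (smoothed_covariance b) k"
      unfolding l2.functional_diff[OF l2_inner_lin[OF k] V smoothed_covariance_in[OF b]] l2.B_linL[OF smoothed_covariance_in[OF h] h k] ..
    then show ?thesis by (simp add: smoothed_covariance_inner h k b Bl_def)
  qed
  have V: "(\<lambda>s. smoothed_covariance h s + l * h s) \<in> l2_space T" if "h \<in> l2_space T" for h
    using l2_lin[OF smoothed_covariance_in[OF that] that, of 1 l] by simp
  have ex: "\<exists>f. f \<in> l2_space T \<and> l2_eq T (\<lambda>s. smoothed_covariance f s + l * f s) (smoothed_covariance b)"
  proof (intro exI[of _ r] conjI r)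
    have "l2_inner T (\<lambda>s. (smoothed_covariance r s + l * r s) - smoothed_covariance b s) (\<lambda>s. (smoothed_covariance r s + l * r s) - smoothed_covariance b s) = 0"
      using eqs[OF r l2.diff_in[OF V[OF r] smoothed_covariance_in[OF b]]] rep[OF l2.diff_in[OF V[OF r] smoothed_covariance_in[OF b]]] by simp
    then show "l2_eq T (\<lambda>s. smoothed_covariance r s + l * r s) (smoothed_covariance b)"
      using l2_eq_iff[OF V[OF r] smoothed_covariance_in[OF b]] by (simp add: l2_norm_def)
  qed
  have f: "f \<in> l2_space T \<and> l2_eq T (\<lambda>s. smoothed_covariance f s + l * f s) (smoothed_covariance b)"
    unfolding f_def l2_op_inverse_def by (rule someI_ex[OF ex])
  then show fV: "f \<in> l2_space T" by simp
  assume gV: "g \<in> l2_space T"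
  show "Bl l f g = t b g"
  proof -
    have "l2_inner T (\<lambda>s. smoothed_covariance f s + l * f s) g = l2_inner T (smoothed_covariance b) g"
      using f gV V[OF fV] smoothed_covariance_in[OF b] by (intro l2_inner_cong) auto
    moreover have "l2_inner T (\<lambda>s. smoothed_covariance f s + l * f s) g = l2_inner T (smoothed_covariance f) g + l * l2_inner T f g"
      using l2.B_linL[OF smoothed_covariance_in[OF fV] fV gV, of 1 l] by simp
    ultimately show ?thesis by (simp add: smoothed_covariance_inner fV gV b Bl_def)
  qed
qed

lemma bounded_functional_l2_Bl:
  assumes l: "0 < l" and c: "l2.bounded_functional \<phi> c"
  shows "fun_form.bounded_functional (l2_space T) (Bl l) \<phi> (c / sqrt l)"
proof -
  interpret B: complete_fun_form "l2_space T" "Bl l" by (rule Bl_complete[OF l])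
  show ?thesis
    unfolding B.bounded_functional_def
  proof (intro conjI ballI l2.bounded_functionalD(1)[OF c])
    show "0 \<le> c / sqrt l" using l2.bounded_functionalD(2)[OF c] l by simp
    fix f assume f: "f \<in> l2_space T"
    have "l2.N f \<le> B.N f / sqrt l" using l2_norm_le_Nl[OF l f] l by (simp add: Nl_eq[OF l] N_eq_l2_norm pos_le_divide_eq mult.commute)
    then have "c * l2.N f \<le> c * (B.N f / sqrt l)" by (intro mult_left_mono l2.bounded_functionalD(2)[OF c])
    then show "\<bar>\<phi> f\<bar> \<le> c / sqrt l * B.N f" using l2.bounded_functionalD(3)[OF c f] by simp
  qed
qed

text \<open>
  Let \<open>r w\<close> be the \<open>Bl l\<close>-representer of \<open>L w\<close>.  Expanded along \<open>g\<close>, the value \<open>L w (r w)\<close> is the sum of the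
  \<open>(L w (g k))\<^sup>2\<close>, with expectations \<open>t (g k) (g k)\<close>.  Expanded along a basis \<open>e\<close> of \<open>L\<^sup>2\<close>, it is the sum of
  \<open>\<langle>r w, e k\<rangle> L w (e k)\<close>, whose expectations are the diagonal entries of the resolvent times the operator, that is, the
  terms of the trace.  The first expansion is cut off at \<open>K\<close>; in the second, expectations and limit are exchanged by
  dominated convergence, with a bound from Bessel's inequality.
\<close>

lemma sum_L_sq_le_effective_dimension:
  assumes l: "0 < l" and g: "fun_form.orthonormal (l2_space T) (Bl l) g" "fun_form.total (l2_space T) (Bl l) (g :: nat \<Rightarrow> _)"
  shows "ennreal (\<Sum>k<K. t (g k) (g k)) \<le> effective_dimension T smoothed_covariance l"
proof -
  interpret B: complete_fun_form "l2_space T" "Bl l" by (rule Bl_complete[OF l])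
  have gV: "g k \<in> l2_space T" for k using B.orthonormal_in[OF g(1)] .
  define BB where "BB = (SOME B. l2_orthonormal_basis T B)"
  have BB: "l2_orthonormal_basis T BB" unfolding BB_def by (rule someI_ex[OF basis_exists])
  obtain e :: "nat \<Rightarrow> real \<Rightarrow> real" and F where e: "l2.orthonormal e" "l2.total e"
    and F: "\<And>n. finite (F n)" "\<And>n. F n \<subseteq> BB"
    and sumF: "\<And>n \<phi>. \<phi> (\<lambda>_. 0) = (0::real) \<Longrightarrow> (\<Sum>k<n. \<phi> (e k)) = (\<Sum>b\<in>F n. \<phi> b)"
    using basis_sequence[OF BB] by blast
  have eV: "e k \<in> l2_space T" for k using l2.orthonormal_in[OF e(1)] .
  define R where "R b = l2_op_inverse T (\<lambda>h s. smoothed_covariance h s + l * h s) (smoothed_covariance b)" for b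
  define x where "x b = l2_inner T (R b) b" for b
  have x0: "x (\<lambda>_. 0) = 0" by (simp add: x_def l2_inner_def)
  have lower: "ennreal (\<Sum>k<n. x (e k)) \<le> effective_dimension T smoothed_covariance l" for n
  proof -
    have "ennreal (\<Sum>k<n. x (e k)) \<le> (\<Sum>b\<in>F n. ennreal (x b))"
      unfolding sumF[of x, OF x0] by (rule ennreal_sum_le)
    also have "\<dots> \<le> (\<Sum>\<^sub>\<infinity>b\<in>BB. ennreal (x b))"
      unfolding nonneg_infsum_complete[of BB "\<lambda>b. ennreal (x b)", simplified] using F by (intro SUP_upper) auto
    also have "\<dots> = effective_dimension T smoothed_covariance l"
      unfolding effective_dimension_def l2_trace_def x_def R_def BB_def ..
    finally show ?thesis .
  qed
  \<comment> \<open>the Riesz representative of the functional in the regularised form\<close>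
  define rep_by where "rep_by w r \<longleftrightarrow> r \<in> l2_space T \<and> (\<forall>f\<in>l2_space T. Bl l r f = L w f)
     \<and> (\<forall>\<psi> C'. B.bounded_functional \<psi> C' \<longrightarrow> (\<lambda>n. \<Sum>k<n. L w (g k) * \<psi> (g k)) \<longlonglongrightarrow> \<psi> r)" for w r
  have rex: "\<exists>r. rep_by w r" if w: "w \<in> space M" for w
  proof -
    have "l2.bounded_functional (L w) (l2_norm T (Y w) * \<kappa>)"
      unfolding L_def[abs_def] by (rule inner_S_bounded_functional[OF Y_in[OF w]])
    note Lw = bounded_functional_l2_Bl[OF l this]
    show ?thesis
    proof (rule B.riesz[OF g Lw])
      fix r assume *: "r \<in> l2_space T" "\<And>f. f \<in> l2_space T \<Longrightarrow> Bl l r f = L w f"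
        "\<And>\<psi> C'. B.bounded_functional \<psi> C' \<Longrightarrow> (\<lambda>n. \<Sum>k<n. L w (g k) * \<psi> (g k)) \<longlonglongrightarrow> \<psi> r"
      show ?thesis unfolding rep_by_def by (intro exI[of _ r] conjI ballI allI impI *)
    qed
  qed
  have some: "rep_by w (SOME r. rep_by w r)" if "w \<in> space M" for w by (rule someI_ex[OF rex[OF that]])
  define r where "r w = (SOME r. rep_by w r)" for w
  have r: "r w \<in> l2_space T" if "w \<in> space M" for w
    using some[OF that] by (simp add: rep_by_def r_def)
  have rep: "Bl l (r w) f = L w f" if "w \<in> space M" "f \<in> l2_space T" for w f
    using some[OF that(1)] that(2) by (simp add: rep_by_def r_def)
  have rconv: "(\<lambda>n. \<Sum>k<n. L w (g k) * \<psi> (g k)) \<longlonglongrightarrow> \<psi> (r w)" if "w \<in> space M" "B.bounded_functional \<psi> C'" for w \<psi> C'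
    using some[OF that(1)] that(2) unfolding rep_by_def r_def by blast
  have inner_bd: "B.bounded_functional (\<lambda>f. l2_inner T f b) (l2_norm T b / sqrt l)" if b: "b \<in> l2_space T" for b
    unfolding B.bounded_functional_def
  proof (intro conjI ballI l2_inner_lin[OF b])
    show "0 \<le> l2_norm T b / sqrt l" using l l2.N_nonneg[OF b] by (simp add: N_eq_l2_norm)
    fix f assume f: "f \<in> l2_space T"
    have "l2.N f \<le> B.N f / sqrt l" using l2_norm_le_Nl[OF l f] l by (simp add: Nl_eq[OF l] N_eq_l2_norm pos_le_divide_eq mult.commute)
    then have "l2.N f * l2.N b \<le> B.N f / sqrt l * l2.N b" by (intro mult_right_mono l2.N_nonneg b)
    then show "\<bar>l2_inner T f b\<bar> \<le> l2_norm T b / sqrt l * B.N f"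
      using l2.cauchy_schwarz[OF f b] by (simp add: N_eq_l2_norm mult.commute)
  qed
  define \<rho> where "\<rho> w b = l2_inner T (r w) b" for w b
  have \<rho>conv: "(\<lambda>n. \<Sum>k<n. L w (g k) * l2_inner T (g k) b) \<longlonglongrightarrow> \<rho> w b" if "w \<in> space M" "b \<in> l2_space T" for w b
    unfolding \<rho>_def by (rule rconv[OF that(1) inner_bd[OF that(2)]])
  have \<rho>m [measurable]: "(\<lambda>w. \<rho> w b) \<in> borel_measurable M" if b: "b \<in> l2_space T" for b
    by (rule borel_measurable_LIMSEQ_metric[OF _ \<rho>conv[OF _ b]]) (use gV in measurable)
  \<comment> \<open>a diagonal entry of the resolvent times the operator as an expectation\<close>
  have xE: "x b = (LINT w|M. L w b * \<rho> w b)" if b: "b \<in> l2_space T" for b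
  proof -
    have RV: "R b \<in> l2_space T" unfolding R_def by (rule resolvent(1)[OF l b])
    have "(\<lambda>n. \<Sum>k<n. Bl l (R b) (g k) * l2_inner T (g k) b) \<longlonglongrightarrow> x b"
      unfolding x_def by (rule B.functional_expansion[OF g RV inner_bd[OF b]])
    then have "(\<lambda>n. \<Sum>k<n. t b (g k) * l2_inner T (g k) b) \<longlonglongrightarrow> x b"
      unfolding R_def by (simp add: resolvent(2)[OF l b gV])
    moreover have "(\<Sum>k<n. t b (g k) * l2_inner T (g k) b) = (LINT w|M. L w b * (\<Sum>k<n. L w (g k) * l2_inner T (g k) b))" for n
    proof -
      have "(LINT w|M. L w b * (\<Sum>k<n. L w (g k) * l2_inner T (g k) b)) = (LINT w|M. (\<Sum>k<n. (L w b * L w (g k)) * l2_inner T (g k) b))"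
        by (simp add: sum_distrib_left mult.assoc)
      also have "\<dots> = (\<Sum>k<n. t b (g k) * l2_inner T (g k) b)"
        unfolding t_def using L_mult_integrable[OF b gV] by (simp add: Bochner_Integration.integral_sum)
      finally show ?thesis by simp
    qed
    moreover have "(\<lambda>n. LINT w|M. L w b * (\<Sum>k<n. L w (g k) * l2_inner T (g k) b)) \<longlonglongrightarrow> (LINT w|M. L w b * \<rho> w b)"
    proof (rule integral_dominated_convergence[where w = "\<lambda>_. m * l2_norm T b * (m / sqrt l * (l2_norm T b / sqrt l))"])
      show "AE w in M. (\<lambda>n. L w b * (\<Sum>k<n. L w (g k) * l2_inner T (g k) b)) \<longlonglongrightarrow> L w b * \<rho> w b"
        using \<rho>conv[OF _ b] by (intro AE_I2 tendsto_mult_left)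
      show "AE w in M. norm (L w b * (\<Sum>k<n. L w (g k) * l2_inner T (g k) b)) \<le> m * l2_norm T b * (m / sqrt l * (l2_norm T b / sqrt l))" for n
        using L_AE
      proof eventually_elim
        case (elim w)
        have "\<bar>\<Sum>k<n. L w (g k) * l2_inner T (g k) b\<bar> \<le> L2_set (\<lambda>k. L w (g k)) {..<n} * L2_set (\<lambda>k. l2_inner T (g k) b) {..<n}"
          by (rule abs_sum_mult_le_L2_set)
        also have "\<dots> \<le> m / sqrt l * (l2_norm T b / sqrt l)"
        proof (intro mult_mono L2_set_nonneg)
          show "L2_set (\<lambda>k. L w (g k)) {..<n} \<le> m / sqrt l"
            unfolding L2_set_def
            by (rule real_le_lsqrt[OF _ B.bessel[OF g(1) _ bounded_functional_l2_Bl[OF l]]]) (use elim m_nonneg l in auto)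
          show "L2_set (\<lambda>k. l2_inner T (g k) b) {..<n} \<le> l2_norm T b / sqrt l"
            unfolding L2_set_def
            by (rule real_le_lsqrt[OF _ B.bessel[OF g(1) _ inner_bd[OF b]]]) (use l l2.N_nonneg[OF b] in \<open>auto simp: N_eq_l2_norm\<close>)
        qed (use m_nonneg l in auto)
        finally have 1: "\<bar>\<Sum>k<n. L w (g k) * l2_inner T (g k) b\<bar> \<le> m / sqrt l * (l2_norm T b / sqrt l)" .
        have 2: "\<bar>L w b\<bar> \<le> m * l2_norm T b" using l2.bounded_functionalD(3)[OF _ b] elim by (simp add: N_eq_l2_norm)
        show ?case unfolding real_norm_def abs_mult by (rule mult_mono[OF 2 1]) (use order_trans[OF abs_ge_zero 2] in auto)
      qed
      show "(\<lambda>w. L w b * \<rho> w b) \<in> borel_measurable M" by (intro borel_measurable_times L_measurable b \<rho>m)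
      show "(\<lambda>w. L w b * (\<Sum>k<n. L w (g k) * l2_inner T (g k) b)) \<in> borel_measurable M" for n
        by (intro borel_measurable_times borel_measurable_sum borel_measurable_const L_measurable b gV)
    qed simp
    ultimately show ?thesis by (intro LIMSEQ_unique) simp_all
  qed
  have r_norm: "l2_norm T (r w) \<le> m / l" if w: "w \<in> space M" and Lw: "l2.bounded_functional (L w) m" for w
  proof -
    have "B.N (r w) * B.N (r w) = L w (r w)" using rep[OF w r[OF w]] B.N_sq[OF r[OF w]] by (simp add: power2_eq_square)
    also have "\<dots> \<le> m / sqrt l * B.N (r w)" using B.bounded_functionalD(3)[OF bounded_functional_l2_Bl[OF l Lw] r[OF w]] by simp
    finally have le: "B.N (r w) * B.N (r w) \<le> m / sqrt l * B.N (r w)" .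
    have "B.N (r w) \<le> m / sqrt l"
    proof (cases "B.N (r w) = 0")
      case True
      then show ?thesis using m_nonneg l by simp
    next
      case False
      then have "0 < B.N (r w)" using B.N_nonneg[OF r[OF w]] by simp
      with le show ?thesis by (rule mult_right_le_imp_le)
    qed
    then have "sqrt l * l2_norm T (r w) \<le> m / sqrt l" using l2_norm_le_Nl[OF l r[OF w]] by (simp add: Nl_eq[OF l])
    then have "sqrt l * (sqrt l * l2_norm T (r w)) \<le> sqrt l * (m / sqrt l)" using l by (intro mult_left_mono) auto
    also have "sqrt l * (m / sqrt l) = m" using l by simp
    also have "sqrt l * (sqrt l * l2_norm T (r w)) = l * l2_norm T (r w)" unfolding mult.assoc[symmetric] using l by simp
    finally show ?thesis using l by (simp add: pos_le_divide_eq mult.commute)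
  qed
  have Lr: "(\<lambda>n. \<Sum>k<n. \<rho> w (e k) * L w (e k)) \<longlonglongrightarrow> L w (r w)" if w: "w \<in> space M" and Lw: "l2.bounded_functional (L w) m" for w
    unfolding \<rho>_def by (rule l2.functional_expansion[OF e r[OF w] Lw])
  have upper: "(\<Sum>k<K. (L w (g k))\<^sup>2) \<le> L w (r w)" if w: "w \<in> space M" and Lw: "l2.bounded_functional (L w) m" for w
  proof (rule LIMSEQ_le_const[OF rconv[OF w bounded_functional_l2_Bl[OF l Lw]]], intro exI allI impI)
    fix n assume "K \<le> n"
    then show "(\<Sum>k<K. (L w (g k))\<^sup>2) \<le> (\<Sum>k<n. L w (g k) * L w (g k))"
      unfolding power2_eq_square by (intro sum_mono2) auto
  qed
  \<comment> \<open>a measurable version of \<open>L w (r w)\<close>, which inherits no measurability from the choice of \<open>r w\<close>\<close>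
  define Q where "Q w = lim (\<lambda>n. \<Sum>k<n. \<rho> w (e k) * L w (e k))" for w
  have Qm [measurable]: "Q \<in> borel_measurable M" unfolding Q_def[abs_def] using eV by measurable
  have Qconv: "AE w in M. (\<lambda>n. \<Sum>k<n. \<rho> w (e k) * L w (e k)) \<longlonglongrightarrow> Q w \<and> (\<Sum>k<K. (L w (g k))\<^sup>2) \<le> Q w"
    using L_AE
  proof eventually_elim
    case (elim w)
    then have "Q w = L w (r w)" unfolding Q_def using Lr by (auto intro: limI)
    then show ?case using Lr upper elim by auto
  qed
  have bound: "AE w in M. norm (\<Sum>k<n. \<rho> w (e k) * L w (e k)) \<le> m / l * m" for n
    using L_AE
  proof eventually_elim
    case (elim w)
    have "\<bar>\<Sum>k<n. \<rho> w (e k) * L w (e k)\<bar> \<le> L2_set (\<lambda>k. \<rho> w (e k)) {..<n} * L2_set (\<lambda>k. L w (e k)) {..<n}"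
      by (rule abs_sum_mult_le_L2_set)
    also have "\<dots> \<le> m / l * m"
    proof (intro mult_mono L2_set_nonneg)
      have "(\<Sum>k<n. (\<rho> w (e k))\<^sup>2) \<le> (l2.N (r w))\<^sup>2"
        using l2.bessel[OF e(1) _ l2.bounded_functional_B[OF r], of "{..<n}" w] elim l2.sym[OF r eV] by (simp add: \<rho>_def)
      then have "L2_set (\<lambda>k. \<rho> w (e k)) {..<n} \<le> l2.N (r w)"
        unfolding L2_set_def using elim by (intro real_le_lsqrt l2.N_nonneg r) auto
      then show "L2_set (\<lambda>k. \<rho> w (e k)) {..<n} \<le> m / l" using r_norm[of w] elim by (simp add: N_eq_l2_norm)
      show "L2_set (\<lambda>k. L w (e k)) {..<n} \<le> m"
        unfolding L2_set_def by (rule real_le_lsqrt[OF m_nonneg l2.bessel[OF e(1)]]) (use elim in auto)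
    qed (use m_nonneg l in auto)
    finally show ?case by simp
  qed
  have Sm: "(\<lambda>w. \<Sum>k<n. \<rho> w (e k) * L w (e k)) \<in> borel_measurable M" for n
    by (intro borel_measurable_sum borel_measurable_times L_measurable \<rho>m eV)
  have Qlim: "AE w in M. (\<lambda>n. \<Sum>k<n. \<rho> w (e k) * L w (e k)) \<longlonglongrightarrow> Q w" using Qconv by eventually_elim simp
  have ci: "integrable M (\<lambda>_. m / l * m)" by simp
  have lim: "(\<lambda>n. LINT w|M. (\<Sum>k<n. \<rho> w (e k) * L w (e k))) \<longlonglongrightarrow> (LINT w|M. Q w)"
    by (rule integral_dominated_convergence[OF Qm Sm ci Qlim bound])
  have Qi: "integrable M Q"
    by (rule integrable_dominated_convergence[OF Qm Sm ci Qlim bound])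
  have term_i: "integrable M (\<lambda>w. \<rho> w (e k) * L w (e k))" for k
  proof -
    have "integrable M (\<lambda>w. (\<Sum>j<Suc k. \<rho> w (e j) * L w (e j)) - (\<Sum>j<k. \<rho> w (e j) * L w (e j)))"
      by (intro Bochner_Integration.integrable_diff integrable_const_bound[where B = "m / l * m"] bound Sm)
    then show ?thesis by simp
  qed
  have "(LINT w|M. (\<Sum>k<n. \<rho> w (e k) * L w (e k))) = (\<Sum>k<n. x (e k))" for n
    using term_i by (simp add: Bochner_Integration.integral_sum xE[OF eV] mult.commute)
  with lim have lim': "(\<lambda>n. \<Sum>k<n. x (e k)) \<longlonglongrightarrow> (LINT w|M. Q w)" by simp
  have "(\<Sum>k<K. t (g k) (g k)) = (LINT w|M. (\<Sum>k<K. (L w (g k))\<^sup>2))"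
    unfolding t_def using L_mult_integrable[OF gV gV] by (simp add: Bochner_Integration.integral_sum power2_eq_square)
  also have "\<dots> \<le> (LINT w|M. Q w)"
  proof (rule integral_mono_AE[OF _ Qi])
    show "integrable M (\<lambda>w. \<Sum>k<K. (L w (g k))\<^sup>2)"
      unfolding power2_eq_square by (intro Bochner_Integration.integrable_sum L_mult_integrable gV)
    show "AE w in M. (\<Sum>k<K. (L w (g k))\<^sup>2) \<le> Q w" using Qconv by eventually_elim simp
  qed
  finally have "ennreal (\<Sum>k<K. t (g k) (g k)) \<le> ennreal (LINT w|M. Q w)" by (rule ennreal_leI)
  also have "\<dots> \<le> effective_dimension T smoothed_covariance l"
    using lower by (intro LIMSEQ_le_const2[OF tendsto_ennrealI[OF lim']]) auto
  finally show ?thesis .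
qed

end

section \<open>Deterministic analysis of the penalised least squares problem\<close>

lemma psd_cauchy_schwarz:
  fixes A :: "real^'p^'p"
  assumes sym: "transpose A = A" and psd: "\<And>x. 0 \<le> x \<bullet> (A *v x)"
  shows "(x \<bullet> (A *v y))\<^sup>2 \<le> (x \<bullet> (A *v x)) * (y \<bullet> (A *v y))"
proof -
  have s: "y \<bullet> (A *v x) = x \<bullet> (A *v y)" for x y
    using dot_lmul_matrix[of y A x] sym by (metis inner_commute transpose_matrix_vector)
  have quad: "0 \<le> x \<bullet> (A *v x) + 2 * t * (x \<bullet> (A *v y)) + t\<^sup>2 * (y \<bullet> (A *v y))" for t
    using psd[of "x + t *\<^sub>R y"] s[of y x]
    by (simp add: matrix_vector_right_distrib inner_add_left inner_add_right matrix_vector_mult_scaleR power2_eq_square algebra_simps)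
  show ?thesis
  proof (cases "y \<bullet> (A *v y) = 0")
    case True
    have "x \<bullet> (A *v y) = 0"
    proof (rule ccontr)
      assume "x \<bullet> (A *v y) \<noteq> 0"
      then show False using quad[of "- (x \<bullet> (A *v x) + 1) / (2 * (x \<bullet> (A *v y)))"] True psd[of x] by (simp add: field_simps)
    qed
    then show ?thesis using True by simp
  next
    case False
    then have "0 < y \<bullet> (A *v y)" using psd[of y] by simp
    then show ?thesis using quad[of "- (x \<bullet> (A *v y)) / (y \<bullet> (A *v y))"] by (simp add: power2_eq_square field_simps)
  qed
qed

lemma pos_def_invertible:
  fixes A :: "real^'p^'p" assumes "pos_def_matrix A" shows "invertible A"
proof -
  have "x = 0" if "A *v x = 0" for x
    using assms that by (metis inner_zero_right less_irrefl pos_def_matrix_def)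
  then have "inj ((*v) A)" by (intro linear_injective_0[THEN iffD2]) auto
  then show ?thesis by (metis invertible_left_inverse matrix_left_invertible_injective)
qed

lemma matrix_inv_right_inverse:
  fixes A :: "real^'p^'p" assumes "invertible A" shows "A ** matrix_inv A = mat 1"
  using assms someI_ex[of "\<lambda>A'. A ** A' = mat 1 \<and> A' ** A = mat 1"]
  unfolding invertible_def matrix_inv_def by blast

text \<open>
  The Cauchy--Schwarz inequality of the form of \<open>A\<close>, applied to \<open>x\<close> and \<open>A\<inverse> x\<close>.
\<close>

lemma pos_def_lower_bound:
  fixes A :: "real^'p^'p" assumes A: "pos_def_matrix A"
  shows "x \<bullet> x \<le> matrix_opnorm (matrix_inv A) * (x \<bullet> (A *v x))"
proof (cases "x = 0")
  case False
  have sym: "transpose A = A" and pd: "\<And>x. x \<noteq> 0 \<Longrightarrow> 0 < x \<bullet> (A *v x)" using A by (auto simp: pos_def_matrix_def)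
  have psd: "0 \<le> x \<bullet> (A *v x)" for x using pd[of x] by (cases "x = 0") auto
  let ?y = "matrix_inv A *v x"
  have Ay: "A *v ?y = x" using pos_def_invertible[OF A] by (simp add: matrix_vector_mul_assoc matrix_inv_right_inverse)
  have "(x \<bullet> x)\<^sup>2 \<le> (x \<bullet> (A *v x)) * (?y \<bullet> x)"
    using psd_cauchy_schwarz[OF sym psd, of x ?y] Ay by simp
  also have "\<dots> \<le> (x \<bullet> (A *v x)) * (matrix_opnorm (matrix_inv A) * (x \<bullet> x))"
  proof (intro mult_left_mono psd)
    have "?y \<bullet> x \<le> norm ?y * norm x" using norm_cauchy_schwarz[of ?y x] .
    also have "\<dots> \<le> matrix_opnorm (matrix_inv A) * norm x * norm x"
      unfolding matrix_opnorm_def by (intro mult_right_mono onorm) (auto intro: linear_linear simp: linear_conv_bounded_linear[symmetric])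
    finally show "?y \<bullet> x \<le> matrix_opnorm (matrix_inv A) * (x \<bullet> x)" by (simp add: dot_square_norm power2_eq_square)
  qed
  finally have "(x \<bullet> x) * (x \<bullet> x) \<le> (matrix_opnorm (matrix_inv A) * (x \<bullet> (A *v x))) * (x \<bullet> x)"
    by (simp add: power2_eq_square mult_ac)
  then show ?thesis using False by (simp add: mult_le_cancel_right)
qed simp

text \<open>
  The maximum in the definition of \<open>max_eigenvalue\<close> is attained: an eigenvalue exists by maximising the Rayleigh
  quotient, and there are finitely many because eigenvectors of different eigenvalues are orthogonal.  Then
  \<open>pos_def_lower_bound\<close> is evaluated at an eigenvector.
\<close>

lemma max_eigenvalue_lower:
  fixes A :: "real^'p^'p" assumes A: "pos_def_matrix A"
  shows "1 \<le> max_eigenvalue A * matrix_opnorm (matrix_inv A)" "0 < max_eigenvalue A"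
proof -
  have sym: "transpose A = A" and pd: "\<And>x. x \<noteq> 0 \<Longrightarrow> 0 < x \<bullet> (A *v x)" using A by (auto simp: pos_def_matrix_def)
  have s: "y \<bullet> (A *v x) = x \<bullet> (A *v y)" for x y
    using dot_lmul_matrix[of y A x] sym by (metis inner_commute transpose_matrix_vector)
  let ?E = "{l. \<exists>x. x \<noteq> 0 \<and> A *v x = l *\<^sub>R x}"
  \<comment> \<open>a maximiser of the Rayleigh quotient is an eigenvector\<close>
  have "compact (sphere (0::real^'p) 1)" by simp
  moreover have "sphere (0::real^'p) 1 \<noteq> {}" by simp
  moreover have "continuous_on (sphere 0 1) (\<lambda>x. x \<bullet> (A *v x))"
    by (intro continuous_intros linear_continuous_on) (auto simp: linear_conv_bounded_linear[symmetric])
  ultimately obtain x where x: "x \<in> sphere 0 1" and mx: "\<And>y. y \<in> sphere 0 1 \<Longrightarrow> y \<bullet> (A *v y) \<le> x \<bullet> (A *v x)"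
    using continuous_attains_sup[of "sphere (0::real^'p) 1" "\<lambda>x. x \<bullet> (A *v x)"] by auto
  define \<mu> where "\<mu> = x \<bullet> (A *v x)"
  have x1: "x \<bullet> x = 1" using x by (simp add: dot_square_norm)
  define C where "C = \<mu> *\<^sub>R mat 1 - A"
  have Cv: "C *v y = \<mu> *\<^sub>R y - A *v y" for y by (simp add: C_def matrix_vector_mult_diff_rdistrib scaleR_matrix_vector_assoc[symmetric])
  have Csym: "transpose C = C" using sym by (simp add: C_def transpose_def vec_eq_iff mat_def)
  have Cpsd: "0 \<le> y \<bullet> (C *v y)" for y
  proof (cases "y = 0")
    case False
    have "(1 / norm y) *\<^sub>R y \<in> sphere 0 1" using False by simp
    from mx[OF this] have "(1 / norm y)\<^sup>2 * (y \<bullet> (A *v y)) \<le> \<mu>"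
      by (simp add: \<mu>_def matrix_vector_mult_scaleR power2_eq_square)
    then have "y \<bullet> (A *v y) \<le> \<mu> * (norm y)\<^sup>2" using False by (simp add: power_divide divide_le_eq)
    then show ?thesis by (simp add: Cv inner_diff_right dot_square_norm)
  qed simp
  have "y \<bullet> (C *v x) = 0" for y
    using psd_cauchy_schwarz[OF Csym Cpsd, of y x] x1 by (simp add: Cv inner_diff_right \<mu>_def)
  then have "C *v x = 0" by (metis inner_eq_zero_iff)
  then have "A *v x = \<mu> *\<^sub>R x" by (simp add: Cv)
  moreover have "x \<noteq> 0" using x1 by auto
  ultimately have ne: "\<mu> \<in> ?E" by auto
  have fin: "finite ?E"
  proof -
    define ev where "ev l = (SOME x. x \<noteq> 0 \<and> A *v x = l *\<^sub>R x)" for l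
    have ev: "ev l \<noteq> 0 \<and> A *v ev l = l *\<^sub>R ev l" if "l \<in> ?E" for l
      unfolding ev_def by (rule someI_ex) (use that in auto)
    have orth: "ev l \<bullet> ev k = 0" if "l \<in> ?E" "k \<in> ?E" "l \<noteq> k" for l k
      using s[of "ev l" "ev k"] ev[OF that(1)] ev[OF that(2)] that(3) by (auto simp: inner_commute)
    have inj: "inj_on ev ?E"
    proof (rule inj_onI, rule ccontr)
      fix l k assume "l \<in> ?E" "k \<in> ?E" "ev l = ev k" "l \<noteq> k"
      then show False using orth[of l k] ev[of k] by auto
    qed
    have "pairwise orthogonal (ev ` ?E)" using orth by (auto simp: pairwise_def orthogonal_def)
    moreover have "0 \<notin> ev ` ?E"
    proof
      assume "0 \<in> ev ` ?E"
      then obtain l where "0 = ev l" and l: "l \<in> ?E" by (rule imageE)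
      then show False using ev[OF l] by simp
    qed
    ultimately have "independent (ev ` ?E)" by (rule pairwise_orthogonal_independent)
    then have "finite (ev ` ?E)" using independent_bound by blast
    then show ?thesis using inj by (rule finite_imageD)
  qed
  have "max_eigenvalue A \<in> ?E" unfolding max_eigenvalue_def using fin ne by (intro Max_in) auto
  then obtain y where y: "y \<noteq> 0" "A *v y = max_eigenvalue A *\<^sub>R y" by auto
  have "y \<bullet> y \<le> matrix_opnorm (matrix_inv A) * (max_eigenvalue A * (y \<bullet> y))"
    using pos_def_lower_bound[OF A, of y] y(2) by simp
  then show "1 \<le> max_eigenvalue A * matrix_opnorm (matrix_inv A)"
    using y(1) inner_gt_zero_iff[of y] by (simp add: mult_ac)
  show "0 < max_eigenvalue A" using pd[OF y(1)] inner_ge_zero[of y] unfolding y(2) inner_scaleR_right zero_less_mult_iff by linarith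
qed

text \<open>
  In the application \<open>N\<close> is the regularised norm of the error and \<open>z = sqrt l * r\<close> its penalty part.  Since \<open>q\<close> may exceed
  \<open>1\<close>, the term \<open>q * N * z\<close> cannot be absorbed by \<open>z \<le> N\<close>.  If \<open>N\<close> were larger than claimed, then the second
  inequality would give \<open>N < (1 + q) * z\<close>, and with this the first one would bound \<open>z\<close> by too little.
\<close>

lemma regularised_error_scalar:
  fixes N z e F q \<beta> :: real
  assumes nn: "0 \<le> N" "0 \<le> z" "z \<le> N" "0 \<le> e" "0 \<le> F" "0 \<le> q" "0 \<le> \<beta>"
    and z: "z\<^sup>2 \<le> e * N + F * z"
    and N: "N\<^sup>2 \<le> e * N + F * z + q * N * z + \<beta> * z\<^sup>2"
  shows "N \<le> (1 + \<beta>) * ((1 + q) * F + (1 + q)\<^sup>2 * e)"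
proof (rule ccontr)
  define W where "W = 1 + q"
  define G where "G = W * F + W\<^sup>2 * e"
  assume "\<not> ?thesis"
  then have big: "(1 + \<beta>) * G < N" by (simp add: G_def W_def)
  have W: "1 \<le> W" using nn by (simp add: W_def)
  have G0: "0 \<le> G" using nn W by (simp add: G_def)
  have N0: "0 < N" using big G0 nn mult_nonneg_nonneg[of "1 + \<beta>" G] by linarith
  have GN: "G < N" using big G0 nn mult_right_mono[of 1 "1 + \<beta>" G] by linarith
  have "W * (e + F) \<le> G"
  proof -
    have "W * e \<le> W\<^sup>2 * e" using W nn mult_right_mono[of W "W\<^sup>2" e] by (simp add: power2_eq_square)
    then show ?thesis by (simp add: G_def algebra_simps)
  qed
  then have "(1 + \<beta>) * (W * (e + F)) \<le> (1 + \<beta>) * G" using nn by (intro mult_left_mono) auto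
  then have lin: "W * ((1 + \<beta>) * (e + F)) < N" using big by (simp add: mult_ac)
  have "N * N \<le> ((1 + \<beta>) * (e + F) + q * z) * N"
  proof -
    have "\<beta> * z\<^sup>2 \<le> \<beta> * (e * N + F * z)" using z nn by (intro mult_left_mono)
    moreover have "(1 + \<beta>) * (F * z) \<le> (1 + \<beta>) * (F * N)" using nn by (intro mult_left_mono) auto
    ultimately show ?thesis using N by (simp add: power2_eq_square algebra_simps)
  qed
  then have "N \<le> (1 + \<beta>) * (e + F) + q * z" using N0 by (simp add: mult_le_cancel_right)
  then have "W * N \<le> W * ((1 + \<beta>) * (e + F) + q * z)" using W by (intro mult_left_mono) auto
  also have "\<dots> < N + W * (q * z)" using lin by (simp add: distrib_left)
  finally have "q * N < q * (W * z)" by (simp add: W_def algebra_simps)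
  then have Nz: "N < W * z" using nn by (simp add: mult_less_cancel_left)
  then have z0: "0 < z" using N0 W nn by (cases "z = 0") auto
  have "z * z \<le> e * (W * z) + F * z"
    using z Nz nn mult_left_mono[of N "W * z" e] by (simp add: power2_eq_square)
  then have "z * z \<le> (e * W + F) * z" by (simp add: algebra_simps)
  then have "z \<le> e * W + F" using z0 by (simp add: mult_le_cancel_right)
  then have "W * z \<le> W * (e * W + F)" using W by (intro mult_left_mono) auto
  also have "\<dots> = G" by (simp add: G_def power2_eq_square algebra_simps)
  finally show False using Nz GN by simp
qed

definition emp_cov :: "nat \<Rightarrow> (nat \<Rightarrow> real^'p) \<Rightarrow> real^'p^'p" where
  "emp_cov n x = (\<chi> i j. (1 / real n) * (\<Sum>k=1..n. x k $ i * x k $ j))"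

lemma emp_cov_mult: "emp_cov n x *v v = (1 / real n) *\<^sub>R (\<Sum>k=1..n. (x k \<bullet> v) *\<^sub>R x k)"
proof -
  have "(emp_cov n x *v v) $ i = ((1 / real n) *\<^sub>R (\<Sum>k=1..n. (x k \<bullet> v) *\<^sub>R x k)) $ i" for i
  proof -
    have "(emp_cov n x *v v) $ i = (\<Sum>j\<in>UNIV. (1 / real n) * (\<Sum>k=1..n. x k $ i * x k $ j) * v $ j)"
      by (simp add: matrix_vector_mult_def emp_cov_def)
    also have "\<dots> = (1 / real n) * (\<Sum>j\<in>UNIV. \<Sum>k=1..n. x k $ i * (x k $ j * v $ j))"
      by (simp add: sum_distrib_left sum_distrib_right mult_ac)
    also have "(\<Sum>j\<in>UNIV. \<Sum>k=1..n. x k $ i * (x k $ j * v $ j)) = (\<Sum>k=1..n. \<Sum>j\<in>UNIV. x k $ i * (x k $ j * v $ j))"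
      by (rule sum.swap)
    also have "\<dots> = (\<Sum>k=1..n. (x k \<bullet> v) * x k $ i)"
      by (simp add: inner_vec_def sum_distrib_left mult.commute)
    finally show ?thesis by simp
  qed
  then show ?thesis by (simp add: vec_eq_iff)
qed

lemma emp_cov_form: "u \<bullet> (emp_cov n x *v v) = (1 / real n) * (\<Sum>k=1..n. (x k \<bullet> u) * (x k \<bullet> v))"
  by (simp add: emp_cov_mult inner_sum_right inner_commute mult.commute)

text \<open>
  The numbers \<open>h i\<close> are the values \<open>l\<^sub>Y\<^sub>i(h)\<close> of the nonparametric error, \<open>r\<close> is its norm and \<open>N\<close> its regularised norm.
  Subtracting the regression \<open>a1\<close> of the noise from \<open>a\<close> leaves the regression \<open>a2\<close> of the \<open>- h i\<close>.  Its energy \<open>q2\<close>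
  is at most \<open>3 / 8\<close> of the penalty by the hypothesis on \<open>\<gamma>\<close>, which says that the empirical correlations are small, and
  also at most the empirical second moment of \<open>h\<close>.  These two facts give the two inequalities of
  \<open>regularised_error_scalar\<close>.
\<close>

lemma deterministic_error_bound:
  fixes x :: "nat \<Rightarrow> real^'p" and D :: "real^'p^'p"
  assumes n: "0 < n" and D: "pos_def_matrix D" and d: "d = matrix_opnorm (matrix_inv D)"
    and low: "\<And>v. 3 / 4 * (v \<bullet> (D *v v)) \<le> v \<bullet> (emp_cov n x *v v)"
    and a1: "emp_cov n x *v a1 = (1 / real n) *\<^sub>R (\<Sum>i=1..n. \<epsilon> i *\<^sub>R x i)"
    and normal_a: "(\<Sum>i=1..n. (\<epsilon> i - x i \<bullet> a - h i) *\<^sub>R x i) = 0"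
    and normal_h: "(1 / real n) * (\<Sum>i=1..n. (\<epsilon> i - x i \<bullet> a - h i) * h i) = l * (f0h + r\<^sup>2)"
    and l: "0 < l" and r: "0 \<le> r" and t: "0 \<le> t" and N: "0 \<le> N" "N\<^sup>2 = t + l * r\<^sup>2"
    and f0: "\<bar>f0h\<bar> \<le> f * r" and f: "0 \<le> f" and e: "0 \<le> e" and q: "0 \<le> q"
    and noise: "\<bar>(1 / real n) * (\<Sum>i=1..n. (\<epsilon> i - x i \<bullet> a1) * h i)\<bar> \<le> e * N"
    and conc: "\<bar>(1 / real n) * (\<Sum>i=1..n. (h i)\<^sup>2) - t\<bar> \<le> q * sqrt l * r * N"
    and cross: "\<And>j. \<bar>(1 / real n) * (\<Sum>i=1..n. x i $ j * h i)\<bar> \<le> \<gamma> * r"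
    and \<beta>: "4 / 3 * d * real CARD('p) * \<gamma>\<^sup>2 \<le> 3 / 8 * l"
  shows "a \<bullet> (D *v a) + t \<le> 8 / 3 * (a1 \<bullet> (emp_cov n x *v a1))
     + (11 / 8 * ((1 + q) * (sqrt l * f) + (1 + q)\<^sup>2 * e))\<^sup>2"
proof -
  define Dn where "Dn = emp_cov n x"
  define a2 where "a2 = a - a1"
  define G where "G = (1 / real n) *\<^sub>R (\<Sum>i=1..n. h i *\<^sub>R x i)"
  define q2 where "q2 = a2 \<bullet> (Dn *v a2)"
  define Tn where "Tn = (1 / real n) * (\<Sum>i=1..n. (h i)\<^sup>2)"
  define atil where "atil = (1 / real n) * (\<Sum>i=1..n. (\<epsilon> i - x i \<bullet> a1) * h i)"
  have psd: "0 \<le> v \<bullet> (Dn *v v)" for v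
    unfolding Dn_def emp_cov_form power2_eq_square[symmetric] by (intro mult_nonneg_nonneg sum_nonneg) auto
  have "Dn *v a = (1 / real n) *\<^sub>R (\<Sum>i=1..n. \<epsilon> i *\<^sub>R x i) - G"
  proof -
    have "(\<Sum>i=1..n. (\<epsilon> i - x i \<bullet> a - h i) *\<^sub>R x i)
       = (\<Sum>i=1..n. \<epsilon> i *\<^sub>R x i) - (\<Sum>i=1..n. (x i \<bullet> a) *\<^sub>R x i) - (\<Sum>i=1..n. h i *\<^sub>R x i)"
      by (simp add: scaleR_diff_left sum_subtractf)
    then have "(\<Sum>i=1..n. (x i \<bullet> a) *\<^sub>R x i) = (\<Sum>i=1..n. \<epsilon> i *\<^sub>R x i) - (\<Sum>i=1..n. h i *\<^sub>R x i)"
      using normal_a by (simp add: algebra_simps)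
    then show ?thesis by (simp add: Dn_def emp_cov_mult G_def scaleR_diff_right)
  qed
  then have Da2: "Dn *v a2 = - G" using a1 by (simp add: a2_def Dn_def matrix_vector_mult_diff_distrib)
  have q2G: "q2 = - (a2 \<bullet> G)" by (simp add: q2_def Da2)
  have Gin: "v \<bullet> G = (1 / real n) * (\<Sum>i=1..n. (x i \<bullet> v) * h i)" for v
    by (simp add: G_def inner_sum_right inner_commute mult.commute)
  have G_norm: "norm G \<le> sqrt (real CARD('p)) * (\<bar>\<gamma>\<bar> * r)"
  proof -
    have "\<bar>G $ j\<bar> \<le> \<bar>\<gamma>\<bar> * r" for j
    proof -
      have "G $ j = (1 / real n) * (\<Sum>i=1..n. x i $ j * h i)" by (simp add: G_def mult.commute)
      then have "\<bar>G $ j\<bar> \<le> \<gamma> * r" using cross[of j] by simp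
      also have "\<dots> \<le> \<bar>\<gamma>\<bar> * r" using r by (intro mult_right_mono) auto
      finally show ?thesis .
    qed
    then have "(G $ j)\<^sup>2 \<le> (\<bar>\<gamma>\<bar> * r)\<^sup>2" for j using power_mono[of "\<bar>G $ j\<bar>" "\<bar>\<gamma>\<bar> * r" 2] by simp
    then have "(\<Sum>j\<in>UNIV. (G $ j)\<^sup>2) \<le> (\<Sum>j\<in>(UNIV::'p set). (\<bar>\<gamma>\<bar> * r)\<^sup>2)" by (rule sum_mono)
    then have "(norm G)\<^sup>2 \<le> real CARD('p) * (\<bar>\<gamma>\<bar> * r)\<^sup>2"
      by (simp add: norm_vec_def L2_set_def sum_nonneg)
    then have "norm G \<le> sqrt (real CARD('p) * (\<bar>\<gamma>\<bar> * r)\<^sup>2)" by (rule real_le_rsqrt)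
    then show ?thesis using r by (simp add: real_sqrt_mult)
  qed
  have d0: "0 \<le> d"
  proof -
    have "norm (matrix_inv D *v (axis undefined 1 :: real^'p)) \<le> d * norm (axis undefined 1 :: real^'p)"
      unfolding d matrix_opnorm_def by (intro onorm) (auto simp: linear_conv_bounded_linear[symmetric])
    from order_trans[OF norm_ge_zero this] show ?thesis by simp
  qed
  have low2: "v \<bullet> (D *v v) \<le> 4 / 3 * (v \<bullet> (Dn *v v))" for v using low[of v] by (simp add: Dn_def)
  have norm2: "(norm v)\<^sup>2 \<le> d * (4 / 3 * (v \<bullet> (Dn *v v)))" for v
  proof -
    have "(norm v)\<^sup>2 \<le> d * (v \<bullet> (D *v v))" using pos_def_lower_bound[OF D, of v] by (simp add: d dot_square_norm)
    also have "\<dots> \<le> d * (4 / 3 * (v \<bullet> (Dn *v v)))" by (intro mult_left_mono low2 d0)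
    finally show ?thesis .
  qed
  have q2_nonneg: "0 \<le> q2" unfolding q2_def by (rule psd)
  \<comment> \<open>\<open>q2 = - a2 \<bullet> G\<close> is bounded by Cauchy--Schwarz, and \<open>(norm a2)\<^sup>2\<close> by a multiple of \<open>q2\<close> itself\<close>
  have q2_le: "q2 \<le> 3 / 8 * (l * r\<^sup>2)"
  proof (cases "q2 = 0")
    case False
    have "q2\<^sup>2 \<le> (norm a2)\<^sup>2 * (norm G)\<^sup>2"
    proof -
      have "\<bar>q2\<bar> \<le> norm a2 * norm G" unfolding q2G using Cauchy_Schwarz_ineq2[of a2 G] by simp
      then have "\<bar>q2\<bar>\<^sup>2 \<le> (norm a2 * norm G)\<^sup>2" by (intro power_mono) auto
      then show ?thesis by (simp add: power_mult_distrib)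
    qed
    also have "\<dots> \<le> (d * (4 / 3 * q2)) * (real CARD('p) * (\<gamma>\<^sup>2 * r\<^sup>2))"
    proof (rule mult_mono)
      show "(norm a2)\<^sup>2 \<le> d * (4 / 3 * q2)" using norm2[of a2] by (simp add: q2_def)
      have "(norm G)\<^sup>2 \<le> (sqrt (real CARD('p)) * (\<bar>\<gamma>\<bar> * r))\<^sup>2" by (intro power_mono G_norm) simp
      then show "(norm G)\<^sup>2 \<le> real CARD('p) * (\<gamma>\<^sup>2 * r\<^sup>2)" by (simp add: power_mult_distrib)
    qed (use d0 q2_nonneg in auto)
    also have "\<dots> = (4 / 3 * d * real CARD('p) * \<gamma>\<^sup>2) * r\<^sup>2 * q2" by (simp add: mult_ac)
    also have "\<dots> \<le> (3 / 8 * l) * r\<^sup>2 * q2" using q2_nonneg by (intro mult_right_mono \<beta>) auto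
    finally have "q2 * q2 \<le> (3 / 8 * (l * r\<^sup>2)) * q2" by (simp add: power2_eq_square mult_ac)
    then show ?thesis using False q2_nonneg by (simp add: mult_le_cancel_right)
  qed (use l in simp)
  \<comment> \<open>the equation tested with \<open>h\<close>, after the elimination of \<open>a\<close>\<close>
  have ident: "l * (f0h + r\<^sup>2) = atil + q2 - Tn"
  proof -
    have "(\<Sum>i=1..n. (\<epsilon> i - x i \<bullet> a - h i) * h i)
        = (\<Sum>i=1..n. (\<epsilon> i - x i \<bullet> a1) * h i) - (\<Sum>i=1..n. (x i \<bullet> a2) * h i) - (\<Sum>i=1..n. (h i)\<^sup>2)"
      unfolding a2_def sum_subtractf[symmetric] by (intro sum.cong) (auto simp: inner_diff_right power2_eq_square algebra_simps)
    then have "l * (f0h + r\<^sup>2) = atil - a2 \<bullet> G - Tn"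
      using normal_h by (simp add: atil_def Tn_def Gin right_diff_distrib)
    then show ?thesis by (simp add: q2G)
  qed
  \<comment> \<open>the residual mean square of the regression of \<open>h\<close> on \<open>x\<close>\<close>
  have Tq: "0 \<le> Tn - q2"
  proof -
    have "Tn - q2 = Tn + 2 * (a2 \<bullet> G) + a2 \<bullet> (Dn *v a2)" using q2G q2_def by simp
    also have "\<dots> = (1 / real n) * (\<Sum>i=1..n. (h i + x i \<bullet> a2)\<^sup>2)"
      unfolding Tn_def Gin Dn_def emp_cov_form
      by (simp add: power2_sum sum.distrib sum_distrib_left distrib_left power2_eq_square[of "x _ \<bullet> a2"] mult_ac)
    finally show ?thesis by (simp add: sum_nonneg)
  qed
  define z where "z = sqrt l * r"
  have z0: "0 \<le> z" using l r by (simp add: z_def)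
  have z2: "z\<^sup>2 = l * r\<^sup>2" using l by (simp add: z_def power_mult_distrib)
  have zN: "z \<le> N" using N t z2 by (intro power2_le_imp_le[OF _ N(1)]) auto
  define F where "F = sqrt l * f"
  have F0: "0 \<le> F" using l f by (simp add: F_def)
  have lf: "\<bar>l * f0h\<bar> \<le> F * z"
  proof -
    have "\<bar>l * f0h\<bar> \<le> l * (f * r)" using f0 l by (simp add: abs_mult)
    also have "\<dots> = F * z" using l by (simp add: F_def z_def mult_ac)
    finally show ?thesis .
  qed
  have atil: "\<bar>atil\<bar> \<le> e * N" using noise by (simp add: atil_def)
  have zz: "z\<^sup>2 \<le> e * N + F * z"
    using ident Tq atil lf unfolding z2 by (simp add: distrib_left abs_le_iff)
  have NN: "N\<^sup>2 \<le> e * N + F * z + q * N * z + 3 / 8 * z\<^sup>2"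
  proof -
    have "Tn - t \<ge> - (q * N * z)" using conc by (simp add: Tn_def z_def abs_le_iff mult_ac)
    then show ?thesis using ident atil lf q2_le unfolding N(2) z2 by (simp add: distrib_left abs_le_iff)
  qed
  have Nle: "N \<le> (1 + 3 / 8) * ((1 + q) * F + (1 + q)\<^sup>2 * e)"
    by (rule regularised_error_scalar[OF N(1) z0 zN e F0 q _ zz NN]) simp
  have "a \<bullet> (D *v a) \<le> 2 * (a1 \<bullet> (D *v a1)) + 2 * (a2 \<bullet> (D *v a2))"
  proof -
    have par: "(u + v) \<bullet> (D *v (u + v)) \<le> 2 * (u \<bullet> (D *v u)) + 2 * (v \<bullet> (D *v v))" for u v
    proof -
      have "0 \<le> (u - v) \<bullet> (D *v (u - v))"
        using D by (cases "u - v = 0") (auto simp: pos_def_matrix_def less_imp_le simp del: right_minus_eq)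
      then show ?thesis
        by (simp add: matrix_vector_mult_diff_distrib matrix_vector_right_distrib inner_diff_left inner_diff_right inner_add_left inner_add_right)
    qed
    have "a = a1 + a2" by (simp add: a2_def)
    then show ?thesis using par[of a1 a2] by simp
  qed
  also have "\<dots> \<le> 8 / 3 * (a1 \<bullet> (Dn *v a1)) + 8 / 3 * q2"
    using low2[of a1] low2[of a2] by (simp add: q2_def)
  finally have "a \<bullet> (D *v a) + t \<le> 8 / 3 * (a1 \<bullet> (Dn *v a1)) + N\<^sup>2"
    using q2_le N(2) by simp
  also have "N\<^sup>2 \<le> (11 / 8 * ((1 + q) * F + (1 + q)\<^sup>2 * e))\<^sup>2"
    using Nle N(1) by (intro power_mono) auto
  finally show ?thesis by (simp add: Dn_def F_def)
qed

section \<open>The sample\<close>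

context covariance_form begin

text \<open>
  \<open>L w\<close> with the random curve replaced by a fixed one; needed for the curves of the sample.
\<close>

definition ly :: "(real \<Rightarrow> real) \<Rightarrow> (real \<Rightarrow> real) \<Rightarrow> real" where "ly y f = l2_inner T y (S f)"

lemma L_eq_ly: "L w f = ly (Y w) f" by (simp add: L_def ly_def)

lemma ly_measurable: "f \<in> l2_space T \<Longrightarrow> (\<lambda>y. ly y f) \<in> borel_measurable (l2_borel T)"
  unfolding ly_def by (intro l2_inner_measurable S_in)

lemma ly_bounded: "y \<in> l2_space T \<Longrightarrow> l2.bounded_functional (ly y) (l2_norm T y * \<kappa>)"
  unfolding ly_def[abs_def] by (rule inner_S_bounded_functional)

lemma ly_functional: "y \<in> l2_space T \<Longrightarrow> lin_functional (l2_space T) (ly y)"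
  by (rule l2.bounded_functionalD(1)[OF ly_bounded])

text \<open>
  The norm of a bilinear form is at most the Hilbert--Schmidt norm of its matrix, here with respect to an orthonormal
  sequence of \<open>L\<^sup>2\<close> on one side and of the regularised form on the other.
\<close>

lemma bilinear_bound_from_coordinates:
  assumes l: "0 < l" and e: "l2.orthonormal e" "l2.total (e :: nat \<Rightarrow> _)"
    and g: "fun_form.orthonormal (l2_space T) (Bl l) g" "fun_form.total (l2_space T) (Bl l) (g :: nat \<Rightarrow> _)"
    and b1: "\<And>h. h \<in> l2_space T \<Longrightarrow> lin_functional (l2_space T) (\<lambda>f. b f h)"
    and b2: "\<And>f. f \<in> l2_space T \<Longrightarrow> lin_functional (l2_space T) (b f)"
    and C: "0 \<le> C" "\<And>f h. f \<in> l2_space T \<Longrightarrow> h \<in> l2_space T \<Longrightarrow> \<bar>b f h\<bar> \<le> C * l2_norm T f * l2_norm T h"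
    and HS: "\<And>k. L2_set (\<lambda>(i, j). b (e i) (g j)) ({..<k} \<times> {..<k}) \<le> r" and r: "0 \<le> r"
    and f: "f \<in> l2_space T" and h: "h \<in> l2_space T"
  shows "\<bar>b f h\<bar> \<le> r * l2_norm T f * Nl l h"
proof -
  interpret B: complete_fun_form "l2_space T" "Bl l" by (rule Bl_complete[OF l])
  have eV: "e k \<in> l2_space T" for k using l2.orthonormal_in[OF e(1)] .
  have fb: "l2.bounded_functional (b f) (C * l2_norm T f)" if "f \<in> l2_space T" for f
    unfolding l2.bounded_functional_def using b2[OF that] C that l2.N_nonneg[OF that] by (auto simp: N_eq_l2_norm)
  have hb: "l2.bounded_functional (\<lambda>f. b f h) (C * l2_norm T h)"
    unfolding l2.bounded_functional_def using b1[OF h] C h l2.N_nonneg[OF h] by (auto simp: N_eq_l2_norm mult_ac)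
  have "L2_set (\<lambda>i. b (e i) h) {..<k} \<le> r * B.N h" for k
  proof -
    define c where "c i = b (e i) h" for i
    have cc: "c = (\<lambda>i. b (e i) h)" by (simp add: c_def fun_eq_iff)
    \<comment> \<open>the column of coordinates is tested against itself, which turns its norm into a functional of \<open>h\<close>\<close>
    define \<psi> where "\<psi> h' = (\<Sum>i<k. c i * b (e i) h')" for h'
    have \<psi>: "l2.bounded_functional \<psi> (\<Sum>i<k. \<bar>c i\<bar> * (C * l2_norm T (e i)))"
      unfolding l2.bounded_functional_def
    proof (intro conjI ballI)
      show "lin_functional (l2_space T) \<psi>"
        unfolding lin_functional_def \<psi>_def using lin_functionalD[OF b2[OF eV]]
        by (simp add: sum.distrib sum_distrib_left algebra_simps)
      show "0 \<le> (\<Sum>i<k. \<bar>c i\<bar> * (C * l2_norm T (e i)))"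
        using C(1) l2.N_nonneg[OF eV] by (intro sum_nonneg mult_nonneg_nonneg) (auto simp: N_eq_l2_norm)
      fix h' assume h': "h' \<in> l2_space T"
      have "\<bar>\<psi> h'\<bar> \<le> (\<Sum>i<k. \<bar>c i * b (e i) h'\<bar>)" unfolding \<psi>_def by (rule sum_abs)
      also have "\<dots> \<le> (\<Sum>i<k. \<bar>c i\<bar> * (C * l2_norm T (e i)) * l2.N h')"
        using C(2)[OF eV h'] by (intro sum_mono) (simp add: abs_mult N_eq_l2_norm mult_left_mono mult.assoc)
      finally show "\<bar>\<psi> h'\<bar> \<le> (\<Sum>i<k. \<bar>c i\<bar> * (C * l2_norm T (e i))) * l2.N h'" by (simp add: sum_distrib_right)
    qed
    have "\<bar>\<psi> h\<bar> \<le> (L2_set c {..<k} * r) * B.N h"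
    proof (rule B.functional_bound_from_coordinates[OF g h bounded_functional_l2_Bl[OF l \<psi>]])
      fix j
      define q where "q = max j k"
      have "(L2_set (\<lambda>i. \<psi> (g i)) {..<j})\<^sup>2 = (\<Sum>i<j. (\<Sum>a<k. c a * b (e a) (g i))\<^sup>2)"
        by (simp add: L2_set_def sum_nonneg \<psi>_def)
      also have "\<dots> \<le> (\<Sum>i<j. (L2_set c {..<k})\<^sup>2 * (L2_set (\<lambda>a. b (e a) (g i)) {..<k})\<^sup>2)"
        unfolding power_mult_distrib[symmetric] by (intro sum_mono abs_le_square_iff[THEN iffD1]) (simp add: abs_sum_mult_le_L2_set)
      also have "\<dots> = (L2_set c {..<k})\<^sup>2 * (\<Sum>i<j. \<Sum>a<k. (b (e a) (g i))\<^sup>2)"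
        by (simp add: sum_distrib_left L2_set_def sum_nonneg)
      also have "(\<Sum>i<j. \<Sum>a<k. (b (e a) (g i))\<^sup>2) = (\<Sum>z\<in>{..<k} \<times> {..<j}. (\<lambda>(i, j). (b (e i) (g j))\<^sup>2) z)"
        by (subst sum.swap) (simp add: sum.cartesian_product)
      also have "(L2_set c {..<k})\<^sup>2 * \<dots> \<le> (L2_set c {..<k})\<^sup>2 * (\<Sum>z\<in>{..<q} \<times> {..<q}. (\<lambda>(i, j). (b (e i) (g j))\<^sup>2) z)"
        by (intro mult_left_mono sum_mono2) (auto simp: q_def)
      also have "\<dots> = (L2_set c {..<k} * L2_set (\<lambda>(i, j). b (e i) (g j)) ({..<q} \<times> {..<q}))\<^sup>2"
        by (simp add: power_mult_distrib L2_set_def sum_nonneg split_beta)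
      also have "\<dots> \<le> (L2_set c {..<k} * r)\<^sup>2" by (intro power_mono mult_left_mono HS) auto
      finally show "L2_set (\<lambda>i. \<psi> (g i)) {..<j} \<le> L2_set c {..<k} * r"
        using r by (intro power2_le_imp_le[OF _ mult_nonneg_nonneg]) auto
    qed
    moreover have "\<psi> h = L2_set c {..<k} * L2_set c {..<k}"
      unfolding power2_eq_square[symmetric] by (simp add: \<psi>_def c_def L2_set_def sum_nonneg) (simp add: power2_eq_square)
    ultimately have le: "L2_set c {..<k} * L2_set c {..<k} \<le> L2_set c {..<k} * (r * B.N h)" by (simp add: mult.assoc)
    show ?thesis
    proof (cases "L2_set c {..<k} = 0")
      case True
      then show ?thesis using r B.N_nonneg[OF h] unfolding cc by simp
    next
      case False
      then have "0 < L2_set c {..<k}" by (simp add: less_le)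
      from mult_left_le_imp_le[OF le this] show ?thesis unfolding cc .
    qed
  qed
  from l2.functional_bound_from_coordinates[OF e f hb this] show ?thesis
    by (simp add: N_eq_l2_norm Nl_eq[OF l] mult_ac)
qed

end

locale sample_model = covariance_form T M S Y M2
  for T :: "real set" and M :: "'w measure" and S :: l2_op and Y :: "'w \<Rightarrow> real \<Rightarrow> real" and M2 :: real +
  fixes X :: "'w \<Rightarrow> real^'p" and Z :: "'w \<Rightarrow> real" and n :: nat
    and Zs :: "nat \<Rightarrow> 'w \<Rightarrow> real" and Xs :: "nat \<Rightarrow> 'w \<Rightarrow> real^'p" and Ys :: "nat \<Rightarrow> 'w \<Rightarrow> real \<Rightarrow> real" and M1 :: real
  assumes Zm [measurable]: "Z \<in> borel_measurable M"
    and indepXY: "independent_rvs M borel X (l2_borel T) Y"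
    and X0: "(LINT w|M. X w) = 0"
    and iid: "iid_copies M (obs_space T) (\<lambda>w. (Z w, X w, Y w)) n (\<lambda>i w. (Zs i w, Xs i w, Ys i w))"
    and n: "0 < n"
    and sg: "\<And>j. sub_gaussian_norm M (\<lambda>w. X w $ j) \<le> ennreal M1" and M1: "0 \<le> M1"
begin

text \<open>
  One generic observation, the sampled ones, and their common law.
\<close>

definition V where "V w = (Z w, X w, Y w)"
definition W where "W i w = (Zs i w, Xs i w, Ys i w)"
definition P where "P = distr M (obs_space T) V"

lemma Xm [measurable]: "X \<in> borel_measurable M" using indepXY by (simp add: independent_rvs_def)

lemma Vm [measurable]: "V \<in> measurable M (obs_space T)"
  unfolding V_def[abs_def] obs_space_def by measurable

lemma iid_W: "iid_sample M (obs_space T) P {1..n} W"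
  using iid prob_space_axioms unfolding iid_sample_def iid_copies_def P_def W_def[abs_def] V_def[abs_def] by auto

lemma I_ne: "{1..n} \<noteq> {}" using n by auto

lemma Wm: "i \<in> {1..n} \<Longrightarrow> W i \<in> measurable M (obs_space T)" by (rule iid_sampleD(3)[OF iid_W])

lemma Ys_in: "i \<in> {1..n} \<Longrightarrow> w \<in> space M \<Longrightarrow> Ys i w \<in> l2_space T"
  using measurable_space[OF Wm] by (fastforce simp: W_def obs_space_def space_pair_measure)

lemma transport_nn: "F \<in> borel_measurable (obs_space T) \<Longrightarrow> (\<integral>\<^sup>+u. F u \<partial>P) = (\<integral>\<^sup>+w. F (V w) \<partial>M)"
  unfolding P_def by (rule nn_integral_distr[OF Vm]) simp

lemma transport: "F \<in> borel_measurable (obs_space T) \<Longrightarrow> (LINT u|P. F u) = (LINT w|M. (F (V w) :: real))"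
  unfolding P_def by (rule integral_distr[OF Vm])

lemma transport_integrable: "F \<in> borel_measurable (obs_space T) \<Longrightarrow> integrable P F \<longleftrightarrow> integrable M (\<lambda>w. F (V w) :: real)"
  unfolding P_def by (rule integrable_distr_eq[OF Vm])

lemma distr_W: "i \<in> {1..n} \<Longrightarrow> distr M (obs_space T) (W i) = P" by (rule iid_sampleD(4)[OF iid_W])

lemma transport_W:
  assumes "i \<in> {1..n}" "F \<in> borel_measurable (obs_space T)"
  shows "(LINT w|M. F (W i w)) = (LINT w|M. (F (V w) :: real))" "integrable M (\<lambda>w. F (W i w)) \<longleftrightarrow> integrable M (\<lambda>w. F (V w))"
  using integral_distr[OF Wm[OF assms(1)] assms(2)] integrable_distr_eq[OF Wm[OF assms(1)] assms(2)]
    transport[OF assms(2)] transport_integrable[OF assms(2)] distr_W[OF assms(1)] by simp_all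

lemma obs_measurable [measurable]:
  "fst \<in> borel_measurable (obs_space T)" "(\<lambda>u. fst (snd u)) \<in> borel_measurable (obs_space T)"
  "(\<lambda>u. snd (snd u)) \<in> measurable (obs_space T) (l2_borel T)"
  unfolding obs_space_def by measurable

lemma obs_ly [measurable]: "f \<in> l2_space T \<Longrightarrow> (\<lambda>u. ly (snd (snd u)) f) \<in> borel_measurable (obs_space T)"
  by (rule measurable_compose[OF obs_measurable(3) ly_measurable])

lemma Ys_bound: "AE w in M. \<forall>i\<in>{1..n}. l2_norm T (Ys i w) \<le> M2"
proof (rule AE_finite_allI)
  fix i assume i: "i \<in> {1..n}"
  have "AE u in P. l2_norm T (snd (snd u)) \<le> M2"
    unfolding P_def by (subst AE_distr_iff[OF Vm]) (use Yb l2_norm_measurable in \<open>auto simp: V_def\<close>)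
  then have "AE u in distr M (obs_space T) (W i). l2_norm T (snd (snd u)) \<le> M2" by (simp only: distr_W[OF i])
  then have "AE w in M. l2_norm T (snd (snd (W i w))) \<le> M2" by (rule AE_distrD[OF Wm[OF i]])
  then show "AE w in M. l2_norm T (Ys i w) \<le> M2" by (simp add: W_def)
qed simp

lemma Xj [measurable]: "(\<lambda>w. X w $ j) \<in> borel_measurable M"
  using borel_measurable_inner[OF Xm borel_measurable_const[of "axis j 1"]] by (simp add: inner_axis)

lemma X_moments:
  "integrable M (\<lambda>w. (X w $ j) ^ (2 * k))" "(LINT w|M. (X w $ j) ^ (2 * k)) \<le> M1 ^ (2 * k) * gauss_moment k"
  "(\<integral>\<^sup>+w. ennreal ((X w $ j) ^ (2 * k)) \<partial>M) \<le> ennreal (M1 ^ (2 * k) * gauss_moment k)"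
  using sub_gaussian_even_moment[OF prob_space_axioms Xj sg M1, of j k] by simp_all

lemma X_sq: "integrable M (\<lambda>w. (X w $ j)\<^sup>2)" "(LINT w|M. (X w $ j)\<^sup>2) \<le> M1\<^sup>2"
  using X_moments(1,2)[of j 1] by (simp_all add: gauss_moment_def)

lemma X_int: "integrable M (\<lambda>w. X w $ j)"
  using X_sq(1) by (rule square_integrable_imp_integrable[OF Xj])

lemma X_vec_int: "integrable M X"
proof (rule Bochner_Integration.integrable_bound[where f = "\<lambda>w. \<Sum>j\<in>UNIV. \<bar>X w $ j\<bar>"])
  show "integrable M (\<lambda>w. \<Sum>j\<in>UNIV. \<bar>X w $ j\<bar>)" using X_int by (intro Bochner_Integration.integrable_sum integrable_abs)
  show "AE w in M. norm (X w) \<le> norm (\<Sum>j\<in>UNIV. \<bar>X w $ j\<bar>)"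
    by (intro AE_I2) (use norm_le_l1_cart in \<open>auto intro: order_trans\<close>)
qed measurable

lemma X_mean: "(LINT w|M. X w \<bullet> v) = 0"
  using integral_inner_left[OF X_vec_int, of v] X0 by simp

lemma indep_real:
  assumes f: "f \<in> borel_measurable borel" and g: "g \<in> borel_measurable (l2_borel T)"
    and fi: "integrable M (\<lambda>w. f (X w))" and gi: "integrable M (\<lambda>w. g (Y w))"
  shows "(LINT w|M. f (X w) * g (Y w)) = (LINT w|M. f (X w)) * (LINT w|M. (g (Y w) :: real))"
proof -
  have "indep_var borel (\<lambda>w. f (X w)) borel (\<lambda>w. g (Y w))"
    unfolding indep_var_eq
  proof (intro conjI)
    show "random_variable borel (\<lambda>w. f (X w))" using fi by simp
    show "random_variable borel (\<lambda>w. g (Y w))" using gi by simp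
    have ind: "indep_set (sets (vimage_algebra (space M) X borel)) (sets (vimage_algebra (space M) Y (l2_borel T)))"
      using indepXY by (simp add: independent_rvs_def generated_algebra_def)
    have sig: "sigma_sets (space M) {(\<lambda>w. h (R w)) -` A \<inter> space M |A. A \<in> sets borel} \<subseteq> sets (vimage_algebra (space M) R N)"
      if R: "R \<in> measurable M N" and h: "h \<in> borel_measurable N" for R :: "'w \<Rightarrow> 'c" and N and h :: "'c \<Rightarrow> real"
    proof -
      have "{(\<lambda>w. h (R w)) -` A \<inter> space M |A. A \<in> sets borel} \<subseteq> sets (vimage_algebra (space M) R N)"
      proof
        fix B assume "B \<in> {(\<lambda>w. h (R w)) -` A \<inter> space M |A. A \<in> sets borel}"
        then obtain A where A: "A \<in> sets borel" "B = (\<lambda>w. h (R w)) -` A \<inter> space M" by auto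
        have "B = R -` (h -` A \<inter> space N) \<inter> space M" using A(2) measurable_space[OF R] by auto
        moreover have "h -` A \<inter> space N \<in> sets N" using h A(1) by (rule measurable_sets)
        ultimately show "B \<in> sets (vimage_algebra (space M) R N)" by (simp only:) (rule in_vimage_algebra)
      qed
      then show ?thesis using sets.sigma_sets_subset[of _ "vimage_algebra (space M) R N"] by simp
    qed
    show "indep_set (sigma_sets (space M) {(\<lambda>w. f (X w)) -` A \<inter> space M |A. A \<in> sets borel})
       (sigma_sets (space M) {(\<lambda>w. g (Y w)) -` A \<inter> space M |A. A \<in> sets borel})"
      using ind sig[OF Xm f] sig[OF Ym g] unfolding indep_set_def
      by (elim indep_sets_mono_sets) (auto split: bool.split)
  qed
  then show ?thesis using indep_var_lebesgue_integral[OF _ fi gi] by simp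
qed

lemma X_L_mean:
  assumes f: "f \<in> l2_space T"
  shows "integrable M (\<lambda>w. (X w \<bullet> v) * L w f)" "(LINT w|M. (X w \<bullet> v) * L w f) = 0"
proof -
  have Xv: "integrable M (\<lambda>w. X w \<bullet> v)" using X_vec_int by simp
  have Li: "integrable M (\<lambda>w. L w f)"
    by (rule integrable_const_bound[OF L_AE_bound[OF f, folded real_norm_def] L_measurable[OF f]])
  show "(LINT w|M. (X w \<bullet> v) * L w f) = 0"
    using indep_real[of "\<lambda>x. x \<bullet> v" "\<lambda>y. ly y f"] ly_measurable[OF f] Xv Li X_mean[of v] by (simp add: L_eq_ly)
  show "integrable M (\<lambda>w. (X w \<bullet> v) * L w f)"
  proof (rule Bochner_Integration.integrable_bound)
    show "integrable M (\<lambda>w. (m * l2_norm T f) * (X w \<bullet> v))" using Xv by simp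
    show "(\<lambda>w. (X w \<bullet> v) * L w f) \<in> borel_measurable M" using L_measurable[OF f] by measurable
    show "AE w in M. norm ((X w \<bullet> v) * L w f) \<le> norm (m * l2_norm T f * (X w \<bullet> v))"
      using L_AE_bound[OF f]
    proof eventually_elim
      case (elim w)
      have "\<bar>X w \<bullet> v\<bar> * \<bar>L w f\<bar> \<le> \<bar>X w \<bullet> v\<bar> * \<bar>m * l2_norm T f\<bar>" by (intro mult_left_mono order_trans[OF elim abs_ge_self]) simp
      then show ?case by (simp add: abs_mult mult_ac)
    qed
  qed
qed

end

section \<open>Concentration of the empirical moments\<close>

text \<open>
  The usual choice of \<open>s\<close> in Bernstein's inequality gives the exponent \<open>- r\<^sup>2 / (2 * (A + b * r / 3))\<close>.
\<close>

lemma bernstein_exponent: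
  fixes A b r Lg :: real
  assumes A: "0 < A" and b: "0 < b" and r: "0 < r" and big: "2 * Lg * (A + b * r / 3) \<le> r\<^sup>2"
  defines "s \<equiv> r / (A + b * r / 3)"
  shows "0 < s" "s * b < 3" "s\<^sup>2 * A / (2 * (1 - s * b / 3)) - s * r \<le> - Lg"
proof -
  define q where "q = A + b * r / 3"
  have q: "0 < q" using A b r by (simp add: q_def add_pos_pos)
  have s: "s = r / q" by (simp add: s_def q_def)
  show "0 < s" using r q by (simp add: s)
  have one: "1 - s * b / 3 = A / q"
  proof -
    have "1 - s * b / 3 = (q - b * r / 3) / q" using q by (simp add: s field_simps)
    then show ?thesis by (simp add: q_def)
  qed
  have "0 < A / q" using A q by simp
  then show "s * b < 3" using one by simp
  have "s\<^sup>2 * A / (2 * (1 - s * b / 3)) = r\<^sup>2 / (2 * q)"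
    unfolding one unfolding s using A q by (simp add: power2_eq_square field_simps)
  moreover have "s * r = r\<^sup>2 / q" by (simp add: s power2_eq_square)
  moreover have "Lg \<le> r\<^sup>2 / (2 * q)" using big q by (simp add: q_def[symmetric] pos_le_divide_eq mult_ac)
  moreover have "r\<^sup>2 / q = 2 * (r\<^sup>2 / (2 * q))" by simp
  ultimately show "s\<^sup>2 * A / (2 * (1 - s * b / 3)) - s * r \<le> - Lg" by linarith
qed

lemma L2_set_product: "L2_set (\<lambda>(i, j). f i * g j) (A \<times> B) = L2_set f A * L2_set g B"
proof -
  have "(\<Sum>z\<in>A \<times> B. (case z of (i, j) \<Rightarrow> f i * g j)\<^sup>2) = (\<Sum>i\<in>A. (f i)\<^sup>2) * (\<Sum>j\<in>B. (g j)\<^sup>2)"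
    unfolding sum_product sum.cartesian_product by (intro sum.cong) (auto simp: power_mult_distrib)
  then show ?thesis by (simp add: L2_set_def real_sqrt_mult)
qed

context sample_model begin

text \<open>
  The matrix of the form \<open>L\<^sub>i \<otimes> L\<^sub>i - t\<close> in the two sequences is a centred random vector.  Its Hilbert--Schmidt norm is
  almost surely at most \<open>2 * m\<^sup>2 / sqrt l\<close> by Bessel's inequality on both sides, while the second moment of that norm is
  at most \<open>m\<^sup>2 * Db\<close>, since the sum over the regularised side is the sum of the \<open>t (g k) (g k)\<close>.  Hence a
  Bernstein bound with the effective dimension in the variance.
\<close>

lemma concentration_covariance:
  assumes l: "0 < l" and e: "l2.orthonormal (e :: nat \<Rightarrow> _)"
    and g: "fun_form.orthonormal (l2_space T) (Bl l) (g :: nat \<Rightarrow> _)"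
    and Db: "0 < Db" "\<And>K. (\<Sum>k<K. t (g k) (g k)) \<le> Db" and m1: "1 \<le> m" and Lg: "1 / 2 \<le> Lg" and \<delta>: "2 * exp (- Lg) \<le> \<delta>"
  defines "r \<equiv> 2 * m\<^sup>2 * Lg * (1 / sqrt l + sqrt (real n * Db))"
  defines "Bad \<equiv> {w\<in>space M. \<exists>k. r < L2_set (\<lambda>z. \<Sum>i\<in>{1..n}. (\<lambda>(a, b) u. ly (snd (snd u)) (e a) * ly (snd (snd u)) (g b) - t (e a) (g b)) z (W i w)) ({..<k} \<times> {..<k})}"
  shows "Bad \<in> sets M" "measure M Bad \<le> \<delta>"
proof -
  interpret B: complete_fun_form "l2_space T" "Bl l" by (rule Bl_complete[OF l])
  have eV: "e k \<in> l2_space T" for k using l2.orthonormal_in[OF e] .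
  have gV: "g k \<in> l2_space T" for k using B.orthonormal_in[OF g] .
  define Vc :: "nat \<times> nat \<Rightarrow> real \<times> (real^'p) \<times> (real \<Rightarrow> real) \<Rightarrow> real"
    where "Vc = (\<lambda>(a, b) u. ly (snd (snd u)) (e a) * ly (snd (snd u)) (g b) - t (e a) (g b))"
  define K where "K k = {..<k} \<times> {..<k::nat}" for k
  have Vcm: "Vc z \<in> borel_measurable (obs_space T)" for z
    unfolding Vc_def split_beta
    by (intro borel_measurable_diff borel_measurable_times borel_measurable_const obs_ly eV gV)
  define U where "U = (\<lambda>(a, b) w. L w (e a) * L w (g b))"
  define \<tau> where "\<tau> = (\<lambda>(a, b). t (e a) (g b))"
  have Vc_V: "Vc z (V w) = U z w - \<tau> z" for z w by (simp add: Vc_def U_def \<tau>_def V_def L_eq_ly split_beta)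
  have Ui: "integrable M (U z)" for z unfolding U_def split_beta by (rule L_mult_integrable[OF eV gV])
  have EU: "(LINT w|M. U z w) = \<tau> z" for z by (simp add: U_def \<tau>_def t_def split_beta)
  have int: "integrable P (Vc z)" for z
    unfolding transport_integrable[OF Vcm] Vc_V using Ui by simp
  have mean: "(LINT u|P. Vc z u) = 0" for z
    unfolding transport[OF Vcm] Vc_V using Ui EU by (simp add: prob_space)
  have Unorm: "AE w in M. L2_set (\<lambda>z. U z w) (K k) \<le> m\<^sup>2 / sqrt l \<and> (L2_set (\<lambda>z. U z w) (K k))\<^sup>2 \<le> m\<^sup>2 * (\<Sum>b<k. (L w (g b))\<^sup>2)" for k
    using L_AE
  proof eventually_elim
    case (elim w)
    then have w: "w \<in> space M" and Lw: "l2.bounded_functional (L w) m" by auto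
    have eq: "L2_set (\<lambda>z. U z w) (K k) = L2_set (\<lambda>a. L w (e a)) {..<k} * L2_set (\<lambda>b. L w (g b)) {..<k}"
      unfolding K_def L2_set_product[symmetric] U_def by (intro L2_set_cong) auto
    have 1: "L2_set (\<lambda>a. L w (e a)) {..<k} \<le> m"
      unfolding L2_set_def by (rule real_le_lsqrt[OF m_nonneg l2.bessel[OF e _ Lw]]) simp
    have 2: "L2_set (\<lambda>b. L w (g b)) {..<k} \<le> m / sqrt l"
      unfolding L2_set_def by (rule real_le_lsqrt[OF _ B.bessel[OF g _ bounded_functional_l2_Bl[OF l Lw]]]) (use l m_nonneg in auto)
    have "L2_set (\<lambda>z. U z w) (K k) \<le> m * (m / sqrt l)"
      unfolding eq using 1 2 m_nonneg by (intro mult_mono) auto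
    moreover have "(L2_set (\<lambda>z. U z w) (K k))\<^sup>2 \<le> m\<^sup>2 * (\<Sum>b<k. (L w (g b))\<^sup>2)"
    proof -
      have "(L2_set (\<lambda>a. L w (e a)) {..<k})\<^sup>2 \<le> m\<^sup>2" using 1 by (intro power_mono) auto
      then have "(L2_set (\<lambda>a. L w (e a)) {..<k})\<^sup>2 * (\<Sum>b<k. (L w (g b))\<^sup>2) \<le> m\<^sup>2 * (\<Sum>b<k. (L w (g b))\<^sup>2)"
        by (intro mult_right_mono sum_nonneg) auto
      then show ?thesis unfolding eq power_mult_distrib by (simp add: L2_set_def sum_nonneg)
    qed
    ultimately show ?case by (simp add: power2_eq_square)
  qed
  have \<tau>norm: "L2_set \<tau> (K k) \<le> m\<^sup>2 / sqrt l" for k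
  proof (cases "L2_set \<tau> (K k) = 0")
    case False
    then have pos: "0 < L2_set \<tau> (K k)" by (simp add: less_le)
    have "L2_set \<tau> (K k) * L2_set \<tau> (K k) = (LINT w|M. (\<Sum>z\<in>K k. \<tau> z * U z w))"
      using Ui by (simp add: Bochner_Integration.integral_sum EU L2_set_def sum_nonneg power2_eq_square)
    also have "\<dots> \<le> (LINT w|M. L2_set \<tau> (K k) * (m\<^sup>2 / sqrt l))"
    proof (rule integral_mono_AE)
      show "AE w in M. (\<Sum>z\<in>K k. \<tau> z * U z w) \<le> L2_set \<tau> (K k) * (m\<^sup>2 / sqrt l)"
        using Unorm[of k]
      proof eventually_elim
        case (elim w)
        have "(\<Sum>z\<in>K k. \<tau> z * U z w) \<le> L2_set \<tau> (K k) * L2_set (\<lambda>z. U z w) (K k)"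
          using abs_sum_mult_le_L2_set[of \<tau> "\<lambda>z. U z w" "K k"] by simp
        also have "\<dots> \<le> L2_set \<tau> (K k) * (m\<^sup>2 / sqrt l)" using elim by (intro mult_left_mono) auto
        finally show ?case .
      qed
    qed (use Ui in auto)
    also have "\<dots> = L2_set \<tau> (K k) * (m\<^sup>2 / sqrt l)" by (simp add: prob_space)
    finally show ?thesis using pos by (rule mult_left_le_imp_le)
  qed (use l in simp)
  \<comment> \<open>almost sure bound and second moment of the norm of one summand\<close>
  define b where "b = 2 * m\<^sup>2 / sqrt l"
  define v where "v = m\<^sup>2 * Db"
  have b0: "0 < b" and v0: "0 < v" using m1 l Db by (auto simp: b_def v_def)
  define Q where "Q k w = L2_set (\<lambda>z. U z w - \<tau> z) (K k)" for k w
  have Qm: "Q k \<in> borel_measurable M" for k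
    unfolding Q_def[abs_def] using Ui by (intro borel_measurable_L2_set borel_measurable_diff borel_measurable_const) auto
  have Qb: "AE w in M. \<bar>Q k w\<bar> \<le> b" for k
    using Unorm[of k]
  proof eventually_elim
    case (elim w)
    have "Q k w \<le> L2_set (\<lambda>z. U z w) (K k) + L2_set (\<lambda>z. - \<tau> z) (K k)"
      unfolding Q_def using L2_set_triangle_ineq[of "\<lambda>z. U z w" "\<lambda>z. - \<tau> z" "K k"] by simp
    also have "L2_set (\<lambda>z. - \<tau> z) (K k) = L2_set \<tau> (K k)" by (simp add: L2_set_def)
    finally have "Q k w \<le> b" using elim \<tau>norm[of k] by (simp add: b_def)
    moreover have "0 \<le> Q k w" by (simp add: Q_def)
    ultimately show ?case by simp
  qed
  have Qv: "(\<integral>\<^sup>+w. ennreal ((Q k w)\<^sup>2) \<partial>M) \<le> ennreal v" for k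
  proof -
    have U2: "integrable M (\<lambda>w. (U z w)\<^sup>2)" for z
    proof (rule integrable_const_bound[where B = "(m\<^sup>2 * l2_norm T (e (fst z)) * l2_norm T (g (snd z)))\<^sup>2"])
      show "AE w in M. norm ((U z w)\<^sup>2) \<le> (m\<^sup>2 * l2_norm T (e (fst z)) * l2_norm T (g (snd z)))\<^sup>2"
        using L_mult_AE_bound[OF eV gV, of "fst z" "snd z"]
        by eventually_elim (auto simp: U_def split_beta abs_le_square_iff[symmetric] intro: order_trans[OF _ abs_ge_self])
    qed (use Ui in auto)
    have i: "integrable M (\<lambda>w. (U z w - \<tau> z)\<^sup>2)" for z
      using U2[of z] Ui[of z] by (simp add: power2_diff)
    have "(\<integral>\<^sup>+w. ennreal ((Q k w)\<^sup>2) \<partial>M) = (\<integral>\<^sup>+w. ennreal (\<Sum>z\<in>K k. (U z w - \<tau> z)\<^sup>2) \<partial>M)"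
      by (simp add: Q_def L2_set_def sum_nonneg)
    also have "\<dots> = ennreal (LINT w|M. (\<Sum>z\<in>K k. (U z w - \<tau> z)\<^sup>2))"
      using i by (intro nn_integral_eq_integral Bochner_Integration.integrable_sum) (auto simp: sum_nonneg)
    also have "\<dots> \<le> ennreal v"
    proof (rule ennreal_leI)
      have "(LINT w|M. (\<Sum>z\<in>K k. (U z w - \<tau> z)\<^sup>2)) = (\<Sum>z\<in>K k. (LINT w|M. (U z w - \<tau> z)\<^sup>2))"
        using i by (simp add: Bochner_Integration.integral_sum)
      also have "\<dots> \<le> (\<Sum>z\<in>K k. (LINT w|M. (U z w)\<^sup>2))"
        using variance_eq[OF Ui U2] by (intro sum_mono) (simp add: EU)
      also have "\<dots> = (LINT w|M. (L2_set (\<lambda>z. U z w) (K k))\<^sup>2)"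
        using U2 by (simp add: Bochner_Integration.integral_sum L2_set_def sum_nonneg)
      also have "\<dots> \<le> (LINT w|M. m\<^sup>2 * (\<Sum>b<k. (L w (g b))\<^sup>2))"
      proof (rule integral_mono_AE)
        show "integrable M (\<lambda>w. (L2_set (\<lambda>z. U z w) (K k))\<^sup>2)" using U2 by (simp add: L2_set_def sum_nonneg)
        show "integrable M (\<lambda>w. m\<^sup>2 * (\<Sum>b<k. (L w (g b))\<^sup>2))"
          unfolding power2_eq_square[of "L _ _"] by (intro integrable_mult_right Bochner_Integration.integrable_sum L_mult_integrable gV)
        show "AE w in M. (L2_set (\<lambda>z. U z w) (K k))\<^sup>2 \<le> m\<^sup>2 * (\<Sum>b<k. (L w (g b))\<^sup>2)" using Unorm[of k] by eventually_elim simp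
      qed
      also have "\<dots> = m\<^sup>2 * (\<Sum>b<k. t (g b) (g b))"
        using L_mult_integrable[OF gV gV] by (simp add: t_def Bochner_Integration.integral_sum power2_eq_square)
      also have "\<dots> \<le> v" unfolding v_def by (intro mult_left_mono Db) simp
      finally show "(LINT w|M. (\<Sum>z\<in>K k. (U z w - \<tau> z)\<^sup>2)) \<le> v" .
    qed
    finally show ?thesis .
  qed
  have r0: "0 < r" unfolding r_def using m1 Lg l Db n by (intro mult_pos_pos add_pos_nonneg) auto
  have A0: "0 < real n * v" using n v0 by simp
  have big: "2 * Lg * (real n * v + b * r / 3) \<le> r\<^sup>2"
  proof -
    define y where "y = sqrt (real n * Db)"
    have y: "0 \<le> y" "y * y = real n * Db" using Db by (auto simp: y_def)
    have rr: "r = Lg * b + 2 * m\<^sup>2 * Lg * y" by (simp add: r_def b_def y_def algebra_simps)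
    have "2 * Lg * (real n * v) = 2 * Lg * m\<^sup>2 * (y * y)" by (simp add: v_def y mult_ac)
    also have "\<dots> \<le> (2 * m\<^sup>2 * Lg * y) * (2 * m\<^sup>2 * Lg * y)"
    proof -
      have "1 * 1 \<le> (2 * Lg) * m\<^sup>2" using Lg m1 by (intro mult_mono) auto
      moreover have "0 \<le> (2 * Lg * m\<^sup>2) * (y * y)" using Lg y(1) by (intro mult_nonneg_nonneg) auto
      ultimately have "(2 * Lg * m\<^sup>2) * (y * y) * 1 \<le> (2 * Lg * m\<^sup>2) * (y * y) * (2 * Lg * m\<^sup>2)"
        by (intro mult_left_mono) auto
      then show ?thesis by (simp add: mult_ac)
    qed
    also have "\<dots> \<le> r * (2 * m\<^sup>2 * Lg * y)"
      unfolding rr using Lg b0 y by (intro mult_right_mono) auto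
    finally have 1: "2 * Lg * (real n * v) \<le> r * (2 * m\<^sup>2 * Lg * y)" .
    have "2 * Lg * (b * r / 3) \<le> Lg * b * r" using Lg b0 r0 by (simp add: mult_ac)
    with 1 have "2 * Lg * (real n * v + b * r / 3) \<le> r * (2 * m\<^sup>2 * Lg * y) + Lg * b * r" by (simp add: distrib_left)
    also have "\<dots> = r * (Lg * b + 2 * m\<^sup>2 * Lg * y)" by (simp add: algebra_simps)
    also have "\<dots> = r\<^sup>2" by (simp only: rr[symmetric]) (simp only: power2_eq_square)
    finally show ?thesis .
  qed
  define s where "s = r / (real n * v + b * r / 3)"
  note bern = bernstein_exponent[OF A0 b0 r0 big, folded s_def]
  define c where "c = s\<^sup>2 * v / (2 * (1 - s * b / 3))"
  have Cb: "(\<integral>\<^sup>+u. ennreal (exp (s * L2_set (\<lambda>z. Vc z u) (K k)) - s * L2_set (\<lambda>z. Vc z u) (K k)) \<partial>P) \<le> ennreal (exp c)" for k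
  proof -
    have meas: "(\<lambda>u. ennreal (exp (s * L2_set (\<lambda>z. Vc z u) (K k)) - s * L2_set (\<lambda>z. Vc z u) (K k))) \<in> borel_measurable (obs_space T)"
      using Vcm by measurable
    have "(\<integral>\<^sup>+u. ennreal (exp (s * L2_set (\<lambda>z. Vc z u) (K k)) - s * L2_set (\<lambda>z. Vc z u) (K k)) \<partial>P)
       = (\<integral>\<^sup>+w. ennreal (exp (s * \<bar>Q k w\<bar>) - s * \<bar>Q k w\<bar>) \<partial>M)"
      unfolding transport_nn[OF meas] by (simp add: Vc_V Q_def)
    also have "\<dots> \<le> ennreal (exp c)"
      unfolding c_def by (rule bounded_exp_bound[OF prob_space_axioms Qm Qb Qv]) (use v0 bern in auto)
    finally show ?thesis .
  qed
  have fin: "2 * exp (real (card {1..n}) * c - s * r) \<le> \<delta>"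
  proof -
    have "real n * c - s * r \<le> - Lg" using bern(3) by (simp add: c_def mult_ac)
    then have "2 * exp (real (card {1..n}) * c - s * r) \<le> 2 * exp (- Lg)" by simp
    then show ?thesis using \<delta> by linarith
  qed
  have BadE: "Bad = {w\<in>space M. \<exists>k. r < L2_set (\<lambda>z. \<Sum>i\<in>{1..n}. Vc z (W i w)) (K k)}"
    by (simp add: Bad_def Vc_def K_def)
  have inc: "incseq K" by (auto simp: K_def incseq_def)
  have finK: "finite (K k)" for k by (simp add: K_def)
  show "Bad \<in> sets M" "measure M Bad \<le> \<delta>"
    unfolding BadE by (rule iid_norm_tail[OF iid_W I_ne finK inc int mean bern(1) Cb fin])+
qed

text \<open>
  The products \<open>X\<^sub>j L(e a)\<close> are centred because \<open>X\<close> and \<open>Y\<close> are independent, and as a vector in \<open>a\<close> they have norm at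
  most \<open>m * \<bar>X\<^sub>j\<bar>\<close>, a sub-Gaussian variable.
\<close>

lemma concentration_cross:
  fixes j :: 'p
  assumes e: "l2.orthonormal (e :: nat \<Rightarrow> _)" and m0: "0 < m" and M10: "0 < M1" and Lg: "0 < Lg" and \<delta>: "2 * exp (- Lg) \<le> \<delta>"
  defines "r \<equiv> 2 * m * M1 * sqrt (real n * Lg)"
  defines "Bad \<equiv> {w\<in>space M. \<exists>k. r < L2_set (\<lambda>a. \<Sum>i\<in>{1..n}. (\<lambda>a u. fst (snd u) $ j * ly (snd (snd u)) (e a)) a (W i w)) {..<k}}"
  shows "Bad \<in> sets M" "measure M Bad \<le> \<delta>"
proof -
  have eV: "e k \<in> l2_space T" for k using l2.orthonormal_in[OF e] .
  define Vc :: "nat \<Rightarrow> real \<times> (real^'p) \<times> (real \<Rightarrow> real) \<Rightarrow> real"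
    where "Vc = (\<lambda>a u. fst (snd u) $ j * ly (snd (snd u)) (e a))"
  have xj: "(\<lambda>u. fst (snd u) $ j) \<in> borel_measurable (obs_space T)"
    using borel_measurable_inner[OF obs_measurable(2) borel_measurable_const[of "axis j 1"]] by (simp add: inner_axis)
  have Vcm: "Vc z \<in> borel_measurable (obs_space T)" for z
    unfolding Vc_def by (intro borel_measurable_times xj obs_ly eV)
  have Vc_V: "Vc a (V w) = (X w \<bullet> axis j 1) * L w (e a)" for a w by (simp add: Vc_def V_def L_eq_ly inner_axis)
  have int: "integrable P (Vc z)" for z unfolding transport_integrable[OF Vcm] Vc_V by (rule X_L_mean(1)[OF eV])
  have mean: "(LINT u|P. Vc z u) = 0" for z unfolding transport[OF Vcm] Vc_V by (rule X_L_mean(2)[OF eV])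
  have r0: "0 < r" using m0 M10 Lg n by (simp add: r_def)
  have r2: "r\<^sup>2 = 4 * m\<^sup>2 * M1\<^sup>2 * (real n * Lg)" using Lg by (simp add: r_def power_mult_distrib)
  \<comment> \<open>minimises \<open>real n * (s * m)\<^sup>2 * M1\<^sup>2 - s * r\<close>\<close>
  define s where "s = r / (2 * real n * m\<^sup>2 * M1\<^sup>2)"
  have s0: "0 < s" using r0 m0 M10 n by (simp add: s_def)
  define c where "c = (s * m)\<^sup>2 * M1\<^sup>2"
  have Cb: "(\<integral>\<^sup>+u. ennreal (exp (s * L2_set (\<lambda>z. Vc z u) {..<k}) - s * L2_set (\<lambda>z. Vc z u) {..<k}) \<partial>P) \<le> ennreal (exp c)" for k
  proof -
    have meas: "(\<lambda>u. ennreal (exp (s * L2_set (\<lambda>z. Vc z u) {..<k}) - s * L2_set (\<lambda>z. Vc z u) {..<k})) \<in> borel_measurable (obs_space T)"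
      using Vcm by measurable
    have "(\<integral>\<^sup>+u. ennreal (exp (s * L2_set (\<lambda>z. Vc z u) {..<k}) - s * L2_set (\<lambda>z. Vc z u) {..<k}) \<partial>P)
       = (\<integral>\<^sup>+w. ennreal (exp (s * L2_set (\<lambda>z. Vc z (V w)) {..<k}) - s * L2_set (\<lambda>z. Vc z (V w)) {..<k}) \<partial>M)"
      by (rule transport_nn[OF meas])
    also have "\<dots> \<le> (\<integral>\<^sup>+w. ennreal (exp (s * m * \<bar>X w $ j\<bar>) - s * m * \<bar>X w $ j\<bar>) \<partial>M)"
    proof (intro nn_integral_mono_AE, use L_AE in eventually_elim)
      fix w assume "w \<in> space M \<and> l2.bounded_functional (L w) m"
      then have Lw: "l2.bounded_functional (L w) m" by simp
      have "L2_set (\<lambda>z. Vc z (V w)) {..<k} = \<bar>X w $ j\<bar> * L2_set (\<lambda>a. L w (e a)) {..<k}"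
        unfolding Vc_V by (simp add: inner_axis L2_set_def power_mult_distrib sum_distrib_left[symmetric] real_sqrt_mult)
      also have "\<dots> \<le> \<bar>X w $ j\<bar> * m"
        unfolding L2_set_def by (intro mult_left_mono real_le_lsqrt[OF m_nonneg l2.bessel[OF e _ Lw]]) auto
      finally have "s * L2_set (\<lambda>z. Vc z (V w)) {..<k} \<le> s * m * \<bar>X w $ j\<bar>" using s0 by (simp add: mult_ac)
      then show "ennreal (exp (s * L2_set (\<lambda>z. Vc z (V w)) {..<k}) - s * L2_set (\<lambda>z. Vc z (V w)) {..<k})
          \<le> ennreal (exp (s * m * \<bar>X w $ j\<bar>) - s * m * \<bar>X w $ j\<bar>)"
        using s0 by (intro ennreal_leI exp_minus_self_mono) auto
    qed
    also have "\<dots> \<le> ennreal (exp c)"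
      unfolding c_def by (rule sub_gaussian_exp_bound[OF Xj _ M1 X_moments(3)]) (use s0 m0 in auto)
    finally show ?thesis .
  qed
  have fin: "2 * exp (real (card {1..n}) * c - s * r) \<le> \<delta>"
  proof -
    have nz: "real n \<noteq> 0" "m \<noteq> 0" "M1 \<noteq> 0" using n m0 M10 by auto
    have "real n * c = r\<^sup>2 / (4 * real n * m\<^sup>2 * M1\<^sup>2)" using nz by (simp add: c_def s_def power2_eq_square field_simps)
    also have "\<dots> = Lg" unfolding r2 using nz by (simp add: power2_eq_square field_simps)
    finally have 1: "real n * c = Lg" .
    have "s * r = r\<^sup>2 / (2 * real n * m\<^sup>2 * M1\<^sup>2)" by (simp add: s_def power2_eq_square)
    also have "\<dots> = 2 * Lg" unfolding r2 using nz by (simp add: power2_eq_square field_simps)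
    finally show ?thesis using 1 \<delta> by simp
  qed
  have BadE: "Bad = {w\<in>space M. \<exists>k. r < L2_set (\<lambda>z. \<Sum>i\<in>{1..n}. Vc z (W i w)) {..<k}}"
    by (simp add: Bad_def Vc_def)
  have inc: "incseq (\<lambda>k. {..<k::nat})" by (auto simp: incseq_def)
  show "Bad \<in> sets M" "measure M Bad \<le> \<delta>"
    unfolding BadE by (rule iid_norm_tail[OF iid_W I_ne finite_lessThan inc int mean s0 Cb fin])+
qed

lemma XX_integrable: "integrable M (\<lambda>w. X w $ j * X w $ k)"
proof (rule Bochner_Integration.integrable_bound)
  show "integrable M (\<lambda>w. (X w $ j)\<^sup>2 + (X w $ k)\<^sup>2)" using X_sq(1) by (intro Bochner_Integration.integrable_add)
  show "AE w in M. norm (X w $ j * X w $ k) \<le> norm ((X w $ j)\<^sup>2 + (X w $ k)\<^sup>2)"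
  proof (rule AE_I2)
    fix w
    have "2 * (\<bar>X w $ j\<bar> * \<bar>X w $ k\<bar>) \<le> (X w $ j)\<^sup>2 + (X w $ k)\<^sup>2"
      using sum_squares_bound[of "\<bar>X w $ j\<bar>" "\<bar>X w $ k\<bar>"] by simp
    moreover have "0 \<le> \<bar>X w $ j\<bar> * \<bar>X w $ k\<bar>" by simp
    ultimately show "norm (X w $ j * X w $ k) \<le> norm ((X w $ j)\<^sup>2 + (X w $ k)\<^sup>2)" unfolding real_norm_def abs_mult by linarith
  qed
qed (intro borel_measurable_times Xj)

lemma XX_mean_bound: "\<bar>LINT w|M. X w $ j * X w $ k\<bar> \<le> M1\<^sup>2"
proof -
  have "\<bar>LINT w|M. X w $ j * X w $ k\<bar> \<le> (LINT w|M. \<bar>X w $ j * X w $ k\<bar>)" by (rule integral_abs_bound)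
  also have "\<dots> \<le> (LINT w|M. ((X w $ j)\<^sup>2 + (X w $ k)\<^sup>2) / 2)"
  proof (rule integral_mono)
    fix w
    show "\<bar>X w $ j * X w $ k\<bar> \<le> ((X w $ j)\<^sup>2 + (X w $ k)\<^sup>2) / 2"
      using sum_squares_bound[of "\<bar>X w $ j\<bar>" "\<bar>X w $ k\<bar>"] by (simp add: abs_mult)
  qed (use XX_integrable X_sq(1) in auto)
  also have "\<dots> = ((LINT w|M. (X w $ j)\<^sup>2) + (LINT w|M. (X w $ k)\<^sup>2)) / 2" using X_sq(1) by simp
  also have "\<dots> \<le> M1\<^sup>2" using X_sq(2)[of j] X_sq(2)[of k] by simp
  finally show ?thesis .
qed

text \<open>
  Convexity of even powers separates the mean, and the inequality of arithmetic and geometric means the product.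
\<close>

lemma XX_moments:
  "(\<integral>\<^sup>+w. ennreal ((X w $ j * X w $ k - (LINT w|M. X w $ j * X w $ k)) ^ (2 * q)) \<partial>M) \<le> ennreal (4 ^ q * M1 ^ (4 * q) * gauss_moment (2 * q))"
proof -
  let ?D = "LINT w|M. X w $ j * X w $ k"
  let ?G = "M1 ^ (4 * q) * gauss_moment (2 * q)"
  have G0: "0 \<le> ?G" using M1 gauss_moment_ge_1[of "2 * q"] by (intro mult_nonneg_nonneg) auto
  have "?D ^ (2 * q) \<le> ?G"
  proof -
    have "?D ^ (2 * q) = \<bar>?D\<bar> ^ (2 * q)" by (simp add: power_even_abs)
    also have "\<dots> \<le> (M1\<^sup>2) ^ (2 * q)" by (intro power_mono XX_mean_bound) simp
    also have "\<dots> = M1 ^ (4 * q) * 1" by (simp flip: power_mult)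
    also have "\<dots> \<le> ?G" using M1 gauss_moment_ge_1 by (intro mult_left_mono) auto
    finally show ?thesis .
  qed
  then have D: "ennreal (?D ^ (2 * q)) \<le> ennreal ?G" by (rule ennreal_leI)
  have conv: "(x - y) ^ (2 * q) \<le> 4 ^ q / 2 * (x ^ (2 * q) + y ^ (2 * q))" for x y :: real
  proof -
    have "((1 - 1/2) *\<^sub>R x + (1/2) *\<^sub>R (- y)) ^ (2 * q) \<le> (1 - 1/2) * x ^ (2 * q) + (1/2) * (- y) ^ (2 * q)"
      by (rule convex_onD[OF convex_power_even]) auto
    then have "((x - y) / 2) ^ (2 * q) \<le> (x ^ (2 * q) + y ^ (2 * q)) / 2" by (simp add: diff_divide_distrib)
    moreover have "((x - y) / 2) ^ (2 * q) = (x - y) ^ (2 * q) / 4 ^ q" by (simp add: power_divide power_mult)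
    ultimately show ?thesis by (simp add: divide_le_eq mult_ac)
  qed
  have am: "(x * y) ^ (2 * q) \<le> (x ^ (2 * (2 * q)) + y ^ (2 * (2 * q))) / 2" for x y :: real
    using sum_squares_bound[of "x ^ (2 * q)" "y ^ (2 * q)"] by (simp add: power_mult_distrib power_mult[symmetric] mult_ac)
  have "(\<integral>\<^sup>+w. ennreal ((X w $ j * X w $ k - ?D) ^ (2 * q)) \<partial>M)
     \<le> (\<integral>\<^sup>+w. ennreal (4 ^ q / 4) * ennreal ((X w $ j) ^ (2 * (2 * q))) + ennreal (4 ^ q / 4) * ennreal ((X w $ k) ^ (2 * (2 * q))) + ennreal (4 ^ q / 2 * ?D ^ (2 * q)) \<partial>M)"
  proof (rule nn_integral_mono)
    fix w
    have "(X w $ j * X w $ k - ?D) ^ (2 * q) \<le> 4 ^ q / 2 * ((X w $ j * X w $ k) ^ (2 * q) + ?D ^ (2 * q))" by (rule conv)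
    also have "\<dots> \<le> 4 ^ q / 2 * (((X w $ j) ^ (2 * (2 * q)) + (X w $ k) ^ (2 * (2 * q))) / 2 + ?D ^ (2 * q))"
      using am[of "X w $ j" "X w $ k"] by (intro mult_left_mono add_right_mono) auto
    also have "\<dots> = 4 ^ q / 4 * (X w $ j) ^ (2 * (2 * q)) + 4 ^ q / 4 * (X w $ k) ^ (2 * (2 * q)) + 4 ^ q / 2 * ?D ^ (2 * q)"
      by (simp add: field_simps)
    finally have "ennreal ((X w $ j * X w $ k - ?D) ^ (2 * q)) \<le> ennreal \<dots>" by (rule ennreal_leI)
    also have "\<dots> = ennreal (4 ^ q / 4 * (X w $ j) ^ (2 * (2 * q))) + ennreal (4 ^ q / 4 * (X w $ k) ^ (2 * (2 * q))) + ennreal (4 ^ q / 2 * ?D ^ (2 * q))"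
      by (subst ennreal_plus, simp_all add: power_mult)
    also have "\<dots> = ennreal (4 ^ q / 4) * ennreal ((X w $ j) ^ (2 * (2 * q))) + ennreal (4 ^ q / 4) * ennreal ((X w $ k) ^ (2 * (2 * q))) + ennreal (4 ^ q / 2 * ?D ^ (2 * q))"
      by (intro arg_cong2[where f = "(+)"] ennreal_mult' refl) simp_all
    finally show "ennreal ((X w $ j * X w $ k - ?D) ^ (2 * q)) \<le> ennreal (4 ^ q / 4) * ennreal ((X w $ j) ^ (2 * (2 * q))) + ennreal (4 ^ q / 4) * ennreal ((X w $ k) ^ (2 * (2 * q))) + ennreal (4 ^ q / 2 * ?D ^ (2 * q))" .
  qed
  also have "\<dots> = ennreal (4 ^ q / 4) * (\<integral>\<^sup>+w. ennreal ((X w $ j) ^ (2 * (2 * q))) \<partial>M) + ennreal (4 ^ q / 4) * (\<integral>\<^sup>+w. ennreal ((X w $ k) ^ (2 * (2 * q))) \<partial>M) + ennreal (4 ^ q / 2 * ?D ^ (2 * q))"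
  proof -
    have mj: "(\<lambda>w. ennreal ((X w $ i) ^ (2 * (2 * q)))) \<in> borel_measurable M" for i by measurable
    show ?thesis using mj by (simp add: nn_integral_add nn_integral_cmult emeasure_space_1)
  qed
  also have "\<dots> \<le> ennreal (4 ^ q / 4) * ennreal ?G + ennreal (4 ^ q / 4) * ennreal ?G + ennreal (4 ^ q / 2 * ?G)"
  proof (intro add_mono mult_left_mono)
    show "(\<integral>\<^sup>+w. ennreal ((X w $ i) ^ (2 * (2 * q))) \<partial>M) \<le> ennreal ?G" for i using X_moments(3)[of i "2 * q"] by simp
    then show "(\<integral>\<^sup>+w. ennreal ((X w $ k) ^ (2 * (2 * q))) \<partial>M) \<le> ennreal ?G" .
    show "ennreal (4 ^ q / 2 * ?D ^ (2 * q)) \<le> ennreal (4 ^ q / 2 * ?G)"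
      using \<open>?D ^ (2 * q) \<le> ?G\<close> by (intro ennreal_leI mult_left_mono) auto
  qed auto
  also have "\<dots> = ennreal (4 ^ q / 4 * ?G + 4 ^ q / 4 * ?G + 4 ^ q / 2 * ?G)"
  proof -
    have e: "ennreal (4 ^ q / 4) * ennreal ?G = ennreal (4 ^ q / 4 * ?G)" by (rule ennreal_mult'[symmetric]) simp
    have p: "0 \<le> 4 ^ q / 4 * ?G" "0 \<le> 4 ^ q / 2 * ?G" by (rule mult_nonneg_nonneg[OF _ G0], simp)+
    show ?thesis unfolding e using p by (simp only: ennreal_plus[symmetric] add_nonneg_nonneg)
  qed
  also have "4 ^ q / 4 * ?G + 4 ^ q / 4 * ?G + 4 ^ q / 2 * ?G = 4 ^ q * M1 ^ (4 * q) * gauss_moment (2 * q)" by simp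
  finally show ?thesis .
qed

text \<open>
  The condition \<open>\<tau> \<le> M1\<^sup>2 / 4\<close> keeps the parameter of the exponential in the range of \<open>sub_exponential_exp_bound\<close>.
\<close>

lemma concentration_entry:
  fixes j k :: 'p
  assumes M10: "0 < M1" and \<tau>: "0 < \<tau>" "\<tau> \<le> M1\<^sup>2 / 4" and Lg: "72 * M1 ^ 4 * Lg \<le> real n * \<tau>\<^sup>2" "0 \<le> Lg" and \<delta>: "2 * exp (- Lg) \<le> \<delta>"
  defines "Bad \<equiv> {w\<in>space M. real n * \<tau> < \<bar>\<Sum>i\<in>{1..n}. Xs i w $ j * Xs i w $ k - (LINT w|M. X w $ j * X w $ k)\<bar>}"
  shows "Bad \<in> sets M" "measure M Bad \<le> \<delta>"
proof -
  define Vc :: "unit \<Rightarrow> real \<times> (real^'p) \<times> (real \<Rightarrow> real) \<Rightarrow> real"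
    where "Vc = (\<lambda>_ u. fst (snd u) $ j * fst (snd u) $ k - (LINT w|M. X w $ j * X w $ k))"
  have xj: "(\<lambda>u. fst (snd u) $ j) \<in> borel_measurable (obs_space T)" for j
    using borel_measurable_inner[OF obs_measurable(2) borel_measurable_const[of "axis j 1"]] by (simp add: inner_axis)
  have Vcm: "Vc z \<in> borel_measurable (obs_space T)" for z
    unfolding Vc_def by (intro borel_measurable_diff borel_measurable_times xj borel_measurable_const)
  have Vc_V: "Vc a (V w) = X w $ j * X w $ k - (LINT w|M. X w $ j * X w $ k)" for a w by (simp add: Vc_def V_def)
  have int: "integrable P (Vc z)" for z unfolding transport_integrable[OF Vcm] Vc_V using XX_integrable by simp
  have mean: "(LINT u|P. Vc z u) = 0" for z unfolding transport[OF Vcm] Vc_V using XX_integrable by (simp add: prob_space)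
  define s where "s = \<tau> / (24 * M1 ^ 4)"
  have s0: "0 < s" using \<tau> M10 by (simp add: s_def)
  define c where "c = 27 / 2 * (s\<^sup>2 * M1 ^ 4)"
  have sM: "s\<^sup>2 * M1 ^ 4 = \<tau>\<^sup>2 / (576 * M1 ^ 4)" using M10 by (simp add: s_def power2_eq_square field_simps)
  have u: "32 * (s\<^sup>2 * M1 ^ 4) \<le> 1 / 9"
  proof -
    have "\<tau>\<^sup>2 \<le> (M1\<^sup>2 / 4)\<^sup>2" using \<tau> by (intro power_mono) auto
    then have "\<tau>\<^sup>2 \<le> M1 ^ 4 / 16" by (simp add: power_divide flip: power_mult)
    moreover have "0 < M1 ^ 4" using M10 by simp
    moreover have "x \<le> y / 16 \<Longrightarrow> 0 < y \<Longrightarrow> 32 * (x / (576 * y)) \<le> 1 / 9" for x y :: real by (simp add: field_simps)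
    ultimately show ?thesis unfolding sM by blast
  qed
  define K where "K = (\<lambda>_::nat. {()})"
  have L1: "L2_set f (K i) = \<bar>f ()\<bar>" for f i by (simp add: K_def)
  have Cb: "(\<integral>\<^sup>+u. ennreal (exp (s * L2_set (\<lambda>z. Vc z u) (K i)) - s * L2_set (\<lambda>z. Vc z u) (K i)) \<partial>P) \<le> ennreal (exp c)" for i
  proof -
    have meas: "(\<lambda>u. ennreal (exp (s * L2_set (\<lambda>z. Vc z u) (K i)) - s * L2_set (\<lambda>z. Vc z u) (K i))) \<in> borel_measurable (obs_space T)"
      using Vcm by measurable
    show ?thesis
      unfolding transport_nn[OF meas] unfolding c_def L1 Vc_V
    proof (rule sub_exponential_exp_bound[OF _ _ u XX_moments])
      show "(\<lambda>w. X w $ j * X w $ k - (LINT w|M. X w $ j * X w $ k)) \<in> borel_measurable M"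
        by (intro borel_measurable_diff borel_measurable_times Xj borel_measurable_const)
    qed (use s0 in simp)
  qed
  have fin: "2 * exp (real (card {1..n}) * c - s * (real n * \<tau>)) \<le> \<delta>"
  proof -
    have "real n * c - s * (real n * \<tau>) = - (real n * \<tau>\<^sup>2) * (7 / (384 * M1 ^ 4))"
      unfolding c_def sM s_def using M10 by (simp add: field_simps power2_eq_square)
    also have "\<dots> \<le> - (72 * M1 ^ 4 * Lg) * (7 / (384 * M1 ^ 4))" using Lg by (intro mult_right_mono) auto
    also have "\<dots> = - (21 / 16 * Lg)" using M10 by simp
    also have "\<dots> \<le> - Lg" using Lg by simp
    finally have "2 * exp (real (card {1..n}) * c - s * (real n * \<tau>)) \<le> 2 * exp (- Lg)" by simp
    then show ?thesis using \<delta> by linarith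
  qed
  have BadE: "Bad = {w\<in>space M. \<exists>i. real n * \<tau> < L2_set (\<lambda>z. \<Sum>i\<in>{1..n}. Vc z (W i w)) (K i)}"
    by (simp add: Bad_def L1 Vc_def W_def)
  have inc: "incseq K" and finK: "finite (K i)" for i by (auto simp: K_def incseq_def)
  show "Bad \<in> sets M" "measure M Bad \<le> \<delta>"
    unfolding BadE by (rule iid_norm_tail[OF iid_W I_ne finK inc int mean s0 Cb fin])+
qed

end

section \<open>Regression of the noise on the covariates\<close>

text \<open>
  Markov's inequality for the supremum of an increasing sequence with uniformly bounded expectations.
\<close>

lemma markov_increasing_sequence:
  fixes Q :: "nat \<Rightarrow> 'w \<Rightarrow> real"
  assumes M: "prob_space M" and Q: "\<And>K. integrable M (Q K)" and E: "\<And>K. (LINT w|M. Q K w) \<le> q"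
    and nn: "\<And>K w. w \<in> space M \<Longrightarrow> 0 \<le> Q K w" and mono: "\<And>K w. w \<in> space M \<Longrightarrow> Q K w \<le> Q (Suc K) w" and a: "0 < a" and \<delta>: "q / a \<le> \<delta>"
  shows "{w\<in>space M. \<exists>K. a < Q K w} \<in> sets M" "measure M {w\<in>space M. \<exists>K. a < Q K w} \<le> \<delta>"
proof -
  interpret prob_space M by fact
  have Qm [measurable]: "Q K \<in> borel_measurable M" for K using Q by auto
  define A where "A K = {w\<in>space M. a < Q K w}" for K
  have A [measurable]: "A K \<in> sets M" for K unfolding A_def by measurable
  have eq: "{w\<in>space M. \<exists>K. a < Q K w} = (\<Union>K. A K)" by (auto simp: A_def)
  show "{w\<in>space M. \<exists>K. a < Q K w} \<in> sets M" unfolding eq by measurable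
  have "incseq A" by (rule incseq_SucI) (use mono in \<open>fastforce simp: A_def intro: less_le_trans\<close>)
  then have "(\<lambda>K. measure M (A K)) \<longlonglongrightarrow> measure M (\<Union>K. A K)" by (intro finite_Lim_measure_incseq) auto
  moreover have "measure M (A K) \<le> \<delta>" for K
  proof -
    have "measure M (A K) \<le> measure M {w\<in>space M. a \<le> Q K w}" by (intro finite_measure_mono) (auto simp: A_def)
    also have "\<dots> \<le> (LINT w|M. Q K w) / a"
      by (rule integral_Markov_inequality_measure[where A = "{}", OF Q]) (use nn a in auto)
    also have "\<dots> \<le> q / a" using E a by (intro divide_right_mono) auto
    finally show ?thesis using \<delta> by simp
  qed
  ultimately show "measure M {w\<in>space M. \<exists>K. a < Q K w} \<le> \<delta>" unfolding eq by (intro LIMSEQ_le_const2) auto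
qed

lemma det_measurable:
  fixes A :: "'a \<Rightarrow> real^'p^'p"
  assumes "\<And>i j. (\<lambda>x. A x $ i $ j) \<in> borel_measurable N"
  shows "(\<lambda>x. det (A x)) \<in> borel_measurable N"
  unfolding det_def using assms by (intro borel_measurable_sum borel_measurable_times borel_measurable_prod borel_measurable_const)

text \<open>
  Cramer's rule exhibits the solution as a measurable function of the entries; singular matrices yield \<open>0\<close>, as
  \<open>x / 0 = 0\<close>.
\<close>

definition cramer_solution :: "real^'p^'p \<Rightarrow> real^'p \<Rightarrow> real^'p" where
  "cramer_solution A v = (\<chi> k. det (\<chi> i j. if j = k then v $ i else A $ i $ j) / det A)"

lemma cramer_solution_measurable:
  fixes A :: "'a \<Rightarrow> real^'p^'p"
  assumes A: "\<And>i j. (\<lambda>x. A x $ i $ j) \<in> borel_measurable N" and v: "\<And>i. (\<lambda>x. v x $ i) \<in> borel_measurable N"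
  shows "(\<lambda>x. cramer_solution (A x) (v x) $ k) \<in> borel_measurable N"
proof -
  have "(\<lambda>x. (\<chi> i j. if j = k then v x $ i else A x $ i $ j) $ i $ j) \<in> borel_measurable N" for i j
    using A v by (cases "j = k") auto
  from det_measurable[OF this] det_measurable[OF A] show ?thesis
    unfolding cramer_solution_def by simp
qed

lemma cramer_solution:
  fixes A :: "real^'p^'p" assumes "det A \<noteq> 0" shows "cramer_solution A v = matrix_inv A *v v"
proof -
  have "A *v (matrix_inv A *v v) = v"
    using matrix_inv_right_inverse[of A] assms by (simp add: invertible_det_nz matrix_vector_mul_assoc)
  then show ?thesis using cramer[OF assms, of "matrix_inv A *v v" v] by (simp add: cramer_solution_def)
qed

lemma emp_cov_nth: "emp_cov n x $ i $ j = (1 / real n) * (\<Sum>k=1..n. x k $ i * x k $ j)"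
  by (simp add: emp_cov_def)

lemma transpose_emp_cov: "transpose (emp_cov n x) = emp_cov n x"
  by (simp add: transpose_def vec_eq_iff emp_cov_def mult.commute)

context
  fixes n :: nat and x :: "nat \<Rightarrow> real^'p" and A B :: "real^'p^'p"
  assumes n: "0 < n" and A: "A = emp_cov n x" and det: "det A \<noteq> 0" and B: "B = matrix_inv A"
begin

lemma hat_inverse: "A *v (B *v v) = v" "B *v (A *v v) = v" "A ** B = mat 1" "B ** A = mat 1"
proof -
  show AB: "A ** B = mat 1" unfolding B by (rule matrix_inv_right_inverse) (simp add: det invertible_det_nz)
  then show BA: "B ** A = mat 1" using matrix_left_right_inverse by blast
  show "A *v (B *v v) = v" "B *v (A *v v) = v" by (simp_all add: matrix_vector_mul_assoc AB BA)
qed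

lemma hat_symmetric: "u \<bullet> (B *v v) = (B *v u) \<bullet> v"
proof -
  have "u \<bullet> (B *v v) = (A *v (B *v u)) \<bullet> (B *v v)" by (simp add: hat_inverse)
  also have "\<dots> = (B *v u) \<bullet> (A *v (B *v v))"
    using dot_lmul_matrix[of "B *v u" A "B *v v"] transpose_emp_cov[of n x] by (metis A transpose_matrix_vector)
  finally show ?thesis by (simp add: hat_inverse)
qed

text \<open>
  The numbers \<open>x i \<bullet> (B *v x k) / n\<close> form the hat matrix of the regression on \<open>x\<close>, an orthogonal projection of rank
  \<open>CARD('p)\<close>.  The next lemmas are its entry bound, positivity, trace, and the fact that the passage to residuals is
  symmetric and contractive.
\<close>

lemma hat_bound:
  assumes ik: "i \<in> {1..n}" "k \<in> {1..n}" shows "\<bar>x i \<bullet> (B *v x k)\<bar> \<le> real n"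
proof -
  define u where "u = B *v x k"
  define s where "s = x k \<bullet> u"
  have s: "s = (1 / real n) * (\<Sum>j=1..n. (x j \<bullet> u)\<^sup>2)"
    using emp_cov_form[of u n x u] hat_inverse(1)[of "x k"] by (simp add: s_def u_def A[symmetric] power2_eq_square inner_commute)
  have le: "(x j \<bullet> u)\<^sup>2 \<le> real n * s" if "j \<in> {1..n}" for j
  proof -
    have "(x j \<bullet> u)\<^sup>2 \<le> (\<Sum>j=1..n. (x j \<bullet> u)\<^sup>2)" using that by (intro member_le_sum) auto
    then show ?thesis using n by (simp add: s)
  qed
  have "s \<le> real n"
  proof (cases "s \<le> 0")
    case False
    then show ?thesis using le[OF ik(2)] by (simp add: s_def[symmetric] power2_eq_square)
  qed simp
  then have "real n * s \<le> (real n)\<^sup>2" using n by (simp add: power2_eq_square)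
  then have "(x i \<bullet> u)\<^sup>2 \<le> (real n)\<^sup>2" using le[OF ik(1)] by linarith
  then have "\<bar>x i \<bullet> u\<bar> \<le> \<bar>real n\<bar>" by (simp only: abs_le_square_iff)
  then show ?thesis by (simp add: u_def)
qed

lemma hat_nonneg: "0 \<le> v \<bullet> (B *v v)"
proof -
  have "v \<bullet> (B *v v) = (B *v v) \<bullet> (A *v (B *v v))" by (simp add: hat_inverse inner_commute)
  also have "\<dots> = (1 / real n) * (\<Sum>j=1..n. (x j \<bullet> (B *v v))\<^sup>2)" unfolding A emp_cov_form by (simp add: power2_eq_square)
  finally show ?thesis by (simp add: sum_nonneg)
qed

lemma hat_trace: "(\<Sum>i=1..n. x i \<bullet> (B *v x i)) = real n * real CARD('p)"
proof -
  have "(\<Sum>i=1..n. x i \<bullet> (B *v x i)) = (\<Sum>i=1..n. \<Sum>a\<in>UNIV. \<Sum>b\<in>UNIV. B $ a $ b * (x i $ b * x i $ a))"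
    by (simp add: inner_vec_def matrix_vector_mult_def sum_distrib_left mult_ac)
  also have "\<dots> = (\<Sum>a\<in>UNIV. \<Sum>b\<in>UNIV. \<Sum>i=1..n. B $ a $ b * (x i $ b * x i $ a))"
    by (subst sum.swap, intro sum.cong refl, subst sum.swap) simp
  also have "\<dots> = (\<Sum>a\<in>UNIV. \<Sum>b\<in>UNIV. B $ a $ b * (real n * A $ b $ a))"
    unfolding A emp_cov_nth using n by (simp add: sum_distrib_left)
  also have "\<dots> = real n * (\<Sum>a\<in>UNIV. (B ** A) $ a $ a)"
    by (simp add: matrix_matrix_mult_def sum_distrib_left mult_ac)
  also have "\<dots> = real n * real CARD('p)" by (simp add: hat_inverse mat_def)
  finally show ?thesis .
qed

lemma hat_quadratic_form:
  fixes \<epsilon> :: "nat \<Rightarrow> real"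
  defines "b \<equiv> (1 / real n) *\<^sub>R (\<Sum>i=1..n. \<epsilon> i *\<^sub>R x i)"
  shows "(\<Sum>i=1..n. \<Sum>k=1..n. \<epsilon> i * \<epsilon> k * (1 / (real n)\<^sup>2 * (x i \<bullet> (B *v x k)))) = b \<bullet> (B *v b)"
proof -
  have lin: "B *v (\<Sum>k=1..n. \<epsilon> k *\<^sub>R x k) = (\<Sum>k=1..n. \<epsilon> k *\<^sub>R (B *v x k))"
    by (simp add: linear_sum[OF matrix_vector_mul_linear] matrix_vector_mult_scaleR)
  show ?thesis
    unfolding b_def matrix_vector_mult_scaleR lin
    by (subst sum.swap) (simp add: inner_sum_left inner_sum_right sum_distrib_left power2_eq_square mult_ac)
qed

lemma hat_residual:
  fixes \<epsilon> l :: "nat \<Rightarrow> real"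
  defines "G \<equiv> (1 / real n) *\<^sub>R (\<Sum>i=1..n. l i *\<^sub>R x i)"
  shows "(\<Sum>i=1..n. (l i - x i \<bullet> (B *v G))\<^sup>2) \<le> (\<Sum>i=1..n. (l i)\<^sup>2)"
    and "(\<Sum>i=1..n. \<epsilon> i * (l i - x i \<bullet> (B *v G))) = (\<Sum>i=1..n. (\<epsilon> i - x i \<bullet> (B *v ((1 / real n) *\<^sub>R (\<Sum>i=1..n. \<epsilon> i *\<^sub>R x i)))) * l i)"
proof -
  define c where "c = B *v G"
  have G: "v \<bullet> G = (1 / real n) * (\<Sum>i=1..n. l i * (x i \<bullet> v))" for v
    by (simp add: G_def inner_sum_right inner_commute)
  have c1: "(\<Sum>i=1..n. (x i \<bullet> c)\<^sup>2) = (\<Sum>i=1..n. l i * (x i \<bullet> c))"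
  proof -
    have "c \<bullet> (A *v c) = c \<bullet> G" by (simp add: c_def hat_inverse)
    then show ?thesis using n unfolding A emp_cov_form G by (simp add: power2_eq_square)
  qed
  have "(\<Sum>i=1..n. (l i - x i \<bullet> c)\<^sup>2) = (\<Sum>i=1..n. (l i)\<^sup>2) - 2 * (\<Sum>i=1..n. l i * (x i \<bullet> c)) + (\<Sum>i=1..n. (x i \<bullet> c)\<^sup>2)"
    by (simp add: power2_diff sum.distrib sum_subtractf sum_distrib_left mult.assoc)
  also have "\<dots> = (\<Sum>i=1..n. (l i)\<^sup>2) - (\<Sum>i=1..n. (x i \<bullet> c)\<^sup>2)" using c1 by simp
  also have "\<dots> \<le> (\<Sum>i=1..n. (l i)\<^sup>2)" by (simp add: sum_nonneg)
  finally show "(\<Sum>i=1..n. (l i - x i \<bullet> (B *v G))\<^sup>2) \<le> (\<Sum>i=1..n. (l i)\<^sup>2)" by (simp add: c_def)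
  define b where "b = (1 / real n) *\<^sub>R (\<Sum>i=1..n. \<epsilon> i *\<^sub>R x i)"
  have bv: "b \<bullet> v = (1 / real n) * (\<Sum>i=1..n. \<epsilon> i * (x i \<bullet> v))" for v by (simp add: b_def inner_sum_left)
  have "(\<Sum>i=1..n. \<epsilon> i * (x i \<bullet> (B *v G))) = real n * (b \<bullet> (B *v G))" using n by (simp add: bv)
  also have "b \<bullet> (B *v G) = (B *v b) \<bullet> G" by (rule hat_symmetric)
  also have "real n * \<dots> = (\<Sum>i=1..n. (x i \<bullet> (B *v b)) * l i)" using n by (simp add: G mult.commute)
  finally show "(\<Sum>i=1..n. \<epsilon> i * (l i - x i \<bullet> (B *v G))) = (\<Sum>i=1..n. (\<epsilon> i - x i \<bullet> (B *v ((1 / real n) *\<^sub>R (\<Sum>i=1..n. \<epsilon> i *\<^sub>R x i)))) * l i)"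
    by (simp add: b_def right_diff_distrib left_diff_distrib sum_subtractf)
qed

end

locale noisy_model = sample_model T M S Y M2 X Z n Zs Xs Ys M1
  for T :: "real set" and M :: "'w measure" and S :: l2_op and Y :: "'w \<Rightarrow> real \<Rightarrow> real" and M2 :: real
    and X :: "'w \<Rightarrow> real^'p" and Z :: "'w \<Rightarrow> real" and n :: nat
    and Zs :: "nat \<Rightarrow> 'w \<Rightarrow> real" and Xs :: "nat \<Rightarrow> 'w \<Rightarrow> real^'p" and Ys :: "nat \<Rightarrow> 'w \<Rightarrow> real \<Rightarrow> real" and M1 :: real +
  fixes \<epsilon> :: "'w \<Rightarrow> real" and \<alpha>0 :: "real^'p" and \<beta>0 :: "real \<Rightarrow> real" and \<sigma> :: real
  assumes \<beta>0: "\<beta>0 \<in> l2_space T"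
    and model: "\<And>w. w \<in> space M \<Longrightarrow> Z w = X w \<bullet> \<alpha>0 + l2_inner T (Y w) \<beta>0 + \<epsilon> w"
    and \<epsilon>m [measurable]: "\<epsilon> \<in> borel_measurable M" and \<epsilon>2: "integrable M (\<lambda>w. (\<epsilon> w)\<^sup>2)" and \<sigma>: "0 < \<sigma>"
    and ce1: "AE w in M. real_cond_exp M (generated_algebra M (\<lambda>w. (X w, Y w)) (borel \<Otimes>\<^sub>M l2_borel T)) \<epsilon> w = 0"
    and ce2: "AE w in M. real_cond_exp M (generated_algebra M (\<lambda>w. (X w, Y w)) (borel \<Otimes>\<^sub>M l2_borel T)) (\<lambda>w. (\<epsilon> w)\<^sup>2) w < \<sigma>\<^sup>2"
begin

abbreviation "U \<equiv> (borel \<Otimes>\<^sub>M l2_borel T :: ((real^'p) \<times> (real \<Rightarrow> real)) measure)"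
definition XY where "XY w = (X w, Y w)"
abbreviation "F \<equiv> generated_algebra M XY U"

lemma XYm [measurable]: "XY \<in> measurable M U" unfolding XY_def[abs_def] by measurable

lemma subalg: "subalgebra M F"
  unfolding subalgebra_def generated_algebra_def
  using sets_vimage_algebra2[of XY "space M" U] measurable_space[OF XYm] measurable_sets[OF XYm] by auto

sublocale F: finite_measure_subalgebra M F by standard (rule subalg)

lemma XY_F: "\<phi> \<in> borel_measurable U \<Longrightarrow> (\<lambda>w. \<phi> (XY w)) \<in> borel_measurable F"
  unfolding generated_algebra_def
  by (rule measurable_compose[OF measurable_vimage_algebra1]) (auto intro: measurable_space[OF XYm])

lemma \<epsilon>_int: "integrable M \<epsilon>" using \<epsilon>2 by (rule square_integrable_imp_integrable[OF \<epsilon>m])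

lemma noise_orthogonal:
  assumes \<phi>: "\<phi> \<in> borel_measurable U" and int: "integrable M (\<lambda>w. \<phi> (XY w) * \<epsilon> w)"
  shows "(LINT w|M. \<phi> (XY w) * \<epsilon> w) = 0"
proof -
  have "(LINT w|M. \<phi> (XY w) * \<epsilon> w) = (LINT w|M. \<phi> (XY w) * real_cond_exp M F \<epsilon> w)"
    by (rule F.real_cond_exp_intg(2)[OF int XY_F[OF \<phi>] \<epsilon>m, symmetric])
  also have "\<dots> = (LINT w|M. 0)"
    using ce1 F.real_cond_exp_intg(1)[OF int XY_F[OF \<phi>] \<epsilon>m]
    by (intro integral_cong_AE) (auto simp: XY_def[abs_def] elim!: eventually_mono)
  finally show ?thesis by simp
qed

definition eo where "eo u = fst u - fst (snd u) \<bullet> \<alpha>0 - l2_inner T (snd (snd u)) \<beta>0"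

lemma eo_measurable [measurable]: "eo \<in> borel_measurable (obs_space T)"
  unfolding eo_def[abs_def]
  by (intro borel_measurable_diff borel_measurable_inner borel_measurable_const obs_measurable(1,2)
      measurable_compose[OF obs_measurable(3) l2_inner_measurable[OF \<beta>0]])

lemma eo_V: "w \<in> space M \<Longrightarrow> eo (V w) = \<epsilon> w" using model[of w] by (simp add: eo_def V_def)

lemma snd_V: "snd (V w) = XY w" by (simp add: V_def XY_def)

lemma snd_obs [measurable]: "snd \<in> measurable (obs_space T) U" unfolding obs_space_def by measurable

lemma sets_P: "sets P = sets (obs_space T)" by (simp add: P_def)

text \<open>
  Conditional moments on the underlying space are transported to the law of one observation.
\<close>

sublocale noise: conditionally_centered_noise P U eo snd \<sigma>
proof (rule conditionally_centered_noise.intro)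
  show "prob_space P" by (rule iid_sample_distr_PiM(2)[OF iid_W I_ne])
  show "eo \<in> borel_measurable P" "snd \<in> measurable P U"
    using eo_measurable snd_obs by (simp_all add: sets_P cong: measurable_cong_sets)
  have e2m: "(\<lambda>u. (eo u)\<^sup>2) \<in> borel_measurable (obs_space T)" by measurable
  show "integrable P (\<lambda>u. (eo u)\<^sup>2)"
    unfolding transport_integrable[OF e2m] using \<epsilon>2 by (simp add: eo_V cong: Bochner_Integration.integrable_cong)
next
  fix \<phi> :: "(real^'p) \<times> (real \<Rightarrow> real) \<Rightarrow> real" and B
  assume \<phi>: "\<phi> \<in> borel_measurable U" and B: "\<And>x. x \<in> space U \<Longrightarrow> \<bar>\<phi> x\<bar> \<le> B"
  have \<phi>o: "(\<lambda>u. \<phi> (snd u)) \<in> borel_measurable (obs_space T)" by (rule measurable_compose[OF snd_obs \<phi>])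
  have \<phi>M: "(\<lambda>w. \<phi> (XY w)) \<in> borel_measurable M" by (rule measurable_compose[OF XYm \<phi>])
  have int: "integrable M (\<lambda>w. \<phi> (XY w) * \<epsilon> w)"
  proof (rule Bochner_Integration.integrable_bound)
    show "integrable M (\<lambda>w. B * \<epsilon> w)" using \<epsilon>_int by simp
    show "(\<lambda>w. \<phi> (XY w) * \<epsilon> w) \<in> borel_measurable M" using \<phi>M by measurable
    show "AE w in M. norm (\<phi> (XY w) * \<epsilon> w) \<le> norm (B * \<epsilon> w)"
    proof (rule AE_I2)
      fix w assume "w \<in> space M"
      then have "\<bar>\<phi> (XY w)\<bar> \<le> \<bar>B\<bar>" using order_trans[OF B[OF measurable_space[OF XYm]] abs_ge_self] by blast
      then show "norm (\<phi> (XY w) * \<epsilon> w) \<le> norm (B * \<epsilon> w)" by (simp add: abs_mult mult_right_mono)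
    qed
  qed
  have eom: "(\<lambda>u. eo u * \<phi> (snd u)) \<in> borel_measurable (obs_space T)" using \<phi>o by measurable
  have "(LINT u|P. eo u * \<phi> (snd u)) = (LINT w|M. \<phi> (XY w) * \<epsilon> w)"
    unfolding transport[OF eom] by (intro Bochner_Integration.integral_cong refl) (simp add: eo_V snd_V)
  then show "(LINT u|P. eo u * \<phi> (snd u)) = 0" using noise_orthogonal[OF \<phi> int] by simp
next
  fix \<phi> :: "(real^'p) \<times> (real \<Rightarrow> real) \<Rightarrow> real" and B
  assume \<phi>: "\<phi> \<in> borel_measurable U" and B: "\<And>x. x \<in> space U \<Longrightarrow> 0 \<le> \<phi> x \<and> \<phi> x \<le> B"
  have \<phi>o: "(\<lambda>u. \<phi> (snd u)) \<in> borel_measurable (obs_space T)" by (rule measurable_compose[OF snd_obs \<phi>])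
  have \<phi>M: "(\<lambda>w. \<phi> (XY w)) \<in> borel_measurable M" by (rule measurable_compose[OF XYm \<phi>])
  have Bw: "0 \<le> \<phi> (XY w) \<and> \<phi> (XY w) \<le> B" if "w \<in> space M" for w by (rule B[OF measurable_space[OF XYm that]])
  have \<phi>i: "integrable M (\<lambda>w. \<phi> (XY w))"
    by (rule integrable_const_bound[where B = B]) (use Bw \<phi>M in auto)
  have int: "integrable M (\<lambda>w. \<phi> (XY w) * (\<epsilon> w)\<^sup>2)"
  proof (rule Bochner_Integration.integrable_bound)
    show "integrable M (\<lambda>w. B * (\<epsilon> w)\<^sup>2)" using \<epsilon>2 by simp
    show "(\<lambda>w. \<phi> (XY w) * (\<epsilon> w)\<^sup>2) \<in> borel_measurable M" using \<phi>M by measurable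
    show "AE w in M. norm (\<phi> (XY w) * (\<epsilon> w)\<^sup>2) \<le> norm (B * (\<epsilon> w)\<^sup>2)"
    proof (rule AE_I2)
      fix w assume "w \<in> space M"
      then show "norm (\<phi> (XY w) * (\<epsilon> w)\<^sup>2) \<le> norm (B * (\<epsilon> w)\<^sup>2)"
        using Bw[of w] by (simp add: abs_mult mult_right_mono)
    qed
  qed
  have e2m: "(\<lambda>u. (eo u)\<^sup>2 * \<phi> (snd u)) \<in> borel_measurable (obs_space T)" using \<phi>o by measurable
  have \<epsilon>2m: "(\<lambda>w. (\<epsilon> w)\<^sup>2) \<in> borel_measurable M" by measurable
  have "(LINT u|P. (eo u)\<^sup>2 * \<phi> (snd u)) = (LINT w|M. \<phi> (XY w) * (\<epsilon> w)\<^sup>2)"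
    unfolding transport[OF e2m] by (intro Bochner_Integration.integral_cong refl) (simp add: eo_V snd_V mult.commute)
  also have "\<dots> = (LINT w|M. \<phi> (XY w) * real_cond_exp M F (\<lambda>w. (\<epsilon> w)\<^sup>2) w)"
    by (rule F.real_cond_exp_intg(2)[OF int XY_F[OF \<phi>] \<epsilon>2m, symmetric])
  also have "\<dots> \<le> (LINT w|M. \<phi> (XY w) * \<sigma>\<^sup>2)"
  proof (rule integral_mono_AE[OF F.real_cond_exp_intg(1)[OF int XY_F[OF \<phi>] \<epsilon>2m]])
    show "AE w in M. \<phi> (XY w) * real_cond_exp M F (\<lambda>w. (\<epsilon> w)\<^sup>2) w \<le> \<phi> (XY w) * \<sigma>\<^sup>2"
      using ce2 AE_space
    proof eventually_elim
      case (elim w)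
      then show ?case using Bw[of w] by (intro mult_left_mono) (auto simp: XY_def[abs_def])
    qed
  qed (use \<phi>i in simp)
  also have "\<dots> = \<sigma>\<^sup>2 * (LINT u|P. \<phi> (snd u))" unfolding transport[OF \<phi>o] by (simp add: snd_V mult.commute)
  finally show "(LINT u|P. (eo u)\<^sup>2 * \<phi> (snd u)) \<le> \<sigma>\<^sup>2 * (LINT u|P. \<phi> (snd u))" .
qed

text \<open>
  The noise, the covariates and their empirical second moment matrix; \<open>a1\<close> are the coefficients of the regression of the
  noise on the covariates.
\<close>

definition es where "es w i = eo (W i w)"
definition xs where "xs w i = Xs i w"
definition Dn where "Dn w = emp_cov n (xs w)"
definition bn where "bn w = (1 / real n) *\<^sub>R (\<Sum>i=1..n. es w i *\<^sub>R xs w i)"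
definition a1 where "a1 w = matrix_inv (Dn w) *v bn w"

lemma fst_component: "i \<in> {1..n} \<Longrightarrow> (\<lambda>\<omega>. fst (\<omega> i) $ j) \<in> borel_measurable (Pi\<^sub>M {1..n} (\<lambda>_. U))"
proof -
  assume i: "i \<in> {1..n}"
  have "(\<lambda>\<omega>. fst (\<omega> i) \<bullet> axis j 1) \<in> borel_measurable (Pi\<^sub>M {1..n} (\<lambda>_. U))"
    by (intro borel_measurable_inner borel_measurable_const measurable_compose[OF measurable_component_singleton[OF i] measurable_fst])
  then show ?thesis by (simp add: inner_axis)
qed

text \<open>
  The matrix \<open>Dn\<close> as a function of the design alone, the argument that \<open>iid_quadratic_form\<close> allows.
\<close>

definition cov\<omega> :: "(nat \<Rightarrow> (real^'p) \<times> (real \<Rightarrow> real)) \<Rightarrow> real^'p^'p" where "cov\<omega> \<omega> = emp_cov n (\<lambda>k. fst (\<omega> k))"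

lemma cov\<omega>_measurable: "(\<lambda>\<omega>. cov\<omega> \<omega> $ i $ j) \<in> borel_measurable (Pi\<^sub>M {1..n} (\<lambda>_. U))"
  unfolding cov\<omega>_def emp_cov_nth
  by (intro borel_measurable_times borel_measurable_sum borel_measurable_const fst_component)

lemma cov\<omega>_eq: "cov\<omega> (\<lambda>j\<in>{1..n}. snd (W j w)) = Dn w"
  by (simp add: cov\<omega>_def Dn_def emp_cov_def xs_def W_def)

lemma inner_measurable_components:
  fixes f g :: "'a \<Rightarrow> real^'p"
  assumes "\<And>k. (\<lambda>x. f x $ k) \<in> borel_measurable N" "\<And>k. (\<lambda>x. g x $ k) \<in> borel_measurable N"
  shows "(\<lambda>x. f x \<bullet> g x) \<in> borel_measurable N"
  unfolding inner_vec_def inner_real_def using assms by (intro borel_measurable_sum borel_measurable_times)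

text \<open>
  The left side is the mean square of the fitted values of the noise.  It is the quadratic form of the hat matrix divided
  by \<open>n\<close>, whose trace is \<open>CARD('p) / n\<close>.
\<close>

lemma noise_parametric:
  assumes \<delta>: "0 < \<delta>"
  shows "\<exists>Bad\<in>sets M. measure M Bad \<le> \<delta> \<and> (\<forall>w\<in>space M - Bad. det (Dn w) \<noteq> 0 \<longrightarrow>
     a1 w \<bullet> (Dn w *v a1 w) \<le> \<sigma>\<^sup>2 * real CARD('p) / (real n * \<delta>))"
proof -
  \<comment> \<open>zero at singular matrices, so that the coefficients are bounded and the diagonal is nonnegative everywhere\<close>
  define H where "H i k \<omega> = (if det (cov\<omega> \<omega>) \<noteq> 0 then 1 / (real n)\<^sup>2 * (fst (\<omega> i) \<bullet> cramer_solution (cov\<omega> \<omega>) (fst (\<omega> k))) else 0)"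
    for i k and \<omega> :: "nat \<Rightarrow> (real^'p) \<times> (real \<Rightarrow> real)"
  have detm: "(\<lambda>\<omega>. det (cov\<omega> \<omega>)) \<in> borel_measurable (Pi\<^sub>M {1..n} (\<lambda>_. U))" by (rule det_measurable[OF cov\<omega>_measurable])
  have Hm: "H i k \<in> borel_measurable (Pi\<^sub>M {1..n} (\<lambda>_. U))" if "i \<in> {1..n}" "k \<in> {1..n}" for i k
  proof -
    have "(\<lambda>\<omega>. fst (\<omega> i) \<bullet> cramer_solution (cov\<omega> \<omega>) (fst (\<omega> k))) \<in> borel_measurable (Pi\<^sub>M {1..n} (\<lambda>_. U))"
      using that by (intro inner_measurable_components cramer_solution_measurable cov\<omega>_measurable fst_component)
    then show ?thesis unfolding H_def[abs_def] using detm by measurable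
  qed
  have Hinv: "H i k \<omega> = 1 / (real n)\<^sup>2 * (fst (\<omega> i) \<bullet> (matrix_inv (cov\<omega> \<omega>) *v fst (\<omega> k)))" if "det (cov\<omega> \<omega>) \<noteq> 0" for i k \<omega>
    using that by (simp add: H_def cramer_solution)
  have HB: "\<bar>H i k \<omega>\<bar> \<le> 1" if "i \<in> {1..n}" "k \<in> {1..n}" for i k \<omega>
  proof (cases "det (cov\<omega> \<omega>) = 0")
    case False
    have "\<bar>H i k \<omega>\<bar> \<le> 1 / (real n)\<^sup>2 * real n"
      unfolding Hinv[OF False] abs_mult using hat_bound[OF n cov\<omega>_def False refl that] by (intro mult_mono) auto
    also have "\<dots> \<le> 1" using n by (simp add: power2_eq_square)
    finally show ?thesis .
  qed (simp add: H_def)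
  have H0: "0 \<le> H i i \<omega>" for i \<omega>
    using hat_nonneg[OF n cov\<omega>_def _ refl, of \<omega> "fst (\<omega> i)"] Hinv[of \<omega> i i] by (cases "det (cov\<omega> \<omega>) = 0") (auto simp: H_def)
  define Q where "Q w = (\<Sum>i\<in>{1..n}. \<Sum>k\<in>{1..n}. eo (W i w) * eo (W k w) * H i k (\<lambda>j\<in>{1..n}. snd (W j w)))" for w
  note qf = noise.iid_quadratic_form[OF iid_W I_ne Hm HB H0]
  have tr: "(\<Sum>i\<in>{1..n}. H i i \<omega>) \<le> real CARD('p) / real n" for \<omega>
  proof (cases "det (cov\<omega> \<omega>) = 0")
    case False
    have "(\<Sum>i\<in>{1..n}. H i i \<omega>) = 1 / (real n)\<^sup>2 * (real n * real CARD('p))"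
      unfolding Hinv[OF False] sum_distrib_left[symmetric] using hat_trace[OF n cov\<omega>_def False refl] by simp
    then show ?thesis using n by (simp add: power2_eq_square)
  qed (simp add: H_def)
  have Hs: "H i k (\<lambda>j\<in>{1..n}. snd (W j w)) = 1 / (real n)\<^sup>2 * (xs w i \<bullet> (matrix_inv (Dn w) *v xs w k))"
    if "det (Dn w) \<noteq> 0" "i \<in> {1..n}" "k \<in> {1..n}" for i k w
    using Hinv[of "\<lambda>j\<in>{1..n}. snd (W j w)" i k] that unfolding cov\<omega>_eq by (simp add: xs_def W_def)
  have Qeq: "Q w = a1 w \<bullet> (Dn w *v a1 w)" if det: "det (Dn w) \<noteq> 0" for w
  proof -
    have "Q w = (\<Sum>i=1..n. \<Sum>k=1..n. es w i * es w k * (1 / (real n)\<^sup>2 * (xs w i \<bullet> (matrix_inv (Dn w) *v xs w k))))"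
      unfolding Q_def es_def using Hs[OF det] by (intro sum.cong) auto
    also have "\<dots> = bn w \<bullet> (matrix_inv (Dn w) *v bn w)"
      unfolding bn_def by (rule hat_quadratic_form[OF n Dn_def det refl])
    also have "\<dots> = a1 w \<bullet> (Dn w *v a1 w)"
      using hat_inverse(1)[OF n Dn_def det refl, of "bn w"] by (simp add: a1_def inner_commute)
    finally show ?thesis .
  qed
  have Qnn: "0 \<le> Q w" for w
  proof (cases "det (Dn w) = 0")
    case True
    then have "H i k (\<lambda>j\<in>{1..n}. snd (W j w)) = 0" for i k unfolding H_def cov\<omega>_eq by simp
    then show ?thesis unfolding Q_def by simp
  next
    case False
    show ?thesis unfolding Qeq[OF False] unfolding Dn_def emp_cov_form power2_eq_square[symmetric] by (intro mult_nonneg_nonneg sum_nonneg) auto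
  qed
  have EQ: "(LINT w|M. Q w) \<le> \<sigma>\<^sup>2 * real CARD('p) / real n"
  proof -
    have "(LINT w|M. Q w) \<le> \<sigma>\<^sup>2 * (LINT w|M. (\<Sum>i\<in>{1..n}. H i i (\<lambda>j\<in>{1..n}. snd (W j w))))" unfolding Q_def by (rule qf(2))
    also have "(LINT w|M. (\<Sum>i\<in>{1..n}. H i i (\<lambda>j\<in>{1..n}. snd (W j w)))) \<le> real CARD('p) / real n"
    proof (rule integral_le_const)
      have "(\<lambda>w. \<lambda>j\<in>{1..n}. snd (W j w)) \<in> measurable M (Pi\<^sub>M {1..n} (\<lambda>_. U))"
        by (intro measurable_restrict measurable_compose[OF Wm snd_obs])
      then have "(\<lambda>w. \<Sum>i\<in>{1..n}. H i i (\<lambda>j\<in>{1..n}. snd (W j w))) \<in> borel_measurable M"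
        by (intro borel_measurable_sum measurable_compose[OF _ Hm]) auto
      then show "integrable M (\<lambda>w. \<Sum>i\<in>{1..n}. H i i (\<lambda>j\<in>{1..n}. snd (W j w)))"
        by (rule integrable_const_bound[where B = "real CARD('p) / real n", rotated]) (use tr H0 in \<open>auto simp: sum_nonneg\<close>)
    qed (use tr in simp)
    finally show ?thesis by (simp add: mult_left_mono)
  qed
  define a where "a = \<sigma>\<^sup>2 * real CARD('p) / (real n * \<delta>)"
  have a0: "0 < a" using \<sigma> n \<delta> by (simp add: a_def)
  have qa: "\<sigma>\<^sup>2 * real CARD('p) / real n / a \<le> \<delta>" using \<sigma> n \<delta> by (simp add: a_def)
  have Qi: "integrable M Q" unfolding Q_def[abs_def] by (rule qf(1))
  note tail = markov_increasing_sequence[of M "\<lambda>_. Q", OF prob_space_axioms Qi EQ Qnn order_refl a0 qa]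
  show ?thesis
  proof (intro bexI[OF _ tail(1)] conjI tail(2) ballI impI)
    fix w assume w: "w \<in> space M - {w \<in> space M. \<exists>K::nat. a < Q w}" and det: "det (Dn w) \<noteq> 0"
    then have "Q w \<le> a" by auto
    then show "a1 w \<bullet> (Dn w *v a1 w) \<le> \<sigma>\<^sup>2 * real CARD('p) / (real n * \<delta>)" unfolding Qeq[OF det] a_def .
  qed
qed

end

section \<open>Normal equations, nonparametric noise term and excess risk\<close>

lemma linear_coefficient_zero:
  fixes b c :: real
  assumes "\<And>s. 0 \<le> 2 * s * b + s\<^sup>2 * c" shows "b = 0"
proof (rule ccontr)
  assume b: "b \<noteq> 0"
  \<comment> \<open>any positive \<open>k\<close> with \<open>c < 2 k\<close>: at \<open>s = - b / k\<close> the polynomial is negative\<close>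
  define k where "k = \<bar>c\<bar> + 1"
  have k: "0 < k" "c < 2 * k" by (auto simp: k_def)
  have "0 \<le> 2 * (- b / k) * b + (- b / k)\<^sup>2 * c" by (rule assms)
  also have "\<dots> = (b / k)\<^sup>2 * (c - 2 * k)" using k by (simp add: power2_eq_square field_simps)
  also have "\<dots> < 0" using b k by (intro mult_pos_neg) auto
  finally show False by simp
qed

context covariance_form begin

lemma ly_sum_bounded:
  assumes "\<And>i. i \<in> I \<Longrightarrow> y i \<in> l2_space T"
  shows "l2.bounded_functional (\<lambda>h. \<Sum>i\<in>I. c i * ly (y i) h) (\<Sum>i\<in>I. \<bar>c i\<bar> * (l2_norm T (y i) * \<kappa>))"
  unfolding l2.bounded_functional_def
proof (intro conjI ballI)
  show "lin_functional (l2_space T) (\<lambda>h. \<Sum>i\<in>I. c i * ly (y i) h)"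
    unfolding lin_functional_def
  proof (intro ballI allI)
    fix f g a b assume fg: "f \<in> l2_space T" "g \<in> l2_space T"
    have "(\<Sum>i\<in>I. c i * ly (y i) (\<lambda>x. a * f x + b * g x)) = (\<Sum>i\<in>I. a * (c i * ly (y i) f) + b * (c i * ly (y i) g))"
      using lin_functionalD[OF ly_functional[OF assms] fg] by (intro sum.cong) (auto simp: algebra_simps)
    then show "(\<Sum>i\<in>I. c i * ly (y i) (\<lambda>x. a * f x + b * g x)) = a * (\<Sum>i\<in>I. c i * ly (y i) f) + b * (\<Sum>i\<in>I. c i * ly (y i) g)"
      by (simp add: sum.distrib sum_distrib_left)
  qed
  show "0 \<le> (\<Sum>i\<in>I. \<bar>c i\<bar> * (l2_norm T (y i) * \<kappa>))"
    using l2.N_nonneg[OF assms] \<kappa>_nonneg by (intro sum_nonneg mult_nonneg_nonneg) (auto simp: N_eq_l2_norm)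
  fix f assume f: "f \<in> l2_space T"
  have "\<bar>\<Sum>i\<in>I. c i * ly (y i) f\<bar> \<le> (\<Sum>i\<in>I. \<bar>c i * ly (y i) f\<bar>)" by (rule sum_abs)
  also have "\<dots> \<le> (\<Sum>i\<in>I. \<bar>c i\<bar> * (l2_norm T (y i) * \<kappa>) * l2.N f)"
    using l2.bounded_functionalD(3)[OF ly_bounded[OF assms] f]
    by (intro sum_mono) (auto simp: abs_mult mult.assoc intro!: mult_left_mono)
  finally show "\<bar>\<Sum>i\<in>I. c i * ly (y i) f\<bar> \<le> (\<Sum>i\<in>I. \<bar>c i\<bar> * (l2_norm T (y i) * \<kappa>)) * l2.N f" by (simp add: sum_distrib_right)
qed

text \<open>
  The loss is a quadratic polynomial along the line \<open>(ah + s *\<^sub>R a', fh + s f')\<close>, with its minimum at \<open>s = 0\<close>.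
\<close>

lemma normal_equations:
  fixes x :: "nat \<Rightarrow> real^'p"
  assumes y: "\<And>i. i \<in> {1..n} \<Longrightarrow> y i \<in> l2_space T"
    and min: "is_arg_min (penalized_loss T S n l z x y) (\<lambda>(a, f). f \<in> l2_space T) (ah, fh)"
    and f': "f' \<in> l2_space T"
  shows "(1 / real n) * (\<Sum>i=1..n. (z i - x i \<bullet> ah - ly (y i) fh) * (x i \<bullet> a' + ly (y i) f')) = l * l2_inner T fh f'"
proof -
  have fh: "fh \<in> l2_space T" using min by (simp add: is_arg_min_def)
  define res where "res i = z i - x i \<bullet> ah - ly (y i) fh" for i
  define q where "q i = x i \<bullet> a' + ly (y i) f'" for i
  define c where "c = (1 / real n) * (\<Sum>i=1..n. (q i)\<^sup>2) + l * l2_inner T f' f'"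
  define b where "b = l * l2_inner T fh f' - (1 / real n) * (\<Sum>i=1..n. res i * q i)"
  have nsq: "(l2_norm T f)\<^sup>2 = l2_inner T f f" if "f \<in> l2_space T" for f
    using l2.N_sq[OF that] by (simp add: N_eq_l2_norm)
  have "0 \<le> 2 * s * b + s\<^sup>2 * c" for s
  proof -
    define fs where "fs = (\<lambda>t. 1 * fh t + s * f' t)"
    have fs: "fs \<in> l2_space T" unfolding fs_def by (rule l2_lin[OF fh f'])
    have "penalized_loss T S n l z x y (ah, fh) \<le> penalized_loss T S n l z x y (ah + s *\<^sub>R a', fs)"
      using min fs by (auto simp: is_arg_min_def not_less)
    moreover have "penalized_loss T S n l z x y (ah, fh) = (1 / real n) * (\<Sum>i=1..n. (res i)\<^sup>2) + l * l2_inner T fh fh"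
      by (simp add: penalized_loss_def res_def ly_def nsq fh)
    moreover have "penalized_loss T S n l z x y (ah + s *\<^sub>R a', fs)
       = (1 / real n) * (\<Sum>i=1..n. (res i)\<^sup>2) + l * l2_inner T fh fh + (2 * s * b + s\<^sup>2 * c)"
    proof -
      have ly_fs: "ly (y i) fs = ly (y i) fh + s * ly (y i) f'" if "i \<in> {1..n}" for i
        unfolding fs_def using lin_functionalD[OF ly_functional[OF y[OF that]] fh f', of 1 s] by simp
      have "(\<Sum>i=1..n. (z i - x i \<bullet> (ah + s *\<^sub>R a') - ly (y i) fs)\<^sup>2) = (\<Sum>i=1..n. (res i)\<^sup>2 - 2 * s * (res i * q i) + s\<^sup>2 * (q i)\<^sup>2)"
        by (intro sum.cong refl, subst ly_fs)
           (auto simp: res_def q_def inner_add_right power2_eq_square algebra_simps)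
      also have "\<dots> = (\<Sum>i=1..n. (res i)\<^sup>2) - 2 * s * (\<Sum>i=1..n. res i * q i) + s\<^sup>2 * (\<Sum>i=1..n. (q i)\<^sup>2)"
        by (simp add: sum.distrib sum_subtractf sum_distrib_left)
      finally have 1: "(\<Sum>i=1..n. (z i - x i \<bullet> (ah + s *\<^sub>R a') - ly (y i) fs)\<^sup>2)
         = (\<Sum>i=1..n. (res i)\<^sup>2) - 2 * s * (\<Sum>i=1..n. res i * q i) + s\<^sup>2 * (\<Sum>i=1..n. (q i)\<^sup>2)" .
      have 2: "l2_inner T fs fs = l2_inner T fh fh + 2 * s * l2_inner T fh f' + s\<^sup>2 * l2_inner T f' f'"
        unfolding fs_def using l2.B_linL[OF fh f' l2_lin[OF fh f'], of 1 s 1 s] l2.B_linR[OF fh f' fh, of 1 s] l2.B_linR[OF fh f' f', of 1 s] l2.sym[OF f' fh]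
        by (simp add: power2_eq_square algebra_simps)
      show ?thesis
        unfolding penalized_loss_def prod.case ly_def[symmetric] 1 nsq[OF fs] 2 b_def c_def by (simp add: algebra_simps)
    qed
    ultimately show ?thesis by simp
  qed
  then have "b = 0" by (rule linear_coefficient_zero)
  then show ?thesis by (simp add: b_def res_def q_def)
qed

end

context noisy_model begin

text \<open>
  The functional of \<open>h\<close> on the left is bounded through its coordinates along \<open>g\<close>.  Their sum of squares is a quadratic
  form in the noise, because the residuals of the noise can be traded for the residuals \<open>\<rho>\<close> of the numbers
  \<open>l\<^sub>Y\<^sub>i(g q)\<close>; these have a sum of squares that is no larger, so the expected trace is at most the sum of the
  \<open>t (g q) (g q)\<close> divided by \<open>n\<close>.
\<close>

lemma noise_functional:
  assumes l: "0 < l" and g: "fun_form.orthonormal (l2_space T) (Bl l) (g :: nat \<Rightarrow> _)" "fun_form.total (l2_space T) (Bl l) g"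
    and Db: "0 < Db" "\<And>K. (\<Sum>k<K. t (g k) (g k)) \<le> Db" and \<delta>: "0 < \<delta>"
  shows "\<exists>Bad\<in>sets M. measure M Bad \<le> \<delta> \<and> (\<forall>w\<in>space M - Bad. det (Dn w) \<noteq> 0 \<longrightarrow> (\<forall>i\<in>{1..n}. l2_norm T (Ys i w) \<le> M2) \<longrightarrow>
     (\<forall>h\<in>l2_space T. \<bar>(1 / real n) * (\<Sum>i=1..n. (es w i - xs w i \<bullet> a1 w) * ly (Ys i w) h)\<bar> \<le> \<sigma> * sqrt (Db / (real n * \<delta>)) * Nl l h))"
proof -
  interpret B: complete_fun_form "l2_space T" "Bl l" by (rule Bl_complete[OF l])
  have gV: "g k \<in> l2_space T" for k using B.orthonormal_in[OF g(1)] .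
  \<comment> \<open>outside of these designs the coefficients are set to zero, which keeps them bounded\<close>
  define good where "good \<omega> \<longleftrightarrow> det (cov\<omega> \<omega>) \<noteq> 0 \<and> (\<forall>j\<in>{1..n}. l2_norm T (snd (\<omega> j)) \<le> M2)" for \<omega>
  define lv where "lv \<omega> q i = ly (snd (\<omega> i)) (g q)" for \<omega> :: "nat \<Rightarrow> (real^'p) \<times> (real \<Rightarrow> real)" and q i
  define G where "G \<omega> q = (1 / real n) *\<^sub>R (\<Sum>i=1..n. lv \<omega> q i *\<^sub>R fst (\<omega> i))" for \<omega> q
  define \<rho> where "\<rho> \<omega> q i = lv \<omega> q i - fst (\<omega> i) \<bullet> cramer_solution (cov\<omega> \<omega>) (G \<omega> q)" for \<omega> q i
  define H where "H K i k \<omega> = (if good \<omega> then 1 / (real n)\<^sup>2 * (\<Sum>q<K. \<rho> \<omega> q i * \<rho> \<omega> q k) else 0)" for K :: nat and i k \<omega>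
  have lvm: "(\<lambda>\<omega>. lv \<omega> q i) \<in> borel_measurable (Pi\<^sub>M {1..n} (\<lambda>_. U))" if "i \<in> {1..n}" for q i
    unfolding lv_def
    by (intro measurable_compose[OF measurable_component_singleton[OF that] measurable_compose[OF measurable_snd ly_measurable[OF gV]]])
  have Gm: "(\<lambda>\<omega>. G \<omega> q $ j) \<in> borel_measurable (Pi\<^sub>M {1..n} (\<lambda>_. U))" for q j
  proof -
    have Gc: "G \<omega> q $ j = (1 / real n) * (\<Sum>i=1..n. lv \<omega> q i * fst (\<omega> i) $ j)" for \<omega> by (simp add: G_def sum_component)
    show ?thesis unfolding Gc by (intro borel_measurable_times borel_measurable_sum borel_measurable_const lvm fst_component)
  qed
  have \<rho>m: "(\<lambda>\<omega>. \<rho> \<omega> q i) \<in> borel_measurable (Pi\<^sub>M {1..n} (\<lambda>_. U))" if "i \<in> {1..n}" for q i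
    unfolding \<rho>_def
    by (intro borel_measurable_diff lvm inner_measurable_components cramer_solution_measurable cov\<omega>_measurable fst_component Gm that)
  have goodm: "Measurable.pred (Pi\<^sub>M {1..n} (\<lambda>_. U)) good"
  proof -
    have [measurable]: "(\<lambda>\<omega>. det (cov\<omega> \<omega>)) \<in> borel_measurable (Pi\<^sub>M {1..n} (\<lambda>_. U))" by (rule det_measurable[OF cov\<omega>_measurable])
    have [measurable]: "(\<lambda>\<omega>. l2_norm T (snd (\<omega> j))) \<in> borel_measurable (Pi\<^sub>M {1..n} (\<lambda>_. U))" if "j \<in> {1..n}" for j
      by (intro measurable_compose[OF measurable_component_singleton[OF that] measurable_compose[OF measurable_snd l2_norm_measurable]])
    show ?thesis unfolding good_def by measurable
  qed
  have Hm: "H K i k \<in> borel_measurable (Pi\<^sub>M {1..n} (\<lambda>_. U))" if "i \<in> {1..n}" "k \<in> {1..n}" for K i k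
    unfolding H_def[abs_def] using goodm
    by (intro measurable_If borel_measurable_times borel_measurable_sum borel_measurable_const \<rho>m that) (auto simp: pred_def)
  have res: "(\<Sum>i=1..n. (\<rho> \<omega> q i)\<^sup>2) \<le> (\<Sum>i=1..n. (lv \<omega> q i)\<^sup>2)" if "good \<omega>" for \<omega> q
    using that hat_residual(1)[OF n cov\<omega>_def _ refl, of \<omega> "lv \<omega> q"]
    unfolding \<rho>_def good_def G_def by (simp add: cramer_solution)
  have lvb: "(lv \<omega> q i)\<^sup>2 \<le> (m * l2_norm T (g q))\<^sup>2" if "good \<omega>" "\<omega> \<in> space (Pi\<^sub>M {1..n} (\<lambda>_. U))" "i \<in> {1..n}" for \<omega> q i
  proof -
    have "\<omega> i \<in> space U" using that(2,3) unfolding space_PiM by (rule PiE_mem)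
    then have yV: "snd (\<omega> i) \<in> l2_space T" by (auto simp: space_pair_measure)
    have "\<bar>lv \<omega> q i\<bar> \<le> l2_norm T (snd (\<omega> i)) * \<kappa> * l2_norm T (g q)"
      using l2.bounded_functionalD(3)[OF ly_bounded[OF yV] gV] by (simp add: lv_def N_eq_l2_norm)
    also have "\<dots> \<le> m * l2_norm T (g q)"
    proof (rule mult_right_mono)
      have "l2_norm T (snd (\<omega> i)) \<le> M2" using that(1,3) by (auto simp: good_def)
      then have "l2_norm T (snd (\<omega> i)) * \<kappa> \<le> M2 * \<kappa>" using \<kappa>_nonneg by (rule mult_right_mono)
      then show "l2_norm T (snd (\<omega> i)) * \<kappa> \<le> m" by (simp add: m_def mult.commute)
      show "0 \<le> l2_norm T (g q)" using l2.N_nonneg[OF gV] by (simp add: N_eq_l2_norm)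
    qed
    finally have "\<bar>lv \<omega> q i\<bar>\<^sup>2 \<le> (m * l2_norm T (g q))\<^sup>2" by (intro power_mono) auto
    then show ?thesis by simp
  qed
  define CB where "CB K = 1 / (real n)\<^sup>2 * (\<Sum>q<K. real n * (m * l2_norm T (g q))\<^sup>2)" for K :: nat
  have HB: "\<bar>H K i k \<omega>\<bar> \<le> CB K" if ik: "i \<in> {1..n}" "k \<in> {1..n}" and \<omega>: "\<omega> \<in> space (Pi\<^sub>M {1..n} (\<lambda>_. U))" for K i k \<omega>
  proof (cases "good \<omega>")
    case True
    have \<rho>b: "(\<rho> \<omega> q i)\<^sup>2 \<le> real n * (m * l2_norm T (g q))\<^sup>2" if "i \<in> {1..n}" for q i
    proof -
      have "(\<rho> \<omega> q i)\<^sup>2 \<le> (\<Sum>i=1..n. (\<rho> \<omega> q i)\<^sup>2)" using that by (intro member_le_sum) auto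
      also have "\<dots> \<le> (\<Sum>i=1..n. (lv \<omega> q i)\<^sup>2)" by (rule res[OF True])
      also have "\<dots> \<le> (\<Sum>i=1..n. (m * l2_norm T (g q))\<^sup>2)" by (intro sum_mono lvb[OF True \<omega>])
      finally show ?thesis by simp
    qed
    have \<rho>2: "\<bar>\<rho> \<omega> q i * \<rho> \<omega> q k\<bar> \<le> real n * (m * l2_norm T (g q))\<^sup>2" for q
      using sum_squares_bound[of "\<bar>\<rho> \<omega> q i\<bar>" "\<bar>\<rho> \<omega> q k\<bar>"] \<rho>b[OF ik(1), of q] \<rho>b[OF ik(2), of q] by (simp add: abs_mult)
    have "\<bar>\<Sum>q<K. \<rho> \<omega> q i * \<rho> \<omega> q k\<bar> \<le> (\<Sum>q<K. real n * (m * l2_norm T (g q))\<^sup>2)"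
      by (rule order_trans[OF sum_abs sum_mono[OF \<rho>2]])
    then have "1 / (real n)\<^sup>2 * \<bar>\<Sum>q<K. \<rho> \<omega> q i * \<rho> \<omega> q k\<bar> \<le> CB K" unfolding CB_def by (intro mult_left_mono) auto
    then show ?thesis using True by (simp add: H_def abs_mult)
  next
    case False
    then show ?thesis by (simp add: H_def CB_def sum_nonneg)
  qed
  have H0: "0 \<le> H K i i \<omega>" for K i \<omega> by (simp add: H_def sum_nonneg)
  note qf = noise.iid_quadratic_form[OF iid_W I_ne Hm HB H0]
  define \<pi> where "\<pi> w = (\<lambda>j\<in>{1..n}. snd (W j w))" for w
  have \<pi>m: "\<pi> \<in> measurable M (Pi\<^sub>M {1..n} (\<lambda>_. U))"
    unfolding \<pi>_def[abs_def] by (intro measurable_restrict measurable_compose[OF Wm snd_obs])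
  have \<pi>cov: "cov\<omega> (\<pi> w) = Dn w" for w unfolding \<pi>_def by (rule cov\<omega>_eq)
  have \<pi>x: "fst (\<pi> w i) = xs w i" "snd (\<pi> w i) = Ys i w" if "i \<in> {1..n}" for i w
    using that by (simp_all add: \<pi>_def W_def xs_def)
  define Q where "Q K w = (\<Sum>i\<in>{1..n}. \<Sum>k\<in>{1..n}. eo (W i w) * eo (W k w) * H K i k (\<pi> w))" for K w
  define atil where "atil w h = (1 / real n) * (\<Sum>i=1..n. (es w i - xs w i \<bullet> a1 w) * ly (Ys i w) h)" for w h
  have Qeq: "Q K w = (if good (\<pi> w) then (\<Sum>q<K. (atil w (g q))\<^sup>2) else 0)" for K w
  proof (cases "good (\<pi> w)")
    case True
    then have det: "det (Dn w) \<noteq> 0" by (simp add: good_def \<pi>cov)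
    define F where "F i k q = 1 / (real n)\<^sup>2 * ((es w i * \<rho> (\<pi> w) q i) * (es w k * \<rho> (\<pi> w) q k))" for i k q
    have "H K i k (\<pi> w) = 1 / (real n)\<^sup>2 * (\<Sum>q<K. \<rho> (\<pi> w) q i * \<rho> (\<pi> w) q k)" for i k using True by (simp add: H_def)
    then have "eo (W i w) * eo (W k w) * H K i k (\<pi> w) = (\<Sum>q<K. F i k q)" for i k
      by (simp add: F_def es_def sum_distrib_left sum_divide_distrib mult_ac)
    then have "Q K w = (\<Sum>i=1..n. \<Sum>k=1..n. \<Sum>q<K. F i k q)" by (simp add: Q_def)
    also have "\<dots> = (\<Sum>i=1..n. \<Sum>q<K. \<Sum>k=1..n. F i k q)" by (rule sum.cong[OF refl sum.swap])
    also have "\<dots> = (\<Sum>q<K. \<Sum>i=1..n. \<Sum>k=1..n. F i k q)" by (rule sum.swap)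
    also have "\<dots> = (\<Sum>q<K. ((1 / real n) * (\<Sum>i=1..n. es w i * \<rho> (\<pi> w) q i))\<^sup>2)"
    proof (rule sum.cong[OF refl])
      fix q
      show "(\<Sum>i=1..n. \<Sum>k=1..n. F i k q) = ((1 / real n) * (\<Sum>i=1..n. es w i * \<rho> (\<pi> w) q i))\<^sup>2"
      proof -
        define E where "E i = es w i * \<rho> (\<pi> w) q i" for i
        have "((1 / real n) * (\<Sum>i=1..n. E i))\<^sup>2 = 1 / (real n)\<^sup>2 * ((\<Sum>i=1..n. E i) * (\<Sum>k=1..n. E k))" by (simp add: power2_eq_square)
        also have "\<dots> = (\<Sum>i=1..n. \<Sum>k=1..n. F i k q)" by (simp only: sum_product) (simp only: sum_distrib_left F_def E_def)
        finally show ?thesis by (simp only: E_def)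
      qed
    qed
    also have "\<dots> = (\<Sum>q<K. (atil w (g q))\<^sup>2)"
    proof (intro sum.cong refl arg_cong[where f = "\<lambda>x. x\<^sup>2"])
      fix q
      have G\<pi>: "G (\<pi> w) q = (1 / real n) *\<^sub>R (\<Sum>i=1..n. ly (Ys i w) (g q) *\<^sub>R xs w i)"
        unfolding G_def lv_def by (intro arg_cong[where f = "(*\<^sub>R) (1 / real n)"] sum.cong refl) (simp add: \<pi>x)
      have "(\<Sum>i=1..n. es w i * \<rho> (\<pi> w) q i)
         = (\<Sum>i=1..n. es w i * (ly (Ys i w) (g q) - xs w i \<bullet> (matrix_inv (Dn w) *v ((1 / real n) *\<^sub>R (\<Sum>i=1..n. ly (Ys i w) (g q) *\<^sub>R xs w i)))))"
        unfolding \<rho>_def \<pi>cov cramer_solution[OF det] G\<pi> lv_def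
        by (intro sum.cong refl) (simp only: \<pi>x)
      also have "\<dots> = (\<Sum>i=1..n. (es w i - xs w i \<bullet> a1 w) * ly (Ys i w) (g q))"
        unfolding a1_def bn_def by (rule hat_residual(2)[OF n Dn_def det refl])
      finally show "(1 / real n) * (\<Sum>i=1..n. es w i * \<rho> (\<pi> w) q i) = atil w (g q)" by (simp add: atil_def)
    qed
    finally show ?thesis using True by simp
  qed (simp add: Q_def H_def)
  have Qi: "integrable M (Q K)" for K unfolding Q_def[abs_def] \<pi>_def by (rule qf(1))
  have EQ: "(LINT w|M. Q K w) \<le> \<sigma>\<^sup>2 * Db / real n" for K
  proof -
    have "(LINT w|M. Q K w) \<le> \<sigma>\<^sup>2 * (LINT w|M. (\<Sum>i\<in>{1..n}. H K i i (\<pi> w)))" unfolding Q_def \<pi>_def by (rule qf(2))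
    also have "(LINT w|M. (\<Sum>i\<in>{1..n}. H K i i (\<pi> w))) \<le> (LINT w|M. (\<Sum>i\<in>{1..n}. \<Sum>q<K. 1 / (real n)\<^sup>2 * (ly (Ys i w) (g q))\<^sup>2))"
    proof (rule integral_mono)
      have mm: "(\<lambda>w. H K i i (\<pi> w)) \<in> borel_measurable M" if "i \<in> {1..n}" for i by (rule measurable_compose[OF \<pi>m Hm[OF that that]])
      show "integrable M (\<lambda>w. \<Sum>i\<in>{1..n}. H K i i (\<pi> w))"
        by (intro Bochner_Integration.integrable_sum integrable_const_bound[where B = "CB K"] mm)
           (auto intro!: AE_I2 HB measurable_space[OF \<pi>m])
      have lW: "integrable M (\<lambda>w. (ly (snd (snd (W i w))) (g q))\<^sup>2)" if "i \<in> {1..n}" for i q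
      proof -
        have "integrable M (\<lambda>w. (L w (g q))\<^sup>2)" using L_mult_integrable[OF gV gV] by (simp add: power2_eq_square)
        moreover have "(\<lambda>u. (ly (snd (snd u)) (g q))\<^sup>2) \<in> borel_measurable (obs_space T)" using obs_ly[OF gV] by measurable
        ultimately show ?thesis using transport_W(2)[OF that, of "\<lambda>u. (ly (snd (snd u)) (g q))\<^sup>2"] by (simp add: V_def L_eq_ly)
      qed
      then show "integrable M (\<lambda>w. \<Sum>i\<in>{1..n}. \<Sum>q<K. 1 / (real n)\<^sup>2 * (ly (Ys i w) (g q))\<^sup>2)"
        by (intro Bochner_Integration.integrable_sum integrable_mult_right) (simp add: W_def)
      fix w assume w: "w \<in> space M"
      show "(\<Sum>i\<in>{1..n}. H K i i (\<pi> w)) \<le> (\<Sum>i\<in>{1..n}. \<Sum>q<K. 1 / (real n)\<^sup>2 * (ly (Ys i w) (g q))\<^sup>2)"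
      proof (cases "good (\<pi> w)")
        case True
        have "(\<Sum>i\<in>{1..n}. H K i i (\<pi> w)) = 1 / (real n)\<^sup>2 * (\<Sum>q<K. \<Sum>i=1..n. (\<rho> (\<pi> w) q i)\<^sup>2)"
          unfolding H_def using True by (simp add: sum_distrib_left power2_eq_square[of "\<rho> _ _ _"] sum.swap[of _ "{..<K}"])
        also have "\<dots> \<le> 1 / (real n)\<^sup>2 * (\<Sum>q<K. \<Sum>i=1..n. (lv (\<pi> w) q i)\<^sup>2)"
          by (intro mult_left_mono sum_mono res[OF True]) simp
        also have "\<dots> = 1 / (real n)\<^sup>2 * (\<Sum>i=1..n. \<Sum>q<K. (ly (Ys i w) (g q))\<^sup>2)"
          by (subst sum.swap) (simp add: lv_def \<pi>x)
        finally show ?thesis by (simp add: sum_distrib_left)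
      next
        case False
        then show ?thesis by (simp add: H_def sum_nonneg)
      qed
    qed
    also have "\<dots> = Db' / real n" if "Db' = (\<Sum>q<K. t (g q) (g q))" for Db'
    proof -
      have lq: "integrable M (\<lambda>w. (ly (Ys i w) (g q))\<^sup>2) \<and> (LINT w|M. (ly (Ys i w) (g q))\<^sup>2) = t (g q) (g q)" if "i \<in> {1..n}" for i q
      proof -
        have 1: "integrable M (\<lambda>w. (L w (g q))\<^sup>2)" using L_mult_integrable[OF gV gV] by (simp add: power2_eq_square)
        have 2: "(\<lambda>u. (ly (snd (snd u)) (g q))\<^sup>2) \<in> borel_measurable (obs_space T)" using obs_ly[OF gV] by measurable
        show ?thesis using 1 transport_W[OF that 2] by (simp add: V_def W_def L_eq_ly t_def power2_eq_square)
      qed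
      have "(LINT w|M. (\<Sum>i\<in>{1..n}. \<Sum>q<K. 1 / (real n)\<^sup>2 * (ly (Ys i w) (g q))\<^sup>2)) = (\<Sum>i\<in>{1..n}. \<Sum>q<K. 1 / (real n)\<^sup>2 * t (g q) (g q))"
        using lq by (subst Bochner_Integration.integral_sum) (auto simp: Bochner_Integration.integral_sum intro!: sum.cong Bochner_Integration.integrable_sum)
      also have "\<dots> = Db' / real n" using n that by (simp add: sum_divide_distrib power2_eq_square sum_distrib_left)
      finally show ?thesis .
    qed
    finally have "(LINT w|M. Q K w) \<le> \<sigma>\<^sup>2 * ((\<Sum>q<K. t (g q) (g q)) / real n)" by (simp add: mult_left_mono)
    also have "\<dots> \<le> \<sigma>\<^sup>2 * (Db / real n)" by (intro mult_left_mono divide_right_mono Db) auto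
    finally show ?thesis by simp
  qed
  define a where "a = \<sigma>\<^sup>2 * Db / (real n * \<delta>)"
  have a0: "0 < a" using \<sigma> n \<delta> Db by (simp add: a_def)
  have qa: "\<sigma>\<^sup>2 * Db / real n / a \<le> \<delta>" using \<sigma> n \<delta> Db by (simp add: a_def)
  have Qnn: "0 \<le> Q K w" and Qmono: "Q K w \<le> Q (Suc K) w" for K w by (simp_all add: Qeq sum_nonneg)
  note tail = markov_increasing_sequence[of M Q, OF prob_space_axioms Qi EQ Qnn Qmono a0 qa]
  show ?thesis
  proof (intro bexI[OF _ tail(1)] conjI tail(2) ballI impI)
    fix w h assume w: "w \<in> space M - {w \<in> space M. \<exists>K. a < Q K w}" and det: "det (Dn w) \<noteq> 0"
      and bd: "\<forall>i\<in>{1..n}. l2_norm T (Ys i w) \<le> M2" and h: "h \<in> l2_space T"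
    have gd: "good (\<pi> w)" using det bd by (simp add: good_def \<pi>cov \<pi>x)
    have "Q K w \<le> a" for K using w by (auto simp: not_less)
    then have le: "(\<Sum>q<K. (atil w (g q))\<^sup>2) \<le> a" for K using gd by (simp add: Qeq)
    have Yw: "Ys i w \<in> l2_space T" if "i \<in> {1..n}" for i using Ys_in[OF that] w by simp
    have bf: "l2.bounded_functional (atil w) (\<Sum>i\<in>{1..n}. \<bar>1 / real n * (es w i - xs w i \<bullet> a1 w)\<bar> * (l2_norm T (Ys i w) * \<kappa>))"
    proof -
      have "atil w = (\<lambda>h. \<Sum>i\<in>{1..n}. (1 / real n * (es w i - xs w i \<bullet> a1 w)) * ly (Ys i w) h)"
        by (simp add: atil_def sum_distrib_left fun_eq_iff mult.assoc)
      then show ?thesis using ly_sum_bounded[of "{1..n}" "\<lambda>i. Ys i w" "\<lambda>i. 1 / real n * (es w i - xs w i \<bullet> a1 w)", OF Yw] by simp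
    qed
    have "\<bar>atil w h\<bar> \<le> sqrt a * B.N h"
      by (rule B.functional_bound_from_coordinates[OF g h bounded_functional_l2_Bl[OF l bf]]) (simp add: L2_set_def le)
    also have "sqrt a = \<sigma> * sqrt (Db / (real n * \<delta>))"
    proof -
      have "a = \<sigma>\<^sup>2 * (Db / (real n * \<delta>))" by (simp add: a_def)
      then have "sqrt a = \<bar>\<sigma>\<bar> * sqrt (Db / (real n * \<delta>))" by (simp only: real_sqrt_mult real_sqrt_abs)
      then show ?thesis using \<sigma> by simp
    qed
    finally show "\<bar>(1 / real n) * (\<Sum>i=1..n. (es w i - xs w i \<bullet> a1 w) * ly (Ys i w) h)\<bar> \<le> \<sigma> * sqrt (Db / (real n * \<delta>)) * Nl l h"
      by (simp add: atil_def Nl_eq[OF l])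
  qed
qed

lemma second_moment_form: "v \<bullet> (second_moment_matrix M X *v v) = (LINT w|M. (X w \<bullet> v)\<^sup>2)" "integrable M (\<lambda>w. (X w \<bullet> v)\<^sup>2)"
proof -
  have eq: "(X w \<bullet> v)\<^sup>2 = (\<Sum>i\<in>UNIV. \<Sum>j\<in>UNIV. v $ i * v $ j * (X w $ i * X w $ j))" for w
    by (simp add: inner_vec_def power2_eq_square sum_product mult_ac)
  show "integrable M (\<lambda>w. (X w \<bullet> v)\<^sup>2)"
    unfolding eq by (intro Bochner_Integration.integrable_sum integrable_mult_right XX_integrable)
  have "(LINT w|M. (X w \<bullet> v)\<^sup>2) = (\<Sum>i\<in>UNIV. \<Sum>j\<in>UNIV. v $ i * v $ j * (LINT w|M. X w $ i * X w $ j))"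
    unfolding eq using XX_integrable by (simp add: Bochner_Integration.integral_sum Bochner_Integration.integrable_sum)
  also have "\<dots> = v \<bullet> (second_moment_matrix M X *v v)"
    by (simp add: second_moment_matrix_def inner_vec_def matrix_vector_mult_def sum_distrib_left mult_ac)
  finally show "v \<bullet> (second_moment_matrix M X *v v) = (LINT w|M. (X w \<bullet> v)\<^sup>2)" by simp
qed

text \<open>
  The noise is orthogonal to functions of \<open>(X, Y)\<close>, and \<open>X \<bullet> a\<close> is orthogonal to \<open>L h\<close> by independence.
\<close>

lemma excess_risk:
  assumes h: "h \<in> l2_space T" and b: "\<And>w. w \<in> space M \<Longrightarrow> l2_inner T (Y w) b = l2_inner T (Y w) \<beta>0 + L w h"
  shows "prediction_risk M Z X Y (linear_rule T (\<alpha>0 + a) b) - prediction_risk M Z X Y (linear_rule T \<alpha>0 \<beta>0)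
     = a \<bullet> (second_moment_matrix M X *v a) + t h h"
proof -
  define \<phi> where "\<phi> w = X w \<bullet> a + L w h" for w
  have sq: "integrable M (\<lambda>w. (L w h)\<^sup>2)" using L_mult_integrable[OF h h] by (simp add: power2_eq_square)
  have \<phi>2eq: "(\<phi> w)\<^sup>2 = (X w \<bullet> a)\<^sup>2 + 2 * ((X w \<bullet> a) * L w h) + (L w h)\<^sup>2" for w by (simp add: \<phi>_def power2_sum)
  have \<phi>2: "integrable M (\<lambda>w. (\<phi> w)\<^sup>2)"
    unfolding \<phi>2eq using second_moment_form(2) X_L_mean(1)[OF h] sq by simp
  have \<phi>m: "\<phi> \<in> borel_measurable M" unfolding \<phi>_def[abs_def] using L_measurable[OF h] by measurable
  have \<phi>E: "(LINT w|M. (\<phi> w)\<^sup>2) = a \<bullet> (second_moment_matrix M X *v a) + t h h"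
    unfolding \<phi>2eq using second_moment_form X_L_mean[OF h] sq by (simp add: t_def power2_eq_square)
  have \<epsilon>\<phi>: "integrable M (\<lambda>w. \<phi> w * \<epsilon> w)"
  proof (rule Bochner_Integration.integrable_bound)
    show "integrable M (\<lambda>w. (\<phi> w)\<^sup>2 + (\<epsilon> w)\<^sup>2)" using \<phi>2 \<epsilon>2 by simp
    show "(\<lambda>w. \<phi> w * \<epsilon> w) \<in> borel_measurable M" using \<phi>m by measurable
    show "AE w in M. norm (\<phi> w * \<epsilon> w) \<le> norm ((\<phi> w)\<^sup>2 + (\<epsilon> w)\<^sup>2)"
    proof (rule AE_I2)
      fix w
      have "2 * (\<bar>\<phi> w\<bar> * \<bar>\<epsilon> w\<bar>) \<le> (\<phi> w)\<^sup>2 + (\<epsilon> w)\<^sup>2" using sum_squares_bound[of "\<bar>\<phi> w\<bar>" "\<bar>\<epsilon> w\<bar>"] by simp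
      moreover have "0 \<le> \<bar>\<phi> w\<bar> * \<bar>\<epsilon> w\<bar>" by simp
      ultimately show "norm (\<phi> w * \<epsilon> w) \<le> norm ((\<phi> w)\<^sup>2 + (\<epsilon> w)\<^sup>2)" unfolding real_norm_def abs_mult by linarith
    qed
  qed
  define \<psi> where "\<psi> u = fst u \<bullet> a + ly (snd u) h" for u :: "(real^'p) \<times> (real \<Rightarrow> real)"
  have \<psi>m: "\<psi> \<in> borel_measurable U"
    unfolding \<psi>_def[abs_def]
    by (intro borel_measurable_add borel_measurable_inner borel_measurable_const measurable_fst measurable_compose[OF measurable_snd ly_measurable[OF h]])
  have \<psi>\<phi>: "\<psi> (XY w) = \<phi> w" for w by (simp add: \<psi>_def XY_def \<phi>_def L_eq_ly)
  have orth: "(LINT w|M. \<phi> w * \<epsilon> w) = 0" using noise_orthogonal[OF \<psi>m] \<epsilon>\<phi> by (simp add: \<psi>\<phi>)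
  have "prediction_risk M Z X Y (linear_rule T (\<alpha>0 + a) b) = (LINT w|M. (\<epsilon> w)\<^sup>2 - 2 * (\<phi> w * \<epsilon> w) + (\<phi> w)\<^sup>2)"
    unfolding prediction_risk_def linear_rule_def
    by (intro Bochner_Integration.integral_cong refl) (simp add: model b \<phi>_def inner_add_right power2_eq_square algebra_simps)
  also have "\<dots> = (LINT w|M. (\<epsilon> w)\<^sup>2) + (LINT w|M. (\<phi> w)\<^sup>2)" using \<epsilon>2 \<epsilon>\<phi> \<phi>2 orth by simp
  also have "(LINT w|M. (\<epsilon> w)\<^sup>2) = prediction_risk M Z X Y (linear_rule T \<alpha>0 \<beta>0)"
    unfolding prediction_risk_def linear_rule_def
    by (intro Bochner_Integration.integral_cong refl) (simp add: model)
  finally show ?thesis using \<phi>E by simp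
qed

text \<open>
  An entrywise error \<open>\<tau>\<close> changes the form at \<open>v\<close> by at most \<open>\<tau> p (v \<bullet> v)\<close>, and \<open>v \<bullet> v\<close> is at most \<open>d\<close> times the form of
  \<open>D\<close>.
\<close>

lemma emp_cov_lower_bound:
  assumes D: "D = second_moment_matrix M X" "pos_def_matrix D" and d: "d = matrix_opnorm (matrix_inv D)" "0 < d"
    and ent: "\<And>j k. \<bar>\<Sum>i\<in>{1..n}. Xs i w $ j * Xs i w $ k - (LINT w|M. X w $ j * X w $ k)\<bar> \<le> real n * (1 / (4 * real CARD('p) * d))"
  shows "3 / 4 * (v \<bullet> (D *v v)) \<le> v \<bullet> (Dn w *v v)"
proof -
  define \<tau> where "\<tau> = 1 / (4 * real CARD('p) * d)"
  define E where "E j k = Dn w $ j $ k - D $ j $ k" for j k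
  have El: "\<bar>E j k\<bar> \<le> \<tau>" for j k
  proof -
    have "E j k = (1 / real n) * (\<Sum>i\<in>{1..n}. Xs i w $ j * Xs i w $ k - (LINT w|M. X w $ j * X w $ k))"
      using n by (simp add: E_def Dn_def emp_cov_nth D second_moment_matrix_def xs_def sum_subtractf right_diff_distrib)
    then have "\<bar>E j k\<bar> = (1 / real n) * \<bar>\<Sum>i\<in>{1..n}. Xs i w $ j * Xs i w $ k - (LINT w|M. X w $ j * X w $ k)\<bar>"
      by (simp only: abs_mult) simp
    also have "\<dots> \<le> (1 / real n) * (real n * \<tau>)" unfolding \<tau>_def by (intro mult_left_mono ent) simp
    finally show ?thesis using n by simp
  qed
  have eq: "v \<bullet> (Dn w *v v) - v \<bullet> (D *v v) = (\<Sum>j\<in>UNIV. \<Sum>k\<in>UNIV. v $ j * v $ k * E j k)"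
    by (simp add: inner_vec_def matrix_vector_mult_def sum_distrib_left E_def right_diff_distrib sum_subtractf mult_ac)
  have "\<bar>\<Sum>j\<in>UNIV. \<Sum>k\<in>UNIV. v $ j * v $ k * E j k\<bar> \<le> (\<Sum>j\<in>UNIV. \<Sum>k\<in>UNIV. \<bar>v $ j * v $ k * E j k\<bar>)"
    by (rule order_trans[OF sum_abs]) (rule sum_mono, rule sum_abs)
  also have "\<dots> \<le> (\<Sum>j\<in>UNIV. \<Sum>k\<in>UNIV. \<bar>v $ j\<bar> * \<bar>v $ k\<bar> * \<tau>)"
    by (intro sum_mono) (simp add: abs_mult mult_left_mono El)
  also have "\<dots> = \<tau> * (\<Sum>j\<in>UNIV. \<bar>v $ j\<bar> * 1)\<^sup>2" by (simp add: power2_eq_square sum_product sum_distrib_left mult_ac)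
  also have "\<dots> \<le> \<tau> * (real CARD('p) * (v \<bullet> v))"
  proof (intro mult_left_mono)
    have "\<bar>\<Sum>j\<in>UNIV. \<bar>v $ j\<bar> * 1\<bar> \<le> L2_set (\<lambda>j. \<bar>v $ j\<bar>) UNIV * L2_set (\<lambda>j. 1) (UNIV :: 'p set)" by (rule abs_sum_mult_le_L2_set)
    then have "\<bar>\<Sum>j\<in>UNIV. \<bar>v $ j\<bar> * 1\<bar>\<^sup>2 \<le> (L2_set (\<lambda>j. \<bar>v $ j\<bar>) UNIV * L2_set (\<lambda>j. 1) (UNIV :: 'p set))\<^sup>2" by (intro power_mono) auto
    also have "\<dots> = real CARD('p) * (v \<bullet> v)"
    proof -
      have "(L2_set (\<lambda>j. \<bar>v $ j\<bar>) UNIV)\<^sup>2 = v \<bullet> v" by (simp add: L2_set_def sum_nonneg inner_vec_def power2_eq_square[symmetric])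
      moreover have "(L2_set (\<lambda>j. 1) (UNIV :: 'p set))\<^sup>2 = real CARD('p)" by (simp add: L2_set_def)
      ultimately show ?thesis by (simp add: power_mult_distrib mult.commute)
    qed
    finally show "(\<Sum>j\<in>UNIV. \<bar>v $ j\<bar> * 1)\<^sup>2 \<le> real CARD('p) * (v \<bullet> v)" by simp
    show "0 \<le> \<tau>" using d by (simp add: \<tau>_def)
  qed
  also have "\<dots> = 1 / (4 * d) * (v \<bullet> v)" by (simp add: \<tau>_def)
  also have "\<dots> \<le> 1 / (4 * d) * (d * (v \<bullet> (D *v v)))"
    using pos_def_lower_bound[OF D(2), of v] d by (intro mult_left_mono) auto
  also have "\<dots> = 1 / 4 * (v \<bullet> (D *v v))" using d by simp
  finally have "\<bar>v \<bullet> (Dn w *v v) - v \<bullet> (D *v v)\<bar> \<le> 1 / 4 * (v \<bullet> (D *v v))" unfolding eq[symmetric] .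
  then show ?thesis by linarith
qed

lemma emp_cov_nonsingular:
  assumes "pos_def_matrix D" and low: "\<And>v. 3 / 4 * (v \<bullet> (D *v v)) \<le> v \<bullet> (Dn w *v v)"
  shows "det (Dn w) \<noteq> 0"
proof -
  have "pos_def_matrix (Dn w)"
    unfolding pos_def_matrix_def
  proof (intro conjI allI impI)
    show "transpose (Dn w) = Dn w" unfolding Dn_def by (rule transpose_emp_cov)
    fix v :: "real^'p" assume "v \<noteq> 0"
    then have "0 < v \<bullet> (D *v v)" using assms(1) by (simp add: pos_def_matrix_def)
    then show "0 < v \<bullet> (Dn w *v v)" using low[of v] by simp
  qed
  then show ?thesis using pos_def_invertible invertible_det_nz by blast
qed

text \<open>
  Passes from coordinates to a bound for all \<open>h\<close> simultaneously; likewise \<open>cross_event\<close>.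
\<close>

lemma covariance_event:
  assumes l: "0 < l" and e: "l2.orthonormal (e :: nat \<Rightarrow> _)" "l2.total e"
    and g: "fun_form.orthonormal (l2_space T) (Bl l) (g :: nat \<Rightarrow> _)" "fun_form.total (l2_space T) (Bl l) g"
    and w: "w \<in> space M" and r: "0 \<le> r" and h: "h \<in> l2_space T"
    and ok: "\<And>k. L2_set (\<lambda>z. \<Sum>i\<in>{1..n}. (\<lambda>(a, b) u. ly (snd (snd u)) (e a) * ly (snd (snd u)) (g b) - t (e a) (g b)) z (W i w)) ({..<k} \<times> {..<k}) \<le> r"
  shows "\<bar>(1 / real n) * (\<Sum>i=1..n. (ly (Ys i w) h)\<^sup>2) - t h h\<bar> \<le> r / real n * l2_norm T h * Nl l h"
proof -
  define b where "b f h = (\<Sum>i\<in>{1..n}. ly (Ys i w) f * ly (Ys i w) h - t f h)" for f h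
  have Yw: "Ys i w \<in> l2_space T" if "i \<in> {1..n}" for i using Ys_in[OF that w] .
  have lin: "lin_functional (l2_space T) (b f)" if f: "f \<in> l2_space T" for f
    unfolding lin_functional_def
  proof (intro ballI allI)
    fix u v c d assume uv: "u \<in> l2_space T" "v \<in> l2_space T"
    have tl: "t f (\<lambda>x. c * u x + d * v x) = c * t f u + d * t f v"
      using lin_functionalD[OF t_functional[OF f] uv, of c d] by (simp add: t_sym)
    have "b f (\<lambda>x. c * u x + d * v x) = (\<Sum>i\<in>{1..n}. c * (ly (Ys i w) f * ly (Ys i w) u - t f u) + d * (ly (Ys i w) f * ly (Ys i w) v - t f v))"
      unfolding b_def tl using lin_functionalD[OF ly_functional[OF Yw] uv] by (intro sum.cong) (auto simp: algebra_simps)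
    then show "b f (\<lambda>x. c * u x + d * v x) = c * b f u + d * b f v" by (simp add: b_def sum.distrib sum_distrib_left)
  qed
  have bsym: "b f h = b h f" for f h by (simp add: b_def t_sym mult.commute)
  define C where "C = (\<Sum>i\<in>{1..n}. (l2_norm T (Ys i w) * \<kappa>)\<^sup>2 + m\<^sup>2)"
  have C0: "0 \<le> C" by (simp add: C_def sum_nonneg)
  have bC: "\<bar>b f h\<bar> \<le> C * l2_norm T f * l2_norm T h" if f: "f \<in> l2_space T" and h: "h \<in> l2_space T" for f h
  proof -
    have "\<bar>b f h\<bar> \<le> (\<Sum>i\<in>{1..n}. \<bar>ly (Ys i w) f * ly (Ys i w) h - t f h\<bar>)" unfolding b_def by (rule sum_abs)
    also have "\<dots> \<le> (\<Sum>i\<in>{1..n}. ((l2_norm T (Ys i w) * \<kappa>)\<^sup>2 + m\<^sup>2) * (l2_norm T f * l2_norm T h))"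
    proof (rule sum_mono)
      fix i assume i: "i \<in> {1..n}"
      note bf = ly_bounded[OF Yw[OF i]]
      have "\<bar>ly (Ys i w) f\<bar> * \<bar>ly (Ys i w) h\<bar> \<le> (l2_norm T (Ys i w) * \<kappa> * l2_norm T f) * (l2_norm T (Ys i w) * \<kappa> * l2_norm T h)"
        using l2.bounded_functionalD(3)[OF bf f] l2.bounded_functionalD(3)[OF bf h] l2.bounded_functionalD(2)[OF bf] l2.N_nonneg[OF f]
        by (intro mult_mono) (auto simp: N_eq_l2_norm)
      then have "\<bar>ly (Ys i w) f * ly (Ys i w) h\<bar> \<le> (l2_norm T (Ys i w) * \<kappa>)\<^sup>2 * (l2_norm T f * l2_norm T h)"
        by (simp add: abs_mult power2_eq_square mult_ac)
      with t_bound[OF f h] show "\<bar>ly (Ys i w) f * ly (Ys i w) h - t f h\<bar> \<le> ((l2_norm T (Ys i w) * \<kappa>)\<^sup>2 + m\<^sup>2) * (l2_norm T f * l2_norm T h)"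
        by (simp add: distrib_right mult.assoc)
    qed
    finally show ?thesis by (simp add: C_def sum_distrib_right mult.assoc)
  qed
  have lin1: "lin_functional (l2_space T) (\<lambda>f. b f h)" if "h \<in> l2_space T" for h
  proof -
    have "(\<lambda>f. b f h) = b h" by (rule ext) (rule bsym)
    then show ?thesis using lin[OF that] by simp
  qed
  have HS: "L2_set (\<lambda>(i, j). b (e i) (g j)) ({..<k} \<times> {..<k}) \<le> r" for k
  proof -
    have "(\<lambda>(i, j). b (e i) (g j)) = (\<lambda>z. \<Sum>i\<in>{1..n}. (\<lambda>(a, b) u. ly (snd (snd u)) (e a) * ly (snd (snd u)) (g b) - t (e a) (g b)) z (W i w))"
      by (simp add: b_def fun_eq_iff W_def)
    then show ?thesis using ok[of k] by simp
  qed
  have "\<bar>b h h\<bar> \<le> r * l2_norm T h * Nl l h"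
    by (rule bilinear_bound_from_coordinates[where b = b, OF l e g lin1 lin C0 bC HS r h h])
  moreover have "b h h = (\<Sum>i=1..n. (ly (Ys i w) h)\<^sup>2) - real n * t h h"
    by (simp only: b_def power2_eq_square sum_subtractf) simp
  moreover define s where "s = (\<Sum>i=1..n. (ly (Ys i w) h)\<^sup>2)"
  ultimately have "\<bar>s - real n * t h h\<bar> \<le> r * l2_norm T h * Nl l h" by simp
  moreover have "real n * \<bar>(1 / real n) * s - t h h\<bar> = \<bar>real n * ((1 / real n) * s - t h h)\<bar>" by (simp add: abs_mult)
  moreover have "real n * ((1 / real n) * s - t h h) = s - real n * t h h" using n by (simp add: right_diff_distrib)
  ultimately have "real n * \<bar>(1 / real n) * s - t h h\<bar> \<le> r * l2_norm T h * Nl l h" by simp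
  then show ?thesis using n unfolding s_def[symmetric] by (simp add: pos_le_divide_eq mult.commute)
qed

lemma cross_event:
  fixes j :: 'p
  assumes e: "l2.orthonormal (e :: nat \<Rightarrow> _)" "l2.total e" and w: "w \<in> space M" and h: "h \<in> l2_space T"
    and ok: "\<And>k. L2_set (\<lambda>a. \<Sum>i\<in>{1..n}. (\<lambda>a u. fst (snd u) $ j * ly (snd (snd u)) (e a)) a (W i w)) {..<k} \<le> r"
  shows "\<bar>(1 / real n) * (\<Sum>i=1..n. xs w i $ j * ly (Ys i w) h)\<bar> \<le> r / real n * l2_norm T h"
proof -
  have Yw: "Ys i w \<in> l2_space T" if "i \<in> {1..n}" for i using Ys_in[OF that w] .
  have "\<bar>\<Sum>i\<in>{1..n}. xs w i $ j * ly (Ys i w) h\<bar> \<le> r * l2.N h"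
  proof (rule l2.functional_bound_from_coordinates[OF e h ly_sum_bounded[OF Yw]])
    fix k show "L2_set (\<lambda>a. \<Sum>i\<in>{1..n}. xs w i $ j * ly (Ys i w) (e a)) {..<k} \<le> r"
      using ok[of k] by (simp add: W_def xs_def)
  qed
  then show ?thesis using n by (simp add: abs_mult N_eq_l2_norm divide_right_mono)
qed

end

section \<open>Excess risk on a good sample\<close>

context noisy_model begin

text \<open>
  What the deterministic analysis requires of a sample.
\<close>

definition good_sample :: "real \<Rightarrow> real \<Rightarrow> real \<Rightarrow> real \<Rightarrow> real \<Rightarrow> 'w \<Rightarrow> bool" where
  "good_sample l q \<gamma> e s w \<longleftrightarrow> w \<in> space M \<and> det (Dn w) \<noteq> 0
     \<and> (\<forall>v. 3 / 4 * (v \<bullet> (second_moment_matrix M X *v v)) \<le> v \<bullet> (Dn w *v v))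
     \<and> a1 w \<bullet> (Dn w *v a1 w) \<le> s
     \<and> (\<forall>h\<in>l2_space T. \<bar>(1 / real n) * (\<Sum>i=1..n. (es w i - xs w i \<bullet> a1 w) * ly (Ys i w) h)\<bar> \<le> e * Nl l h)
     \<and> (\<forall>h\<in>l2_space T. \<bar>(1 / real n) * (\<Sum>i=1..n. (ly (Ys i w) h)\<^sup>2) - t h h\<bar> \<le> q * sqrt l * l2_norm T h * Nl l h)
     \<and> (\<forall>h\<in>l2_space T. \<forall>j. \<bar>(1 / real n) * (\<Sum>i=1..n. xs w i $ j * ly (Ys i w) h)\<bar> \<le> \<gamma> * l2_norm T h)"

text \<open>
  The union of the exceptional events; the cross moments need one event for each covariate and the matrix entries one
  for each pair of covariates, which accounts for the divisions by \<open>CARD('p)\<close> and its square.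
\<close>

lemma good_sample_event:
  assumes l: "0 < l" and Db: "0 < Db" "effective_dimension T smoothed_covariance l \<le> ennreal Db" and m1: "1 \<le> m" and M10: "0 < M1"
    and D: "pos_def_matrix (second_moment_matrix M X)"
    and d: "d = matrix_opnorm (matrix_inv (second_moment_matrix M X))" "0 < d"
    and \<delta>3: "0 < \<delta>3" and \<delta>4: "0 < \<delta>4"
    and L1: "1 / 2 \<le> L1" "2 * exp (- L1) \<le> \<delta>1"
    and L2: "0 < L2" "2 * exp (- L2) \<le> \<delta>2 / real CARD('p)"
    and L5: "0 \<le> L5" "2 * exp (- L5) \<le> \<delta>5 / (real CARD('p))\<^sup>2"
    and \<tau>: "\<tau> = 1 / (4 * real CARD('p) * d)" "\<tau> \<le> M1\<^sup>2 / 4" "72 * M1 ^ 4 * L5 \<le> real n * \<tau>\<^sup>2"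
  shows "\<exists>E\<in>sets M. 1 - (\<delta>1 + \<delta>2 + \<delta>3 + \<delta>4 + \<delta>5) \<le> measure M E \<and>
    (\<forall>w\<in>E. good_sample l (2 * m\<^sup>2 * L1 * (1 / sqrt l + sqrt (real n * Db)) / (real n * sqrt l)) (2 * m * M1 * sqrt (real n * L2) / real n)
       (\<sigma> * sqrt (Db / (real n * \<delta>3))) (\<sigma>\<^sup>2 * real CARD('p) / (real n * \<delta>4)) w)"
proof -
  obtain e :: "nat \<Rightarrow> real \<Rightarrow> real" where e: "l2.orthonormal e" "l2.total e" using ex_orthonormal_total by auto
  obtain g :: "nat \<Rightarrow> real \<Rightarrow> real" where g: "fun_form.orthonormal (l2_space T) (Bl l) g" "fun_form.total (l2_space T) (Bl l) g"
    using Bl_ex_basis[OF l] by auto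
  have Dbs: "(\<Sum>k<K. t (g k) (g k)) \<le> Db" for K
  proof -
    have "ennreal (\<Sum>k<K. t (g k) (g k)) \<le> ennreal Db" by (rule order_trans[OF sum_L_sq_le_effective_dimension[OF l g] Db(2)])
    then show ?thesis using Db(1) by (simp add: ennreal_le_iff)
  qed
  define r1 where "r1 = 2 * m\<^sup>2 * L1 * (1 / sqrt l + sqrt (real n * Db))"
  define r2 where "r2 = 2 * m * M1 * sqrt (real n * L2)"
  have r1: "0 \<le> r1" using l Db(1) L1(1) unfolding r1_def by (intro mult_nonneg_nonneg add_nonneg_nonneg) auto
  have \<tau>0: "0 < \<tau>" using d(2) by (simp add: \<tau>(1))
  define B1 where "B1 = {w\<in>space M. \<exists>k. r1 < L2_set (\<lambda>z. \<Sum>i\<in>{1..n}. (\<lambda>(a, b) u. ly (snd (snd u)) (e a) * ly (snd (snd u)) (g b) - t (e a) (g b)) z (W i w)) ({..<k} \<times> {..<k})}"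
  define B2 where "B2 j = {w\<in>space M. \<exists>k. r2 < L2_set (\<lambda>a. \<Sum>i\<in>{1..n}. (\<lambda>a u. fst (snd u) $ j * ly (snd (snd u)) (e a)) a (W i w)) {..<k}}" for j :: 'p
  define B5 where "B5 jk = {w\<in>space M. real n * \<tau> < \<bar>\<Sum>i\<in>{1..n}. Xs i w $ fst jk * Xs i w $ snd jk - (LINT w|M. X w $ fst jk * X w $ snd jk)\<bar>}" for jk :: "'p \<times> 'p"
  have B1: "B1 \<in> sets M" "measure M B1 \<le> \<delta>1"
    unfolding B1_def r1_def by (rule concentration_covariance[OF l e(1) g(1) Db(1) Dbs m1 L1])+
  have m0: "0 < m" using m1 by simp
  have B2: "B2 j \<in> sets M" "measure M (B2 j) \<le> \<delta>2 / real CARD('p)" for j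
    unfolding B2_def r2_def by (rule concentration_cross[OF e(1) m0 M10 L2])+
  have B5: "B5 jk \<in> sets M" "measure M (B5 jk) \<le> \<delta>5 / (real CARD('p))\<^sup>2" for jk
    unfolding B5_def by (rule concentration_entry[OF M10 \<tau>0 \<tau>(2,3) L5])+
  obtain B3 where B3: "B3 \<in> sets M" "measure M B3 \<le> \<delta>3"
    "\<And>w h. w \<in> space M - B3 \<Longrightarrow> det (Dn w) \<noteq> 0 \<Longrightarrow> (\<forall>i\<in>{1..n}. l2_norm T (Ys i w) \<le> M2) \<Longrightarrow> h \<in> l2_space T \<Longrightarrow>
       \<bar>(1 / real n) * (\<Sum>i=1..n. (es w i - xs w i \<bullet> a1 w) * ly (Ys i w) h)\<bar> \<le> \<sigma> * sqrt (Db / (real n * \<delta>3)) * Nl l h"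
    using noise_functional[OF l g Db(1) Dbs \<delta>3] by auto
  obtain B4 where B4: "B4 \<in> sets M" "measure M B4 \<le> \<delta>4"
    "\<And>w. w \<in> space M - B4 \<Longrightarrow> det (Dn w) \<noteq> 0 \<Longrightarrow> a1 w \<bullet> (Dn w *v a1 w) \<le> \<sigma>\<^sup>2 * real CARD('p) / (real n * \<delta>4)"
    using noise_parametric[OF \<delta>4] by auto
  obtain B0 where B0: "{w\<in>space M. \<not> (\<forall>i\<in>{1..n}. l2_norm T (Ys i w) \<le> M2)} \<subseteq> B0" "emeasure M B0 = 0" "B0 \<in> sets M"
    using AE_E[OF Ys_bound] .
  define C2 where "C2 = (\<Union>j. B2 j)"
  define C5 where "C5 = (\<Union>jk. B5 jk)"
  have C2: "C2 \<in> sets M" "measure M C2 \<le> \<delta>2"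
  proof -
    show "C2 \<in> sets M" unfolding C2_def using B2(1) by auto
    have "measure M C2 \<le> (\<Sum>j\<in>UNIV. measure M (B2 j))" unfolding C2_def by (rule measure_UNION_le) (use B2(1) in auto)
    also have "\<dots> \<le> (\<Sum>j\<in>(UNIV :: 'p set). \<delta>2 / real CARD('p))" by (intro sum_mono B2(2))
    finally show "measure M C2 \<le> \<delta>2" by simp
  qed
  have C5: "C5 \<in> sets M" "measure M C5 \<le> \<delta>5"
  proof -
    show "C5 \<in> sets M" unfolding C5_def using B5(1) by (intro sets.finite_UN) auto
    have "measure M C5 \<le> (\<Sum>jk\<in>UNIV. measure M (B5 jk))" unfolding C5_def by (rule measure_UNION_le) (use B5(1) in auto)
    also have "\<dots> \<le> (\<Sum>jk\<in>(UNIV :: ('p \<times> 'p) set). \<delta>5 / (real CARD('p))\<^sup>2)" by (intro sum_mono B5(2))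
    finally show "measure M C5 \<le> \<delta>5" by (simp add: power2_eq_square)
  qed
  \<comment> \<open>the null set \<open>B0\<close>, where some sampled curve violates the norm bound, costs nothing\<close>
  define Bad where "Bad = B0 \<union> (B1 \<union> (C2 \<union> (B3 \<union> (B4 \<union> C5))))"
  have Bad: "Bad \<in> sets M" unfolding Bad_def using B0(3) B1(1) C2(1) B3(1) B4(1) C5(1) by (intro sets.Un)
  have "measure M Bad \<le> 0 + (\<delta>1 + (\<delta>2 + (\<delta>3 + (\<delta>4 + \<delta>5))))"
    unfolding Bad_def
    by (intro order_trans[OF measure_Un_le] add_mono sets.Un B0(3) B1 C2 B3(1,2) B4(1,2) C5)
       (simp add: measure_def B0(2))
  then have "1 - (\<delta>1 + \<delta>2 + \<delta>3 + \<delta>4 + \<delta>5) \<le> measure M (space M - Bad)"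
    using prob_compl[OF Bad] by simp
  moreover have "space M - Bad \<in> sets M" using Bad by auto
  moreover have "good_sample l (r1 / (real n * sqrt l)) (r2 / real n) (\<sigma> * sqrt (Db / (real n * \<delta>3))) (\<sigma>\<^sup>2 * real CARD('p) / (real n * \<delta>4)) w"
    if "w \<in> space M - Bad" for w
  proof -
    have w: "w \<in> space M" and n0: "w \<notin> B0" "w \<notin> B1" "w \<notin> C2" "w \<notin> B3" "w \<notin> B4" "w \<notin> C5" using that by (auto simp: Bad_def)
    have "\<bar>\<Sum>i\<in>{1..n}. Xs i w $ j * Xs i w $ k - (LINT w|M. X w $ j * X w $ k)\<bar> \<le> real n * (1 / (4 * real CARD('p) * d))" for j k
    proof -
      have "w \<notin> B5 (j, k)" using n0(6) by (auto simp: C5_def)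
      then show ?thesis using w by (simp add: B5_def \<tau>(1) not_less)
    qed
    note low = emp_cov_lower_bound[OF refl D d this]
    have det: "det (Dn w) \<noteq> 0" by (rule emp_cov_nonsingular[OF D low])
    have Yb: "\<forall>i\<in>{1..n}. l2_norm T (Ys i w) \<le> M2"
    proof (rule ccontr)
      assume "\<not> (\<forall>i\<in>{1..n}. l2_norm T (Ys i w) \<le> M2)"
      then have "w \<in> B0" using w by (intro subsetD[OF B0(1)]) simp
      then show False using n0(1) by simp
    qed
    have cov: "\<bar>(1 / real n) * (\<Sum>i=1..n. (ly (Ys i w) h)\<^sup>2) - t h h\<bar> \<le> r1 / (real n * sqrt l) * sqrt l * l2_norm T h * Nl l h"
      if h: "h \<in> l2_space T" for h
    proof -
      have "\<bar>(1 / real n) * (\<Sum>i=1..n. (ly (Ys i w) h)\<^sup>2) - t h h\<bar> \<le> r1 / real n * l2_norm T h * Nl l h"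
      proof (rule covariance_event[OF l e g w r1 h])
        fix k show "L2_set (\<lambda>z. \<Sum>i\<in>{1..n}. (\<lambda>(a, b) u. ly (snd (snd u)) (e a) * ly (snd (snd u)) (g b) - t (e a) (g b)) z (W i w)) ({..<k} \<times> {..<k}) \<le> r1"
          using n0(2) w unfolding B1_def by (simp only: mem_Collect_eq not_ex not_less simp_thms)
      qed
      then show ?thesis using l by simp
    qed
    have cross: "\<bar>(1 / real n) * (\<Sum>i=1..n. xs w i $ j * ly (Ys i w) h)\<bar> \<le> r2 / real n * l2_norm T h" if h: "h \<in> l2_space T" for h j
    proof (rule cross_event[OF e w h])
      have "w \<notin> B2 j" using n0(3) by (auto simp: C2_def)
      then show "L2_set (\<lambda>a. \<Sum>i\<in>{1..n}. (\<lambda>a u. fst (snd u) $ j * ly (snd (snd u)) (e a)) a (W i w)) {..<k} \<le> r2" for k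
        using w unfolding B2_def by (simp only: mem_Collect_eq not_ex not_less simp_thms)
    qed
    have w3: "w \<in> space M - B3" and w4: "w \<in> space M - B4" using w n0 by auto
    show ?thesis
      unfolding good_sample_def using w det low B4(3)[OF w4 det] B3(3)[OF w3 det Yb] cov cross by simp
  qed
  ultimately show ?thesis unfolding r1_def r2_def by (intro bexI[of _ "space M - Bad"]) auto
qed

lemma excess_risk_le:
  assumes good: "good_sample l q \<gamma> e s w" and l: "0 < l" and q: "0 \<le> q" and e: "0 \<le> e"
    and D: "pos_def_matrix (second_moment_matrix M X)" and d: "d = matrix_opnorm (matrix_inv (second_moment_matrix M X))"
    and \<gamma>: "4 / 3 * d * real CARD('p) * \<gamma>\<^sup>2 \<le> 3 / 8 * l"
    and f0: "f0 \<in> l2_space T" "l2_eq T (S f0) \<beta>0"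
    and min: "is_arg_min (penalized_loss T S n l (\<lambda>i. Zs i w) (\<lambda>i. Xs i w) (\<lambda>i. Ys i w)) (\<lambda>(a, f). f \<in> l2_space T) (ah, fh)"
  shows "prediction_risk M Z X Y (linear_rule T ah (S fh)) - prediction_risk M Z X Y (linear_rule T \<alpha>0 \<beta>0)
    \<le> 8 / 3 * s + (11 / 8 * ((1 + q) * (sqrt l * l2_norm T f0) + (1 + q)\<^sup>2 * e))\<^sup>2"
proof -
  have w: "w \<in> space M" and det: "det (Dn w) \<noteq> 0"
    and low: "\<And>v. 3 / 4 * (v \<bullet> (second_moment_matrix M X *v v)) \<le> v \<bullet> (Dn w *v v)"
    and a1s: "a1 w \<bullet> (Dn w *v a1 w) \<le> s"
    and noise: "\<And>h. h \<in> l2_space T \<Longrightarrow> \<bar>(1 / real n) * (\<Sum>i=1..n. (es w i - xs w i \<bullet> a1 w) * ly (Ys i w) h)\<bar> \<le> e * Nl l h"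
    and cov: "\<And>h. h \<in> l2_space T \<Longrightarrow> \<bar>(1 / real n) * (\<Sum>i=1..n. (ly (Ys i w) h)\<^sup>2) - t h h\<bar> \<le> q * sqrt l * l2_norm T h * Nl l h"
    and cross: "\<And>h j. h \<in> l2_space T \<Longrightarrow> \<bar>(1 / real n) * (\<Sum>i=1..n. xs w i $ j * ly (Ys i w) h)\<bar> \<le> \<gamma> * l2_norm T h"
    using good by (simp_all add: good_sample_def)
  have fh: "fh \<in> l2_space T" using min by (simp add: is_arg_min_def)
  define a where "a = ah - \<alpha>0"
  define h where "h = (\<lambda>x. 1 * fh x + (- 1) * f0 x)"
  have h: "h \<in> l2_space T" unfolding h_def by (rule l2_lin[OF fh f0(1)])
  have Yw: "Ys i w \<in> l2_space T" if "i \<in> {1..n}" for i using Ys_in[OF that w] .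
  have ly_f0: "ly y f0 = l2_inner T y \<beta>0" if y: "y \<in> l2_space T" for y
    using l2_inner_cong[OF f0(2) S_in[OF f0(1)] \<beta>0 y] l2.sym[OF y S_in[OF f0(1)]] l2.sym[OF y \<beta>0] by (simp add: ly_def)
  have ly_h: "ly y h = ly y fh - l2_inner T y \<beta>0" if y: "y \<in> l2_space T" for y
    unfolding h_def using lin_functionalD[OF ly_functional[OF y] fh f0(1), of 1 "-1"] ly_f0[OF y] by simp
  define res where "res i = es w i - xs w i \<bullet> a - ly (Ys i w) h" for i
  have res: "Zs i w - Xs i w \<bullet> ah - ly (Ys i w) fh = res i" if "i \<in> {1..n}" for i
    using ly_h[OF Yw[OF that]] by (simp add: res_def es_def eo_def W_def xs_def a_def inner_diff_right)
  have normal: "(1 / real n) * (\<Sum>i=1..n. res i * (xs w i \<bullet> a' + ly (Ys i w) f')) = l * l2_inner T fh f'" if f': "f' \<in> l2_space T" for a' f'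
  proof -
    have "(\<Sum>i=1..n. res i * (xs w i \<bullet> a' + ly (Ys i w) f')) = (\<Sum>i=1..n. (Zs i w - Xs i w \<bullet> ah - ly (Ys i w) fh) * (Xs i w \<bullet> a' + ly (Ys i w) f'))"
      by (intro sum.cong refl) (simp add: res xs_def)
    then show ?thesis using normal_equations[OF Yw min f', of a'] by simp
  qed
  have zero: "(\<lambda>x. 0 * h x + 0 * h x) \<in> l2_space T" by (rule l2_lin[OF h h])
  \<comment> \<open>testing with the sum itself shows that it vanishes\<close>
  have normal_a: "(\<Sum>i=1..n. res i *\<^sub>R xs w i) = 0"
  proof -
    define u where "u = (\<Sum>i=1..n. res i *\<^sub>R xs w i)"
    have "ly (Ys i w) (\<lambda>x. 0 * h x + 0 * h x) = 0" if "i \<in> {1..n}" for i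
      using lin_functionalD[OF ly_functional[OF Yw[OF that]] h h, of 0 0] by simp
    then have "(\<Sum>i=1..n. res i * (xs w i \<bullet> u + ly (Ys i w) (\<lambda>x. 0 * h x + 0 * h x))) = (\<Sum>i=1..n. res i * (xs w i \<bullet> u))"
      by (intro sum.cong refl) simp
    also have "\<dots> = u \<bullet> u" by (subst (2) u_def) (simp add: inner_sum_left)
    finally have "(1 / real n) * (u \<bullet> u) = l * l2_inner T fh (\<lambda>x. 0 * h x + 0 * h x)" using normal[OF zero, of u] by simp
    then have "u \<bullet> u = 0" using n l2.B_linR[OF h h fh, of 0 0] by simp
    then show ?thesis by (simp add: u_def)
  qed
  have normal_h: "(1 / real n) * (\<Sum>i=1..n. res i * ly (Ys i w) h) = l * (l2_inner T f0 h + (l2_norm T h)\<^sup>2)"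
  proof -
    have "l2_inner T h h = l2_inner T fh h - l2_inner T f0 h"
      using l2.B_linL[OF fh f0(1) h, of 1 "-1"] by (simp add: h_def)
    moreover have "(l2_norm T h)\<^sup>2 = l2_inner T h h" using l2.N_sq[OF h] by (simp add: N_eq_l2_norm)
    ultimately show ?thesis using normal[OF h, of 0] by simp
  qed
  have a1eq: "emp_cov n (xs w) *v a1 w = (1 / real n) *\<^sub>R (\<Sum>i=1..n. es w i *\<^sub>R xs w i)"
  proof -
    have "Dn w *v a1 w = bn w" using hat_inverse(1)[OF n Dn_def det refl, of "bn w"] by (simp only: a1_def)
    then show ?thesis by (simp only: Dn_def bn_def)
  qed
  have Bh: "0 \<le> Bl l h h" using fun_form.N_nonneg[OF Bl_form[OF l] h] l t_nonneg[of h] l2.N_sq[OF h]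
    by (simp add: Bl_def N_eq_l2_norm[symmetric] flip: l2.N_sq[OF h])
  have N: "0 \<le> Nl l h" "(Nl l h)\<^sup>2 = t h h + l * (l2_norm T h)\<^sup>2"
    using Bh l2.N_sq[OF h] by (simp_all add: Nl_def Bl_def N_eq_l2_norm)
  have f0h: "\<bar>l2_inner T f0 h\<bar> \<le> l2_norm T f0 * l2_norm T h" using l2.cauchy_schwarz[OF f0(1) h] by (simp add: N_eq_l2_norm)
  have norms: "0 \<le> l2_norm T h" "0 \<le> l2_norm T f0" using l2.N_nonneg[OF h] l2.N_nonneg[OF f0(1)] by (simp_all add: N_eq_l2_norm)
  have "prediction_risk M Z X Y (linear_rule T (\<alpha>0 + a) (S fh)) - prediction_risk M Z X Y (linear_rule T \<alpha>0 \<beta>0)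
     = a \<bullet> (second_moment_matrix M X *v a) + t h h"
  proof (rule excess_risk[OF h])
    fix w assume "w \<in> space M"
    then show "l2_inner T (Y w) (S fh) = l2_inner T (Y w) \<beta>0 + L w h"
      using ly_h[OF Y_in] by (simp add: L_eq_ly ly_def)
  qed
  also have "\<dots> \<le> 8 / 3 * (a1 w \<bullet> (emp_cov n (xs w) *v a1 w)) + (11 / 8 * ((1 + q) * (sqrt l * l2_norm T f0) + (1 + q)\<^sup>2 * e))\<^sup>2"
    by (rule deterministic_error_bound[OF n D d low[unfolded Dn_def] a1eq normal_a[unfolded res_def] normal_h[unfolded res_def]
          l norms(1) t_nonneg N f0h norms(2) e q noise[OF h] cov[OF h] cross[OF h] \<gamma>])
  also have "\<dots> \<le> 8 / 3 * s + (11 / 8 * ((1 + q) * (sqrt l * l2_norm T f0) + (1 + q)\<^sup>2 * e))\<^sup>2"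
    using a1s by (simp add: Dn_def)
  finally show ?thesis by (simp add: a_def)
qed

end

section \<open>Comparison of the constants\<close>

text \<open>
  With this choice of \<open>lam\<close> the variance \<open>Db / n\<close> is a constant multiple of \<open>lam\<close>, namely \<open>c * \<omega> powr (- (1 + \<theta>))\<close> times it.
  The last claim inverts the power law in the definition of the minimal sample size.
\<close>

lemma rate_balance:
  fixes n :: real
  assumes n: "1 \<le> n" and \<omega>: "0 < \<omega>" and \<theta>: "0 < \<theta>" and c: "0 < c"
    and lam: "lam = \<omega> * n powr (- 1 / (1 + \<theta>))" and Db: "Db = c * lam powr (- \<theta>)"
  shows "0 < lam" "0 < Db" "1 / (n * lam) + sqrt (Db / (n * lam)) \<le> 1 / \<omega> + \<omega> powr (- (1 + \<theta>) / 2) * sqrt c"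
    and "0 \<le> G \<Longrightarrow> G powr ((1 + \<theta>) / \<theta>) \<le> n \<Longrightarrow> \<omega> * G \<le> n * lam"
proof -
  show lam0: "0 < lam" using \<omega> n by (simp add: lam)
  then show Db0: "0 < Db" using c by (simp add: Db)
  have "n * n powr (- 1 / (1 + \<theta>)) = n powr (1 + - 1 / (1 + \<theta>))" using n powr_add[of n 1 "- 1 / (1 + \<theta>)"] by simp
  also have "1 + - 1 / (1 + \<theta>) = \<theta> / (1 + \<theta>)" using \<theta> by (simp add: field_simps)
  finally have nl: "n * lam = \<omega> * n powr (\<theta> / (1 + \<theta>))" by (simp add: lam)
  have "1 \<le> n powr (\<theta> / (1 + \<theta>))" using n \<theta> by (intro ge_one_powr_ge_zero) auto
  then have "\<omega> \<le> n * lam" using \<omega> unfolding nl by simp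
  then have 1: "1 / (n * lam) \<le> 1 / \<omega>" using \<omega> n lam0 by (intro divide_left_mono mult_pos_pos) auto
  have "Db / (n * lam) = c * lam powr (- \<theta>) * lam powr (- 1) / n" using lam0 by (simp add: Db powr_minus field_simps)
  also have "\<dots> = c * lam powr (- (1 + \<theta>)) / n"
  proof -
    have "- \<theta> + - 1 = - (1 + \<theta>)" by simp
    then have "lam powr (- \<theta>) * lam powr (- 1) = lam powr (- (1 + \<theta>))" using powr_add[of lam "- \<theta>" "- 1"] by (simp only:)
    then show ?thesis by (simp only: mult.assoc)
  qed
  also have "lam powr (- (1 + \<theta>)) = \<omega> powr (- (1 + \<theta>)) * n powr ((- 1 / (1 + \<theta>)) * (- (1 + \<theta>)))"
    using \<omega> n by (simp add: lam powr_mult powr_powr)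
  also have "(- 1 / (1 + \<theta>)) * (- (1 + \<theta>)) = 1" using \<theta> by (simp add: field_simps)
  finally have 2: "Db / (n * lam) = c * \<omega> powr (- (1 + \<theta>))" using n by simp
  have "sqrt (\<omega> powr (- (1 + \<theta>))) = \<omega> powr (- (1 + \<theta>) / 2)" using \<omega> by (simp add: powr_powr flip: powr_half_sqrt)
  then have "sqrt (Db / (n * lam)) = \<omega> powr (- (1 + \<theta>) / 2) * sqrt c" unfolding 2 by (simp add: real_sqrt_mult)
  with 1 show "1 / (n * lam) + sqrt (Db / (n * lam)) \<le> 1 / \<omega> + \<omega> powr (- (1 + \<theta>) / 2) * sqrt c" by simp
  assume G: "0 \<le> G" "G powr ((1 + \<theta>) / \<theta>) \<le> n"
  have "G = (G powr ((1 + \<theta>) / \<theta>)) powr (\<theta> / (1 + \<theta>))" using G(1) \<theta> by (simp add: powr_powr)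
  also have "\<dots> \<le> n powr (\<theta> / (1 + \<theta>))" using G(2) \<theta> by (intro powr_mono2) auto
  finally show "\<omega> * G \<le> n * lam" unfolding nl using \<omega> by simp
qed

lemma scaled_errors:
  fixes n :: real
  assumes n: "0 < n" and lam: "0 < lam" and Db: "0 < Db" and A: "1 / (n * lam) + sqrt (Db / (n * lam)) \<le> A"
    and B: "0 \<le> B" and \<sigma>: "0 < \<sigma>" and \<delta>: "0 < \<delta>"
  shows "B * (1 / sqrt lam + sqrt (n * Db)) / (n * sqrt lam) \<le> B * A" "\<sigma> * sqrt (Db / (n * \<delta>)) \<le> sqrt lam * (\<sigma> * A / sqrt \<delta>)"
proof -
  have s: "sqrt lam * sqrt lam = lam" "sqrt n * sqrt n = n" using lam n by auto
  have "(1 / sqrt lam + sqrt (n * Db)) / (n * sqrt lam) = 1 / (n * lam) + sqrt (n * Db) / (n * sqrt lam)"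
    using lam n s(1) by (simp add: add_divide_distrib mult.left_commute)
  also have "sqrt (n * Db) / (n * sqrt lam) = sqrt (Db / (n * lam))"
    using lam n s(2) by (simp add: real_sqrt_mult real_sqrt_divide field_simps)
  finally have "(1 / sqrt lam + sqrt (n * Db)) / (n * sqrt lam) \<le> A" using A by simp
  then have "B * ((1 / sqrt lam + sqrt (n * Db)) / (n * sqrt lam)) \<le> B * A" using B by (rule mult_left_mono)
  then show "B * (1 / sqrt lam + sqrt (n * Db)) / (n * sqrt lam) \<le> B * A" by simp
  have "sqrt (Db / (n * \<delta>)) = sqrt lam * sqrt (Db / (n * lam)) / sqrt \<delta>"
    using lam n \<delta> by (simp add: real_sqrt_mult real_sqrt_divide field_simps)
  also have "\<dots> \<le> sqrt lam * A / sqrt \<delta>"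
  proof -
    have "0 \<le> 1 / (n * lam)" using n lam by simp
    then have "sqrt (Db / (n * lam)) \<le> A" using A by linarith
    then show ?thesis using lam \<delta> by (intro divide_right_mono mult_left_mono) auto
  qed
  finally have "\<sigma> * sqrt (Db / (n * \<delta>)) \<le> \<sigma> * (sqrt lam * A / sqrt \<delta>)" using \<sigma> by (intro mult_left_mono) auto
  then show "\<sigma> * sqrt (Db / (n * \<delta>)) \<le> sqrt lam * (\<sigma> * A / sqrt \<delta>)" by (simp add: mult_ac)
qed

text \<open>
  Probabilities of sum below \<open>1\<close> cannot both exceed \<open>1 / 2\<close>, and for the smaller one the logarithm is at least
  \<open>ln 4 \<ge> 4 / 3\<close>.
\<close>

lemma log_product_bound:
  fixes p :: real
  assumes p: "1 \<le> p" and \<delta>2: "0 < \<delta>2" "\<delta>2 < 2 * exp (- 1)" and \<delta>5: "0 < \<delta>5" "\<delta>5 < 1" and sum: "\<delta>2 + \<delta>5 < 1"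
  shows "1 \<le> ln (2 * p / \<delta>2)" "32 / 27 \<le> (ln (2 * p / \<delta>2))\<^sup>2 * ln (2 * p / \<delta>5)"
proof -
  have le: "2 / \<delta> \<le> 2 * p / \<delta>" if "0 < \<delta>" for \<delta> using p that by (intro divide_right_mono) auto
  have ln2: "2 / 3 \<le> ln (2::real)" by (rule ln2_ge_two_thirds)
  have ln4: "4 / 3 \<le> ln (4::real)"
  proof -
    have "ln (4::real) = ln (2 * 2)" by simp
    then show ?thesis using ln2 by (simp only: ln_mult) simp
  qed
  have mono: "ln x \<le> ln (2 * p / \<delta>)" if "0 < x" "x \<le> 2 / \<delta>" "0 < \<delta>" for x \<delta>
    using that le[OF that(3)] by (simp add: ln_mono order_trans)
  have "exp 1 \<le> 2 / \<delta>2" using \<delta>2 by (simp add: exp_minus field_simps)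
  then have "ln (exp 1) \<le> ln (2 * p / \<delta>2)" using \<delta>2(1) by (intro mono) auto
  then show L2: "1 \<le> ln (2 * p / \<delta>2)" by simp
  have "2 \<le> 2 / \<delta>5" using \<delta>5 by (simp add: pos_le_divide_eq)
  then have L5: "2 / 3 \<le> ln (2 * p / \<delta>5)" using mono[of 2 \<delta>5] ln2 \<delta>5 by simp
  show "32 / 27 \<le> (ln (2 * p / \<delta>2))\<^sup>2 * ln (2 * p / \<delta>5)"
  proof (cases "\<delta>5 \<le> 1 / 2")
    case True
    then have "4 \<le> 2 / \<delta>5" using \<delta>5 by (simp add: pos_le_divide_eq)
    then have "4 / 3 \<le> ln (2 * p / \<delta>5)" using mono[of 4 \<delta>5] ln4 \<delta>5 by simp
    moreover have "1 \<le> (ln (2 * p / \<delta>2))\<^sup>2" using L2 by (simp add: one_le_power)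
    ultimately have "1 * (4 / 3) \<le> (ln (2 * p / \<delta>2))\<^sup>2 * ln (2 * p / \<delta>5)" by (intro mult_mono) auto
    then show ?thesis by simp
  next
    case False
    then have "4 \<le> 2 / \<delta>2" using \<delta>2 sum by (simp add: pos_le_divide_eq)
    then have "4 / 3 \<le> ln (2 * p / \<delta>2)" using mono[of 4 \<delta>2] ln4 \<delta>2 by simp
    then have "(4 / 3)\<^sup>2 \<le> (ln (2 * p / \<delta>2))\<^sup>2" by (intro power_mono) auto
    then have "(4 / 3)\<^sup>2 * (2 / 3) \<le> (ln (2 * p / \<delta>2))\<^sup>2 * ln (2 * p / \<delta>5)" using L5 by (intro mult_mono) auto
    then show ?thesis by (simp add: power2_eq_square)
  qed
qed

text \<open>
  The threshold \<open>32 / 27\<close> is the quotient of \<open>128 / 9\<close>, required by the conclusion, and the factor \<open>12\<close> of the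
  hypothesis on \<open>n * lam\<close>.
\<close>

lemma cross_term_dominated:
  fixes n :: real
  assumes n: "0 < n" and p: "1 \<le> p" and d: "0 < d" and M1: "0 \<le> M1" and v: "0 \<le> v" and l2: "1 \<le> l2" and l25: "32 / 27 \<le> l2\<^sup>2 * l5"
    and lam: "12 * p\<^sup>2 * m\<^sup>2 * (v + M1)\<^sup>2 * d * l2 ^ 3 * l5 \<le> n * lam"
  shows "4 / 3 * d * p * (2 * m * M1 * sqrt (n * l2) / n)\<^sup>2 \<le> 3 / 8 * lam"
proof -
  have sq: "(2 * m * M1 * sqrt (n * l2) / n)\<^sup>2 = 4 * m\<^sup>2 * M1\<^sup>2 * l2 / n"
    using n l2 by (simp add: power_divide power_mult_distrib power2_eq_square[of n])
  have "M1\<^sup>2 \<le> (v + M1)\<^sup>2" using M1 v by (intro power_mono) auto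
  moreover have "p \<le> p\<^sup>2" using p by (simp add: power2_eq_square)
  ultimately have "(p * M1\<^sup>2) * (32 / 27) \<le> (p\<^sup>2 * (v + M1)\<^sup>2) * (l2\<^sup>2 * l5)"
    using p M1 l25 by (intro mult_mono) auto
  then have "(12 * m\<^sup>2 * d * l2) * ((p * M1\<^sup>2) * (32 / 27)) \<le> (12 * m\<^sup>2 * d * l2) * ((p\<^sup>2 * (v + M1)\<^sup>2) * (l2\<^sup>2 * l5))"
    using d l2 by (intro mult_left_mono) auto
  also have "\<dots> = 12 * p\<^sup>2 * m\<^sup>2 * (v + M1)\<^sup>2 * d * l2 ^ 3 * l5" by (simp add: power3_eq_cube power2_eq_square mult_ac)
  also have "\<dots> \<le> n * lam" by (rule lam)
  finally have "128 / 9 * (d * p * m\<^sup>2 * M1\<^sup>2 * l2) \<le> n * lam" by (simp add: mult_ac)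
  then have "16 / 3 * (d * p * m\<^sup>2 * M1\<^sup>2 * l2) \<le> 3 / 8 * lam * n" by (simp add: mult.commute[of n lam])
  then have "16 / 3 * (d * p * m\<^sup>2 * M1\<^sup>2 * l2) / n \<le> 3 / 8 * lam" using n by (simp add: pos_divide_le_eq)
  then show ?thesis unfolding sq by (simp add: mult_ac)
qed

text \<open>
  The square of \<open>c5\<close> carries the additional factors \<open>v\<^sup>2 * d\<close> and \<open>d\<close>; the latter is compensated by \<open>lm\<close>.
\<close>

lemma parametric_term_dominated:
  fixes n :: real
  assumes n: "0 < n" and p: "1 \<le> p" and \<sigma>: "0 < \<sigma>" and \<delta>: "0 < \<delta>" and lm: "1 \<le> lm * d" "0 < lm" and d: "0 < d" and v: "1 \<le> v\<^sup>2 * d" "0 \<le> v"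
    and c5: "c5 = 3 * sqrt p * \<sigma> * v * d / (2 * sqrt \<delta>)" and x: "0 \<le> x"
  shows "8 / 3 * (\<sigma>\<^sup>2 * p / (n * \<delta>)) \<le> 2 * lm * (x + c5)\<^sup>2 / n"
proof -
  define b where "b = \<sigma>\<^sup>2 * p / \<delta>"
  have b: "0 \<le> b" using p \<delta> by (simp add: b_def)
  have c50: "0 \<le> c5" using p \<sigma> \<delta> d v unfolding c5 by (intro divide_nonneg_nonneg mult_nonneg_nonneg) auto
  have "c5\<^sup>2 = 9 / 4 * b * (v\<^sup>2 * d) * d" using p \<delta> by (simp add: c5 b_def power_divide power_mult_distrib power2_eq_square[of d])
  then have "2 * lm * c5\<^sup>2 = 9 / 2 * b * ((v\<^sup>2 * d) * (lm * d))" by simp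
  moreover have "1 * 1 \<le> (v\<^sup>2 * d) * (lm * d)" using lm v by (intro mult_mono) auto
  ultimately have "9 / 2 * b * (1 * 1) \<le> 2 * lm * c5\<^sup>2" using b by (simp only: mult_left_mono)
  moreover have "2 * lm * c5\<^sup>2 \<le> 2 * lm * (x + c5)\<^sup>2" using lm c50 x by (intro mult_left_mono power_mono) auto
  ultimately have "8 / 3 * b \<le> 2 * lm * (x + c5)\<^sup>2" using b by simp
  then have "8 / 3 * b / n \<le> 2 * lm * (x + c5)\<^sup>2 / n" using n by (intro divide_right_mono) auto
  then show ?thesis by (simp add: b_def mult.commute[of n])
qed

lemma nonparametric_term_dominated:
  assumes lam: "0 < lam" and q: "0 \<le> q" "1 + q \<le> W" and f: "0 \<le> f" and e: "0 \<le> e" "e \<le> sqrt lam * b"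
  shows "(11 / 8 * ((1 + q) * (sqrt lam * f) + (1 + q)\<^sup>2 * e))\<^sup>2 \<le> 2 * (f * W + W\<^sup>2 * b)\<^sup>2 * lam"
proof -
  have "(1 + q) * (sqrt lam * f) + (1 + q)\<^sup>2 * e \<le> W * (sqrt lam * f) + W\<^sup>2 * (sqrt lam * b)"
    using assms by (intro add_mono mult_mono power_mono mult_nonneg_nonneg) auto
  then have "11 / 8 * ((1 + q) * (sqrt lam * f) + (1 + q)\<^sup>2 * e) \<le> 11 / 8 * (sqrt lam * (f * W + W\<^sup>2 * b))" by (simp add: algebra_simps)
  moreover have "0 \<le> 11 / 8 * ((1 + q) * (sqrt lam * f) + (1 + q)\<^sup>2 * e)"
    using lam q f e by (intro mult_nonneg_nonneg add_nonneg_nonneg) auto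
  ultimately have "(11 / 8 * ((1 + q) * (sqrt lam * f) + (1 + q)\<^sup>2 * e))\<^sup>2 \<le> (11 / 8 * (sqrt lam * (f * W + W\<^sup>2 * b)))\<^sup>2"
    by (rule power_mono)
  also have "\<dots> = 121 / 64 * (lam * (f * W + W\<^sup>2 * b)\<^sup>2)" using lam by (simp add: power_mult_distrib power_divide)
  also have "\<dots> \<le> 2 * (lam * (f * W + W\<^sup>2 * b)\<^sup>2)" using lam by (intro mult_right_mono) auto
  finally show ?thesis by (simp add: mult_ac)
qed

context sample_model begin

lemma second_moment_diag: "1 \<le> matrix_opnorm (matrix_inv (second_moment_matrix M X)) * (LINT w|M. (X w $ j)\<^sup>2)"
  if D: "pos_def_matrix (second_moment_matrix M X)"
proof -
  have "axis j 1 \<bullet> (second_moment_matrix M X *v axis j 1) = (LINT w|M. (X w $ j)\<^sup>2)"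
    by (simp add: inner_axis' matrix_vector_mult_basis column_def second_moment_matrix_def power2_eq_square)
  then show ?thesis using pos_def_lower_bound[OF D, of "axis j 1"] by (simp add: inner_axis_axis)
qed

end

section \<open>The risk bound\<close>

theorem theorem1:
  fixes M :: "'w measure"
    and T :: "real set"
    and K :: "real \<Rightarrow> real \<Rightarrow> real" and S :: l2_op
    and Z \<epsilon> :: "'w \<Rightarrow> real" and X :: "'w \<Rightarrow> real^'p" and Y :: "'w \<Rightarrow> real \<Rightarrow> real"
    and Zs :: "nat \<Rightarrow> 'w \<Rightarrow> real" and Xs :: "nat \<Rightarrow> 'w \<Rightarrow> real^'p" and Ys :: "nat \<Rightarrow> 'w \<Rightarrow> real \<Rightarrow> real"
    and \<alpha>0 :: "real^'p" and \<beta>0 f0 :: "real \<Rightarrow> real"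
    and \<alpha>h :: "'w \<Rightarrow> real^'p" and fh :: "'w \<Rightarrow> real \<Rightarrow> real"
    and D :: "real^'p^'p"
    and n :: nat and n0 :: int
    and p \<kappa> M1 M2 v \<sigma> c \<theta> \<omega> lam \<delta>1 \<delta>2 \<delta>3 \<delta>4 \<delta>5 N1 N2 A c1 c4 c5 c6 c7 c8 c9 :: real
  assumes "prob_space M" and "compact T"
    \<comment> \<open>kernel\<close>
    and "continuous_psd_kernel T K"
    and "l2_nonneg_sqrt T (integral_operator T K) S"
    and "l2_dense T (rkhs T S)" and "l2_injective T S"
    and "\<kappa> = l2_opnorm T S" and "\<kappa> > 1" and "M2 > 1"
    \<comment> \<open>model\<close>
    and "independent_rvs M borel X (l2_borel T) Y"
    and "(\<lambda>(w, t). Y w t) \<in> borel_measurable (M \<Otimes>\<^sub>M leb T)"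
    and "\<epsilon> \<in> borel_measurable M"
    and "(LINT w|M. X w) = 0"
    and "AE t in leb T. (LINT w|M. Y w t) = 0"
    and "\<beta>0 \<in> rkhs T S" and "f0 \<in> l2_space T" and "l2_eq T (S f0) \<beta>0"
    and "\<forall>w\<in>space M. Z w = X w \<bullet> \<alpha>0 + l2_inner T (Y w) \<beta>0 + \<epsilon> w"
    and "iid_copies M (obs_space T) (\<lambda>w. (Z w, X w, Y w)) n (\<lambda>i w. (Zs i w, Xs i w, Ys i w))"
    and "D = second_moment_matrix M X"
    \<comment> \<open>condition (1)\<close>
    and "CARD('p) \<le> n" and "p = real CARD('p)"
    and "AE w in M. pos_def_matrix (empirical_second_moment_matrix n Xs w)"
    and "pos_def_matrix D"
    \<comment> \<open>condition (2)\<close>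
    and "\<forall>j. sub_gaussian_norm M (\<lambda>w. X w $ j) \<le> ennreal M1"
    and "\<forall>j. (LINT w|M. \<bar>X w $ j\<bar>\<^sup>2) \<le> v\<^sup>2" and "0 \<le> M1" and "0 \<le> v"
    \<comment> \<open>condition (3)\<close>
    and "AE w in M. l2_norm T (Y w) \<le> M2"
    \<comment> \<open>condition (4)\<close>
    and "integrable M (\<lambda>w. (\<epsilon> w)\<^sup>2)" and "0 < \<sigma>"
    and "AE w in M. real_cond_exp M
           (generated_algebra M (\<lambda>w. (X w, Y w)) (borel \<Otimes>\<^sub>M l2_borel T)) \<epsilon> w = 0"
    and "AE w in M. real_cond_exp M
           (generated_algebra M (\<lambda>w. (X w, Y w)) (borel \<Otimes>\<^sub>M l2_borel T)) (\<lambda>w. (\<epsilon> w)\<^sup>2) w < \<sigma>\<^sup>2"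
    \<comment> \<open>condition (5)\<close>
    and "0 < c" and "0 < \<theta>" and "\<theta> \<le> 1"
    and "\<forall>l>0. effective_dimension T
           (S \<circ> integral_operator T (second_moment_kernel M Y) \<circ> S) l \<le> ennreal (c * l powr (-\<theta>))"
    \<comment> \<open>constants\<close>
    and "\<delta>1 \<in> {0<..<1}" and "\<delta>3 \<in> {0<..<1}" and "\<delta>4 \<in> {0<..<1}" and "\<delta>5 \<in> {0<..<1}"
    and "\<delta>2 \<in> {0<..<2 * exp (-1)}"
    and "0 < \<omega>" and "lam = \<omega> * real n powr (- 1 / (1 + \<theta>))"
    and "N1 = 24 * p * matrix_opnorm (matrix_inv D)
           * (48 * p * matrix_opnorm (matrix_inv D) * M1 ^ 4 + M1\<^sup>2) * ln (2 * p\<^sup>2 / \<delta>5)"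
    and "N2 = (12 * p\<^sup>2 * \<kappa>\<^sup>2 * (v + M1)\<^sup>2 * M2\<^sup>2 * matrix_opnorm (matrix_inv D) / \<omega>
           * (ln (2 * p / \<delta>2)) ^ 3 * ln (2 * p / \<delta>5)) powr ((1 + \<theta>) / \<theta>)"
    and "n0 = \<lceil>max N1 N2\<rceil>"
    and "A = 1 / \<omega> + \<omega> powr (- (1 + \<theta>) / 2) * sqrt c"
    and "c1 = 2 * \<kappa>\<^sup>2 * M2\<^sup>2"
    and "c4 = \<kappa> * M2 * (v + 8 * M1 * sqrt (ln (p / \<delta>2))) * (3 * matrix_opnorm (matrix_inv D) / 2)"
    and "c5 = 3 * sqrt p * \<sigma> * v * matrix_opnorm (matrix_inv D) / (2 * sqrt \<delta>4)"
    and "c6 = l2_norm T f0 + 2 * p * \<kappa> * (v + M1) * M2 * c5 / \<omega> * ln (2 * p / \<delta>2) + \<sigma> * A / sqrt \<delta>3"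
    and "c7 = l2_norm T f0 * (2 * \<kappa>\<^sup>2 * M2\<^sup>2 * A * ln (2 / \<delta>1) + 1)"
    and "c8 = (2 * \<kappa>\<^sup>2 * M2\<^sup>2 * A * ln (2 / \<delta>1) + 1)\<^sup>2 * (\<sigma> * A / sqrt \<delta>3)"
    and "c9 = \<kappa> * M2 * (2 * c4 * c6 + c5) / sqrt \<omega> * (c1 * A * ln (2 / \<delta>1) + 1)
           * (v + 8 * M1 * sqrt (ln (p / \<delta>2)))"
    \<comment> \<open>estimator\<close>
    and "\<forall>w\<in>space M. is_arg_min
           (penalized_loss T S n lam (\<lambda>i. Zs i w) (\<lambda>i. Xs i w) (\<lambda>i. Ys i w))
           (\<lambda>(a, f). f \<in> l2_space T) (\<alpha>h w, fh w)"
    and "n0 \<le> int n"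
  shows "\<exists>E\<in>sets M. measure M E \<ge> 1 - (\<delta>1 + \<delta>2 + \<delta>3 + \<delta>4 + \<delta>5) \<and>
    (\<forall>w\<in>E. prediction_risk M Z X Y (linear_rule T (\<alpha>h w) (S (fh w)))
          - prediction_risk M Z X Y (linear_rule T \<alpha>0 \<beta>0)
        \<le> (2 * max_eigenvalue D * (2 * c4 * c6 + c5)\<^sup>2 + 2 * c9\<^sup>2) / real n
          + 4 * (c7 + c8) * c9 * sqrt \<omega> * real n powr (- (2 + \<theta>) / (2 + 2 * \<theta>))
          + 2 * (c7 + c8)\<^sup>2 * \<omega> * real n powr (- 1 / (1 + \<theta>)))"
proof (cases "\<delta>1 + \<delta>2 + \<delta>3 + \<delta>4 + \<delta>5 < 1")
  case False
  \<comment> \<open>the required probability is nonpositive\<close>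
  then show ?thesis by (intro bexI[of _ "{}"]) auto
next
  case True
  have \<delta>: "0 < \<delta>1" "\<delta>1 < 1" "0 < \<delta>2" "\<delta>2 < 2 * exp (- 1)" "0 < \<delta>3" "0 < \<delta>4" "0 < \<delta>5" "\<delta>5 < 1"
    using assms(38-42) by auto
  have p: "1 \<le> p" unfolding \<open>p = real CARD('p)\<close> using zero_less_card_finite[where 'a = 'p] by simp
  have "p \<le> real n" unfolding \<open>p = real CARD('p)\<close> using \<open>CARD('p) \<le> n\<close> by (rule of_nat_mono)
  with p have n: "1 \<le> real n" by linarith
  have S: "l2_nonneg_operator T S" using assms(4) by (simp add: l2_nonneg_sqrt_def)
  have \<beta>0: "\<beta>0 \<in> l2_space T" using assms(15) by (simp add: rkhs_def)
  have cov: "covariance_form T M S Y M2"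
  proof -
    interpret prob_space M by (rule assms(1))
    show ?thesis
      by unfold_locales (use assms(2,9,10,11,29) S in \<open>auto simp: independent_rvs_def\<close>)
  qed
  have Zm: "Z \<in> borel_measurable M"
  proof -
    interpret C: covariance_form T M S Y M2 by (rule cov)
    have "X \<in> borel_measurable M" using assms(10) by (simp add: independent_rvs_def)
    moreover have "(\<lambda>w. l2_inner T (Y w) \<beta>0) \<in> borel_measurable M"
      by (rule measurable_compose[OF C.Ym C.l2_inner_measurable[OF \<beta>0]])
    ultimately have "(\<lambda>w. X w \<bullet> \<alpha>0 + l2_inner T (Y w) \<beta>0 + \<epsilon> w) \<in> borel_measurable M"
      using assms(12) by measurable
    then show ?thesis using assms(18) by (subst measurable_cong) auto
  qed
  interpret N: noisy_model T M S Y M2 X Z n Zs Xs Ys M1 \<epsilon> \<alpha>0 \<beta>0 \<sigma>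
  proof -
    interpret covariance_form T M S Y M2 by (rule cov)
    show "noisy_model T M S Y M2 X Z n Zs Xs Ys M1 \<epsilon> \<alpha>0 \<beta>0 \<sigma>"
      by unfold_locales (use assms(10,12,13,18,19,25,27,30-33) n Zm \<beta>0 in auto)
  qed
  define m where "m = \<kappa> * M2"
  have Nm: "N.m = m" by (simp add: N.m_def N.\<kappa>_def m_def assms(7))
  have m1: "1 \<le> m" unfolding m_def using \<open>\<kappa> > 1\<close> \<open>M2 > 1\<close> mult_mono[of 1 \<kappa> 1 M2] by simp
  define d where "d = matrix_opnorm (matrix_inv D)"
  have D: "pos_def_matrix (second_moment_matrix M X)" using \<open>pos_def_matrix D\<close> \<open>D = second_moment_matrix M X\<close> by simp
  have dD: "d = matrix_opnorm (matrix_inv (second_moment_matrix M X))" by (simp add: d_def \<open>D = second_moment_matrix M X\<close>)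
  have d: "0 < d" and v2: "1 \<le> v\<^sup>2 * d" and M12: "1 \<le> M1\<^sup>2 * d"
  proof -
    fix j :: 'p
    define s where "s = (LINT w|M. (X w $ j)\<^sup>2)"
    have ds: "1 \<le> d * s" unfolding s_def dD by (rule N.second_moment_diag[OF D])
    have s0: "0 \<le> s" unfolding s_def by (rule integral_nonneg_AE) simp
    show d: "0 < d" using ds s0 by (metis mult_nonpos_nonneg not_le not_one_le_zero order_trans)
    \<comment> \<open>a diagonal entry of \<open>D\<close> lies between \<open>1 / d\<close> and both moment bounds\<close>
    have "s \<le> v\<^sup>2" using assms(26) by (simp add: s_def)
    then have "d * s \<le> v\<^sup>2 * d" using d by (simp add: mult.commute)
    then show "1 \<le> v\<^sup>2 * d" using ds by linarith
    have "s \<le> M1\<^sup>2" using N.X_sq(2)[of j] by (simp add: s_def)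
    then have "d * s \<le> M1\<^sup>2 * d" using d by (simp add: mult.commute)
    then show "1 \<le> M1\<^sup>2 * d" using ds by linarith
  qed
  have M10: "0 < M1" using M12 \<open>0 \<le> M1\<close> by (cases "M1 = 0") auto
  define Db where "Db = c * lam powr (- \<theta>)"
  note rate = rate_balance[OF n \<open>0 < \<omega>\<close> \<open>0 < \<theta>\<close> \<open>0 < c\<close> \<open>lam = _\<close> Db_def]
  note lam = rate(1) and Db = rate(2)
  define L1 where "L1 = ln (2 / \<delta>1)"
  define L2 where "L2 = ln (2 * p / \<delta>2)"
  define L5 where "L5 = ln (2 * p\<^sup>2 / \<delta>5)"
  define l5 where "l5 = ln (2 * p / \<delta>5)"
  have logs: "1 \<le> L2" "32 / 27 \<le> L2\<^sup>2 * l5"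
    unfolding L2_def l5_def using log_product_bound[OF p \<delta>(3,4,7,8)] True \<delta> by simp_all
  have l50: "0 \<le> l5" using p \<delta> unfolding l5_def by (intro ln_ge_zero) (simp add: pos_le_divide_eq)
  have L1: "1 / 2 \<le> L1" "2 * exp (- L1) \<le> \<delta>1"
  proof -
    have "ln 2 \<le> L1" unfolding L1_def using \<delta>(1,2) by (simp add: pos_le_divide_eq)
    then show "1 / 2 \<le> L1" using ln2_ge_two_thirds by linarith
    show "2 * exp (- L1) \<le> \<delta>1" using \<delta>(1) by (simp add: L1_def exp_minus)
  qed
  have L2e: "2 * exp (- L2) \<le> \<delta>2 / real CARD('p)" using \<delta>(3) p by (simp add: L2_def exp_minus \<open>p = _\<close>)
  have L5: "0 \<le> L5" "2 * exp (- L5) \<le> \<delta>5 / (real CARD('p))\<^sup>2"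
  proof -
    have "1 \<le> p\<^sup>2" using p by (rule one_le_power)
    then show "0 \<le> L5" using \<delta>(7,8) unfolding L5_def by (intro ln_ge_zero) (simp add: pos_le_divide_eq)
    show "2 * exp (- L5) \<le> \<delta>5 / (real CARD('p))\<^sup>2" using \<delta>(7) p by (simp add: L5_def exp_minus \<open>p = _\<close>)
  qed
  have nN: "N1 \<le> real n" "N2 \<le> real n" using assms(57) unfolding \<open>n0 = _\<close> by (simp_all add: ceiling_le_iff)
  define \<tau> where "\<tau> = 1 / (4 * real CARD('p) * d)"
  have \<tau>: "\<tau> \<le> M1\<^sup>2 / 4" "72 * M1 ^ 4 * L5 \<le> real n * \<tau>\<^sup>2"
  proof -
    have "1 * 1 \<le> p * (M1\<^sup>2 * d)" using p M12 by (intro mult_mono) auto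
    then show "\<tau> \<le> M1\<^sup>2 / 4" using p d by (simp add: \<tau>_def \<open>p = _\<close>[symmetric] pos_divide_le_eq mult_ac)
    have "N1 = 24 * p * d * (48 * p * d * M1 ^ 4 + M1\<^sup>2) * L5" by (simp only: \<open>N1 = _\<close> d_def L5_def)
    then have "N1 = 1152 * p\<^sup>2 * d\<^sup>2 * M1 ^ 4 * L5 + 24 * p * d * M1\<^sup>2 * L5"
      by (simp add: power2_eq_square algebra_simps)
    moreover have "0 \<le> 24 * p * d * M1\<^sup>2 * L5" using p d L5(1) by simp
    ultimately have "1152 * p\<^sup>2 * d\<^sup>2 * M1 ^ 4 * L5 \<le> real n" using nN(1) by linarith
    moreover have "0 < 16 * p\<^sup>2 * d\<^sup>2" using p d by simp
    moreover have "\<tau>\<^sup>2 = 1 / (16 * p\<^sup>2 * d\<^sup>2)" by (simp add: \<tau>_def \<open>p = _\<close>[symmetric] power_divide power_mult_distrib)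
    ultimately show "72 * M1 ^ 4 * L5 \<le> real n * \<tau>\<^sup>2" by (simp add: pos_le_divide_eq mult_ac)
  qed
  have eff: "effective_dimension T N.smoothed_covariance lam \<le> ennreal Db"
    using assms(37) lam by (simp add: N.smoothed_covariance_def Db_def)
  obtain E where E: "E \<in> sets M" "1 - (\<delta>1 + \<delta>2 + \<delta>3 + \<delta>4 + \<delta>5) \<le> measure M E"
    and good: "\<And>w. w \<in> E \<Longrightarrow> N.good_sample lam (2 * m\<^sup>2 * L1 * (1 / sqrt lam + sqrt (real n * Db)) / (real n * sqrt lam))
       (2 * m * M1 * sqrt (real n * L2) / real n) (\<sigma> * sqrt (Db / (real n * \<delta>3))) (\<sigma>\<^sup>2 * real CARD('p) / (real n * \<delta>4)) w"
    using N.good_sample_event[OF lam Db eff _ M10 D dD d \<delta>(5,6) L1 _ L2e L5 \<tau>_def \<tau>] m1 logs(1) unfolding Nm by auto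
  define q where "q = 2 * m\<^sup>2 * L1 * (1 / sqrt lam + sqrt (real n * Db)) / (real n * sqrt lam)"
  define e where "e = \<sigma> * sqrt (Db / (real n * \<delta>3))"
  define W where "W = 2 * \<kappa>\<^sup>2 * M2\<^sup>2 * A * ln (2 / \<delta>1) + 1"
  have A0: "0 \<le> A" using \<open>0 < \<omega>\<close> \<open>0 < c\<close> unfolding \<open>A = _\<close> by (intro add_nonneg_nonneg mult_nonneg_nonneg) auto
  have n0: "0 < real n" using n by simp
  have B0: "0 \<le> 2 * m\<^sup>2 * L1" using L1(1) by simp
  note scaled = scaled_errors[OF n0 lam Db rate(3)[folded \<open>A = _\<close>] B0 \<open>0 < \<sigma>\<close> \<delta>(5)]
  have q: "0 \<le> q" "1 + q \<le> W"
  proof -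
    show "0 \<le> q" unfolding q_def using L1(1) lam Db n0 by (intro divide_nonneg_nonneg mult_nonneg_nonneg add_nonneg_nonneg) auto
    have "2 * m\<^sup>2 * L1 * A + 1 = W" by (simp add: W_def m_def power_mult_distrib L1_def[symmetric])
    then show "1 + q \<le> W" using scaled(1) by (simp add: q_def)
  qed
  have e: "0 \<le> e" "e \<le> sqrt lam * (\<sigma> * A / sqrt \<delta>3)"
    using scaled(2) \<open>0 < \<sigma>\<close> Db n0 \<delta>(5) by (simp_all add: e_def)
  have \<gamma>: "4 / 3 * d * real CARD('p) * (2 * m * M1 * sqrt (real n * L2) / real n)\<^sup>2 \<le> 3 / 8 * lam"
    unfolding \<open>p = _\<close>[symmetric]
  proof (rule cross_term_dominated[OF n0 p d \<open>0 \<le> M1\<close> \<open>0 \<le> v\<close> logs])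
    define G where "G = 12 * p\<^sup>2 * \<kappa>\<^sup>2 * (v + M1)\<^sup>2 * M2\<^sup>2 * d / \<omega> * L2 ^ 3 * l5"
    have G0: "0 \<le> G" unfolding G_def using p d \<open>0 < \<omega>\<close> logs(1) l50 by (intro mult_nonneg_nonneg divide_nonneg_nonneg) auto
    have "N2 = G powr ((1 + \<theta>) / \<theta>)" unfolding \<open>N2 = _\<close> G_def d_def L2_def l5_def by (rule refl)
    then have "\<omega> * G \<le> real n * lam" using rate(4)[OF G0] nN(2) by simp
    moreover have "\<omega> * G = 12 * p\<^sup>2 * m\<^sup>2 * (v + M1)\<^sup>2 * d * L2 ^ 3 * l5"
      using \<open>0 < \<omega>\<close> by (simp add: G_def m_def power_mult_distrib mult_ac)
    ultimately show "12 * p\<^sup>2 * m\<^sup>2 * (v + M1)\<^sup>2 * d * L2 ^ 3 * l5 \<le> real n * lam" by simp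
  qed
  have norm_f0: "0 \<le> l2_norm T f0" using N.l2.N_nonneg[OF assms(16)] by (simp add: N.N_eq_l2_norm)
  have W1: "1 \<le> W" using q by linarith
  have ln2: "0 \<le> ln (p / \<delta>2)"
  proof -
    have "\<delta>2 < 1" using True \<delta> by simp
    then show ?thesis using p \<delta>(3) by (intro ln_ge_zero) (simp add: pos_le_divide_eq)
  qed
  have v8: "0 \<le> v + 8 * M1 * sqrt (ln (p / \<delta>2))" using \<open>0 \<le> v\<close> \<open>0 \<le> M1\<close> ln2 by simp
  have c40: "0 \<le> c4" unfolding \<open>c4 = _\<close> d_def[symmetric] using \<open>\<kappa> > 1\<close> \<open>M2 > 1\<close> v8 d by (intro mult_nonneg_nonneg) auto
  have c5: "c5 = 3 * sqrt p * \<sigma> * v * d / (2 * sqrt \<delta>4)" by (simp add: \<open>c5 = _\<close> d_def)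
  have c50: "0 \<le> c5" unfolding c5 using p \<open>0 < \<sigma>\<close> \<open>0 \<le> v\<close> d \<delta>(6) by (intro divide_nonneg_nonneg mult_nonneg_nonneg) auto
  have c60: "0 \<le> c6"
    unfolding \<open>c6 = _\<close> L2_def[symmetric] using norm_f0 p \<open>\<kappa> > 1\<close> \<open>M2 > 1\<close> \<open>0 \<le> v\<close> \<open>0 \<le> M1\<close> c50 \<open>0 < \<omega>\<close> logs(1) \<open>0 < \<sigma>\<close> A0 \<delta>(5)
    by (intro add_nonneg_nonneg mult_nonneg_nonneg divide_nonneg_nonneg) auto
  have c78: "c7 + c8 = l2_norm T f0 * W + W\<^sup>2 * (\<sigma> * A / sqrt \<delta>3)" by (simp add: \<open>c7 = _\<close> \<open>c8 = _\<close> W_def)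
  have c780: "0 \<le> c7 + c8" unfolding c78 using norm_f0 W1 \<open>0 < \<sigma>\<close> A0 \<delta>(5) by (intro add_nonneg_nonneg mult_nonneg_nonneg divide_nonneg_nonneg) auto
  have c90: "0 \<le> c9"
  proof -
    have cW: "c1 * A * ln (2 / \<delta>1) + 1 = W" by (simp add: \<open>c1 = _\<close> W_def)
    have x: "0 \<le> 2 * c4 * c6 + c5" using c40 c50 c60 by simp
    show ?thesis
      unfolding \<open>c9 = _\<close> cW using \<open>\<kappa> > 1\<close> \<open>M2 > 1\<close> \<open>0 < \<omega>\<close> W1
      by (intro mult_nonneg_nonneg divide_nonneg_nonneg x v8) auto
  qed
  have lm: "1 \<le> max_eigenvalue D * d" "0 < max_eigenvalue D"
    using max_eigenvalue_lower[OF \<open>pos_def_matrix D\<close>] by (simp_all add: d_def)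
  show ?thesis
  proof (intro bexI[OF _ E(1)] conjI ballI)
    show "measure M E \<ge> 1 - (\<delta>1 + \<delta>2 + \<delta>3 + \<delta>4 + \<delta>5)" by (rule E(2))
    fix w assume w: "w \<in> E"
    then have wM: "w \<in> space M" using sets.sets_into_space[OF E(1)] by auto
    have "prediction_risk M Z X Y (linear_rule T (\<alpha>h w) (S (fh w))) - prediction_risk M Z X Y (linear_rule T \<alpha>0 \<beta>0)
       \<le> 8 / 3 * (\<sigma>\<^sup>2 * p / (real n * \<delta>4)) + (11 / 8 * ((1 + q) * (sqrt lam * l2_norm T f0) + (1 + q)\<^sup>2 * e))\<^sup>2"
      unfolding \<open>p = _\<close>
      by (rule N.excess_risk_le[OF good[OF w, folded q_def e_def] lam q(1) e(1) D dD \<gamma> assms(16,17)]) (use assms(56) wM in blast)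
    also have "\<dots> \<le> 2 * max_eigenvalue D * (2 * c4 * c6 + c5)\<^sup>2 / real n + 2 * (c7 + c8)\<^sup>2 * lam"
      unfolding c78 using c40 c60
      by (intro add_mono parametric_term_dominated[OF n0 p \<open>0 < \<sigma>\<close> \<delta>(6) lm d v2 \<open>0 \<le> v\<close> c5]
          nonparametric_term_dominated[OF lam q norm_f0 e]) auto
    also have "\<dots> \<le> (2 * max_eigenvalue D * (2 * c4 * c6 + c5)\<^sup>2 + 2 * c9\<^sup>2) / real n
          + 4 * (c7 + c8) * c9 * sqrt \<omega> * real n powr (- (2 + \<theta>) / (2 + 2 * \<theta>)) + 2 * (c7 + c8)\<^sup>2 * \<omega> * real n powr (- 1 / (1 + \<theta>))"
    proof -
      have "0 \<le> 4 * (c7 + c8) * c9 * sqrt \<omega> * real n powr (- (2 + \<theta>) / (2 + 2 * \<theta>))"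
        using c780 c90 \<open>0 < \<omega>\<close> by (intro mult_nonneg_nonneg) auto
      moreover have "0 \<le> 2 * c9\<^sup>2 / real n" by simp
      moreover have "2 * (c7 + c8)\<^sup>2 * lam = 2 * (c7 + c8)\<^sup>2 * \<omega> * real n powr (- 1 / (1 + \<theta>))" by (simp only: \<open>lam = _\<close> mult.assoc)
      ultimately show ?thesis unfolding add_divide_distrib by linarith
    qed
    finally show "prediction_risk M Z X Y (linear_rule T (\<alpha>h w) (S (fh w)))
          - prediction_risk M Z X Y (linear_rule T \<alpha>0 \<beta>0)
        \<le> (2 * max_eigenvalue D * (2 * c4 * c6 + c5)\<^sup>2 + 2 * c9\<^sup>2) / real n
          + 4 * (c7 + c8) * c9 * sqrt \<omega> * real n powr (- (2 + \<theta>) / (2 + 2 * \<theta>))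
          + 2 * (c7 + c8)\<^sup>2 * \<omega> * real n powr (- 1 / (1 + \<theta>))" .
  qed
qed

end
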